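(* Let $S$ be a compact spacelike codimension-two embedded submanifold of an orientable spacetime $(M,g)$ of dimension $n+2\ge4$, admitting a lightlike normal vector field $\xi$. Let $\Sigma=\Phi(\mathscr O)$ be the lightlike hypersurface emanating from $S$ by the normal exponential construction along $\xi$ (see context), and assume that $\Sigma$ is totally umbilical. Then the volume of each compact leaf $S_t$ of the screen distribution $\mathcal S$ evolves according to the formula $$\operatorname{Vol}(S_t)=\operatorname{Vol}(S)\exp\left(\int_0^t\Theta(s)\,ds\right),$$ where $\Theta$ is the average lightlike expansion scalar. This formula holds for all $t\in D$, for the fixed geodesic extension $U$ of $\xi$ and its affine parameter.
   Context: A spacetime is a connected time-oriented Lorentzian manifold of signature $(-,+,\dots,+)$, with Levi-Civita connection $\widetilde\nabla$; lightlike vectors are nonzero null vectors; $S$ is connected of dimension $n$ with induced Riemannian metric and volume element $\mathrm dV$. Normal exponential construction: choose an open neighborhood $\mathscr V$ of the zero section of the normal bundle $T^\perp S$, fiberwise star-shaped about $0$, such that the normal exponential map $\exp^\perp$ restricts to a diffeomorphism from $\mathscr V$ onto an open neighborhood of $S$ in $M$. Put $\mathscr O=\{(p,t)\in S\times\mathbb R: t\xi_p\in\mathscr V\}$, $\Phi\colon\mathscr O\to M$, $\Phi(p,t)=\exp^\perp_p(t\xi_p)$, and $\Sigma=\Phi(\mathscr O)$. Then $\Phi$ is an embedding, $\Sigma$ is a lightlike hypersurface (the induced metric is everywhere degenerate) containing $S=\Phi(S\times\{0\})$; $U=\Phi_*(\partial_t)$ is a lightlike vector field on $\Sigma$ with $\widetilde\nabla_UU=0$,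 $U|_S=\xi$, spanning the radical of the induced metric; $\mathcal S$ is the integrable screen distribution (complementary to $\operatorname{span}\{U\}$) given by the images under $\Phi_*$ of the tangent spaces to the slices $\{t=\text{const}\}$ of $\mathscr O$. $I_p=\{t:(p,t)\in\mathscr O\}$ is an open interval containing $0$, $D=\bigcap_{p\in S}I_p$ (an open interval containing $0$ since $S$ is compact), and for $t\in D$, $S_t=\Phi(S\times\{t\})$ is a leaf of $\mathcal S$ (with $S_0=S$). $B_U(X,Y)=-g(\widetilde\nabla_XU,Y)$ on $\Sigma$; $\Sigma$ is totally umbilical if $B_U=\mu g$ for a smooth function $\mu$ on $\Sigma$. The screen shape operator $A_U^*$ is the $\mathcal S$-valued endomorphism with $B_U(X,Y)=g(A_U^*X,Y)$, and the lightlike expansion scalar is $\theta=-\operatorname{trace}(A_U^*|_{\mathcal S})$ (so $\theta=-n\mu$ in the totally umbilical case). For $t\in D$ the average lightlike expansion scalar is $$\Theta(t)=\frac{\int_S\theta(\Phi(p,t))\exp\left(\int_0^t\theta(\Phi(p,s))\,ds\right)\mathrm dV}{\int_S\exp\left(\int_0^t\theta(\Phi(p,s))\,ds\right)\mathrm dV}.$$ *)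

theory Defs
  imports "HOL-Analysis.Analysis"
begin

section \<open>Smooth manifolds given by atlases\<close>

fun Ck_on :: "nat \<Rightarrow> 'a::real_normed_vector set \<Rightarrow> ('a \<Rightarrow> 'b::real_normed_vector) \<Rightarrow> bool" where
  "Ck_on 0 X f \<longleftrightarrow> continuous_on X f"
| "Ck_on (Suc k) X f \<longleftrightarrow>
     (\<forall>x\<in>X. f differentiable (at x)) \<and> (\<forall>v. Ck_on k X (\<lambda>x. frechet_derivative f (at x) v))"

text \<open>Only used for open sets \<open>X\<close>.\<close>
definition smooth_on :: "'a::real_normed_vector set \<Rightarrow> ('a \<Rightarrow> 'b::real_normed_vector) \<Rightarrow> bool" where
  "smooth_on X f \<longleftrightarrow> (\<forall>k. Ck_on k X f)"

text \<open>A chart is a pair of a domain and a coordinate map (irrelevant outside the domain) into the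
  model space \<open>'e\<close>; the point set and the topology of a manifold are read off from its atlas.\<close>
type_synonym ('m, 'e) atlas = "('m set \<times> ('m \<Rightarrow> 'e)) set"

definition points :: "('m, 'e) atlas \<Rightarrow> 'm set" where
  "points A = \<Union>(fst ` A)"

definition chart_inv :: "'m set \<times> ('m \<Rightarrow> 'e) \<Rightarrow> 'e \<Rightarrow> 'm" where
  "chart_inv c = inv_into (fst c) (snd c)"

definition smooth_atlas :: "('m, 'e::euclidean_space) atlas \<Rightarrow> bool" where
  "smooth_atlas A \<longleftrightarrow>
     (\<forall>c\<in>A. inj_on (snd c) (fst c) \<and> open (snd c ` fst c)) \<and>
     (\<forall>c\<in>A. \<forall>d\<in>A. open (snd c ` (fst c \<inter> fst d)) \<and>
        smooth_on (snd c ` (fst c \<inter> fst d)) (snd d \<circ> chart_inv c))"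

definition manifold_top :: "('m, 'e::euclidean_space) atlas \<Rightarrow> 'm topology" where
  "manifold_top A = topology (\<lambda>W. W \<subseteq> points A \<and> (\<forall>c\<in>A. open (snd c ` (fst c \<inter> W))))"

lemma openin_manifold_top:
  assumes "smooth_atlas A"
  shows "openin (manifold_top A) W \<longleftrightarrow> W \<subseteq> points A \<and> (\<forall>c\<in>A. open (snd c ` (fst c \<inter> W)))"
proof -
  have "istopology (\<lambda>W. W \<subseteq> points A \<and> (\<forall>c\<in>A. open (snd c ` (fst c \<inter> W))))"
    unfolding istopology_def
  proof (intro conjI allI impI ballI)
    fix S T c
    assume S: "S \<subseteq> points A \<and> (\<forall>c\<in>A. open (snd c ` (fst c \<inter> S)))"
      and T: "T \<subseteq> points A \<and> (\<forall>c\<in>A. open (snd c ` (fst c \<inter> T)))" and c: "c \<in> A"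
    have "inj_on (snd c) (fst c)" using assms c unfolding smooth_atlas_def by blast
    then have "snd c ` (fst c \<inter> (S \<inter> T)) = snd c ` (fst c \<inter> S) \<inter> snd c ` (fst c \<inter> T)"
      by (auto simp: inj_on_def)
    then show "open (snd c ` (fst c \<inter> (S \<inter> T)))" using S T c by auto
  next
    fix \<K> c
    assume K: "\<forall>K\<in>\<K>. K \<subseteq> points A \<and> (\<forall>c\<in>A. open (snd c ` (fst c \<inter> K)))" and c: "c \<in> A"
    have "snd c ` (fst c \<inter> \<Union>\<K>) = (\<Union>K\<in>\<K>. snd c ` (fst c \<inter> K))" by auto
    then show "open (snd c ` (fst c \<inter> \<Union>\<K>))" using K c by auto
  qed blast+
  then show ?thesis unfolding manifold_top_def by simp
qed

definition smooth_manifold :: "('m, 'e::euclidean_space) atlas \<Rightarrow> bool" where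
  "smooth_manifold A \<longleftrightarrow>
     smooth_atlas A \<and> Hausdorff_space (manifold_top A) \<and> second_countable (manifold_top A)"

definition euclid_atlas :: "('e::euclidean_space, 'e) atlas" where
  "euclid_atlas = {(UNIV, \<lambda>x. x)}"

definition prod_atlas :: "('m, 'd) atlas \<Rightarrow> ('k, 'e) atlas \<Rightarrow> ('m \<times> 'k, 'd \<times> 'e) atlas" where
  "prod_atlas A B = {(fst c \<times> fst d, \<lambda>(p, q). (snd c p, snd d q)) | c d. c \<in> A \<and> d \<in> B}"

text \<open>Smoothness of a map on an open set; openness of the coordinate domains expresses continuity.\<close>
definition smooth_map_on ::
    "('m, 'd::euclidean_space) atlas \<Rightarrow> ('k, 'e::euclidean_space) atlas \<Rightarrow> 'm set \<Rightarrow> ('m \<Rightarrow> 'k) \<Rightarrow> bool" where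
  "smooth_map_on A B W f \<longleftrightarrow> openin (manifold_top A) W \<and> f ` W \<subseteq> points B \<and>
     (\<forall>c\<in>A. \<forall>d\<in>B. open (snd c ` (fst c \<inter> W \<inter> f -` fst d)) \<and>
        smooth_on (snd c ` (fst c \<inter> W \<inter> f -` fst d)) (snd d \<circ> f \<circ> chart_inv c))"

text \<open>Smoothness on an arbitrary subset: local extendability to smooth maps on open sets.\<close>
definition smooth_on_set ::
    "('m, 'd::euclidean_space) atlas \<Rightarrow> ('k, 'e::euclidean_space) atlas \<Rightarrow> 'm set \<Rightarrow> ('m \<Rightarrow> 'k) \<Rightarrow> bool" where
  "smooth_on_set A B X f \<longleftrightarrow>
     (\<forall>p\<in>X. \<exists>W F. p \<in> W \<and> smooth_map_on A B W F \<and> (\<forall>q\<in>W \<inter> X. F q = f q))"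

definition diffeo ::
    "('m, 'd::euclidean_space) atlas \<Rightarrow> ('k, 'e::euclidean_space) atlas \<Rightarrow> 'm set \<Rightarrow> 'k set \<Rightarrow> ('m \<Rightarrow> 'k) \<Rightarrow> bool" where
  "diffeo A B X Y f \<longleftrightarrow>
     bij_betw f X Y \<and> smooth_on_set A B X f \<and> smooth_on_set B A Y (inv_into X f)"


section \<open>Tangent vectors\<close>

text \<open>The tangent space at \<open>p\<close> is the model space \<open>'e\<close>, a vector being represented by its components
  in the preferred chart \<open>chart_at A p\<close>; \<open>tan_coord\<close> and \<open>tan_vec\<close> convert to and from the
  components in another chart around \<open>p\<close>. The preferred charts do not depend continuously on
  the point, so smoothness of a vector field \<open>W\<close> means smoothness of \<open>\<lambda>p. (p, W p)\<close> with respect to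
  \<open>tangent_atlas A\<close>.\<close>
definition chart_at :: "('m, 'e) atlas \<Rightarrow> 'm \<Rightarrow> 'm set \<times> ('m \<Rightarrow> 'e)" where
  "chart_at A p = (SOME c. c \<in> A \<and> p \<in> fst c)"

definition tan_coord ::
    "('m, 'e::euclidean_space) atlas \<Rightarrow> 'm set \<times> ('m \<Rightarrow> 'e) \<Rightarrow> 'm \<Rightarrow> 'e \<Rightarrow> 'e" where
  "tan_coord A c p v =
     frechet_derivative (snd c \<circ> chart_inv (chart_at A p)) (at (snd (chart_at A p) p)) v"

definition tan_vec ::
    "('m, 'e::euclidean_space) atlas \<Rightarrow> 'm set \<times> ('m \<Rightarrow> 'e) \<Rightarrow> 'm \<Rightarrow> 'e \<Rightarrow> 'e" where
  "tan_vec A c p u =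
     frechet_derivative (snd (chart_at A p) \<circ> chart_inv c) (at (snd c p)) u"

definition tangent_atlas :: "('m, 'e::euclidean_space) atlas \<Rightarrow> ('m \<times> 'e, 'e \<times> 'e) atlas" where
  "tangent_atlas A = (\<lambda>c. (fst c \<times> UNIV, \<lambda>(p, v). (snd c p, tan_coord A c p v))) ` A"

definition mfderiv ::
    "('m, 'd::euclidean_space) atlas \<Rightarrow> ('k, 'e::euclidean_space) atlas \<Rightarrow> ('m \<Rightarrow> 'k) \<Rightarrow> 'm \<Rightarrow> 'd \<Rightarrow> 'e" where
  "mfderiv A B f p v =
     frechet_derivative (snd (chart_at B (f p)) \<circ> f \<circ> chart_inv (chart_at A p))
       (at (snd (chart_at A p) p)) v"


section \<open>Embedded submanifolds\<close>

text \<open>All charts of a subset \<open>S\<close> (with the subspace topology) whose inverses are smooth immersions.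
  \<open>S\<close> is embedded if they cover it, and they then form its maximal atlas. The dimension of \<open>S\<close> is
  that of the model space \<open>'d\<close>.\<close>
definition sub_atlas :: "('m, 'e::euclidean_space) atlas \<Rightarrow> 'm set \<Rightarrow> ('m, 'd::euclidean_space) atlas" where
  "sub_atlas A S = {(W, \<phi>). openin (subtopology (manifold_top A) S) W \<and> open (\<phi> ` W) \<and>
     homeomorphic_map (subtopology (manifold_top A) W) (top_of_set (\<phi> ` W)) \<phi> \<and>
     smooth_map_on euclid_atlas A (\<phi> ` W) (inv_into W \<phi>) \<and>
     (\<forall>x\<in>\<phi> ` W. inj (mfderiv euclid_atlas A (inv_into W \<phi>) x))}"

definition embedded_submanifold ::
    "('m, 'e::euclidean_space) atlas \<Rightarrow> 'm set \<Rightarrow> ('m, 'd::euclidean_space) atlas \<Rightarrow> bool" where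
  "embedded_submanifold A S AS \<longleftrightarrow> S \<subseteq> points A \<and> AS = sub_atlas A S \<and> points AS = S"

definition tangent_space ::
    "('m, 'e::euclidean_space) atlas \<Rightarrow> ('m, 'd::euclidean_space) atlas \<Rightarrow> 'm \<Rightarrow> 'e set" where
  "tangent_space A AS p = range (mfderiv AS A (\<lambda>q. q) p)"


section \<open>Metrics, the Levi-Civita connection and geodesics\<close>

definition metric_coord ::
    "('m, 'e::euclidean_space) atlas \<Rightarrow> ('m \<Rightarrow> 'e \<Rightarrow> 'e \<Rightarrow> real) \<Rightarrow> 'm set \<times> ('m \<Rightarrow> 'e) \<Rightarrow> 'e \<Rightarrow> 'e \<Rightarrow> 'e \<Rightarrow> real" where
  "metric_coord A g c x u v =
     g (chart_inv c x) (tan_vec A c (chart_inv c x) u) (tan_vec A c (chart_inv c x) v)"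

definition lorentzian_form :: "('e::euclidean_space \<Rightarrow> 'e \<Rightarrow> real) \<Rightarrow> bool" where
  "lorentzian_form b \<longleftrightarrow> bilinear b \<and> (\<forall>u v. b u v = b v u) \<and>
     (\<exists>(e::'e \<Rightarrow> 'e) (e0::'e). e0 \<in> Basis \<and> span (e ` Basis) = UNIV \<and>
        (\<forall>i\<in>Basis. \<forall>j\<in>Basis. b (e i) (e j) = (if i \<noteq> j then 0 else if i = e0 then - 1 else 1)))"

definition lorentzian_metric ::
    "('m, 'e::euclidean_space) atlas \<Rightarrow> ('m \<Rightarrow> 'e \<Rightarrow> 'e \<Rightarrow> real) \<Rightarrow> bool" where
  "lorentzian_metric A g \<longleftrightarrow> (\<forall>p\<in>points A. lorentzian_form (g p)) \<and>
     (\<forall>c\<in>A. \<forall>u v. smooth_on (snd c ` fst c) (\<lambda>x. metric_coord A g c x u v))"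

text \<open>The time orientation is given by a smooth timelike vector field \<open>T\<close>.\<close>
definition spacetime ::
    "('m, 'e::euclidean_space) atlas \<Rightarrow> ('m \<Rightarrow> 'e \<Rightarrow> 'e \<Rightarrow> real) \<Rightarrow> ('m \<Rightarrow> 'e) \<Rightarrow> bool" where
  "spacetime A g T \<longleftrightarrow> smooth_manifold A \<and> connected_space (manifold_top A) \<and>
     lorentzian_metric A g \<and>
     smooth_on_set A (tangent_atlas A) (points A) (\<lambda>p. (p, T p)) \<and>
     (\<forall>p\<in>points A. g p (T p) (T p) < 0)"

text \<open>Existence of an oriented atlas \<open>B\<close> for the smooth structure of \<open>A\<close>.\<close>
definition orientable :: "('m, real ^ 'k) atlas \<Rightarrow> bool" where
  "orientable A \<longleftrightarrow> (\<exists>B. smooth_atlas (A \<union> B) \<and> points B = points A \<and>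
     (\<forall>c\<in>B. \<forall>d\<in>B. \<forall>x\<in>snd c ` (fst c \<inter> fst d).
        det (matrix (frechet_derivative (snd d \<circ> chart_inv c) (at x))) > 0))"

text \<open>The Levi-Civita connection in the chart \<open>c\<close>: for \<open>\<nabla>\<^sub>u Y = D\<^sub>u Y + \<Gamma>(u, Y)\<close>, symmetry of \<open>\<Gamma>\<close> is
  vanishing torsion and the last clause is metric compatibility.\<close>
definition christoffel ::
    "('m, 'e::euclidean_space) atlas \<Rightarrow> ('m \<Rightarrow> 'e \<Rightarrow> 'e \<Rightarrow> real) \<Rightarrow> 'm set \<times> ('m \<Rightarrow> 'e) \<Rightarrow> 'e \<Rightarrow> 'e \<Rightarrow> 'e \<Rightarrow> 'e" where
  "christoffel A g c x = (THE \<Gamma>. bilinear \<Gamma> \<and> (\<forall>u v. \<Gamma> u v = \<Gamma> v u) \<and>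
     (\<forall>u v w. frechet_derivative (\<lambda>y. metric_coord A g c y u v) (at x) w =
        metric_coord A g c x (\<Gamma> w u) v + metric_coord A g c x u (\<Gamma> w v)))"

text \<open>Covariant derivative, in the direction \<open>x\<close> tangent to \<open>N\<close> at \<open>p\<close>, of a vector field \<open>W\<close> along a
  map \<open>f\<close> from \<open>N\<close> into the manifold with metric \<open>g\<close> (induced connection on the pull-back bundle),
  computed in the preferred chart at \<open>f p\<close>.\<close>
definition cov_along ::
    "('q, 'd::euclidean_space) atlas \<Rightarrow> ('m, 'e::euclidean_space) atlas \<Rightarrow> ('m \<Rightarrow> 'e \<Rightarrow> 'e \<Rightarrow> real) \<Rightarrow>
     ('q \<Rightarrow> 'm) \<Rightarrow> ('q \<Rightarrow> 'e) \<Rightarrow> 'q \<Rightarrow> 'd \<Rightarrow> 'e" where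
  "cov_along N A g f W p x =
     mfderiv N euclid_atlas (\<lambda>q. tan_coord A (chart_at A (f p)) (f q) (W q)) p x +
     christoffel A g (chart_at A (f p)) (snd (chart_at A (f p)) (f p)) (mfderiv N A f p x) (W p)"

definition velocity :: "('m, 'e::euclidean_space) atlas \<Rightarrow> (real \<Rightarrow> 'm) \<Rightarrow> real \<Rightarrow> 'e" where
  "velocity A \<gamma> s = mfderiv euclid_atlas A \<gamma> s 1"

definition geodesic ::
    "('m, 'e::euclidean_space) atlas \<Rightarrow> ('m \<Rightarrow> 'e \<Rightarrow> 'e \<Rightarrow> real) \<Rightarrow> real set \<Rightarrow> (real \<Rightarrow> 'm) \<Rightarrow> bool" where
  "geodesic A g I \<gamma> \<longleftrightarrow> open I \<and> is_interval I \<and> smooth_map_on euclid_atlas A I \<gamma> \<and>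
     (\<forall>t\<in>I. cov_along euclid_atlas A g \<gamma> (velocity A \<gamma>) t 1 = 0)"

definition exp_rel ::
    "('m, 'e::euclidean_space) atlas \<Rightarrow> ('m \<Rightarrow> 'e \<Rightarrow> 'e \<Rightarrow> real) \<Rightarrow> 'm \<times> 'e \<Rightarrow> 'm \<Rightarrow> bool" where
  "exp_rel A g pv q \<longleftrightarrow> (\<exists>I \<gamma>. geodesic A g I \<gamma> \<and> {0..1} \<subseteq> I \<and>
     \<gamma> 0 = fst pv \<and> velocity A \<gamma> 0 = snd pv \<and> \<gamma> 1 = q)"

definition exp_domain ::
    "('m, 'e::euclidean_space) atlas \<Rightarrow> ('m \<Rightarrow> 'e \<Rightarrow> 'e \<Rightarrow> real) \<Rightarrow> ('m \<times> 'e) set" where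
  "exp_domain A g = {pv. \<exists>q. exp_rel A g pv q}"

definition geod_exp ::
    "('m, 'e::euclidean_space) atlas \<Rightarrow> ('m \<Rightarrow> 'e \<Rightarrow> 'e \<Rightarrow> real) \<Rightarrow> 'm \<times> 'e \<Rightarrow> 'm" where
  "geod_exp A g pv = (THE q. exp_rel A g pv q)"


section \<open>Riemannian volume\<close>

definition induced_metric ::
    "('m, 'e::euclidean_space) atlas \<Rightarrow> ('m \<Rightarrow> 'e \<Rightarrow> 'e \<Rightarrow> real) \<Rightarrow> ('m, 'd::euclidean_space) atlas \<Rightarrow> 'm \<Rightarrow> 'd \<Rightarrow> 'd \<Rightarrow> real" where
  "induced_metric A g AS p x y =
     g p (mfderiv AS A (\<lambda>q. q) p x) (mfderiv AS A (\<lambda>q. q) p y)"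

text \<open>The Borel measure with density \<open>sqrt (det h)\<close> in every chart.\<close>
definition riemannian_measure ::
    "('m, real ^ 'n) atlas \<Rightarrow> ('m \<Rightarrow> real ^ 'n \<Rightarrow> real ^ 'n \<Rightarrow> real) \<Rightarrow> 'm measure" where
  "riemannian_measure N h = (THE \<nu>. space \<nu> = points N \<and>
     sets \<nu> = sigma_sets (points N) {W. openin (manifold_top N) W} \<and>
     (\<forall>c\<in>N. \<forall>E\<in>sets \<nu>. E \<subseteq> fst c \<longrightarrow> emeasure \<nu> E =
        (\<integral>\<^sup>+x\<in>snd c ` E. ennreal (sqrt (det (\<chi> i j. metric_coord N h c x (axis i 1) (axis j 1)))) \<partial>lborel)))"

definition vol ::
    "('m, 'e::euclidean_space) atlas \<Rightarrow> ('m \<Rightarrow> 'e \<Rightarrow> 'e \<Rightarrow> real) \<Rightarrow> ('m, real ^ 'n) atlas \<Rightarrow> real" where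
  "vol A g AS = measure (riemannian_measure AS (induced_metric A g AS)) (points AS)"


section \<open>The normal exponential construction\<close>

definition spacelike ::
    "('m, 'e::euclidean_space) atlas \<Rightarrow> ('m \<Rightarrow> 'e \<Rightarrow> 'e \<Rightarrow> real) \<Rightarrow> ('m, 'd::euclidean_space) atlas \<Rightarrow> bool" where
  "spacelike A g AS \<longleftrightarrow> (\<forall>p\<in>points AS. \<forall>X\<in>tangent_space A AS p. X \<noteq> 0 \<longrightarrow> g p X X > 0)"

definition normal_bundle ::
    "('m, 'e::euclidean_space) atlas \<Rightarrow> ('m \<Rightarrow> 'e \<Rightarrow> 'e \<Rightarrow> real) \<Rightarrow> ('m, 'd::euclidean_space) atlas \<Rightarrow> ('m \<times> 'e) set" where
  "normal_bundle A g AS = {(p, v). p \<in> points AS \<and> (\<forall>X\<in>tangent_space A AS p. g p v X = 0)}"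

definition lightlike_normal_field ::
    "('m, 'e::euclidean_space) atlas \<Rightarrow> ('m \<Rightarrow> 'e \<Rightarrow> 'e \<Rightarrow> real) \<Rightarrow> ('m, 'd::euclidean_space) atlas \<Rightarrow> ('m \<Rightarrow> 'e) \<Rightarrow> bool" where
  "lightlike_normal_field A g AS \<xi> \<longleftrightarrow>
     smooth_on_set A (tangent_atlas A) (points AS) (\<lambda>p. (p, \<xi> p)) \<and>
     (\<forall>p\<in>points AS. (p, \<xi> p) \<in> normal_bundle A g AS \<and> \<xi> p \<noteq> 0 \<and> g p (\<xi> p) (\<xi> p) = 0)"

definition normal_exp_neighborhood ::
    "('m, 'e::euclidean_space) atlas \<Rightarrow> ('m \<Rightarrow> 'e \<Rightarrow> 'e \<Rightarrow> real) \<Rightarrow> ('m, 'd::euclidean_space) atlas \<Rightarrow> ('m \<times> 'e) set \<Rightarrow> bool" where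
  "normal_exp_neighborhood A g AS V \<longleftrightarrow>
     openin (subtopology (manifold_top (tangent_atlas A)) (normal_bundle A g AS)) V \<and>
     (\<forall>p\<in>points AS. (p, 0) \<in> V) \<and>
     (\<forall>p v. \<forall>s\<in>{0..1}. (p, v) \<in> V \<longrightarrow> (p, s *\<^sub>R v) \<in> V) \<and>
     V \<subseteq> exp_domain A g \<and>
     (\<exists>W. openin (manifold_top A) W \<and> points AS \<subseteq> W \<and> diffeo (tangent_atlas A) A V W (geod_exp A g))"

text \<open>The trace of a linear endomorphism \<open>f\<close> of a subspace \<open>W\<close>.\<close>
definition trace_on :: "'e::euclidean_space set \<Rightarrow> ('e \<Rightarrow> 'e) \<Rightarrow> real" where
  "trace_on W f = (let B = (SOME B. independent B \<and> span B = W) in \<Sum>b\<in>B. representation B (f b) b)"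

context
  fixes A :: "('m, 'e::euclidean_space) atlas"
    and g :: "'m \<Rightarrow> 'e \<Rightarrow> 'e \<Rightarrow> real"
    and AS :: "('m, real ^ 'n) atlas"
    and \<xi> :: "'m \<Rightarrow> 'e"
    and V :: "('m \<times> 'e) set"
begin

text \<open>\<open>\<O>\<close>, \<open>\<Phi>\<close>, \<open>\<Sigma>\<close> with its smooth structure, and \<open>\<Phi>\<^sub>*\<close>.\<close>

definition flow_dom :: "('m \<times> real) set" where
  "flow_dom = {(p, t). p \<in> points AS \<and> (p, t *\<^sub>R \<xi> p) \<in> V}"

definition flow :: "'m \<times> real \<Rightarrow> 'm" where
  "flow = (\<lambda>(p, t). geod_exp A g (p, t *\<^sub>R \<xi> p))"

definition hypersurface :: "'m set" where
  "hypersurface = flow ` flow_dom"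

definition hyper_atlas :: "('m, (real ^ 'n) \<times> real) atlas" where
  "hyper_atlas = sub_atlas A hypersurface"

definition dflow :: "'m \<times> real \<Rightarrow> (real ^ 'n) \<times> real \<Rightarrow> 'e" where
  "dflow = mfderiv (prod_atlas AS euclid_atlas) A flow"

definition flow_inv :: "'m \<Rightarrow> 'm \<times> real" where
  "flow_inv = inv_into flow_dom flow"

definition null_field :: "'m \<Rightarrow> 'e" where
  "null_field q = dflow (flow_inv q) (0, 1)"

definition screen :: "'m \<Rightarrow> 'e set" where
  "screen q = range (\<lambda>x. dflow (flow_inv q) (x, 0))"

text \<open>\<open>\<nabla>\<^sub>X U\<close> for \<open>X\<close> tangent to \<open>\<Sigma>\<close> at \<open>q\<close>; the \<open>inv\<close> turns \<open>X\<close> into a vector in the model space of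
  \<open>\<Sigma>\<close>.\<close>
definition nabla_null :: "'m \<Rightarrow> 'e \<Rightarrow> 'e" where
  "nabla_null q X =
     cov_along hyper_atlas A g (\<lambda>q. q) null_field q (inv (mfderiv hyper_atlas A (\<lambda>q. q) q) X)"

definition null_second_form :: "'m \<Rightarrow> 'e \<Rightarrow> 'e \<Rightarrow> real" where
  "null_second_form q X Y = - g q (nabla_null q X) Y"

definition totally_umbilical :: bool where
  "totally_umbilical \<longleftrightarrow> (\<exists>\<mu>::'m \<Rightarrow> real. smooth_on_set A euclid_atlas hypersurface \<mu> \<and>
     (\<forall>q\<in>hypersurface. \<forall>X\<in>tangent_space A hyper_atlas q. \<forall>Y\<in>tangent_space A hyper_atlas q.
        null_second_form q X Y = \<mu> q * g q X Y))"

definition screen_shape :: "'m \<Rightarrow> 'e \<Rightarrow> 'e" where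
  "screen_shape q X = (THE Z. Z \<in> screen q \<and>
     (\<forall>Y\<in>tangent_space A hyper_atlas q. null_second_form q X Y = g q Z Y))"

definition expansion :: "'m \<Rightarrow> real" where
  "expansion q = - trace_on (screen q) (screen_shape q)"

definition common_domain :: "real set" where
  "common_domain = (\<Inter>p\<in>points AS. {t. (p, t) \<in> flow_dom})"

definition leaf :: "real \<Rightarrow> 'm set" where
  "leaf t = flow ` (points AS \<times> {t})"

definition average_expansion :: "real \<Rightarrow> real" where
  "average_expansion t =
     (let \<nu> = riemannian_measure AS (induced_metric A g AS) in
      (LINT p|\<nu>. expansion (flow (p, t)) * exp (LBINT s=0..t. expansion (flow (p, s)))) /
      (LINT p|\<nu>. exp (LBINT s=0..t. expansion (flow (p, s)))))"

end

end

theory Submission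
  imports Defs
begin

text \<open>Along a null geodesic \<open>s \<mapsto> \<Phi>(p, s)\<close> the torsion-freeness of the connection gives
  \<open>\<nabla>\<^sub>U (\<Phi>\<^sub>* X) = \<nabla>\<^bsub>\<Phi>\<^sub>* X\<^esub> U\<close>, so that the induced metrics \<open>h\<^sub>s\<close> of the leaves, pulled back to \<open>S\<close>, satisfy
  \<open>\<partial>\<^sub>s h\<^sub>s = - 2 B\<^sub>U = - 2 \<mu> h\<^sub>s\<close>. Hence \<open>h\<^sub>t\<close> is conformal to \<open>h\<^sub>0\<close> with factor \<open>exp (- 2 \<integral> \<mu>)\<close>, the volume
  elements differ by the factor \<open>exp (- n \<integral> \<mu>) = exp (\<integral> \<theta>)\<close>, and
  \<open>Vol(S\<^sub>t) = a(t)\<close> for \<open>a(t) = \<integral>\<^sub>S exp (\<integral>\<^sub>0\<^sup>t \<theta>) dV\<close>. Differentiating under the integral sign shows that the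
  average expansion is \<open>a' / a\<close>, the logarithmic derivative of \<open>a\<close>, which gives the formula.

  About geodesics only \<open>exp(p, 0) = p\<close> is needed: that a geodesic with zero initial velocity is
  constant, which makes \<open>S\<^sub>0 = S\<close>.\<close>

section \<open>Calculus of smooth maps\<close>

text \<open>The objects of the statement are given by choices and descriptions: preferred charts
  that jump from point to point, the set of all inverse immersions as atlas of a subset,
  \<open>THE\<close> for the Riemannian measure, the connection and the screen shape operator. Each
  must first be shown to be what its name promises, and most of the work lies there. The means is to
  build from a chart \<open>C\<close> of \<open>S\<close> the explicit charts
  \<open>hyper_chart C\<close> of the hypersurface and \<open>leaf_chart t C\<close> of a leaf. In
  the first, \<open>U\<close> is the derivative in the last coordinate. In the second, a leaf point
  has the coordinates of the point of \<open>S\<close> from which it flows, so that volumes are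
  compared density by density in the same coordinates. The order of the argument matters: the
  evolution of the leaf metrics uses only \<mu>; it shows that they stay positive definite; this
  makes the screen shape operator unique and yields \<theta> = - n \<mu>. Compactness of
  \<open>S\<close> provides a finite measure and the uniform bounds on \<theta> that justify
  differentiating under the integral.\<close>

abbreviation "fderiv f x \<equiv> frechet_derivative f (at x)"

lemma frechet_derivative_transform:
  assumes "open X" "x \<in> X" "\<And>y. y \<in> X \<Longrightarrow> f y = g y"
  shows "fderiv f x = fderiv g x"
    and "f differentiable (at x) \<longleftrightarrow> g differentiable (at x)"
proof -
  have iff: "(f has_derivative D) (at x) \<longleftrightarrow> (g has_derivative D) (at x)" for D
    using assms by (metis has_derivative_transform_within_open)
  show "fderiv f x = fderiv g x"
    unfolding frechet_derivative_def iff ..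
  show "f differentiable (at x) \<longleftrightarrow> g differentiable (at x)"
    unfolding differentiable_def iff ..
qed

lemma frechet_derivative_comp:
  assumes "f differentiable (at x)" "g differentiable (at (f x))"
  shows "fderiv (g \<circ> f) x v =
    fderiv g (f x) (fderiv f x v)"
  using frechet_derivative_compose[OF assms] by simp

lemma linear_frechet: "f differentiable (at x) \<Longrightarrow> linear (fderiv f x)"
  by (rule linear_frechet_derivative)

lemma has_frechet: "f differentiable (at x) \<Longrightarrow> (f has_derivative fderiv f x) (at x)"
  by (simp add: frechet_derivative_works)

lemma frechet_eq: "(f has_derivative D) (at x) \<Longrightarrow> fderiv f x = D"
  using frechet_derivative_at by metis

section \<open>Closure properties of functions of class C^k\<close>

lemma Ck_on_cong:
  assumes "open X" "\<And>x. x \<in> X \<Longrightarrow> f x = g x" "Ck_on k X f"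
  shows "Ck_on k X g"
  using assms(2,3)
proof (induction k arbitrary: f g)
  case 0
  then show ?case by (auto cong: continuous_on_cong)
next
  case (Suc k)
  note * = frechet_derivative_transform[OF \<open>open X\<close> _ Suc.prems(1)]
  show ?case
    unfolding Ck_on.simps
  proof (intro conjI ballI allI)
    fix x assume "x \<in> X"
    then show "g differentiable (at x)" using * Suc.prems(2) by auto
  next
    fix v
    have "Ck_on k X (\<lambda>x. fderiv f x v)" using Suc.prems by simp
    then show "Ck_on k X (\<lambda>x. fderiv g x v)"
      by (rule Suc.IH[rotated]) (simp add: *)
  qed
qed

lemma Ck_on_subset: "Ck_on k X f \<Longrightarrow> Y \<subseteq> X \<Longrightarrow> Ck_on k Y f"
  by (induction k arbitrary: f) (auto intro: continuous_on_subset)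

lemma Ck_on_SucD: "Ck_on (Suc k) X f \<Longrightarrow> Ck_on k X f"
proof (induction k arbitrary: f)
  case 0
  then show ?case
    by (auto intro!: continuous_at_imp_continuous_on differentiable_imp_continuous_within)
qed auto

lemma Ck_on_local:
  assumes "\<And>x. x \<in> X \<Longrightarrow> \<exists>Y. open Y \<and> x \<in> Y \<and> Ck_on k Y f"
  shows "Ck_on k X f"
  using assms
proof (induction k arbitrary: f)
  case 0
  show ?case unfolding Ck_on.simps
  proof (rule continuous_at_imp_continuous_on, rule ballI)
    fix x assume "x \<in> X"
    with 0 obtain Y where "open Y" "x \<in> Y" "continuous_on Y f" by auto
    then show "isCont f x" using continuous_on_eq_continuous_at by blast
  qed
next
  case (Suc k)
  then show ?case by (simp; metis)
qed

lemma Ck_on_const: "Ck_on k X (\<lambda>x. c)"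
  by (induction k arbitrary: c) (auto simp: frechet_derivative_const)

text \<open>Trades \<open>fderiv\<close>, which is a choice, for any explicit derivative formula.
  The inductions below consist of such a formula together with the induction hypothesis for its
  terms.\<close>

lemma Ck_on_SucI:
  assumes "open X" "\<And>x. x \<in> X \<Longrightarrow> (f has_derivative f' x) (at x)"
    and "\<And>v. Ck_on k X (\<lambda>x. f' x v)"
  shows "Ck_on (Suc k) X f"
  unfolding Ck_on.simps
proof (intro conjI ballI allI)
  show "f differentiable (at x)" if "x \<in> X" for x
    using assms(2)[OF that] by (auto simp: differentiable_def)
  show "Ck_on k X (\<lambda>x. fderiv f x v)" for v
    by (rule Ck_on_cong[OF assms(1) _ assms(3)[of v]]) (simp add: frechet_eq[OF assms(2)])
qed

lemma Ck_on_SucE: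
  assumes "Ck_on (Suc k) X f"
  obtains "\<And>x. x \<in> X \<Longrightarrow> (f has_derivative fderiv f x) (at x)"
    and "\<And>v. Ck_on k X (\<lambda>x. fderiv f x v)" and "Ck_on k X f"
  using assms Ck_on_SucD[OF assms] by (auto simp: frechet_derivative_works)

lemma Ck_on_compose_linear:
  assumes "open X" and L: "bounded_linear L"
  shows "Ck_on k X f \<Longrightarrow> Ck_on k X (\<lambda>x. L (f x))"
proof (induction k arbitrary: f)
  case 0
  then show ?case using L by (simp add: bounded_linear.continuous_on)
next
  case (Suc k)
  from Suc.prems show ?case
    by (rule Ck_on_SucE)
      (rule Ck_on_SucI[OF \<open>open X\<close> bounded_linear.has_derivative[OF L]], auto intro: Suc.IH)
qed

lemma Ck_on_add:
  assumes "open X"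
  shows "Ck_on k X f \<Longrightarrow> Ck_on k X g \<Longrightarrow> Ck_on k X (\<lambda>x. f x + g x)"
proof (induction k arbitrary: f g)
  case 0
  then show ?case by (simp add: continuous_on_add)
next
  case (Suc k)
  from Suc.prems(1) show ?case
  proof (rule Ck_on_SucE)
    assume f: "\<And>x. x \<in> X \<Longrightarrow> (f has_derivative fderiv f x) (at x)"
      "\<And>v. Ck_on k X (\<lambda>x. fderiv f x v)"
    from Suc.prems(2) show ?case
      by (rule Ck_on_SucE)
        (rule Ck_on_SucI[OF \<open>open X\<close> has_derivative_add[OF f(1)]], auto intro: Suc.IH f)
  qed
qed

lemma Ck_on_bilinear:
  assumes "open X" and B: "bounded_bilinear B"
  shows "Ck_on k X f \<Longrightarrow> Ck_on k X g \<Longrightarrow> Ck_on k X (\<lambda>x. B (f x) (g x))"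
proof (induction k arbitrary: f g)
  case 0
  then show ?case using B by (simp add: bounded_bilinear.continuous_on)
next
  case (Suc k)
  from Suc.prems(1) show ?case
  proof (rule Ck_on_SucE)
    assume f: "\<And>x. x \<in> X \<Longrightarrow> (f has_derivative fderiv f x) (at x)"
      "\<And>v. Ck_on k X (\<lambda>x. fderiv f x v)" "Ck_on k X f"
    from Suc.prems(2) show ?case
      by (rule Ck_on_SucE)
        (rule Ck_on_SucI[OF \<open>open X\<close> bounded_bilinear.FDERIV[OF B f(1)]],
          auto intro!: Suc.IH f Ck_on_add[OF \<open>open X\<close>])
  qed
qed

lemma Ck_on_sum:
  assumes "open X"
  shows "(\<And>i. i \<in> I \<Longrightarrow> Ck_on k X (f i)) \<Longrightarrow> Ck_on k X (\<lambda>x. \<Sum>i\<in>I. f i x)"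
  by (induction I rule: infinite_finite_induct) (auto intro!: Ck_on_add[OF assms] Ck_on_const)

lemma Ck_on_Pair:
  assumes "open X" "Ck_on k X f" "Ck_on k X g"
  shows "Ck_on k X (\<lambda>x. (f x, g x))"
proof -
  have "Ck_on k X (\<lambda>x. (f x, 0) + (0, g x))"
    using assms
    by (intro Ck_on_add Ck_on_compose_linear[where L = "\<lambda>y. (y, 0)"]
        Ck_on_compose_linear[where L = "\<lambda>y. (0, y)"])
      (auto intro!: bounded_linear_intros simp: bounded_linear_Pair bounded_linear_ident bounded_linear_zero)
  then show ?thesis by simp
qed

lemma Ck_on_id: "open X \<Longrightarrow> Ck_on k X (\<lambda>x. x)"
  by (cases k) (auto simp: frechet_derivative_ident intro!: Ck_on_SucI Ck_on_const derivative_eq_intros)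

lemma linear_expand:
  fixes L :: "'a::euclidean_space \<Rightarrow> 'b::real_vector"
  assumes "linear L"
  shows "L v = (\<Sum>b\<in>Basis. (v \<bullet> b) *\<^sub>R L b)"
  by (metis (no_types, lifting) assms euclidean_representation linear_scale linear_sum sum.cong)

lemma Ck_on_compose:
  fixes g :: "'b::euclidean_space \<Rightarrow> 'c::real_normed_vector"
  assumes "open X" "open Y"
  shows "Ck_on k X f \<Longrightarrow> Ck_on k Y g \<Longrightarrow> f ` X \<subseteq> Y \<Longrightarrow> Ck_on k X (\<lambda>x. g (f x))"
proof (induction k arbitrary: f g)
  case 0
  then show ?case by (simp add: continuous_on_compose2)
next
  case (Suc k)
  from Suc.prems(1) show ?case
  proof (rule Ck_on_SucE)
    assume f: "\<And>x. x \<in> X \<Longrightarrow> (f has_derivative fderiv f x) (at x)"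
      "\<And>v. Ck_on k X (\<lambda>x. fderiv f x v)" "Ck_on k X f"
    from Suc.prems(2) show ?case
    proof (rule Ck_on_SucE)
      assume g: "\<And>x. x \<in> Y \<Longrightarrow> (g has_derivative fderiv g x) (at x)"
        "\<And>v. Ck_on k Y (\<lambda>x. fderiv g x v)"
      have fX: "f x \<in> Y" if "x \<in> X" for x using Suc.prems(3) that by auto
      show ?case
      proof (rule Ck_on_SucI[OF \<open>open X\<close>])
        \<comment> \<open>The direction \<open>fderiv f x v\<close> moves with \<open>x\<close>,
          while \<open>Ck_on\<close> controls the derivative of \<open>g\<close> in fixed directions
          only. Expanding in \<open>Basis\<close> leaves products to which the induction hypothesis
          applies.\<close>
        show "((\<lambda>x. g (f x)) has_derivative
            (\<lambda>v. \<Sum>b\<in>Basis. (fderiv f x v \<bullet> b) *\<^sub>R fderiv g (f x) b)) (at x)"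
          if "x \<in> X" for x
          using has_derivative_compose[OF f(1) g(1), OF that fX[OF that]]
          by (subst (asm) linear_expand[OF has_derivative_linear[OF g(1)[OF fX[OF that]]]])
        show "Ck_on k X (\<lambda>x. \<Sum>b\<in>Basis. (fderiv f x v \<bullet> b) *\<^sub>R fderiv g (f x) b)" for v
          using Suc.prems(3) f(3)
          by (intro Ck_on_sum[OF \<open>open X\<close>] Ck_on_bilinear[OF \<open>open X\<close> bounded_bilinear_scaleR] 
              Ck_on_compose_linear[OF \<open>open X\<close> bounded_linear_inner_left] Suc.IH f(2) g(2))
      qed
    qed
  qed
qed

section \<open>Smooth functions on open sets\<close>

lemma smooth_on_cong: "open X \<Longrightarrow> (\<And>x. x \<in> X \<Longrightarrow> f x = g x) \<Longrightarrow> smooth_on X f \<Longrightarrow> smooth_on X g"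
  unfolding smooth_on_def using Ck_on_cong by blast

lemma smooth_on_subset: "smooth_on X f \<Longrightarrow> Y \<subseteq> X \<Longrightarrow> smooth_on Y f"
  unfolding smooth_on_def using Ck_on_subset by blast

lemma smooth_on_local:
  assumes "\<And>x. x \<in> X \<Longrightarrow> \<exists>Y. open Y \<and> x \<in> Y \<and> smooth_on Y f"
  shows "smooth_on X f"
  unfolding smooth_on_def using assms Ck_on_local[of X] by (metis (no_types, lifting) smooth_on_def)

lemma smooth_on_continuous: "smooth_on X f \<Longrightarrow> continuous_on X f"
  unfolding smooth_on_def by (metis Ck_on.simps(1))

lemma smooth_on_differentiable: "smooth_on X f \<Longrightarrow> x \<in> X \<Longrightarrow> f differentiable (at x)"
  unfolding smooth_on_def by (metis Ck_on.simps(2))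

lemma smooth_on_has_derivative:
  "smooth_on X f \<Longrightarrow> x \<in> X \<Longrightarrow> (f has_derivative fderiv f x) (at x)"
  by (intro has_frechet smooth_on_differentiable)

lemma smooth_on_frechet: "smooth_on X f \<Longrightarrow> smooth_on X (\<lambda>x. fderiv f x v)"
  unfolding smooth_on_def by (metis Ck_on.simps(2))

lemma smooth_on_const: "smooth_on X (\<lambda>x. c)"
  by (simp add: smooth_on_def Ck_on_const)

lemma smooth_on_id: "open X \<Longrightarrow> smooth_on X (\<lambda>x. x)"
  by (simp add: smooth_on_def Ck_on_id)

lemma smooth_on_compose_linear:
  "open X \<Longrightarrow> bounded_linear L \<Longrightarrow> smooth_on X f \<Longrightarrow> smooth_on X (\<lambda>x. L (f x))"
  by (simp add: smooth_on_def Ck_on_compose_linear)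

lemma smooth_on_Pair:
  "open X \<Longrightarrow> smooth_on X f \<Longrightarrow> smooth_on X g \<Longrightarrow> smooth_on X (\<lambda>x. (f x, g x))"
  by (simp add: smooth_on_def Ck_on_Pair)

lemma smooth_on_fst: "open X \<Longrightarrow> smooth_on X f \<Longrightarrow> smooth_on X (\<lambda>x. fst (f x))"
  by (rule smooth_on_compose_linear[OF _ bounded_linear_fst])

lemma smooth_on_snd: "open X \<Longrightarrow> smooth_on X f \<Longrightarrow> smooth_on X (\<lambda>x. snd (f x))"
  by (rule smooth_on_compose_linear[OF _ bounded_linear_snd])

lemma smooth_on_sum:
  "open X \<Longrightarrow> (\<And>i. i \<in> I \<Longrightarrow> smooth_on X (f i)) \<Longrightarrow> smooth_on X (\<lambda>x. \<Sum>i\<in>I. f i x)"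
  by (simp add: smooth_on_def Ck_on_sum)

lemma smooth_on_scaleR:
  "open X \<Longrightarrow> smooth_on X f \<Longrightarrow> smooth_on X g \<Longrightarrow> smooth_on X (\<lambda>x. f x *\<^sub>R g x)"
  by (simp add: smooth_on_def Ck_on_bilinear bounded_bilinear_scaleR)

lemma smooth_on_compose:
  fixes g :: "'b::euclidean_space \<Rightarrow> 'c::real_normed_vector"
  shows "open X \<Longrightarrow> open Y \<Longrightarrow> smooth_on X f \<Longrightarrow> smooth_on Y g \<Longrightarrow> f ` X \<subseteq> Y
    \<Longrightarrow> smooth_on X (\<lambda>x. g (f x))"
  unfolding smooth_on_def using Ck_on_compose by blast

text \<open>Base point and direction both vary, so the derivative is expanded over the constant
  directions in \<open>Basis\<close>. With \<open>h\<close> and \<open>w\<close> the two projections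
  this gives the smoothness of tangent maps.\<close>

lemma smooth_on_frechet_apply:
  fixes f :: "'a::euclidean_space \<Rightarrow> 'b::real_normed_vector"
  assumes "open X" "open Y" "smooth_on X f" "smooth_on Y h" "smooth_on Y w" "h ` Y \<subseteq> X"
  shows "smooth_on Y (\<lambda>y. fderiv f (h y) (w y))"
proof -
  have "smooth_on Y (\<lambda>y. \<Sum>b\<in>Basis. (w y \<bullet> b) *\<^sub>R fderiv f (h y) b)"
  proof (rule smooth_on_sum[OF \<open>open Y\<close>], rule smooth_on_scaleR[OF \<open>open Y\<close>])
    fix b :: 'a
    show "smooth_on Y (\<lambda>y. w y \<bullet> b)"
      by (rule smooth_on_compose_linear[OF \<open>open Y\<close> bounded_linear_inner_left]) fact
    show "smooth_on Y (\<lambda>y. fderiv f (h y) b)"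
      by (rule smooth_on_compose[OF \<open>open Y\<close> \<open>open X\<close> \<open>smooth_on Y h\<close> smooth_on_frechet]) fact+
  qed
  then show ?thesis
  proof (rule smooth_on_cong[rotated 2])
    fix y assume "y \<in> Y"
    then have "f differentiable (at (h y))"
      using assms(3,6) smooth_on_differentiable by blast
    then show "(\<Sum>b\<in>Basis. (w y \<bullet> b) *\<^sub>R fderiv f (h y) b) =
        fderiv f (h y) (w y)"
      by (rule linear_expand[symmetric, OF linear_frechet])
  qed fact
qed

section \<open>Symmetry of second derivatives\<close>

lemma double_mvt:
  fixes f :: "'a::real_normed_vector \<Rightarrow> real"
  assumes h: "0 < h" and X: "\<And>a b. 0 \<le> a \<Longrightarrow> a \<le> h \<Longrightarrow> 0 \<le> b \<Longrightarrow> b \<le> h \<Longrightarrow> x + a *\<^sub>R u + b *\<^sub>R v \<in> X"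
    and f: "smooth_on X f"
  shows "\<exists>a b. 0 < a \<and> a < h \<and> 0 < b \<and> b < h \<and>
    f (x + h *\<^sub>R u + h *\<^sub>R v) - f (x + h *\<^sub>R u) - f (x + h *\<^sub>R v) + f x =
    h * h * fderiv (\<lambda>y. fderiv f y u) (x + a *\<^sub>R u + b *\<^sub>R v) v"
proof -
  define P where "P y = fderiv f y u" for y
  have line: "((\<lambda>s. k (y + s *\<^sub>R w)) has_real_derivative fderiv k (y + s *\<^sub>R w) w) (at s)"
    if "smooth_on X k" "y + s *\<^sub>R w \<in> X" for k :: "'a \<Rightarrow> real" and y w s
  proof -
    note D = smooth_on_has_derivative[OF that]
    have "((\<lambda>s. k (y + s *\<^sub>R w)) has_derivative (\<lambda>r. fderiv k (y + s *\<^sub>R w) (r *\<^sub>R w))) (at s)"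
      by (rule has_derivative_compose[of "\<lambda>s. y + s *\<^sub>R w" "\<lambda>r. r *\<^sub>R w" s UNIV k, OF _ D])
        (auto intro!: derivative_eq_intros)
    then show ?thesis
      using has_derivative_linear[OF D] by (simp add: has_field_derivative_def linear_scale mult_commute_abs)
  qed
  \<comment> \<open>First mean value theorem: the difference of \<open>f\<close> on two parallel
    \<open>u\<close>-segments, one shifted by \<open>h *\<^sub>R v\<close>. The second one below is
    applied to the \<open>u\<close>-derivative \<open>P\<close> in the direction
    \<open>v\<close>.\<close>
  have "\<exists>z>0. z < h \<and> (f ((x + h *\<^sub>R v) + h *\<^sub>R u) - f (x + h *\<^sub>R u)) - (f ((x + h *\<^sub>R v) + 0 *\<^sub>R u) - f (x + 0 *\<^sub>R u))
      = (h - 0) * (P (x + h *\<^sub>R v + z *\<^sub>R u) - P (x + z *\<^sub>R u))"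
  proof (rule MVT2[OF h])
    fix a assume "0 \<le> a" "a \<le> h"
    then have "x + h *\<^sub>R v + a *\<^sub>R u \<in> X" "x + a *\<^sub>R u \<in> X"
      using X[of a h] X[of a 0] h by (auto simp: algebra_simps)
    then show "((\<lambda>a. f ((x + h *\<^sub>R v) + a *\<^sub>R u) - f (x + a *\<^sub>R u)) has_real_derivative
        P (x + h *\<^sub>R v + a *\<^sub>R u) - P (x + a *\<^sub>R u)) (at a)"
      unfolding P_def by (intro DERIV_diff line f)
  qed
  then obtain a where a: "0 < a" "a < h"
    "f (x + h *\<^sub>R u + h *\<^sub>R v) - f (x + h *\<^sub>R u) - f (x + h *\<^sub>R v) + f x
      = h * (P (x + a *\<^sub>R u + h *\<^sub>R v) - P (x + a *\<^sub>R u))"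
    by (auto simp: algebra_simps)
  have "\<exists>z>0. z < h \<and> P (x + a *\<^sub>R u + h *\<^sub>R v) - P (x + a *\<^sub>R u + 0 *\<^sub>R v)
      = (h - 0) * fderiv P (x + a *\<^sub>R u + z *\<^sub>R v) v"
  proof (rule MVT2[OF h])
    fix b assume "0 \<le> b" "b \<le> h"
    then have "x + a *\<^sub>R u + b *\<^sub>R v \<in> X" using X[of a b] a by auto
    then show "((\<lambda>b. P (x + a *\<^sub>R u + b *\<^sub>R v)) has_real_derivative
        fderiv P (x + a *\<^sub>R u + b *\<^sub>R v) v) (at b)"
      by (intro line smooth_on_frechet[OF f, of u, folded P_def])
  qed
  then obtain b where b: "0 < b" "b < h" "P (x + a *\<^sub>R u + h *\<^sub>R v) - P (x + a *\<^sub>R u)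
      = h * fderiv P (x + a *\<^sub>R u + b *\<^sub>R v) v" by auto
  show ?thesis using a b by (auto simp: P_def[abs_def] mult.assoc)
qed

text \<open>The second difference in \<open>double_mvt\<close> is symmetric in \<open>u\<close> and
  \<open>v\<close>, so the two iterated derivatives take a common value at points arbitrarily close
  to \<open>x\<close>; continuity then excludes a gap of \<open>2 * e\<close>.\<close>

lemma symmetric_second_derivative_real:
  fixes f :: "'a::real_normed_vector \<Rightarrow> real"
  assumes "open X" "x \<in> X" and f: "smooth_on X f"
  shows "fderiv (\<lambda>y. fderiv f y u) x v =
    fderiv (\<lambda>y. fderiv f y v) x u" (is "?P x = ?Q x")
proof (rule ccontr)
  assume ne: "?P x \<noteq> ?Q x"
  define e where "e = \<bar>?P x - ?Q x\<bar> / 2"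
  have "e > 0" using ne by (simp add: e_def)
  have cont: "isCont ?P x" "isCont ?Q x"
    using smooth_on_continuous[OF smooth_on_frechet[OF smooth_on_frechet[OF f]]] assms(1,2)
    by (auto simp: continuous_on_eq_continuous_at)
  obtain d1 where d1: "d1 > 0" "\<And>y. dist y x < d1 \<Longrightarrow> dist (?P y) (?P x) < e"
    using cont(1) \<open>e > 0\<close> unfolding continuous_at_eps_delta by (metis dist_norm real_norm_def)
  obtain d2 where d2: "d2 > 0" "\<And>y. dist y x < d2 \<Longrightarrow> dist (?Q y) (?Q x) < e"
    using cont(2) \<open>e > 0\<close> unfolding continuous_at_eps_delta by (metis dist_norm real_norm_def)
  obtain d3 where d3: "d3 > 0" "ball x d3 \<subseteq> X" using assms(1,2) openE by blast
  define d where "d = min d1 (min d2 d3)"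
  \<comment> \<open>This \<open>h\<close> keeps the parallelogram with sides
    \<open>h *\<^sub>R u\<close> and \<open>h *\<^sub>R v\<close> inside the ball of radius
    \<open>d\<close>; the summand 1 keeps the denominator positive when
    \<open>u = v = 0\<close>.\<close>
  define h where "h = d / (norm u + norm v + 1) / 2"
  have "d > 0" using d1 d2 d3 by (simp add: d_def)
  have nn: "norm u + norm v + 1 > 0" by (simp add: add_nonneg_pos)
  then have "h > 0" using \<open>d > 0\<close> by (simp add: h_def)
  have "d / q / 2 * q = d / 2" if "q > 0" for q :: real using that by simp
  then have "h * (norm u + norm v + 1) = d / 2" using nn unfolding h_def by blast
  then have hd: "h * (norm u + norm v) < d" using \<open>h > 0\<close> \<open>d > 0\<close> by (simp add: algebra_simps)
  have near: "dist (x + a *\<^sub>R p + b *\<^sub>R q) x < d"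
    if "0 \<le> a" "a \<le> h" "0 \<le> b" "b \<le> h" "norm p + norm q = norm u + norm v" for a b p q
  proof -
    have "dist (x + a *\<^sub>R p + b *\<^sub>R q) x \<le> norm (a *\<^sub>R p) + norm (b *\<^sub>R q)"
    proof -
      have "x + a *\<^sub>R p + b *\<^sub>R q - x = a *\<^sub>R p + b *\<^sub>R q" by simp
      then show ?thesis unfolding dist_norm by (metis norm_triangle_ineq)
    qed
    also have "\<dots> \<le> h * norm p + h * norm q" using that by (auto intro!: add_mono mult_right_mono)
    also have "\<dots> = h * (norm u + norm v)" using that(5) by (simp add: distrib_left[symmetric])
    finally show ?thesis using hd by simp
  qed
  have inX: "x + a *\<^sub>R p + b *\<^sub>R q \<in> X"
    if "0 \<le> a" "a \<le> h" "0 \<le> b" "b \<le> h" "norm p + norm q = norm u + norm v" for a b p q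
    using near[OF that] d3(2) by (auto simp: d_def dist_commute subset_iff)
  obtain a b where ab: "0 < a" "a < h" "0 < b" "b < h"
    "f (x + h *\<^sub>R u + h *\<^sub>R v) - f (x + h *\<^sub>R u) - f (x + h *\<^sub>R v) + f x = h * h * ?P (x + a *\<^sub>R u + b *\<^sub>R v)"
    using double_mvt[OF \<open>h > 0\<close> inX[OF _ _ _ _ refl] f] by blast
  have swap: "norm v + norm u = norm u + norm v" by simp
  obtain a' b' where ab': "0 < a'" "a' < h" "0 < b'" "b' < h"
    "f (x + h *\<^sub>R v + h *\<^sub>R u) - f (x + h *\<^sub>R v) - f (x + h *\<^sub>R u) + f x = h * h * ?Q (x + a' *\<^sub>R v + b' *\<^sub>R u)"
    using double_mvt[OF \<open>h > 0\<close> inX[OF _ _ _ _ swap] f] by blast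
  have "x + h *\<^sub>R v + h *\<^sub>R u = x + h *\<^sub>R u + h *\<^sub>R v" by simp
  then have "h * h * ?P (x + a *\<^sub>R u + b *\<^sub>R v) = h * h * ?Q (x + a' *\<^sub>R v + b' *\<^sub>R u)"
    unfolding ab(5)[symmetric] ab'(5)[symmetric] by (simp add: algebra_simps)
  then have "?P (x + a *\<^sub>R u + b *\<^sub>R v) = ?Q (x + a' *\<^sub>R v + b' *\<^sub>R u)" using \<open>h > 0\<close> by simp
  moreover have "dist (?P (x + a *\<^sub>R u + b *\<^sub>R v)) (?P x) < e"
    using near[of a b u v] ab by (intro d1) (auto simp: d_def)
  moreover have "dist (?Q (x + a' *\<^sub>R v + b' *\<^sub>R u)) (?Q x) < e"
    using near[of a' b' v u] ab' by (intro d2) (auto simp: d_def)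
  ultimately have "\<bar>?P x - ?Q x\<bar> < 2 * e" by (simp add: dist_real_def)
  then show False by (simp add: e_def)
qed

lemma frechet_inner:
  "f differentiable (at x) \<Longrightarrow> fderiv (\<lambda>y. f y \<bullet> b) x v = fderiv f x v \<bullet> b"
  using frechet_eq[OF has_derivative_inner_left[OF has_frechet]] by metis

lemma symmetric_second_derivative:
  fixes f :: "'a::real_normed_vector \<Rightarrow> 'b::euclidean_space"
  assumes "open X" "x \<in> X" and f: "smooth_on X f"
  shows "fderiv (\<lambda>y. fderiv f y u) x v =
    fderiv (\<lambda>y. fderiv f y v) x u"
proof (rule euclidean_eqI)
  fix b :: 'b
  have fb: "smooth_on X (\<lambda>y. f y \<bullet> b)"
    by (rule smooth_on_compose_linear[OF \<open>open X\<close> bounded_linear_inner_left f])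
  have *: "fderiv (\<lambda>y. fderiv f y u) x v \<bullet> b =
    fderiv (\<lambda>y. fderiv (\<lambda>y. f y \<bullet> b) y u) x v" for u v
  proof -
    have "fderiv (\<lambda>y. fderiv f y u) x v \<bullet> b =
        fderiv (\<lambda>y. fderiv f y u \<bullet> b) x v"
      by (rule frechet_inner[symmetric, OF smooth_on_differentiable[OF smooth_on_frechet[OF f] \<open>x \<in> X\<close>]])
    also have "\<dots> = fderiv (\<lambda>y. fderiv (\<lambda>y. f y \<bullet> b) y u) x v"
      by (rule fun_cong[OF frechet_derivative_transform(1)[OF assms(1,2)]])
        (simp add: frechet_inner smooth_on_differentiable[OF f])
    finally show ?thesis .
  qed
  show "fderiv (\<lambda>y. fderiv f y u) x v \<bullet> b =
    fderiv (\<lambda>y. fderiv f y v) x u \<bullet> b"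
    unfolding * by (rule symmetric_second_derivative_real[OF assms(1,2) fb])
qed

text \<open>This replaces the inverse function theorem when changing between two parametrizations of the
  same embedded submanifold: the continuity of \<open>\<tau>\<close> lets the remainder term of \<open>\<psi>\<close> be absorbed.\<close>
lemma has_derivative_through_immersion:
  fixes \<psi> :: "'b::euclidean_space \<Rightarrow> 'c::euclidean_space"
  assumes "isCont \<tau> x" and f: "(f has_derivative f') (at x)"
    and psi: "(\<psi> has_derivative \<psi>') (at (\<tau> x))" and "inj \<psi>'"
    and ev: "\<forall>\<^sub>F y in at x. f y = \<psi> (\<tau> y)" and fx: "f x = \<psi> (\<tau> x)"
  obtains \<tau>' where "(\<tau> has_derivative \<tau>') (at x)" "\<And>v. \<psi>' (\<tau>' v) = f' v"
proof -
  have "linear \<psi>'" using psi by (rule has_derivative_linear)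
  then obtain L where L: "linear L" "L \<circ> \<psi>' = id"
    using linear_injective_left_inverse \<open>inj \<psi>'\<close> by blast
  then have bl: "bounded_linear L" by (simp add: linear_conv_bounded_linear)
  obtain K where K: "K > 0" "\<And>y. norm (L y) \<le> norm y * K"
    using bounded_linear.pos_bounded[OF bl] by auto
  have L\<psi>: "L (\<psi>' k) = k" for k using L(2) by (metis comp_apply id_apply)
  \<comment> \<open>If \<tau> is differentiable, the chain rule forces its derivative to be the left
    inverse \<open>L\<close> after \<open>f'\<close>.\<close>
  have der: "(\<tau> has_derivative (\<lambda>v. L (f' v))) (at x)"
    unfolding has_derivative_at_alt
  proof (intro conjI allI impI)
    show bl': "bounded_linear (\<lambda>v. L (f' v))"
      using bl has_derivative_bounded_linear[OF f] by (rule bounded_linear_compose)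
    obtain C where C: "C > 0" "\<And>y. norm (L (f' y)) \<le> norm y * C"
      using bounded_linear.pos_bounded[OF bl'] by auto
    fix e :: real assume "e > 0"
    \<comment> \<open>The bound \<open>a * K \<le> 1 / 2\<close> lets the term in
      \<open>norm k\<close> on the right of \<open>rem\<close> be absorbed, which produces
      \<open>kb\<close> with the constant \<open>2 * (C + 1)\<close>. The second argument of
      \<open>min\<close> then makes the total error at most \<open>e\<close> times
      \<open>norm (y - x)\<close>.\<close>
    define a where "a = min (1 / (2 * K)) (e / (2 * K * (2 * (C + 1) + 1)))"
    have a: "a > 0" "a * K \<le> 1 / 2" "a * K * (2 * (C + 1) + 1) \<le> e"
    proof -
      have c: "2 * (C + 1) + 1 > 0" using C(1) by simp
      show "a > 0" using K(1) c \<open>e > 0\<close> by (simp add: a_def)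
      have "a * K \<le> 1 / (2 * K) * K" using K(1) by (intro mult_right_mono) (auto simp: a_def)
      then show "a * K \<le> 1 / 2" using K(1) by simp
      have "a * (K * (2 * (C + 1) + 1)) \<le> e / (2 * K * (2 * (C + 1) + 1)) * (K * (2 * (C + 1) + 1))"
        using K(1) c by (intro mult_right_mono) (auto simp: a_def)
      also have "\<dots> = e / 2"
      proof -
        have "e / (2 * K * q) * (K * q) = e / 2" if "q > 0" for q using K(1) that by (simp add: field_simps)
        then show ?thesis using c by blast
      qed
      finally show "a * K * (2 * (C + 1) + 1) \<le> e" using \<open>e > 0\<close> unfolding mult.assoc by linarith
    qed
    obtain d1 where d1: "d1 > 0" "\<And>z. norm (z - \<tau> x) < d1 \<Longrightarrow>
        norm (\<psi> z - \<psi> (\<tau> x) - \<psi>' (z - \<tau> x)) \<le> a * norm (z - \<tau> x)"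
      using psi a(1) unfolding has_derivative_at_alt by metis
    define a' where "a' = min a (1 / K)"
    have a': "a' > 0" "a' \<le> a" "a' * K \<le> 1" using a(1) K(1) by (auto simp: a'_def min_mult_distrib_right)
    obtain d2 where d2: "d2 > 0" "\<And>y. norm (y - x) < d2 \<Longrightarrow>
        norm (f y - f x - f' (y - x)) \<le> a' * norm (y - x)"
      using f a'(1) unfolding has_derivative_at_alt by metis
    obtain d3 where d3: "d3 > 0" "\<And>y. dist y x < d3 \<Longrightarrow> dist (\<tau> y) (\<tau> x) < d1"
      using \<open>isCont \<tau> x\<close> d1(1) unfolding continuous_at_eps_delta by (metis dist_norm)
    obtain d4 where d4: "d4 > 0" "\<And>y. dist y x < d4 \<Longrightarrow> f y = \<psi> (\<tau> y)"
      using ev fx unfolding eventually_at by (metis UNIV_I)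
    show "\<exists>d>0. \<forall>y. norm (y - x) < d \<longrightarrow> norm (\<tau> y - \<tau> x - L (f' (y - x))) \<le> e * norm (y - x)"
    proof (intro exI[of _ "min d2 (min d3 d4)"] conjI allI impI)
      fix y assume y: "norm (y - x) < min d2 (min d3 d4)"
      define k where "k = \<tau> y - \<tau> x"
      have 1: "norm (\<psi> (\<tau> y) - \<psi> (\<tau> x) - \<psi>' k) \<le> a * norm k"
        using d1(2)[of "\<tau> y"] d3(2)[of y] y by (simp add: k_def dist_norm)
      have 2: "norm (f y - f x - f' (y - x)) \<le> a' * norm (y - x)" using d2(2) y by simp
      have ff: "f y = \<psi> (\<tau> y)" using d4(2) y by (simp add: dist_norm)
      have keq: "k - L (f' (y - x)) = L (f y - f x - f' (y - x)) - L (\<psi> (\<tau> y) - \<psi> (\<tau> x) - \<psi>' k)"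
        using L(1) by (simp add: linear_diff L\<psi> ff fx)
      have rem: "norm (k - L (f' (y - x))) \<le> a' * norm (y - x) * K + a * norm k * K"
      proof -
        have "norm (k - L (f' (y - x))) \<le> norm (f y - f x - f' (y - x)) * K + norm (\<psi> (\<tau> y) - \<psi> (\<tau> x) - \<psi>' k) * K"
          unfolding keq by (rule order_trans[OF norm_triangle_ineq4]) (intro add_mono K(2))
        also have "\<dots> \<le> a' * norm (y - x) * K + a * norm k * K"
          using 1 2 K(1) by (intro add_mono mult_right_mono) auto
        finally show ?thesis .
      qed
      have "norm k \<le> norm (k - L (f' (y - x))) + norm (L (f' (y - x)))" by norm
      also have "\<dots> \<le> a' * norm (y - x) * K + a * norm k * K + norm (y - x) * C"
        using rem C(2) by (intro add_mono)
      also have "\<dots> \<le> norm (y - x) + norm k / 2 + norm (y - x) * C"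
      proof -
        have "a' * K * norm (y - x) \<le> 1 * norm (y - x)" using a' by (intro mult_right_mono) auto
        moreover have "a * K * norm k \<le> 1 / 2 * norm k" using a by (intro mult_right_mono) auto
        ultimately show ?thesis by (simp add: ac_simps)
      qed
      finally have kb: "norm k \<le> 2 * (C + 1) * norm (y - x)" by (simp add: algebra_simps)
      have "norm (k - L (f' (y - x))) \<le> a * norm (y - x) * K + a * (2 * (C + 1) * norm (y - x)) * K"
        using rem kb a a' K(1)
        by (elim order_trans) (intro add_mono mult_right_mono mult_left_mono; simp)
      also have "\<dots> = (a * K * (2 * (C + 1) + 1)) * norm (y - x)" by (simp add: algebra_simps)
      also have "\<dots> \<le> e * norm (y - x)" using a(3) by (rule mult_right_mono) simp
      finally show "norm (\<tau> y - \<tau> x - L (f' (y - x))) \<le> e * norm (y - x)" by (simp add: k_def)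
    qed (use d2 d3 d4 in auto)
  qed
  \<comment> \<open>So far \<open>L\<close> is only a left inverse of \<open>\<psi>'\<close>. That
    \<open>f'\<close> takes values in the range of \<open>\<psi>'\<close> comes from uniqueness of
    the derivative of \<open>f\<close>, which equals \<open>\<psi> \<circ> \<tau>\<close> near
    \<open>x\<close>.\<close>
  have "(f has_derivative (\<lambda>v. \<psi>' (L (f' v)))) (at x)"
  proof (rule has_derivative_transform_eventually[OF has_derivative_compose[OF der psi]])
    show "\<forall>\<^sub>F y in at x. \<psi> (\<tau> y) = f y" using ev by eventually_elim simp
  qed (use fx in auto)
  then have "f' = (\<lambda>v. \<psi>' (L (f' v)))" using f has_derivative_unique by blast
  then show ?thesis using der that by metis
qed

section \<open>Atlases\<close>

text \<open>\<open>sub_atlas\<close> is only shown to have differentiable transition maps, which is all that is needed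
  of it; hence this weakening of \<open>smooth_atlas\<close>.\<close>
definition diff_atlas :: "('m, 'e::euclidean_space) atlas \<Rightarrow> bool" where
  "diff_atlas A \<longleftrightarrow> (\<forall>c\<in>A. inj_on (snd c) (fst c)) \<and>
     (\<forall>c\<in>A. \<forall>d\<in>A. open (snd c ` (fst c \<inter> fst d)) \<and>
        (\<forall>x\<in>snd c ` (fst c \<inter> fst d). (snd d \<circ> chart_inv c) differentiable (at x)))"

lemma smooth_atlas_imp_diff_atlas: "smooth_atlas A \<Longrightarrow> diff_atlas A"
  unfolding smooth_atlas_def diff_atlas_def using smooth_on_differentiable by blast

lemma chart_apply_inv: "x \<in> snd c ` fst c \<Longrightarrow> snd c (chart_inv c x) = x"
  unfolding chart_inv_def by (rule f_inv_into_f)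

lemma chart_inv_mem: "x \<in> snd c ` fst c \<Longrightarrow> chart_inv c x \<in> fst c"
  unfolding chart_inv_def by (rule inv_into_into)

lemma chart_at_mem:
  assumes "p \<in> points A"
  shows "chart_at A p \<in> A" "p \<in> fst (chart_at A p)"
proof -
  have "\<exists>c. c \<in> A \<and> p \<in> fst c" using assms by (auto simp: points_def)
  from someI_ex[OF this] show "chart_at A p \<in> A" "p \<in> fst (chart_at A p)"
    by (auto simp: chart_at_def)
qed

lemma fst_subset_points: "c \<in> A \<Longrightarrow> fst c \<subseteq> points A"
  by (auto simp: points_def)

context
  fixes A :: "('m, 'e::euclidean_space) atlas"
  assumes A: "diff_atlas A"
begin

lemma chart_inj: "c \<in> A \<Longrightarrow> inj_on (snd c) (fst c)"
  using A by (simp add: diff_atlas_def)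

lemma chart_inv_apply: "c \<in> A \<Longrightarrow> p \<in> fst c \<Longrightarrow> chart_inv c (snd c p) = p"
  unfolding chart_inv_def by (simp add: chart_inj)

lemma open_overlap: "c \<in> A \<Longrightarrow> d \<in> A \<Longrightarrow> open (snd c ` (fst c \<inter> fst d))"
  using A by (simp add: diff_atlas_def)

lemma open_chart_image: "c \<in> A \<Longrightarrow> open (snd c ` fst c)"
  using open_overlap[of c c] by simp

lemma transition_differentiable:
  "c \<in> A \<Longrightarrow> d \<in> A \<Longrightarrow> p \<in> fst c \<Longrightarrow> p \<in> fst d \<Longrightarrow> (snd d \<circ> chart_inv c) differentiable (at (snd c p))"
  using A unfolding diff_atlas_def by blast

text \<open>Injectivity of the charts makes images commute with intersections, which turns the
  defining predicate of \<open>manifold_top\<close> into a topology.\<close>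

lemma openin_atlas:
  "openin (manifold_top A) W \<longleftrightarrow> W \<subseteq> points A \<and> (\<forall>c\<in>A. open (snd c ` (fst c \<inter> W)))"
proof -
  have "istopology (\<lambda>W. W \<subseteq> points A \<and> (\<forall>c\<in>A. open (snd c ` (fst c \<inter> W))))"
    unfolding istopology_def
  proof (intro conjI allI impI ballI; (elim conjE)?)
    fix S T c
    assume ST: "\<forall>c\<in>A. open (snd c ` (fst c \<inter> S))" "\<forall>c\<in>A. open (snd c ` (fst c \<inter> T))" and "c \<in> A"
    have "snd c ` (fst c \<inter> (S \<inter> T)) = snd c ` (fst c \<inter> S) \<inter> snd c ` (fst c \<inter> T)"
      using chart_inj[OF \<open>c \<in> A\<close>] by (auto simp: inj_on_def)
    then show "open (snd c ` (fst c \<inter> (S \<inter> T)))" using ST \<open>c \<in> A\<close> by auto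
  next
    fix \<K> c
    assume K: "\<forall>K\<in>\<K>. K \<subseteq> points A \<and> (\<forall>c\<in>A. open (snd c ` (fst c \<inter> K)))" and "c \<in> A"
    have "snd c ` (fst c \<inter> \<Union>\<K>) = (\<Union>K\<in>\<K>. snd c ` (fst c \<inter> K))" by auto
    then show "open (snd c ` (fst c \<inter> \<Union>\<K>))" using K \<open>c \<in> A\<close> by auto
  qed blast+
  then show ?thesis unfolding manifold_top_def by simp
qed

lemma topspace_manifold_top: "topspace (manifold_top A) = points A"
proof
  show "topspace (manifold_top A) \<subseteq> points A"
    unfolding topspace_def by (auto simp: openin_atlas)
  have "openin (manifold_top A) (points A)"
    unfolding openin_atlas by (simp add: Int_absorb2 fst_subset_points open_chart_image)
  then show "points A \<subseteq> topspace (manifold_top A)" by (rule openin_subset)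
qed

lemma open_chart_openin: "openin (manifold_top A) W \<Longrightarrow> c \<in> A \<Longrightarrow> open (snd c ` (fst c \<inter> W))"
  by (simp add: openin_atlas)

text \<open>Read in another chart, the set is a preimage under a transition map, and transition maps
  are differentiable, hence continuous.\<close>

lemma openin_chart_vimage:
  assumes "c \<in> A" "open U"
  shows "openin (manifold_top A) (fst c \<inter> snd c -` U)"
  unfolding openin_atlas
proof (intro conjI ballI)
  show "fst c \<inter> snd c -` U \<subseteq> points A" using fst_subset_points[OF \<open>c \<in> A\<close>] by auto
  fix d assume "d \<in> A"
  have eq: "snd d ` (fst d \<inter> (fst c \<inter> snd c -` U)) =
      snd d ` (fst d \<inter> fst c) \<inter> (snd c \<circ> chart_inv d) -` U"
    using chart_inv_apply[OF \<open>d \<in> A\<close>] by force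
  have "continuous_on (snd d ` (fst d \<inter> fst c)) (snd c \<circ> chart_inv d)"
    using transition_differentiable[OF \<open>d \<in> A\<close> \<open>c \<in> A\<close>]
    by (intro continuous_at_imp_continuous_on ballI differentiable_imp_continuous_within) blast
  then show "open (snd d ` (fst d \<inter> (fst c \<inter> snd c -` U)))"
    unfolding eq by (rule continuous_open_preimage) (use open_overlap assms \<open>d \<in> A\<close> in auto)
qed

lemma openin_chart: "c \<in> A \<Longrightarrow> openin (manifold_top A) (fst c)"
  using openin_chart_vimage[of c UNIV] by simp

lemma continuous_map_chart:
  "c \<in> A \<Longrightarrow> continuous_map (subtopology (manifold_top A) (fst c)) euclidean (snd c)"
  unfolding continuous_map
proof (intro conjI allI impI)
  fix U :: "'e set" assume c: "c \<in> A" and "openin euclidean U"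
  then have "open U" by simp
  have "{x \<in> topspace (subtopology (manifold_top A) (fst c)). snd c x \<in> U} = (fst c \<inter> snd c -` U) \<inter> fst c"
    using fst_subset_points[OF c] by (auto simp: topspace_manifold_top)
  then show "openin (subtopology (manifold_top A) (fst c))
      {x \<in> topspace (subtopology (manifold_top A) (fst c)). snd c x \<in> U}"
    using openin_chart_vimage[OF c \<open>open U\<close>] by (auto simp: openin_subtopology)
qed auto

text \<open>The cocycle law from the chain rule. Since \<open>tan_coord\<close> and
  \<open>tan_vec\<close> are derivatives of transitions from and to the preferred chart, their
  inversion and change of chart laws are instances of it.\<close>

lemma frechet_transition_comp:
  assumes "c \<in> A" "d \<in> A" "e \<in> A" "p \<in> fst c" "p \<in> fst d" "p \<in> fst e"
  shows "fderiv (snd e \<circ> chart_inv d) (snd d p)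
      (fderiv (snd d \<circ> chart_inv c) (snd c p) v) =
    fderiv (snd e \<circ> chart_inv c) (snd c p) v"
proof -
  have eq: "(snd d \<circ> chart_inv c) (snd c p) = snd d p" using assms by (simp add: chart_inv_apply)
  have "fderiv ((snd e \<circ> chart_inv d) \<circ> (snd d \<circ> chart_inv c)) (snd c p) v =
      fderiv (snd e \<circ> chart_inv d) (snd d p)
      (fderiv (snd d \<circ> chart_inv c) (snd c p) v)"
    using frechet_derivative_comp[of "snd d \<circ> chart_inv c" "snd c p" "snd e \<circ> chart_inv d" v] assms
    unfolding eq by (simp add: transition_differentiable)
  moreover have "fderiv ((snd e \<circ> chart_inv d) \<circ> (snd d \<circ> chart_inv c)) (snd c p) =
      fderiv (snd e \<circ> chart_inv c) (snd c p)"
    by (rule frechet_derivative_transform(1)[OF open_overlap[OF assms(1,2)]])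
      (use assms in \<open>auto simp: chart_inv_apply\<close>)
  ultimately show ?thesis by simp
qed

lemma frechet_transition_self:
  assumes "c \<in> A" "p \<in> fst c"
  shows "fderiv (snd c \<circ> chart_inv c) (snd c p) v = v"
proof -
  have "fderiv (snd c \<circ> chart_inv c) (snd c p) = fderiv (\<lambda>x. x) (snd c p)"
    by (rule frechet_derivative_transform(1)[OF open_chart_image[OF assms(1)]])
      (use assms in \<open>auto simp: chart_inv_apply\<close>)
  then show ?thesis by (simp add: frechet_derivative_ident)
qed

lemma linear_transition:
  "c \<in> A \<Longrightarrow> d \<in> A \<Longrightarrow> p \<in> fst c \<Longrightarrow> p \<in> fst d \<Longrightarrow> linear (fderiv (snd d \<circ> chart_inv c) (snd c p))"
  by (intro linear_frechet transition_differentiable)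

section \<open>Tangent vectors and metrics in an arbitrary chart\<close>

context
  fixes c p assumes c: "c \<in> A" "p \<in> fst c"
begin

lemma chart_domain_points: "p \<in> points A"
  using c(2) fst_subset_points[OF c(1)] by blast

lemma linear_tan_coord: "linear (tan_coord A c p)"
  unfolding tan_coord_def[abs_def] using linear_transition[OF chart_at_mem(1)[OF chart_domain_points] c(1) chart_at_mem(2)[OF chart_domain_points] c(2)] .

lemma tan_coord_vec: "tan_coord A c p (tan_vec A c p u) = u"
  unfolding tan_coord_def tan_vec_def
  by (simp add: frechet_transition_comp frechet_transition_self c chart_at_mem[OF chart_domain_points])

lemma tan_vec_coord: "tan_vec A c p (tan_coord A c p u) = u"
  unfolding tan_coord_def tan_vec_def
  by (simp add: frechet_transition_comp frechet_transition_self c chart_at_mem[OF chart_domain_points])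

lemma metric_coord_at: "metric_coord A h c (snd c p) u v = h p (tan_vec A c p u) (tan_vec A c p v)"
  unfolding metric_coord_def by (simp add: chart_inv_apply c)

lemma metric_via_coord: "h p u v = metric_coord A h c (snd c p) (tan_coord A c p u) (tan_coord A c p v)"
  by (simp add: metric_coord_at tan_vec_coord)

end

lemma tan_vec_chart_at: "p \<in> points A \<Longrightarrow> tan_vec A (chart_at A p) p u = u"
  unfolding tan_vec_def by (simp add: frechet_transition_self chart_at_mem)

text \<open>The preferred chart hidden in \<open>tan_vec\<close> drops out by
  \<open>frechet_transition_comp\<close>; what remains is the pullback of a form under the
  transition map.\<close>

lemma metric_coord_change:
  assumes "c \<in> A" "d \<in> A" "p \<in> fst c" "p \<in> fst d"
  shows "metric_coord A h c (snd c p) u v = metric_coord A h d (snd d p)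
    (fderiv (snd d \<circ> chart_inv c) (snd c p) u)
    (fderiv (snd d \<circ> chart_inv c) (snd c p) v)"
  using chart_at_mem[OF chart_domain_points[OF assms(1,3)]] assms
  by (simp add: metric_coord_at tan_vec_def frechet_transition_comp)

lemma frechet_change_chart:
  fixes f :: "'d::real_normed_vector \<Rightarrow> 'm"
  assumes "c \<in> A" "d \<in> A" "f x \<in> fst d"
    and U: "open U" "x \<in> U" "f ` U \<subseteq> fst c" and diff: "(snd c \<circ> f) differentiable (at x)"
  shows "fderiv (snd d \<circ> f) x v =
      fderiv (snd d \<circ> chart_inv c) (snd c (f x)) (fderiv (snd c \<circ> f) x v)"
    and "(snd d \<circ> f) differentiable (at x)"
proof -
  have fx: "f x \<in> fst c" using U by auto
  have eq: "(snd d \<circ> f) y = ((snd d \<circ> chart_inv c) \<circ> (snd c \<circ> f)) y" if "y \<in> U" for y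
    using U that assms(1) by (simp add: image_subset_iff chart_inv_apply)
  have td: "(snd d \<circ> chart_inv c) differentiable (at ((snd c \<circ> f) x))"
    using transition_differentiable[OF assms(1,2) fx assms(3)] by simp
  have tr: "fderiv (snd d \<circ> f) x = fderiv ((snd d \<circ> chart_inv c) \<circ> (snd c \<circ> f)) x"
    by (rule frechet_derivative_transform(1)[OF U(1,2)]) (rule eq)
  have "fderiv ((snd d \<circ> chart_inv c) \<circ> (snd c \<circ> f)) x v =
      fderiv (snd d \<circ> chart_inv c) ((snd c \<circ> f) x) (fderiv (snd c \<circ> f) x v)"
    by (rule frechet_derivative_comp[OF diff td])
  then show "fderiv (snd d \<circ> f) x v =
      fderiv (snd d \<circ> chart_inv c) (snd c (f x)) (fderiv (snd c \<circ> f) x v)"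
    unfolding tr o_apply[of "snd c" f x] .
  have "(snd d \<circ> f) differentiable (at x) \<longleftrightarrow> ((snd d \<circ> chart_inv c) \<circ> (snd c \<circ> f)) differentiable (at x)"
    by (rule frechet_derivative_transform(2)[OF U(1,2)]) (rule eq)
  then show "(snd d \<circ> f) differentiable (at x)"
    using differentiable_chain_at[OF diff td] by simp
qed

end

section \<open>Smooth maps between manifolds\<close>

text \<open>This is \<open>smooth_map_on\<close> out of \<open>euclid_atlas\<close> with the
  identity chart stripped off (\<open>smooth_map_on_euclid\<close>). Curves, inverse charts and the
  flow in coordinates are all handled in this form.\<close>

definition smooth_param :: "('m, 'e::euclidean_space) atlas \<Rightarrow> 'd::euclidean_space set \<Rightarrow> ('d \<Rightarrow> 'm) \<Rightarrow> bool" where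
  "smooth_param A W f \<longleftrightarrow> open W \<and> f ` W \<subseteq> points A \<and>
     (\<forall>d\<in>A. open (W \<inter> f -` fst d) \<and> smooth_on (W \<inter> f -` fst d) (snd d \<circ> f))"

lemma chart_inv_euclid: "chart_inv (UNIV, \<lambda>x. x) x = x"
  by (simp add: chart_inv_def inv_into_def)

lemma chart_inv_euclid': "chart_inv (UNIV, \<lambda>x. x) = (\<lambda>x. x)"
  by (rule ext) (rule chart_inv_euclid)

lemma smooth_atlas_euclid: "smooth_atlas euclid_atlas"
  by (simp add: smooth_atlas_def euclid_atlas_def chart_inv_euclid' comp_def smooth_on_id)

lemma points_euclid: "points euclid_atlas = UNIV"
  by (simp add: points_def euclid_atlas_def)

lemma openin_manifold_top_euclid: "openin (manifold_top euclid_atlas) W \<longleftrightarrow> open W"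
  using openin_atlas[OF smooth_atlas_imp_diff_atlas[OF smooth_atlas_euclid]]
  by (simp add: points_euclid) (simp add: euclid_atlas_def)

lemma chart_at_euclid: "chart_at euclid_atlas x = (UNIV, \<lambda>x. x)"
  unfolding chart_at_def by (rule some_equality) (auto simp: euclid_atlas_def)

lemma manifold_top_euclid: "manifold_top euclid_atlas = euclidean"
  by (simp add: topology_eq openin_manifold_top_euclid)

lemma smooth_map_on_euclid: "smooth_map_on euclid_atlas A W f \<longleftrightarrow> smooth_param A W f"
  unfolding smooth_map_on_def smooth_param_def openin_manifold_top_euclid
  by (simp add: euclid_atlas_def chart_inv_euclid' comp_def)

lemma smooth_map_on_imp_param:
  assumes "diff_atlas A" "smooth_map_on A B G F" "c \<in> A"
  shows "smooth_param B (snd c ` (fst c \<inter> G)) (F \<circ> chart_inv c)"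
proof -
  have eq: "snd c ` (fst c \<inter> G) \<inter> (F \<circ> chart_inv c) -` V = snd c ` (fst c \<inter> G \<inter> F -` V)" for V
    using chart_inv_apply[OF assms(1,3)] by force
  have "open (snd c ` (fst c \<inter> G))" "F ` G \<subseteq> points B"
    using assms open_chart_openin unfolding smooth_map_on_def by blast+
  moreover have "(F \<circ> chart_inv c) ` (snd c ` (fst c \<inter> G)) \<subseteq> F ` G"
    using chart_inv_apply[OF assms(1,3)] by auto
  ultimately show ?thesis
    using assms(2,3) unfolding smooth_map_on_def smooth_param_def eq comp_assoc by blast
qed

text \<open>Each chart \<open>d\<close> contributes the preimage, under the continuous map
  \<open>snd d \<circ> f\<close>, of the coordinate image of \<open>G\<close>; injectivity of
  \<open>d\<close> ensures that nothing outside \<open>G\<close> is picked up.\<close>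

lemma smooth_param_open_vimage:
  assumes A: "diff_atlas A" and f: "smooth_param A W f" and G: "openin (manifold_top A) G"
  shows "open (W \<inter> f -` G)"
proof -
  have "W \<inter> f -` G = (\<Union>d\<in>A. (W \<inter> f -` fst d) \<inter> (snd d \<circ> f) -` (snd d ` (fst d \<inter> G)))" (is "_ = ?R")
  proof
    show "W \<inter> f -` G \<subseteq> ?R"
      using f unfolding smooth_param_def points_def by fastforce
    show "?R \<subseteq> W \<inter> f -` G"
    proof
      fix x assume "x \<in> ?R"
      then obtain d q where "d \<in> A" "x \<in> W" "f x \<in> fst d" "q \<in> fst d" "q \<in> G" "snd d (f x) = snd d q"
        by auto
      then show "x \<in> W \<inter> f -` G" using chart_inj[OF A] by (metis IntI inj_onD vimageI)
    qed
  qed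
  also have "open \<dots>"
  proof (rule open_UN, rule ballI, rule continuous_open_preimage)
    fix d assume "d \<in> A"
    then show "continuous_on (W \<inter> f -` fst d) (snd d \<circ> f)" "open (W \<inter> f -` fst d)"
      using f smooth_on_continuous unfolding smooth_param_def by blast+
    show "open (snd d ` (fst d \<inter> G))" by (rule open_chart_openin) fact+
  qed
  finally show ?thesis .
qed

lemma smooth_param_subset: "smooth_param A W f \<Longrightarrow> open U \<Longrightarrow> U \<subseteq> W \<Longrightarrow> smooth_param A U f"
  unfolding smooth_param_def
proof (intro conjI ballI)
  fix d assume *: "open W \<and> f ` W \<subseteq> points A \<and> (\<forall>d\<in>A. open (W \<inter> f -` fst d) \<and> smooth_on (W \<inter> f -` fst d) (snd d \<circ> f))"
    "open U" "U \<subseteq> W" "d \<in> A"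
  then have "U \<inter> f -` fst d = U \<inter> (W \<inter> f -` fst d)" by auto
  then show "open (U \<inter> f -` fst d)" "smooth_on (U \<inter> f -` fst d) (snd d \<circ> f)"
    using * by (auto intro: smooth_on_subset)
qed auto

lemma smooth_param_cong:
  assumes "smooth_param A W f" "\<And>x. x \<in> W \<Longrightarrow> f x = g x"
  shows "smooth_param A W g"
proof -
  have eq: "W \<inter> g -` V = W \<inter> f -` V" for V using assms(2) by auto
  have "smooth_on (W \<inter> f -` fst d) (snd d \<circ> g)" if "d \<in> A" for d
    by (rule smooth_on_cong[of _ "snd d \<circ> f"]) (use assms that in \<open>auto simp: smooth_param_def\<close>)
  moreover have "g ` W = f ` W" using assms(2) by auto
  ultimately show ?thesis using assms(1) unfolding smooth_param_def eq by auto
qed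

lemma smooth_param_local:
  assumes "open W" and loc: "\<And>x. x \<in> W \<Longrightarrow> \<exists>U. x \<in> U \<and> smooth_param A U f"
  shows "smooth_param A W f"
  unfolding smooth_param_def
proof (intro conjI ballI)
  show "f ` W \<subseteq> points A" using loc unfolding smooth_param_def by fastforce
  fix d assume "d \<in> A"
  have *: "\<exists>Y. open Y \<and> x \<in> Y \<and> Y \<subseteq> W \<inter> f -` fst d \<and> smooth_on Y (snd d \<circ> f)" if x: "x \<in> W \<inter> f -` fst d" for x
  proof -
    obtain U where U: "x \<in> U" "smooth_param A U f" using loc x by auto
    then have "open (W \<inter> (U \<inter> f -` fst d))" "smooth_on (U \<inter> f -` fst d) (snd d \<circ> f)"
      using \<open>d \<in> A\<close> \<open>open W\<close> by (auto simp: smooth_param_def)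
    then show ?thesis using U x by (intro exI[of _ "W \<inter> (U \<inter> f -` fst d)"]) (auto intro: smooth_on_subset)
  qed
  show "open (W \<inter> f -` fst d)" by (subst open_subopen) (use * in blast)
  show "smooth_on (W \<inter> f -` fst d) (snd d \<circ> f)" by (rule smooth_on_local) (use * in blast)
qed fact

lemma smooth_param_comp:
  assumes A: "diff_atlas A" and B: "diff_atlas B"
    and F: "smooth_map_on A B G F" and f: "smooth_param A W f"
  shows "smooth_param B (W \<inter> f -` G) (F \<circ> f)"
proof -
  have G: "openin (manifold_top A) G" and FG: "F ` G \<subseteq> points B" using F by (auto simp: smooth_map_on_def)
  have o: "open (W \<inter> f -` G)" by (rule smooth_param_open_vimage[OF A f G])
  have open_e: "openin (manifold_top A) (G \<inter> F -` fst e)" if "e \<in> B" for e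
    using F that G openin_subset[OF G] unfolding smooth_map_on_def openin_atlas[OF A]
    by (auto simp: Int_assoc)
  show ?thesis unfolding smooth_param_def
  proof (intro conjI ballI)
    show "(F \<circ> f) ` (W \<inter> f -` G) \<subseteq> points B" using FG by auto
    fix e assume "e \<in> B"
    have eq: "W \<inter> f -` G \<inter> (F \<circ> f) -` fst e = W \<inter> f -` (G \<inter> F -` fst e)" by auto
    show "open (W \<inter> f -` G \<inter> (F \<circ> f) -` fst e)"
      unfolding eq by (rule smooth_param_open_vimage[OF A f open_e]) fact
    show "smooth_on (W \<inter> f -` G \<inter> (F \<circ> f) -` fst e) (snd e \<circ> (F \<circ> f))"
    proof (rule smooth_on_local)
      fix x assume x: "x \<in> W \<inter> f -` G \<inter> (F \<circ> f) -` fst e"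
      then obtain d where d: "d \<in> A" "f x \<in> fst d"
        using f by (auto simp: smooth_param_def points_def)
      \<comment> \<open>On \<open>H\<close> both maps are seen in the charts \<open>d\<close> and
        \<open>e\<close>, so the composition is locally one of smooth functions between open sets of
        model spaces.\<close>
      define H where "H = fst d \<inter> G \<inter> F -` fst e"
      have H: "openin (manifold_top A) H"
        unfolding H_def Int_assoc by (intro openin_Int openin_chart[OF A] open_e) fact+
      have oY: "open (W \<inter> f -` H)" by (rule smooth_param_open_vimage[OF A f H])
      have "fst d \<inter> H = H" by (auto simp: H_def)
      then have oH: "open (snd d ` H)" using open_chart_openin[OF A H d(1)] by simp
      have smH: "smooth_on (snd d ` H) (snd e \<circ> F \<circ> chart_inv d)"
        using F d \<open>e \<in> B\<close> unfolding smooth_map_on_def H_def by auto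
      have "smooth_on (W \<inter> f -` fst d) (snd d \<circ> f)" using f d by (auto simp: smooth_param_def)
      then have smY: "smooth_on (W \<inter> f -` H) (snd d \<circ> f)" by (rule smooth_on_subset) (auto simp: H_def)
      have "smooth_on (W \<inter> f -` H) (\<lambda>y. (snd e \<circ> F \<circ> chart_inv d) ((snd d \<circ> f) y))"
        by (rule smooth_on_compose[OF oY oH smY smH]) auto
      then have "smooth_on (W \<inter> f -` H) (snd e \<circ> (F \<circ> f))"
        by (rule smooth_on_cong[OF oY, rotated]) (use d in \<open>auto simp: H_def chart_inv_apply[OF A]\<close>)
      then show "\<exists>Y. open Y \<and> x \<in> Y \<and> smooth_on Y (snd e \<circ> (F \<circ> f))"
        using oY x d by (intro exI[of _ "W \<inter> f -` H"]) (auto simp: H_def)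
    qed
  qed fact
qed

lemma smooth_param_reparam:
  assumes f: "smooth_param A W f" and "open U" "smooth_on U \<tau>" "\<tau> ` U \<subseteq> W"
  shows "smooth_param A U (f \<circ> \<tau>)"
  unfolding smooth_param_def
proof (intro conjI ballI)
  show "(f \<circ> \<tau>) ` U \<subseteq> points A" using f assms(4) by (auto simp: smooth_param_def)
  fix d assume "d \<in> A"
  then have o: "open (W \<inter> f -` fst d)" and s: "smooth_on (W \<inter> f -` fst d) (snd d \<circ> f)"
    using f by (auto simp: smooth_param_def)
  have eq: "U \<inter> (f \<circ> \<tau>) -` fst d = U \<inter> \<tau> -` (W \<inter> f -` fst d)" using assms(4) by auto
  show oU: "open (U \<inter> (f \<circ> \<tau>) -` fst d)"
    unfolding eq by (rule continuous_open_preimage[OF smooth_on_continuous]) fact+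
  have "smooth_on (U \<inter> (f \<circ> \<tau>) -` fst d) (\<lambda>x. (snd d \<circ> f) (\<tau> x))"
    by (rule smooth_on_compose[OF oU o smooth_on_subset[OF assms(3)] s]) (use assms(4) in auto)
  then show "smooth_on (U \<inter> (f \<circ> \<tau>) -` fst d) (snd d \<circ> (f \<circ> \<tau>))" by (simp add: comp_def)
qed fact

text \<open>One chart suffices because every other coordinate expression differs from this one by a
  smooth transition map.\<close>

lemma smooth_param_in_chart:
  assumes A: "smooth_atlas A" and "d \<in> A" "open W" "f ` W \<subseteq> fst d" and s: "smooth_on W (snd d \<circ> f)"
  shows "smooth_param A W f"
  unfolding smooth_param_def
proof (intro conjI ballI)
  note A' = smooth_atlas_imp_diff_atlas[OF A]
  show "f ` W \<subseteq> points A" using assms(2,4) fst_subset_points by blast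
  fix e assume "e \<in> A"
  have eq: "W \<inter> f -` fst e = W \<inter> (snd d \<circ> f) -` (snd d ` (fst d \<inter> fst e))"
  proof
    show "W \<inter> (snd d \<circ> f) -` (snd d ` (fst d \<inter> fst e)) \<subseteq> W \<inter> f -` fst e"
    proof
      fix x assume "x \<in> W \<inter> (snd d \<circ> f) -` (snd d ` (fst d \<inter> fst e))"
      then obtain q where "x \<in> W" "q \<in> fst d" "q \<in> fst e" "snd d (f x) = snd d q" by auto
      moreover from this have "f x = q" using assms(4) inj_onD[OF chart_inj[OF A' \<open>d \<in> A\<close>]] by blast
      ultimately show "x \<in> W \<inter> f -` fst e" by simp
    qed
  qed (use assms(4) in auto)
  show o: "open (W \<inter> f -` fst e)"
    unfolding eq by (rule continuous_open_preimage[OF smooth_on_continuous[OF s] \<open>open W\<close>])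
      (rule open_overlap[OF A']; fact)
  have "smooth_on (W \<inter> f -` fst e) (\<lambda>x. (snd e \<circ> chart_inv d) ((snd d \<circ> f) x))"
  proof (rule smooth_on_compose[OF o open_overlap[OF A' \<open>d \<in> A\<close> \<open>e \<in> A\<close>] smooth_on_subset[OF s]])
    show "smooth_on (snd d ` (fst d \<inter> fst e)) (snd e \<circ> chart_inv d)"
      using A \<open>d \<in> A\<close> \<open>e \<in> A\<close> by (auto simp: smooth_atlas_def)
  qed (use assms(4) in auto)
  then show "smooth_on (W \<inter> f -` fst e) (snd e \<circ> f)"
    by (rule smooth_on_cong[OF o, rotated]) (use assms in \<open>auto simp: chart_inv_apply[OF A'] image_subset_iff\<close>)
qed fact

section \<open>Continuity of smooth maps\<close>

lemma continuous_map_smooth_param: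
  assumes A: "diff_atlas A" and f: "smooth_param A W f"
  shows "continuous_map (top_of_set W) (manifold_top A) f"
  unfolding continuous_map
proof (intro conjI allI impI)
  show "f ` topspace (top_of_set W) \<subseteq> topspace (manifold_top A)"
    using f by (auto simp: topspace_manifold_top[OF A] smooth_param_def)
  fix U assume "openin (manifold_top A) U"
  from smooth_param_open_vimage[OF A f this]
  have "openin (top_of_set W) (W \<inter> f -` U)" by (auto simp: openin_open)
  then show "openin (top_of_set W) {x \<in> topspace (top_of_set W). f x \<in> U}"
    by (simp add: vimage_def Int_def)
qed

lemma continuous_map_smooth_map_on:
  assumes A: "diff_atlas A" and B: "diff_atlas B" and F: "smooth_map_on A B W F"
  shows "continuous_map (subtopology (manifold_top A) W) (manifold_top B) F"
  unfolding continuous_map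
proof (intro conjI allI impI)
  have W: "openin (manifold_top A) W" "F ` W \<subseteq> points B" using F by (auto simp: smooth_map_on_def)
  then have tW: "topspace (subtopology (manifold_top A) W) = W"
    using openin_subset[OF W(1)] by (intro topspace_subtopology_subset)
  show "F ` topspace (subtopology (manifold_top A) W) \<subseteq> topspace (manifold_top B)"
    unfolding tW using W by (auto simp: topspace_manifold_top[OF B])
  fix U assume U: "openin (manifold_top B) U"
  have "openin (manifold_top A) {x \<in> W. F x \<in> U}"
    unfolding openin_atlas[OF A]
  proof (intro conjI ballI)
    show "{x \<in> W. F x \<in> U} \<subseteq> points A" using openin_subset[OF W(1)] by (auto simp: topspace_manifold_top[OF A])
    fix c assume "c \<in> A"
    have "snd c ` (fst c \<inter> {x \<in> W. F x \<in> U}) = snd c ` (fst c \<inter> W) \<inter> (F \<circ> chart_inv c) -` U"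
      using chart_inv_apply[OF A \<open>c \<in> A\<close>] by force
    then show "open (snd c ` (fst c \<inter> {x \<in> W. F x \<in> U}))"
      using smooth_param_open_vimage[OF B smooth_map_on_imp_param[OF A F \<open>c \<in> A\<close>] U] by simp
  qed
  then show "openin (subtopology (manifold_top A) W) {x \<in> topspace (subtopology (manifold_top A) W). F x \<in> U}"
    unfolding tW using W(1) by (auto simp: openin_open_subtopology)
qed

text \<open>Near each point \<open>f\<close> agrees on \<open>X\<close> with a smooth map on an open
  set, so its preimages are locally traces on \<open>X\<close> of open sets.\<close>

lemma continuous_map_smooth_on_set:
  assumes A: "diff_atlas A" and B: "diff_atlas B" and f: "smooth_on_set A B X f" and X: "X \<subseteq> points A"
  shows "continuous_map (subtopology (manifold_top A) X) (manifold_top B) f"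
  unfolding continuous_map
proof (intro conjI allI impI)
  have tX: "topspace (subtopology (manifold_top A) X) = X"
    using X by (simp add: topspace_subtopology topspace_manifold_top[OF A] Int_absorb1)
  have "f p \<in> points B" if p: "p \<in> X" for p
  proof -
    obtain W F where "p \<in> W" "smooth_map_on A B W F" "\<forall>q\<in>W \<inter> X. F q = f q"
      using f p by (auto simp: smooth_on_set_def)
    then show "f p \<in> points B" using p by (force simp: smooth_map_on_def)
  qed
  then show "f ` topspace (subtopology (manifold_top A) X) \<subseteq> topspace (manifold_top B)"
    unfolding tX by (auto simp: topspace_manifold_top[OF B])
  fix U assume U: "openin (manifold_top B) U"
  have *: "\<exists>T. openin (subtopology (manifold_top A) X) T \<and> p \<in> T \<and> T \<subseteq> {x \<in> X. f x \<in> U}"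
    if p: "p \<in> X" "f p \<in> U" for p
  proof -
    obtain W F where W: "p \<in> W" "smooth_map_on A B W F" "\<forall>q\<in>W \<inter> X. F q = f q"
      using f p by (auto simp: smooth_on_set_def)
    then have oW: "openin (manifold_top A) W" by (simp add: smooth_map_on_def)
    have "openin (subtopology (manifold_top A) W) {x \<in> W. F x \<in> U}"
      using continuous_map_smooth_map_on[OF A B W(2)] U openin_subset[OF oW]
      unfolding continuous_map topspace_subtopology_subset[OF openin_subset[OF oW]] by blast
    then have o: "openin (manifold_top A) {x \<in> W. F x \<in> U}" using oW openin_trans_full by blast
    show ?thesis
      by (rule exI[of _ "{x \<in> W. F x \<in> U} \<inter> X"])
        (use W p o in \<open>auto simp: openin_subtopology\<close>)
  qed
  then have "openin (subtopology (manifold_top A) X) {x \<in> X. f x \<in> U}"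
    by (subst openin_subopen) blast
  then show "openin (subtopology (manifold_top A) X) {x \<in> topspace (subtopology (manifold_top A) X). f x \<in> U}"
    unfolding tX .
qed

lemma smooth_param_differentiable:
  assumes f: "smooth_param A W f" and "d \<in> A" "x \<in> W" "f x \<in> fst d"
  shows "(snd d \<circ> f) differentiable (at x)"
  using assms unfolding smooth_param_def by (intro smooth_on_differentiable[of "W \<inter> f -` fst d"]) auto

lemma smooth_param_change_chart:
  assumes A: "diff_atlas A" and f: "smooth_param A W f" and "c \<in> A" "d \<in> A" "x \<in> W" "f x \<in> fst c" "f x \<in> fst d"
  shows "fderiv (snd d \<circ> f) x v =
      fderiv (snd d \<circ> chart_inv c) (snd c (f x)) (fderiv (snd c \<circ> f) x v)"
  by (rule frechet_change_chart(1)[OF A \<open>c \<in> A\<close> \<open>d \<in> A\<close>, of f x "W \<inter> f -` fst c"])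
    (use assms in \<open>auto simp: smooth_param_def intro: smooth_param_differentiable\<close>)

section \<open>The tangent bundle\<close>

definition tangent_chart :: "('m, 'e::euclidean_space) atlas \<Rightarrow> 'm set \<times> ('m \<Rightarrow> 'e) \<Rightarrow> ('m \<times> 'e) set \<times> ('m \<times> 'e \<Rightarrow> 'e \<times> 'e)" where
  "tangent_chart A c = (fst c \<times> UNIV, \<lambda>(p, v). (snd c p, tan_coord A c p v))"

lemma tangent_atlas_eq: "tangent_atlas A = tangent_chart A ` A"
  by (simp add: tangent_atlas_def tangent_chart_def)

lemma points_tangent_atlas: "points (tangent_atlas A) = points A \<times> UNIV"
  by (auto simp: points_def tangent_atlas_eq tangent_chart_def)

context
  fixes A :: "('m, 'e::euclidean_space) atlas"
  assumes SA: "smooth_atlas A"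
begin

private lemma diff_of_smooth: "diff_atlas A" by (rule smooth_atlas_imp_diff_atlas[OF SA])

lemma inj_on_tangent_chart: "c \<in> A \<Longrightarrow> inj_on (snd (tangent_chart A c)) (fst (tangent_chart A c))"
proof (rule inj_onI, clarsimp simp: tangent_chart_def)
  fix p q v w
  assume *: "c \<in> A" "p \<in> fst c" "q \<in> fst c" "snd c p = snd c q" "tan_coord A c p v = tan_coord A c q w"
  have pq: "p = q" by (rule inj_onD[OF chart_inj[OF diff_of_smooth *(1)] *(4,2,3)])
  have "tan_vec A c p (tan_coord A c p v) = tan_vec A c p (tan_coord A c p w)" using *(5) pq by simp
  then show "p = q \<and> v = w" using pq tan_vec_coord[OF diff_of_smooth *(1,2)] by metis
qed

text \<open>Every fibre coordinate is attained because \<open>tan_vec\<close> inverts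
  \<open>tan_coord\<close>, whence the factor \<open>UNIV\<close>.\<close>

lemma tangent_chart_image:
  "c \<in> A \<Longrightarrow> d \<in> A \<Longrightarrow> snd (tangent_chart A c) ` (fst (tangent_chart A c) \<inter> fst (tangent_chart A d)) =
    snd c ` (fst c \<inter> fst d) \<times> UNIV"
proof
  assume c: "c \<in> A" and d: "d \<in> A"
  show "snd c ` (fst c \<inter> fst d) \<times> UNIV \<subseteq> snd (tangent_chart A c) ` (fst (tangent_chart A c) \<inter> fst (tangent_chart A d))"
  proof clarify
    fix p and u :: 'e assume "p \<in> fst c" "p \<in> fst d"
    then show "(snd c p, u) \<in> snd (tangent_chart A c) ` (fst (tangent_chart A c) \<inter> fst (tangent_chart A d))"
      by (intro image_eqI[where x = "(p, tan_vec A c p u)"]) (simp_all add: tangent_chart_def tan_coord_vec[OF diff_of_smooth c])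
  qed
qed (auto simp: tangent_chart_def)

lemma chart_inv_tangent_chart:
  assumes "c \<in> A" "x \<in> snd c ` fst c"
  shows "chart_inv (tangent_chart A c) (x, u) = (chart_inv c x, tan_vec A c (chart_inv c x) u)"
  unfolding chart_inv_def[of "tangent_chart A c"]
  by (rule inv_into_f_eq[OF inj_on_tangent_chart[OF assms(1)]])
    (use assms in \<open>auto simp: tangent_chart_def tan_coord_vec[OF diff_of_smooth] chart_inv_mem chart_inv_apply[OF diff_of_smooth]\<close>)

text \<open>With \<tau> the transition of the base, the transition upstairs sends
  \<open>(x, u)\<close> to \<open>(\<tau> x, fderiv \<tau> x u)\<close>; the preferred charts of the
  points cancel although they vary without any continuity.\<close>

lemma smooth_tangent_transition:
  assumes "c \<in> A" "d \<in> A"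
  shows "smooth_on (snd c ` (fst c \<inter> fst d) \<times> UNIV) (snd (tangent_chart A d) \<circ> chart_inv (tangent_chart A c))"
proof -
  define \<tau> where "\<tau> = snd d \<circ> chart_inv c"
  define X where "X = snd c ` (fst c \<inter> fst d)"
  have X: "open X" unfolding X_def by (rule open_overlap[OF diff_of_smooth assms])
  have XU: "open (X \<times> (UNIV :: 'e set))" using X by (simp add: open_Times)
  have s: "smooth_on X \<tau>" using SA assms by (auto simp: smooth_atlas_def X_def \<tau>_def)
  have f: "smooth_on (X \<times> (UNIV :: 'e set)) fst" "smooth_on (X \<times> (UNIV :: 'e set)) snd"
    using smooth_on_fst[OF XU smooth_on_id[OF XU]] smooth_on_snd[OF XU smooth_on_id[OF XU]] by simp_all
  have "smooth_on (X \<times> UNIV) (\<lambda>y. (\<tau> (fst y), fderiv \<tau> (fst y) (snd y)))"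
    by (rule smooth_on_Pair[OF XU smooth_on_compose[OF XU X f(1) s] smooth_on_frechet_apply[OF X XU s f(1) f(2)]]) auto
  then show ?thesis unfolding X_def[symmetric]
  proof (rule smooth_on_cong[OF XU, rotated], clarify)
    fix x u assume "x \<in> X"
    then obtain p where p: "p \<in> fst c" "p \<in> fst d" "x = snd c p" by (auto simp: X_def)
    have "p \<in> points A" using p assms fst_subset_points by blast
    then show "(\<tau> (fst (x, u)), fderiv \<tau> (fst (x, u)) (snd (x, u))) =
        (snd (tangent_chart A d) \<circ> chart_inv (tangent_chart A c)) (x, u)"
      using p assms chart_at_mem[of p A]
      by (simp add: chart_inv_tangent_chart, simp add: tangent_chart_def chart_inv_apply[OF diff_of_smooth] tan_coord_def tan_vec_def
          frechet_transition_comp[OF diff_of_smooth] \<tau>_def)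
  qed
qed

lemma smooth_atlas_tangent: "smooth_atlas (tangent_atlas A)"
  unfolding smooth_atlas_def tangent_atlas_eq
proof (intro conjI ballI)
  have UO: "open (X \<times> (UNIV :: 'e set))" if "open X" for X :: "'e set" using that by (simp add: open_Times)
  fix c' assume "c' \<in> tangent_chart A ` A"
  then obtain c where c: "c \<in> A" "c' = tangent_chart A c" by auto
  show "inj_on (snd c') (fst c')" using c inj_on_tangent_chart by simp
  show "open (snd c' ` fst c')"
    using tangent_chart_image[OF c(1,1)] UO[OF open_chart_image[OF diff_of_smooth c(1)]] c(2) by simp
  fix d' assume "d' \<in> tangent_chart A ` A"
  then obtain d where d: "d \<in> A" "d' = tangent_chart A d" by auto
  show "open (snd c' ` (fst c' \<inter> fst d'))"
    unfolding c(2) d(2) tangent_chart_image[OF c(1) d(1)] by (rule UO[OF open_overlap[OF diff_of_smooth c(1) d(1)]])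
  show "smooth_on (snd c' ` (fst c' \<inter> fst d')) (snd d' \<circ> chart_inv c')"
    unfolding c(2) d(2) tangent_chart_image[OF c(1) d(1)] by (rule smooth_tangent_transition[OF c(1) d(1)])
qed

end

section \<open>Submanifolds\<close>

lemma mfderiv_param: "mfderiv euclid_atlas A f x v = fderiv (snd (chart_at A (f x)) \<circ> f) x v"
  by (simp add: mfderiv_def chart_at_euclid chart_inv_euclid' comp_def)

text \<open>\<open>mfderiv\<close> refers to the preferred chart at \<open>q\<close>, and
  \<open>tan_vec\<close> feeds into it a vector given in the chart \<open>C\<close>. The chain rule
  cancels the detour, so a derivative can be computed in whichever chart suits the problem.\<close>

lemma mfderiv_tan_vec:
  assumes N: "diff_atlas N" and C: "C \<in> N" "q \<in> fst C"
    and diff: "(snd (chart_at B (f q)) \<circ> f \<circ> chart_inv C) differentiable (at (snd C q))"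
  shows "mfderiv N B f q (tan_vec N C q u) =
    fderiv (snd (chart_at B (f q)) \<circ> f \<circ> chart_inv C) (snd C q) u"
proof -
  define D where "D = chart_at N q"
  define h where "h = snd (chart_at B (f q)) \<circ> f"
  have q: "q \<in> points N" using C fst_subset_points by blast
  then have D: "D \<in> N" "q \<in> fst D" by (simp_all add: D_def chart_at_mem)
  have eq: "(snd C \<circ> chart_inv D) (snd D q) = snd C q" by (simp add: chart_inv_apply[OF N] D)
  have "fderiv (h \<circ> chart_inv D) (snd D q) v =
      fderiv (h \<circ> chart_inv C) (snd C q) (fderiv (snd C \<circ> chart_inv D) (snd D q) v)" for v
  proof -
    have "fderiv (h \<circ> chart_inv D) (snd D q) =
        fderiv ((h \<circ> chart_inv C) \<circ> (snd C \<circ> chart_inv D)) (snd D q)"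
      by (rule frechet_derivative_transform(1)[OF open_overlap[OF N D(1) C(1)]])
        (use D C in \<open>auto simp: chart_inv_apply[OF N]\<close>)
    then show ?thesis
      using frechet_derivative_comp[of "snd C \<circ> chart_inv D" "snd D q" "h \<circ> chart_inv C" v]
        transition_differentiable[OF N D(1) C(1) D(2) C(2)] diff
      unfolding eq h_def[symmetric] by (simp only:)
  qed
  then show ?thesis
    unfolding mfderiv_def D_def[symmetric] h_def[symmetric] tan_vec_def
    by (simp only: frechet_transition_comp[OF N C(1) D(1) C(1) C(2) D(2) C(2)] frechet_transition_self[OF N C])
qed

lemma mfderiv_id_tan_vec:
  assumes N: "diff_atlas N" and C: "C \<in> N" "q \<in> fst C"
    and diff: "(snd (chart_at A q) \<circ> chart_inv C) differentiable (at (snd C q))"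
  shows "mfderiv N A (\<lambda>q. q) q (tan_vec N C q u) =
    fderiv (snd (chart_at A q) \<circ> chart_inv C) (snd C q) u"
  using mfderiv_tan_vec[OF N C, of A "\<lambda>q. q" u] diff by (simp add: comp_def)

lemma surj_tan_vec:
  assumes "diff_atlas N" "C \<in> N" "q \<in> fst C"
  shows "range (tan_vec N C q) = UNIV"
  by (metis assms surjI tan_vec_coord)

section \<open>Charts of an embedded submanifold\<close>

context
  fixes A :: "('m, 'e::euclidean_space) atlas" and T :: "'m set"
  assumes SA: "smooth_atlas A"
begin

private lemma diff_ambient: "diff_atlas A" by (rule smooth_atlas_imp_diff_atlas[OF SA])

context
  fixes C :: "'m set \<times> ('m \<Rightarrow> 'd::euclidean_space)"
  assumes C: "C \<in> sub_atlas A T"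
begin

lemma sub_chart_openin: "openin (subtopology (manifold_top A) T) (fst C)"
  and sub_chart_open_image: "open (snd C ` fst C)"
  and sub_chart_homeomorphic: "homeomorphic_map (subtopology (manifold_top A) (fst C)) (top_of_set (snd C ` fst C)) (snd C)"
  and sub_chart_smooth: "smooth_param A (snd C ` fst C) (chart_inv C)"
  using C by (cases C; auto simp: sub_atlas_def chart_inv_def smooth_map_on_euclid)+

lemma sub_chart_subset: "fst C \<subseteq> T" "fst C \<subseteq> points A"
  using openin_subset[OF sub_chart_openin] by (auto simp: topspace_manifold_top[OF diff_ambient])

lemma topspace_sub_chart: "topspace (subtopology (manifold_top A) (fst C)) = fst C"
  using sub_chart_subset by (auto simp: topspace_manifold_top[OF diff_ambient])

lemma sub_chart_inj: "inj_on (snd C) (fst C)"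
  using homeomorphic_imp_injective_map[OF sub_chart_homeomorphic] unfolding topspace_sub_chart .

text \<open>The derivative read in the preferred chart, which \<open>sub_atlas\<close> makes
  injective, factors through the derivative read in \<open>c\<close>.\<close>

lemma sub_chart_immersion:
  assumes "x \<in> snd C ` fst C" "c \<in> A" "chart_inv C x \<in> fst c"
  shows "inj (fderiv (snd c \<circ> chart_inv C) x)"
proof -
  define p where "p = chart_inv C x"
  have p: "p \<in> points A" using assms chart_inv_mem[OF assms(1)] sub_chart_subset by (auto simp: p_def)
  have "inj (mfderiv euclid_atlas A (chart_inv C) x)"
    using C assms(1) by (cases C) (auto simp: sub_atlas_def chart_inv_def)
  then have i: "inj (fderiv (snd (chart_at A p) \<circ> chart_inv C) x)"
    unfolding p_def by (simp add: mfderiv_param[abs_def])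
  have "fderiv (snd (chart_at A p) \<circ> chart_inv C) x v =
      fderiv (snd (chart_at A p) \<circ> chart_inv c) (snd c p) (fderiv (snd c \<circ> chart_inv C) x v)" for v
    using smooth_param_change_chart[OF diff_ambient sub_chart_smooth assms(2) chart_at_mem(1)[OF p] assms(1,3)]
      chart_at_mem(2)[OF p] by (simp add: p_def)
  then show ?thesis using i unfolding inj_def by metis
qed

lemma continuous_map_sub_chart: "continuous_map (subtopology (manifold_top A) (fst C)) euclidean (snd C)"
  using homeomorphic_imp_continuous_map[OF sub_chart_homeomorphic] by (simp add: continuous_map_in_subtopology)

lemma sub_chart_image_open:
  assumes "openin (subtopology (manifold_top A) T) U"
  shows "open (snd C ` (fst C \<inter> U))"
proof -
  obtain O' where "openin (manifold_top A) O'" "U = O' \<inter> T" using assms by (auto simp: openin_subtopology)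
  then have "fst C \<inter> U = O' \<inter> fst C" using sub_chart_subset by auto
  then have "openin (subtopology (manifold_top A) (fst C)) (fst C \<inter> U)" using \<open>openin (manifold_top A) O'\<close> by (auto simp: openin_subtopology)
  then have "openin (top_of_set (snd C ` fst C)) (snd C ` (fst C \<inter> U))"
    using homeomorphic_imp_open_map[OF sub_chart_homeomorphic] by (simp add: open_map_def)
  then show ?thesis using sub_chart_open_image by (rule openin_open_trans)
qed

lemma sub_chart_vimage_open:
  assumes "open U"
  shows "openin (subtopology (manifold_top A) T) (fst C \<inter> snd C -` U)"
proof -
  have "openin (subtopology (manifold_top A) (fst C)) {p \<in> topspace (subtopology (manifold_top A) (fst C)). snd C p \<in> U}"
    using continuous_map_sub_chart assms by (simp only: continuous_map) simp
  then have "openin (subtopology (manifold_top A) (fst C)) (fst C \<inter> snd C -` U)"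
    unfolding topspace_sub_chart by (simp add: vimage_def Int_def)
  moreover have "subtopology (manifold_top A) (fst C) = subtopology (subtopology (manifold_top A) T) (fst C)"
    using sub_chart_subset by (simp add: subtopology_subtopology Int_absorb1)
  ultimately show ?thesis using sub_chart_openin openin_trans_full by metis
qed

end

text \<open>Transition maps are continuous because charts are homeomorphisms for the subspace
  topology. On the overlap \<open>chart_inv C\<close> equals \<open>chart_inv D\<close> after the
  transition map, and \<open>chart_inv D\<close> is an immersion, so
  \<open>has_derivative_through_immersion\<close> upgrades continuity to differentiability.\<close>

lemma diff_atlas_sub_atlas: "diff_atlas (sub_atlas A T :: ('m, 'd::euclidean_space) atlas)"
  unfolding diff_atlas_def
proof (intro conjI ballI)
  fix C D :: "'m set \<times> ('m \<Rightarrow> 'd)" and x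
  assume C: "C \<in> sub_atlas A T"
  show iC: "inj_on (snd C) (fst C)" by (rule sub_chart_inj[OF C])
  have inv: "chart_inv C (snd C p) = p" if "p \<in> fst C" for p
    using iC that by (simp add: chart_inv_def)
  assume D: "D \<in> sub_atlas A T"
  have invD: "chart_inv D (snd D p) = p" if "p \<in> fst D" for p
    using sub_chart_inj[OF D] that by (simp add: chart_inv_def)
  show o: "open (snd C ` (fst C \<inter> fst D))"
    by (rule sub_chart_image_open[OF C sub_chart_openin[OF D]])
  assume xo: "x \<in> snd C ` (fst C \<inter> fst D)"
  then obtain p where p: "p \<in> fst C" "p \<in> fst D" "x = snd C p" by auto
  define c where "c = chart_at A p"
  have pA: "p \<in> points A" using sub_chart_subset[OF C] p by auto
  have c: "c \<in> A" "p \<in> fst c" using chart_at_mem[OF pA] by (auto simp: c_def)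
  have xC: "x \<in> snd C ` fst C" and pD: "snd D p \<in> snd D ` fst D" using p by auto
  have "continuous_on (snd C ` (fst C \<inter> fst D)) (snd D \<circ> chart_inv C)"
    unfolding continuous_on_open_vimage[OF o]
  proof (intro allI impI)
    fix B :: "'d set" assume "open B"
    have "(snd D \<circ> chart_inv C) -` B \<inter> snd C ` (fst C \<inter> fst D) = snd C ` (fst C \<inter> (fst D \<inter> snd D -` B))"
      using inv by force
    then show "open ((snd D \<circ> chart_inv C) -` B \<inter> snd C ` (fst C \<inter> fst D))"
      using sub_chart_image_open[OF C sub_chart_vimage_open[OF D \<open>open B\<close>]] by simp
  qed
  then have cont: "isCont (snd D \<circ> chart_inv C) x"
    using o \<open>x \<in> snd C ` (fst C \<inter> fst D)\<close> unfolding continuous_on_eq_continuous_at[OF o] by blast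
  have \<tau>x: "(snd D \<circ> chart_inv C) x = snd D p" using p inv by simp
  have f: "((snd c \<circ> chart_inv C) has_derivative fderiv (snd c \<circ> chart_inv C) x) (at x)"
    by (rule has_frechet, rule smooth_param_differentiable[OF sub_chart_smooth[OF C] c(1) xC])
      (use p inv c in simp)
  have psi: "((snd c \<circ> chart_inv D) has_derivative fderiv (snd c \<circ> chart_inv D) (snd D p))
      (at ((snd D \<circ> chart_inv C) x))"
    unfolding \<tau>x
    by (rule has_frechet, rule smooth_param_differentiable[OF sub_chart_smooth[OF D] c(1) pD])
      (use p invD c in simp)
  have i: "inj (fderiv (snd c \<circ> chart_inv D) (snd D p))"
    by (rule sub_chart_immersion[OF D pD c(1)]) (use p invD c in simp)
  have loc: "(snd c \<circ> chart_inv C) y = (snd c \<circ> chart_inv D) ((snd D \<circ> chart_inv C) y)"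
    if "y \<in> snd C ` (fst C \<inter> fst D)" for y
    using that inv invD by auto
  have ev: "\<forall>\<^sub>F y in at x. (snd c \<circ> chart_inv C) y = (snd c \<circ> chart_inv D) ((snd D \<circ> chart_inv C) y)"
    using eventually_at_in_open'[OF o xo] by (rule eventually_mono) (rule loc)
  obtain \<tau>' where "((snd D \<circ> chart_inv C) has_derivative \<tau>') (at x)"
    by (rule has_derivative_through_immersion[OF cont f psi i ev loc[OF xo]])
  then show "(snd D \<circ> chart_inv C) differentiable (at x)" by (auto simp: differentiable_def)
qed

text \<open>Relative openness can be tested chart by chart, since the charts are homeomorphisms on
  relatively open sets and cover \<open>T\<close>.\<close>

lemma manifold_top_sub_atlas:
  assumes "points (sub_atlas A T :: ('m, 'd::euclidean_space) atlas) = T"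
  shows "manifold_top (sub_atlas A T :: ('m, 'd) atlas) = subtopology (manifold_top A) T"
  unfolding topology_eq openin_atlas[OF diff_atlas_sub_atlas] assms
proof (intro allI iffI conjI ballI)
  fix U assume U: "openin (subtopology (manifold_top A) T) U"
  then show "U \<subseteq> T" using openin_subset by fastforce
  show "open (snd C ` (fst C \<inter> U))" if "C \<in> sub_atlas A T" for C :: "'m set \<times> ('m \<Rightarrow> 'd)"
    by (rule sub_chart_image_open[OF that U])
next
  fix U assume U: "U \<subseteq> T \<and> (\<forall>C\<in>sub_atlas A T :: ('m, 'd) atlas. open (snd C ` (fst C \<inter> U)))"
  have "openin (subtopology (manifold_top A) T) (fst C \<inter> U)" if C: "C \<in> sub_atlas A T" for C :: "'m set \<times> ('m \<Rightarrow> 'd)"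
  proof -
    have "fst C \<inter> U = fst C \<inter> snd C -` (snd C ` (fst C \<inter> U))"
      using sub_chart_inj[OF C] by (auto dest: inj_onD)
    then show ?thesis using sub_chart_vimage_open[OF C] U C by metis
  qed
  then have "openin (subtopology (manifold_top A) T) (\<Union>C\<in>sub_atlas A T :: ('m, 'd) atlas. fst C \<inter> U)" by blast
  moreover have "(\<Union>C\<in>sub_atlas A T :: ('m, 'd) atlas. fst C \<inter> U) = U"
    using U assms by (auto simp: points_def)
  ultimately show "openin (subtopology (manifold_top A) T) U" by simp
qed

lemma chart_inv_param: "inj_on f W \<Longrightarrow> x \<in> W \<Longrightarrow> chart_inv (f ` W, inv_into W f) x = f x"
  unfolding chart_inv_def by (rule inv_into_f_eq) (auto simp: inj_on_inv_into)

text \<open>The atlases of the hypersurface and of the leaves are given abstractly as all inverse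
  immersions; this criterion is how explicit charts enter them.\<close>

lemma sub_atlasI:
  fixes f :: "'d::euclidean_space \<Rightarrow> 'm"
  assumes f: "smooth_param A W f" and "inj_on f W" and o: "openin (subtopology (manifold_top A) T) (f ` W)"
    and cont: "continuous_map (subtopology (manifold_top A) (f ` W)) euclidean (inv_into W f)"
    and im: "\<And>x. x \<in> W \<Longrightarrow> inj (fderiv (snd (chart_at A (f x)) \<circ> f) x)"
  shows "(f ` W, inv_into W f) \<in> sub_atlas A T"
proof -
  \<comment> \<open>\<open>sub_atlas\<close> speaks of the inverse of the coordinate map, that is,
    of the inverse of the inverse of \<open>f\<close>, which is only known to agree with
    \<open>f\<close> on \<open>W\<close>.\<close>
  define k where "k = inv_into (f ` W) (inv_into W f)"
  have k: "k x = f x" if "x \<in> W" for x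
    using chart_inv_param[OF \<open>inj_on f W\<close> that] by (simp add: chart_inv_def k_def)
  have img: "inv_into W f ` f ` W = W" using \<open>inj_on f W\<close> by (simp add: inv_into_image_cancel)
  have W: "open W" "f ` W \<subseteq> points A" using f by (auto simp: smooth_param_def)
  have "homeomorphic_maps (subtopology (manifold_top A) (f ` W)) (top_of_set W) (inv_into W f) f"
    unfolding homeomorphic_maps_def
    using cont continuous_map_smooth_param[OF diff_ambient f] \<open>inj_on f W\<close>
    by (auto simp: continuous_map_in_subtopology inv_into_into f_inv_into_f)
  then have "homeomorphic_map (subtopology (manifold_top A) (f ` W)) (top_of_set W) (inv_into W f)"
    using homeomorphic_map_maps by blast
  moreover have "smooth_param A W k" using f by (rule smooth_param_cong) (simp add: k)
  moreover have "inj (mfderiv euclid_atlas A k x)" if "x \<in> W" for x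
  proof -
    have "fderiv (snd (chart_at A (k x)) \<circ> k) x = fderiv (snd (chart_at A (f x)) \<circ> f) x"
      by (rule frechet_derivative_transform(1)[OF \<open>open W\<close> that]) (use that in \<open>simp add: k\<close>)
    then show ?thesis using im[OF that] by (simp add: mfderiv_param[abs_def])
  qed
  ultimately show ?thesis
    using o W unfolding sub_atlas_def
    by (simp add: img k_def[symmetric] smooth_map_on_euclid inv_into_f_f[OF \<open>inj_on f W\<close>])
qed

section \<open>Differential of the inclusion and induced metric\<close>

context
  fixes N :: "('m, 'd::euclidean_space) atlas" and C :: "'m set \<times> ('m \<Rightarrow> 'd)" and p :: 'm
  assumes N_def: "N = sub_atlas A T" and C: "C \<in> N" "p \<in> fst C"
begin

private lemma diff_sub: "diff_atlas N" unfolding N_def by (rule diff_atlas_sub_atlas)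

private lemma C': "C \<in> sub_atlas A T" "snd C p \<in> snd C ` fst C" "chart_inv C (snd C p) = p" "p \<in> points A"
  using C sub_chart_subset[of C] chart_inv_apply[OF diff_sub] by (auto simp: N_def)

lemma sub_chart_differentiable:
  "c \<in> A \<Longrightarrow> p \<in> fst c \<Longrightarrow> (snd c \<circ> chart_inv C) differentiable (at (snd C p))"
  by (rule smooth_param_differentiable[OF sub_chart_smooth[OF C'(1)] _ C'(2)]) (simp_all add: C'(3))

lemma mfderiv_incl:
  "mfderiv N A (\<lambda>q. q) p (tan_vec N C p u) = fderiv (snd (chart_at A p) \<circ> chart_inv C) (snd C p) u"
  by (rule mfderiv_id_tan_vec[OF diff_sub C sub_chart_differentiable]) (use chart_at_mem[OF C'(4)] in auto)

text \<open>This gives the \<open>inv\<close> in \<open>nabla_null\<close> its meaning: a tangent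
  vector of the submanifold is determined by its image in the ambient tangent space.\<close>

lemma inj_mfderiv_incl: "inj (mfderiv N A (\<lambda>q. q) p)"
proof -
  have "inj (fderiv (snd (chart_at A p) \<circ> chart_inv C) (snd C p))"
    by (rule sub_chart_immersion[OF C'(1,2)]) (use chart_at_mem[OF C'(4)] in \<open>auto simp: C'(3)\<close>)
  moreover have "mfderiv N A (\<lambda>q. q) p v =
      fderiv (snd (chart_at A p) \<circ> chart_inv C) (snd C p) (tan_coord N C p v)" for v
    using mfderiv_incl[of "tan_coord N C p v"] by (simp add: tan_vec_coord[OF diff_sub C])
  ultimately show ?thesis unfolding inj_def by (metis tan_vec_coord[OF diff_sub C])
qed

lemma tangent_space_chart:
  "tangent_space A N p = range (fderiv (snd (chart_at A p) \<circ> chart_inv C) (snd C p))"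
proof -
  have "tangent_space A N p = mfderiv N A (\<lambda>q. q) p ` range (tan_vec N C p)"
    unfolding tangent_space_def surj_tan_vec[OF diff_sub C] ..
  then show ?thesis by (simp add: image_image mfderiv_incl)
qed

text \<open>In coordinates the induced metric is the pullback of \<open>g\<close> under the inverse
  chart; the ambient chart \<open>c\<close> is free, so that it can be held fixed while the point
  moves.\<close>

lemma induced_metric_coord:
  assumes "c \<in> A" "p \<in> fst c"
  shows "metric_coord N (induced_metric A g N) C (snd C p) u v = metric_coord A g c (snd c p)
    (fderiv (snd c \<circ> chart_inv C) (snd C p) u)
    (fderiv (snd c \<circ> chart_inv C) (snd C p) v)"
proof -
  note a = chart_at_mem[OF C'(4)]
  have *: "fderiv (snd (chart_at A p) \<circ> chart_inv C) (snd C p) w = tan_vec A c p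
      (fderiv (snd c \<circ> chart_inv C) (snd C p) w)" for w
    unfolding tan_vec_def
    using smooth_param_change_chart[OF diff_ambient sub_chart_smooth[OF C'(1)] assms(1) a(1) C'(2)] assms(2) a(2)
    by (simp add: C'(3))
  show ?thesis
    by (simp add: metric_coord_at[OF diff_sub C] induced_metric_def mfderiv_incl * metric_coord_at[OF diff_ambient assms])
qed

end

end

section \<open>Change of variables\<close>

text \<open>The library states the change of variables formula for \<open>real ^ 'n\<close> only if the index type is
  well-ordered; \<open>'n wo\<close> is a well-ordered copy of an arbitrary finite index type.\<close>
typedef 'n wo = "UNIV :: 'n set" by simp

instance wo :: (finite) finite
proof
  have "UNIV = range (Abs_wo :: 'a \<Rightarrow> 'a wo)" by (metis Rep_wo_inverse surjI)
  then show "finite (UNIV :: 'a wo set)" by (metis finite_code finite_imageI)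
qed

instantiation wo :: (finite) linorder
begin

definition "(a :: 'a wo) \<le> b \<longleftrightarrow> to_nat_on (UNIV :: 'a set) (Rep_wo a) \<le> to_nat_on UNIV (Rep_wo b)"
definition "(a :: 'a wo) < b \<longleftrightarrow> to_nat_on (UNIV :: 'a set) (Rep_wo a) < to_nat_on UNIV (Rep_wo b)"

instance
proof
  fix a b :: "'a wo"
  assume "a \<le> b" "b \<le> a"
  then have "to_nat_on (UNIV :: 'a set) (Rep_wo a) = to_nat_on UNIV (Rep_wo b)"
    by (simp add: less_eq_wo_def)
  then have "Rep_wo a = Rep_wo b"
    using inj_on_to_nat_on[OF countable_finite, of "UNIV :: 'a set"] by (auto dest: inj_onD)
  then show "a = b" by (simp add: Rep_wo_inject)
next
  fix a b c :: "'a wo"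
  show "a \<le> b \<Longrightarrow> b \<le> c \<Longrightarrow> a \<le> c" by (simp add: less_eq_wo_def)
qed (auto simp: less_eq_wo_def less_wo_def)

end

instance wo :: (finite) wellorder
proof
  fix P :: "'a wo \<Rightarrow> bool" and a
  assume step: "\<And>x. (\<And>y. y < x \<Longrightarrow> P y) \<Longrightarrow> P x"
  show "P a"
    by (rule measure_induct_rule[of "\<lambda>a. to_nat_on (UNIV :: 'a set) (Rep_wo a)" P a], rule step)
      (metis less_wo_def)
qed

definition to_wo :: "real ^ 'n \<Rightarrow> real ^ 'n wo" where "to_wo x = (\<chi> i. x $ Rep_wo i)"
definition of_wo :: "real ^ 'n wo \<Rightarrow> real ^ 'n" where "of_wo y = (\<chi> i. y $ Abs_wo i)"

lemma of_wo_to_wo [simp]: "of_wo (to_wo x) = x" "to_wo (of_wo y) = y"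
  by (simp_all add: to_wo_def of_wo_def vec_eq_iff Abs_wo_inverse Rep_wo_inverse)

lemma bounded_linear_wo:
  "bounded_linear (to_wo :: real ^ 'n::finite \<Rightarrow> _)" "bounded_linear (of_wo :: _ \<Rightarrow> real ^ 'n::finite)"
  by (auto simp: linear_conv_bounded_linear[symmetric] linear_iff to_wo_def of_wo_def vec_eq_iff)

lemma bij_Rep_wo: "bij (Rep_wo :: 'n wo \<Rightarrow> 'n)" "bij (Abs_wo :: 'n \<Rightarrow> 'n wo)"
  by (auto intro!: o_bij[of Abs_wo] o_bij[of Rep_wo] simp: fun_eq_iff Abs_wo_inverse Rep_wo_inverse)

text \<open>Relabelling rows and columns by the same bijection conjugates the permutations in the
  Leibniz sum, and conjugation preserves signs.\<close>

lemma det_wo: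
  fixes B :: "real ^ 'n::finite ^ 'n"
  shows "det (\<chi> i j. B $ Rep_wo i $ Rep_wo j) = det B"
proof -
  define k :: "('n \<Rightarrow> 'n) \<Rightarrow> ('n wo \<Rightarrow> 'n wo)" where "k p = Abs_wo \<circ> p \<circ> Rep_wo" for p
  have sgn: "sign (k p) = sign p" if "p permutes UNIV" for p
  proof -
    interpret permutes_bij_finite p UNIV UNIV Abs_wo Rep_wo "\<lambda>x. if x \<in> UNIV then Abs_wo (p (Rep_wo x)) else x"
      by unfold_locales (auto simp: that Abs_wo_inverse bij_Rep_wo)
    have "(\<lambda>x. if x \<in> UNIV then Abs_wo (p (Rep_wo x)) else x) = k p" by (auto simp: k_def)
    then show ?thesis using sign_p' by simp
  qed
  have "det (\<chi> i j. B $ Rep_wo i $ Rep_wo j) =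
      (\<Sum>q | q permutes UNIV. of_int (sign q) * (\<Prod>i\<in>UNIV. B $ Rep_wo i $ Rep_wo (q i)))"
    by (simp add: det_def)
  also have "\<dots> = (\<Sum>p | p permutes UNIV. of_int (sign (k p)) * (\<Prod>i\<in>UNIV. B $ Rep_wo i $ Rep_wo (k p i)))"
  proof (rule sum.reindex_bij_witness[of _ k "\<lambda>q. Rep_wo \<circ> q \<circ> Abs_wo"])
    show "k (Rep_wo \<circ> q \<circ> Abs_wo) = q" for q by (simp add: k_def fun_eq_iff Rep_wo_inverse)
    then show "of_int (sign (k (Rep_wo \<circ> q \<circ> Abs_wo))) * (\<Prod>i\<in>UNIV. B $ Rep_wo i $ Rep_wo (k (Rep_wo \<circ> q \<circ> Abs_wo) i)) =
        of_int (sign q) * (\<Prod>i\<in>UNIV. B $ Rep_wo i $ Rep_wo (q i))" for q :: "'n wo \<Rightarrow> 'n wo"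
      by simp
    show "Rep_wo \<circ> k p \<circ> Abs_wo = p" for p by (simp add: k_def fun_eq_iff Abs_wo_inverse)
    show "Rep_wo \<circ> q \<circ> Abs_wo \<in> {p. p permutes UNIV}" if "q \<in> {q. q permutes UNIV}" for q :: "'n wo \<Rightarrow> 'n wo"
      using that by (auto intro!: bij_imp_permutes bij_comp bij_Rep_wo permutes_bij)
    show "k p \<in> {q. q permutes UNIV}" if "p \<in> {q. q permutes UNIV}" for p
      using that by (auto simp: k_def intro!: bij_imp_permutes bij_comp bij_Rep_wo permutes_bij)
  qed
  also have "\<dots> = (\<Sum>p | p permutes UNIV. of_int (sign p) * (\<Prod>i\<in>UNIV. B $ i $ p i))"
  proof (rule sum.cong[OF refl])
    fix p :: "'n \<Rightarrow> 'n" assume "p \<in> {p. p permutes UNIV}"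
    moreover have "(\<Prod>i\<in>UNIV. B $ Rep_wo i $ Rep_wo (k p i)) = (\<Prod>i\<in>UNIV. B $ i $ p i)"
      by (rule prod.reindex_bij_witness[of _ Abs_wo Rep_wo]) (auto simp: k_def Abs_wo_inverse Rep_wo_inverse)
    ultimately show "of_int (sign (k p)) * (\<Prod>i\<in>UNIV. B $ Rep_wo i $ Rep_wo (k p i)) =
        of_int (sign p) * (\<Prod>i\<in>UNIV. B $ i $ p i)" by (simp add: sgn)
  qed
  finally show ?thesis by (simp add: det_def)
qed

lemma det_matrix_wo: "det (matrix (\<lambda>y. to_wo (T (of_wo y)))) = det (matrix (T :: real ^ 'n::finite \<Rightarrow> real ^ 'n))"
proof -
  have "of_wo (axis j 1) = axis (Rep_wo j) (1 :: real)" for j :: "'n wo"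
    by (auto simp: of_wo_def vec_eq_iff axis_def Abs_wo_inverse Rep_wo_inverse)
  then show ?thesis using det_wo[of "matrix T"] by (simp add: matrix_def to_wo_def)
qed

lemma prod_Basis_cart:
  fixes x :: "real ^ 'n::finite"
  shows "(\<Prod>b\<in>Basis. x \<bullet> b) = (\<Prod>i\<in>UNIV. x $ i)"
  by (rule prod.reindex_bij_witness[of _ "\<lambda>i. axis i 1" axis_index])
    (auto simp: cart_eq_inner_axis axis_index[symmetric])

text \<open>Relabelling coordinates maps boxes to boxes of equal volume, and Lebesgue measure is
  determined by its values on boxes.\<close>

lemma lborel_wo: "distr lborel borel of_wo = (lborel :: (real ^ 'n::finite) measure)"
proof (rule lborel_eqI[symmetric])
  have m: "of_wo \<in> borel_measurable (lborel :: (real ^ 'n wo) measure)"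
    using borel_measurable_continuous_onI[OF linear_continuous_on[OF bounded_linear_wo(2)]] by simp
  fix l u :: "real ^ 'n" assume le: "\<And>b. b \<in> Basis \<Longrightarrow> l \<bullet> b \<le> u \<bullet> b"
  have "emeasure (distr lborel borel of_wo) (box l u) = emeasure lborel (of_wo -` box l u :: (real ^ 'n wo) set)"
    by (subst emeasure_distr[OF m]) auto
  also have "of_wo -` box l u = box (to_wo l) (to_wo u)"
    by (auto simp: mem_box_cart to_wo_def of_wo_def) (metis Rep_wo_inverse Abs_wo_inverse UNIV_I)+
  also have "emeasure lborel (box (to_wo l) (to_wo u)) = (\<Prod>b\<in>Basis. (to_wo u - to_wo l) \<bullet> b)"
  proof (rule emeasure_lborel_box)
    have "l $ i \<le> u $ i" for i using le[of "axis i 1"] by (simp add: inner_axis)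
    then show "to_wo l \<bullet> b \<le> to_wo u \<bullet> b" if "b \<in> Basis" for b
      using that by (auto simp: Basis_vec_def inner_axis to_wo_def)
  qed
  also have "(\<Prod>b\<in>Basis. (to_wo u - to_wo l) \<bullet> b) = (\<Prod>b\<in>Basis. (u - l) \<bullet> b)"
    unfolding prod_Basis_cart
    by (rule prod.reindex_bij_witness[of _ Abs_wo Rep_wo]) (auto simp: to_wo_def Abs_wo_inverse Rep_wo_inverse)
  finally show "emeasure (distr lborel borel of_wo) (box l u) = (\<Prod>b\<in>Basis. (u - l) \<bullet> b)" .
qed simp

text \<open>Bridge between integrals over \<open>lborel\<close> and the gauge integral in which the
  change of variables theorem is stated; it covers the finite values.\<close>

lemma nn_integral_iff_has_integral:
  fixes b :: "'a::euclidean_space \<Rightarrow> real"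
  assumes [measurable]: "b \<in> borel_measurable borel" "S \<in> sets borel" and b: "\<And>x. 0 \<le> b x" and r: "0 \<le> r"
  shows "(\<integral>\<^sup>+x\<in>S. ennreal (b x) \<partial>lborel) = ennreal r \<longleftrightarrow> (b has_integral r) S"
proof
  assume *: "(\<integral>\<^sup>+x\<in>S. ennreal (b x) \<partial>lborel) = ennreal r"
  have "(\<integral>\<^sup>+x. ennreal (indicator S x * b x) \<partial>lborel) = ennreal r"
    unfolding *[symmetric] by (rule nn_integral_cong) (auto simp: indicator_def)
  then have "((\<lambda>x. indicator S x * b x) has_integral r) UNIV"
    using b r by (intro nn_integral_has_integral) auto
  moreover have "(\<lambda>x. indicator S x * b x) = (\<lambda>x. if x \<in> S then b x else 0)" by auto
  ultimately show "(b has_integral r) S" by (simp add: has_integral_restrict_UNIV)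
next
  assume "(b has_integral r) S"
  then show "(\<integral>\<^sup>+x\<in>S. ennreal (b x) \<partial>lborel) = ennreal r"
    by (rule nn_integral_has_integral_lebesgue'[rotated]) (rule b)
qed

lemma nn_integral_change_of_variables_wellorder:
  fixes \<tau> :: "real ^ 'n::{finite,wellorder} \<Rightarrow> real ^ 'n::_"
  assumes [measurable]: "a \<in> borel_measurable borel" "b \<in> borel_measurable borel" "E \<in> sets borel" "\<tau> ` E \<in> sets borel"
    and nn: "\<And>x. 0 \<le> a x" "\<And>x. 0 \<le> b x"
    and der: "\<And>x. x \<in> E \<Longrightarrow> (\<tau> has_derivative \<tau>' x) (at x within E)" and inj: "inj_on \<tau> E"
    and ab: "\<And>x. x \<in> E \<Longrightarrow> a x = \<bar>det (matrix (\<tau>' x))\<bar> * b (\<tau> x)"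
  shows "(\<integral>\<^sup>+x\<in>E. ennreal (a x) \<partial>lborel) = (\<integral>\<^sup>+y\<in>\<tau> ` E. ennreal (b y) \<partial>lborel)"
proof -
  have E: "E \<in> sets lebesgue" by (simp add: assms(3))
  have one: "f absolutely_integrable_on S \<and> integral S f = r \<longleftrightarrow> (f has_integral r) S"
    if "\<And>x. x \<in> S \<Longrightarrow> 0 \<le> f x" for f :: "real ^ 'n::_ \<Rightarrow> real" and S r
    using that by (auto simp: absolutely_integrable_on_iff_nonneg has_integral_iff)
  \<comment> \<open>\<open>has_absolute_integral_change_of_variables\<close> is about vector-valued
    functions, so real functions are embedded through \<open>real ^ 1\<close>.\<close>
  have vec: "(\<lambda>x. vec (f x) :: real ^ 1) absolutely_integrable_on S \<and> integral S (\<lambda>x. vec (f x) :: real ^ 1) = vec r \<longleftrightarrow>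
      f absolutely_integrable_on S \<and> integral S f = r" for f :: "real ^ 'n::_ \<Rightarrow> real" and S r
    by (simp add: absolutely_integrable_on_1_iff integral_on_1_eq)
  have iff: "(a has_integral r) E \<longleftrightarrow> (b has_integral r) (\<tau> ` E)" for r
  proof -
    have eq: "(\<lambda>x. \<bar>det (matrix (\<tau>' x))\<bar> *\<^sub>R vec (b (\<tau> x)) :: real ^ 1) = (\<lambda>x. vec (\<bar>det (matrix (\<tau>' x))\<bar> * b (\<tau> x)))"
      by (auto simp: vec_eq_iff)
    have "((\<lambda>x. \<bar>det (matrix (\<tau>' x))\<bar> * b (\<tau> x)) has_integral r) E \<longleftrightarrow> (b has_integral r) (\<tau> ` E)"
    proof -
      have "(\<lambda>x. \<bar>det (matrix (\<tau>' x))\<bar> * b (\<tau> x)) absolutely_integrable_on E \<and>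
          integral E (\<lambda>x. \<bar>det (matrix (\<tau>' x))\<bar> * b (\<tau> x)) = r \<longleftrightarrow>
          b absolutely_integrable_on \<tau> ` E \<and> integral (\<tau> ` E) b = r"
        using has_absolute_integral_change_of_variables[OF E der inj, of "\<lambda>y. vec (b y) :: real ^ 1" "vec r"]
        unfolding eq vec by blast
      then show ?thesis using nn one[of E] one[of "\<tau> ` E" b r] by simp
    qed
    moreover have "(a has_integral r) E \<longleftrightarrow> ((\<lambda>x. \<bar>det (matrix (\<tau>' x))\<bar> * b (\<tau> x)) has_integral r) E"
      using ab by (intro has_integral_cong) auto
    ultimately show ?thesis by simp
  qed
  note Q = nn_integral_iff_has_integral[OF assms(1,3) nn(1)] nn_integral_iff_has_integral[OF assms(2,4) nn(2)]
  show ?thesis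
  \<comment> \<open>Finite values agree by \<open>iff\<close>. If the left side is infinite, so is
    the right one, because a finite value there could be carried back.\<close>
  proof (cases "\<integral>\<^sup>+x\<in>E. ennreal (a x) \<partial>lborel" rule: ennreal_cases)
    case (real r)
    then show ?thesis using iff Q by metis
  next
    case top
    then show ?thesis
      using iff Q by (cases "\<integral>\<^sup>+y\<in>\<tau> ` E. ennreal (b y) \<partial>lborel" rule: ennreal_cases) (metis, simp)
  qed
qed

text \<open>Conjugation by \<open>to_wo\<close> and \<open>of_wo\<close> preserves Lebesgue measure
  (\<open>lborel_wo\<close>) and Jacobian determinants (\<open>det_matrix_wo\<close>).\<close>

lemma nn_integral_change_of_variables:
  fixes \<tau> :: "real ^ 'n::finite \<Rightarrow> real ^ 'n"
  assumes [measurable]: "a \<in> borel_measurable borel" "b \<in> borel_measurable borel" "E \<in> sets borel" "\<tau> ` E \<in> sets borel"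
    and nn: "\<And>x. 0 \<le> a x" "\<And>x. 0 \<le> b x"
    and der: "\<And>x. x \<in> E \<Longrightarrow> (\<tau> has_derivative \<tau>' x) (at x within E)" and inj: "inj_on \<tau> E"
    and ab: "\<And>x. x \<in> E \<Longrightarrow> a x = \<bar>det (matrix (\<tau>' x))\<bar> * b (\<tau> x)"
  shows "(\<integral>\<^sup>+x\<in>E. ennreal (a x) \<partial>lborel) = (\<integral>\<^sup>+y\<in>\<tau> ` E. ennreal (b y) \<partial>lborel)"
proof -
  have [measurable]: "(of_wo :: real ^ 'n wo \<Rightarrow> real ^ 'n) \<in> borel_measurable borel"
    using borel_measurable_continuous_onI[OF linear_continuous_on[OF bounded_linear_wo(2)]] by simp
  have mem: "y \<in> to_wo ` S \<longleftrightarrow> of_wo y \<in> S" for y :: "real ^ 'n wo" and S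
    by (metis image_iff of_wo_to_wo)
  have img: "to_wo ` S = of_wo -` S \<inter> space borel" for S :: "(real ^ 'n) set" using mem by auto
  have ms: "to_wo ` S \<in> sets borel" if [measurable]: "S \<in> sets borel" for S :: "(real ^ 'n) set"
    unfolding img by measurable
  have transfer: "(\<integral>\<^sup>+x\<in>S. ennreal (f x) \<partial>lborel) = (\<integral>\<^sup>+y\<in>to_wo ` S. ennreal (f (of_wo y)) \<partial>lborel)"
    if [measurable]: "f \<in> borel_measurable borel" "S \<in> sets borel" for f :: "real ^ 'n \<Rightarrow> real" and S
  proof -
    have "(\<integral>\<^sup>+x\<in>S. ennreal (f x) \<partial>lborel) = (\<integral>\<^sup>+x\<in>S. ennreal (f x) \<partial>distr lborel borel of_wo)"
      by (simp add: lborel_wo)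
    also have "\<dots> = (\<integral>\<^sup>+y. ennreal (f (of_wo y)) * indicator S (of_wo y) \<partial>lborel)"
      by (rule nn_integral_distr) auto
    also have "\<dots> = (\<integral>\<^sup>+y\<in>to_wo ` S. ennreal (f (of_wo y)) \<partial>lborel)"
      by (rule nn_integral_cong) (simp add: indicator_def mem)
    finally show ?thesis .
  qed
  define \<sigma> where "\<sigma> y = to_wo (\<tau> (of_wo y))" for y :: "real ^ 'n wo"
  have \<sigma>img: "\<sigma> ` to_wo ` E = to_wo ` \<tau> ` E" by (auto simp: \<sigma>_def image_image)
  have "(\<integral>\<^sup>+y\<in>to_wo ` E. ennreal (a (of_wo y)) \<partial>lborel) = (\<integral>\<^sup>+y\<in>\<sigma> ` to_wo ` E. ennreal (b (of_wo y)) \<partial>lborel)"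
  proof (rule nn_integral_change_of_variables_wellorder[where \<tau>' = "\<lambda>y v. to_wo (\<tau>' (of_wo y) (of_wo v))"])
    show "inj_on \<sigma> (to_wo ` E)"
      using inj by (auto simp: inj_on_def \<sigma>_def) (metis of_wo_to_wo)
    fix y assume "y \<in> to_wo ` E"
    then have y: "of_wo y \<in> E" by (simp add: mem)
    have w: "(of_wo has_derivative of_wo) (at y within to_wo ` E)"
      by (rule bounded_linear_imp_has_derivative[OF bounded_linear_wo(2)])
    have "of_wo ` to_wo ` E = E" by (auto simp: image_image)
    then have "((\<lambda>y. \<tau> (of_wo y)) has_derivative (\<lambda>v. \<tau>' (of_wo y) (of_wo v))) (at y within to_wo ` E)"
      using has_derivative_in_compose[OF w, of \<tau> "\<tau>' (of_wo y)"] der[OF y] by simp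
    then show "(\<sigma> has_derivative (\<lambda>v. to_wo (\<tau>' (of_wo y) (of_wo v)))) (at y within to_wo ` E)"
      unfolding \<sigma>_def[abs_def] by (rule bounded_linear.has_derivative[OF bounded_linear_wo(1)])
    show "a (of_wo y) = \<bar>det (matrix (\<lambda>v. to_wo (\<tau>' (of_wo y) (of_wo v))))\<bar> * b (of_wo (\<sigma> y))"
      by (simp add: det_matrix_wo ab[OF y] \<sigma>_def)
  qed (auto simp: ms nn \<sigma>img)
  then show ?thesis by (simp add: transfer \<sigma>img)
qed

section \<open>Riemannian measures\<close>

definition volume_density ::
    "('m, real ^ 'n) atlas \<Rightarrow> ('m \<Rightarrow> real ^ 'n \<Rightarrow> real ^ 'n \<Rightarrow> real) \<Rightarrow> 'm set \<times> ('m \<Rightarrow> real ^ 'n) \<Rightarrow> real ^ 'n \<Rightarrow> real" where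
  "volume_density N h C x = sqrt (det (\<chi> i j. metric_coord N h C x (axis i 1) (axis j 1)))"

text \<open>The predicate inside the description \<open>riemannian_measure\<close>; in the locale
  below exactly one measure satisfies it.\<close>

definition is_riemannian_measure ::
    "('m, real ^ 'n) atlas \<Rightarrow> ('m \<Rightarrow> real ^ 'n \<Rightarrow> real ^ 'n \<Rightarrow> real) \<Rightarrow> 'm measure \<Rightarrow> bool" where
  "is_riemannian_measure N h \<nu> \<longleftrightarrow> space \<nu> = points N \<and>
     sets \<nu> = sigma_sets (points N) {W. openin (manifold_top N) W} \<and>
     (\<forall>C\<in>N. \<forall>E\<in>sets \<nu>. E \<subseteq> fst C \<longrightarrow>
        emeasure \<nu> E = (\<integral>\<^sup>+x\<in>snd C ` E. ennreal (volume_density N h C x) \<partial>lborel))"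

text \<open>The Gram matrix of the pulled back form is the product of the transposed Jacobian, the
  Gram matrix and the Jacobian.\<close>

lemma det_bilinear_pullback:
  fixes b :: "real ^ 'n \<Rightarrow> real ^ 'n \<Rightarrow> real" and J :: "real ^ 'n \<Rightarrow> real ^ 'n"
  assumes "bilinear b"
  shows "det (\<chi> i j. b (J (axis i 1)) (J (axis j 1))) =
    (det (matrix J))\<^sup>2 * det (\<chi> i j. b (axis i 1) (axis j 1))"
proof -
  define H where "H = (\<chi> i j. b (axis i 1) (axis j 1))"
  have expand: "b u v = (\<Sum>k\<in>UNIV. \<Sum>l\<in>UNIV. u $ k * v $ l * b (axis k 1) (axis l 1))" for u v
  proof -
    have "b u v = b (\<Sum>k\<in>UNIV. u $ k *\<^sub>R axis k 1) (\<Sum>l\<in>UNIV. v $ l *\<^sub>R axis l 1)"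
      using basis_expansion[of u] basis_expansion[of v] by (simp add: scalar_mult_eq_scaleR)
    also have "\<dots> = (\<Sum>(k, l)\<in>UNIV \<times> UNIV. b (u $ k *\<^sub>R axis k 1) (v $ l *\<^sub>R axis l 1))"
      by (rule bilinear_sum[OF assms])
    also have "\<dots> = (\<Sum>k\<in>UNIV. \<Sum>l\<in>UNIV. u $ k * v $ l * b (axis k 1) (axis l 1))"
      unfolding sum.cartesian_product[symmetric]
      by (simp add: bilinear_lmul[OF assms] bilinear_rmul[OF assms] mult.assoc mult.left_commute)
    finally show ?thesis .
  qed
  have "(\<chi> i j. b (J (axis i 1)) (J (axis j 1))) = transpose (matrix J) ** (H ** matrix J)"
    by (simp add: vec_eq_iff matrix_matrix_mult_def transpose_def H_def matrix_def expand[of "J _"]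
        sum_distrib_left mult_ac)
  then show ?thesis by (simp add: det_mul det_transpose H_def power2_eq_square)
qed

locale compact_riemannian =
  fixes N :: "('m, real ^ 'n) atlas" and h :: "'m \<Rightarrow> real ^ 'n \<Rightarrow> real ^ 'n \<Rightarrow> real"
  assumes N: "diff_atlas N" and N_nonempty: "N \<noteq> {}"
    and compact: "compact_space (manifold_top N)"
    and bil: "p \<in> points N \<Longrightarrow> bilinear (h p)"
    and cont: "C \<in> N \<Longrightarrow> continuous_on (snd C ` fst C) (\<lambda>x. metric_coord N h C x u v)"
begin

abbreviation "borel_sets \<equiv> sigma_sets (points N) {W. openin (manifold_top N) W}"
abbreviation "dens \<equiv> volume_density N h"

lemma opens_Pow: "{W. openin (manifold_top N) W} \<subseteq> Pow (points N)"
  using openin_subset topspace_manifold_top[OF N] by blast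

lemma borel_sets_into: "E \<in> borel_sets \<Longrightarrow> E \<subseteq> points N"
  by (rule sigma_sets_into_sp[OF opens_Pow])

lemma chart_borel: "C \<in> N \<Longrightarrow> fst C \<in> borel_sets"
  using openin_chart[OF N] by (auto intro: sigma_sets.Basic)

lemma sigma_alg: "sigma_algebra (points N) borel_sets"
  by (rule sigma_algebra_sigma_sets[OF opens_Pow])

lemma chart_image_borel:
  assumes "C \<in> N" "E \<in> borel_sets"
  shows "snd C ` (fst C \<inter> E) \<in> sets borel"
  using assms(2)
proof (induction E rule: sigma_sets.induct)
  case (Basic a)
  then show ?case using open_chart_openin[OF N] assms(1) by (auto intro: borel_open)
next
  case (Compl a)
  have "snd C ` (fst C \<inter> (points N - a)) = snd C ` (fst C - fst C \<inter> a)"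
    using fst_subset_points[OF \<open>C \<in> N\<close>] by (intro arg_cong[where f = "(`) (snd C)"]) auto
  also have "\<dots> = snd C ` fst C - snd C ` (fst C \<inter> a)"
    by (rule inj_on_image_set_diff[OF chart_inj[OF N \<open>C \<in> N\<close>]]) auto
  finally show ?case
    using sets.Diff[OF borel_open[OF open_chart_image[OF N \<open>C \<in> N\<close>]] Compl.IH] by simp
next
  case (Union a)
  then show ?case unfolding Int_UN_distrib image_UN by (intro sets.countable_UN) auto
qed simp

lemma chart_image_borel': "C \<in> N \<Longrightarrow> E \<in> borel_sets \<Longrightarrow> E \<subseteq> fst C \<Longrightarrow> snd C ` E \<in> sets borel"
  using chart_image_borel[of C E] by (simp add: Int_absorb1)

lemma dens_continuous: "C \<in> N \<Longrightarrow> continuous_on (snd C ` fst C) (dens C)"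
  unfolding volume_density_def[abs_def] det_def by (auto intro!: continuous_intros cont)

text \<open>Cut off outside the coordinate image so as to be Borel on the whole model space;
  continuity of \<open>dens C\<close> is known only on that image.\<close>

definition "rdens C x = indicator (snd C ` fst C) x * dens C x"

lemma rdens_measurable: "C \<in> N \<Longrightarrow> rdens C \<in> borel_measurable borel"
  using borel_measurable_continuous_on_indicator[OF borel_open[OF open_chart_image[OF N]] dens_continuous]
  by (simp add: rdens_def[abs_def])

definition "chart_vol C E = (\<integral>\<^sup>+x\<in>snd C ` E. ennreal (dens C x) \<partial>lborel)"

lemma chart_vol_rdens: "E \<subseteq> fst C \<Longrightarrow> chart_vol C E = (\<integral>\<^sup>+x\<in>snd C ` E. ennreal (rdens C x) \<partial>lborel)"
  unfolding chart_vol_def by (rule nn_integral_cong) (auto simp: rdens_def indicator_def)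

lemma chart_vol_emeasure:
  assumes "C \<in> N" "E \<in> borel_sets" "E \<subseteq> fst C"
  shows "chart_vol C E = emeasure (density lborel (\<lambda>x. ennreal (rdens C x))) (snd C ` E)"
  using rdens_measurable[OF assms(1)] chart_image_borel'[OF assms]
  by (simp add: chart_vol_rdens[OF assms(3)] emeasure_density)

lemma dens_change:
  assumes "C \<in> N" "D \<in> N" "p \<in> fst C" "p \<in> fst D"
  shows "dens C (snd C p) = \<bar>det (matrix (fderiv (snd D \<circ> chart_inv C) (snd C p)))\<bar> * dens D (snd D p)"
proof -
  define J where "J = fderiv (snd D \<circ> chart_inv C) (snd C p)"
  have p: "p \<in> points N" using assms fst_subset_points by blast
  have lin: "linear (tan_vec N D p)"
    unfolding tan_vec_def[abs_def] using linear_transition[OF N assms(2) chart_at_mem(1)[OF p] assms(4) chart_at_mem(2)[OF p]] .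
  have "bilinear (metric_coord N h D (snd D p))"
    unfolding bilinear_def metric_coord_at[OF N assms(2,4)]
    using bil[OF p] linear_compose[OF lin, of "h p _"] linear_compose[OF lin, of "\<lambda>x. h p x _"]
    by (auto simp: bilinear_def comp_def)
  then have "det (\<chi> i j. metric_coord N h C (snd C p) (axis i 1) (axis j 1)) =
      (det (matrix J))\<^sup>2 * det (\<chi> i j. metric_coord N h D (snd D p) (axis i 1) (axis j 1))"
    unfolding metric_coord_change[OF N assms, of h] J_def[symmetric] by (rule det_bilinear_pullback)
  then show ?thesis by (simp add: volume_density_def J_def[symmetric] real_sqrt_mult)
qed

text \<open>The factor by which the densities differ (\<open>dens_change\<close>) is the Jacobian
  factor of the change of variables formula.\<close>

lemma chart_vol_change:
  assumes C: "C \<in> N" and D: "D \<in> N" and E: "E \<in> borel_sets" "E \<subseteq> fst C" "E \<subseteq> fst D"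
  shows "chart_vol C E = chart_vol D E"
proof -
  define \<tau> where "\<tau> = snd D \<circ> chart_inv C"
  have img: "\<tau> ` snd C ` E = snd D ` E"
    unfolding image_image \<tau>_def by (rule image_cong[OF refl]) (use E chart_inv_apply[OF N C] in auto)
  \<comment> \<open>As \<open>h\<close> is merely bilinear here, the density may be negative. Both
    \<open>ennreal\<close> and \<open>max 0\<close> send such values to 0, and the change of
    variables lemma asks for nonnegative functions.\<close>
  have max: "chart_vol C' E = (\<integral>\<^sup>+x\<in>snd C' ` E. ennreal (max 0 (rdens C' x)) \<partial>lborel)" if "E \<subseteq> fst C'" for C'
    unfolding chart_vol_rdens[OF that] by (rule nn_integral_cong) (simp add: max_def ennreal_neg)
  have "(\<integral>\<^sup>+x\<in>snd C ` E. ennreal (max 0 (rdens C x)) \<partial>lborel) =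
      (\<integral>\<^sup>+x\<in>\<tau> ` snd C ` E. ennreal (max 0 (rdens D x)) \<partial>lborel)"
  proof (rule nn_integral_change_of_variables[where \<tau>' = "\<lambda>x. fderiv \<tau> x"])
    show "inj_on \<tau> (snd C ` E)"
    proof (rule inj_onI, clarify)
      fix x y assume *: "x \<in> E" "y \<in> E" "\<tau> (snd C x) = \<tau> (snd C y)"
      then have "snd D x = snd D y" using E(2) by (simp add: \<tau>_def chart_inv_apply[OF N C] subset_iff)
      then show "snd C x = snd C y" using inj_onD[OF chart_inj[OF N D]] * E(3) by blast
    qed
    fix x assume "x \<in> snd C ` E"
    then obtain p where p: "p \<in> E" "x = snd C p" by auto
    then have pC: "p \<in> fst C" "p \<in> fst D" using E by auto
    show "(\<tau> has_derivative fderiv \<tau> x) (at x within snd C ` E)"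
      using has_frechet[OF transition_differentiable[OF N C D pC]]
      unfolding p(2) \<tau>_def by (rule has_derivative_at_withinI)
    have "rdens C x = \<bar>det (matrix (fderiv \<tau> x))\<bar> * rdens D (\<tau> x)"
      using dens_change[OF C D pC] pC by (simp add: p \<tau>_def rdens_def chart_inv_apply[OF N C])
    then show "max 0 (rdens C x) = \<bar>det (matrix (fderiv \<tau> x))\<bar> * max 0 (rdens D (\<tau> x))"
      by (simp add: max_mult_distrib_left)
  qed (use C D E chart_image_borel' in \<open>auto simp: img intro!: borel_measurable_max rdens_measurable\<close>)
  then show ?thesis unfolding max[OF E(2)] max[OF E(3)] img .
qed

text \<open>Compactness leaves finitely many charts, whose domains are then made disjoint. The
  pieces carry the chart volumes from which the measure is assembled.\<close>

lemma chart_partition: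
  obtains C :: "nat \<Rightarrow> 'm set \<times> ('m \<Rightarrow> real ^ 'n)" and D where "\<And>i. C i \<in> N" "\<And>i. D i \<in> borel_sets"
    "\<And>i. D i \<subseteq> fst (C i)" "disjoint_family D" "(\<Union>i. D i) = points N"
proof -
  have "compactin (manifold_top N) (topspace (manifold_top N))" using compact by (simp add: compact_space_def)
  moreover have "topspace (manifold_top N) \<subseteq> \<Union>(fst ` N)" by (simp add: topspace_manifold_top[OF N] points_def)
  ultimately obtain \<F> where F: "finite \<F>" "\<F> \<subseteq> fst ` N" "topspace (manifold_top N) \<subseteq> \<Union>\<F>"
    unfolding compactin_def using openin_chart[OF N] by (metis (no_types, lifting) image_iff)
  then obtain F where F': "finite F" "F \<subseteq> N" "\<F> = fst ` F" by (meson finite_subset_image)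
  \<comment> \<open>\<open>from_nat_into\<close> needs a nonempty set, while the finite subcover may
    be empty if the manifold has no points.\<close>
  obtain C0 where "C0 \<in> N" using N_nonempty by auto
  define C where "C = from_nat_into (insert C0 F)"
  have rng: "range C = insert C0 F"
    unfolding C_def by (rule range_from_nat_into) (use F' in \<open>auto intro: countable_finite\<close>)
  have C: "C i \<in> N" for i using rng F' \<open>C0 \<in> N\<close> by (metis insert_subset rangeI subsetD)
  interpret sigma_algebra "points N" borel_sets by (rule sigma_alg)
  define D where "D = disjointed (\<lambda>i. fst (C i))"
  have "(\<Union>i. fst (C i)) = (\<Union>d\<in>insert C0 F. fst d)" using rng by (metis image_image)
  also have "\<dots> = points N"
  proof
    show "(\<Union>d\<in>insert C0 F. fst d) \<subseteq> points N"
      using F' \<open>C0 \<in> N\<close> fst_subset_points[of _ N] by blast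
    show "points N \<subseteq> (\<Union>d\<in>insert C0 F. fst d)" using F F' by (auto simp: topspace_manifold_top[OF N])
  qed
  finally have U: "(\<Union>i. D i) = points N" by (simp add: D_def UN_disjointed_eq)
  have "range D \<subseteq> borel_sets" unfolding D_def
    by (rule range_disjointed_sets) (use chart_borel[OF C] in auto)
  then have "D i \<in> borel_sets" for i by auto
  then show ?thesis
    using U that[of C D] C disjointed_subset[of "\<lambda>i. fst (C i)"] disjoint_family_disjointed[of "\<lambda>i. fst (C i)"]
    unfolding D_def by blast
qed

text \<open>Countable additivity over the partition expresses the measure of every Borel set by
  chart volumes.\<close>

lemma riemannian_measure_unique:
  assumes 1: "is_riemannian_measure N h \<nu>" and 2: "is_riemannian_measure N h \<nu>'"
  shows "\<nu> = \<nu>'"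
proof (rule measure_eqI)
  show "sets \<nu> = sets \<nu>'" using 1 2 by (simp add: is_riemannian_measure_def)
  fix E assume E: "E \<in> sets \<nu>"
  obtain C D where CD: "\<And>i. C i \<in> N" "\<And>i. D i \<in> borel_sets" "\<And>i::nat. D i \<subseteq> fst (C i)"
    "disjoint_family D" "(\<Union>i. D i) = points N"
    using chart_partition by metis
  have "emeasure \<mu> E = (\<Sum>i. chart_vol (C i) (E \<inter> D i))" if "is_riemannian_measure N h \<mu>" for \<mu>
  proof -
    have s: "sets \<mu> = borel_sets" "E \<in> sets \<mu>" using that 1 E by (simp_all add: is_riemannian_measure_def)
    then have m: "E \<inter> D i \<in> sets \<mu>" for i using CD(2)[of i] by auto
    have "E = (\<Union>i. E \<inter> D i)" using borel_sets_into[of E] s CD(5) by auto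
    then have "emeasure \<mu> E = emeasure \<mu> (\<Union>i. E \<inter> D i)" by simp
    also have "\<dots> = (\<Sum>i. emeasure \<mu> (E \<inter> D i))"
      using m CD(4) by (intro suminf_emeasure[symmetric]) (auto simp: disjoint_family_on_def)
    also have "\<dots> = (\<Sum>i. chart_vol (C i) (E \<inter> D i))"
      using that CD(1,3) m unfolding is_riemannian_measure_def chart_vol_def by (intro suminf_cong) (simp add: le_infI2)
    finally show ?thesis .
  qed
  then show "emeasure \<nu> E = emeasure \<nu>' E" using 1 2 by simp
qed

text \<open>The chart volumes of the pieces are added up. The prescribed value in an arbitrary chart
  follows since \<open>chart_vol_change\<close> lets every piece be measured in that chart.\<close>

lemma riemannian_measure_exists: "\<exists>\<nu>. is_riemannian_measure N h \<nu>"
proof -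
  obtain C D where CD: "\<And>i. C i \<in> N" "\<And>i. D i \<in> borel_sets" "\<And>i::nat. D i \<subseteq> fst (C i)"
    "disjoint_family D" "(\<Union>i. D i) = points N"
    using chart_partition by metis
  interpret sigma_algebra "points N" borel_sets by (rule sigma_alg)
  have additive: "(\<Sum>k. chart_vol C' (E k)) = chart_vol C' (\<Union>k. E k)"
    if "C' \<in> N" "\<And>k. E k \<in> borel_sets" "\<And>k. E k \<subseteq> fst C'" "disjoint_family E" for C' and E :: "nat \<Rightarrow> 'm set"
  proof -
    have "(\<Union>k. E k) \<in> borel_sets" using that(2) by auto
    then have "chart_vol C' (\<Union>k. E k) = emeasure (density lborel (\<lambda>x. ennreal (rdens C' x))) (\<Union>k. snd C' ` E k)"
      using that by (subst chart_vol_emeasure) (auto simp: image_UN)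
    also have "\<dots> = (\<Sum>k. emeasure (density lborel (\<lambda>x. ennreal (rdens C' x))) (snd C' ` E k))"
    proof (rule suminf_emeasure[symmetric])
      show "range (\<lambda>k. snd C' ` E k) \<subseteq> sets (density lborel (\<lambda>x. ennreal (rdens C' x)))"
        using chart_image_borel'[OF that(1-3)] by auto
      show "disjoint_family (\<lambda>k. snd C' ` E k)"
        unfolding disjoint_family_on_def
      proof (intro ballI impI)
        fix k l :: nat assume "k \<noteq> l"
        then have "E k \<inter> E l = {}" using that(4) by (auto simp: disjoint_family_on_def)
        then show "snd C' ` E k \<inter> snd C' ` E l = {}"
          using inj_on_image_Int[OF chart_inj[OF N that(1)] that(3) that(3), of k l] by simp
      qed
    qed
    also have "\<dots> = (\<Sum>k. chart_vol C' (E k))"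
      using that by (intro suminf_cong) (simp add: chart_vol_emeasure)
    finally show ?thesis by simp
  qed
  define \<mu> where "\<mu> E = (\<Sum>i. chart_vol (C i) (E \<inter> D i))" for E
  define \<nu> where "\<nu> = measure_of (points N) {W. openin (manifold_top N) W} \<mu>"
  have sp: "space \<nu> = points N" and se: "sets \<nu> = borel_sets"
    unfolding \<nu>_def by (auto simp: space_measure_of[OF opens_Pow] sets_measure_of[OF opens_Pow])
  have em: "emeasure \<nu> E = \<mu> E" if "E \<in> borel_sets" for E
  proof (rule emeasure_measure_of[OF \<nu>_def opens_Pow])
    show "positive (sets \<nu>) \<mu>" by (simp add: positive_def \<mu>_def chart_vol_def)
    show "countably_additive (sets \<nu>) \<mu>"
      unfolding countably_additive_def se
    proof (intro allI impI)
      fix E :: "nat \<Rightarrow> 'm set" assume E: "range E \<subseteq> borel_sets" "disjoint_family E"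
      \<comment> \<open>The order of summation is interchanged by reading the outer series over
        \<open>i\<close> as an integral over \<open>count_space UNIV\<close>.\<close>
      have "(\<Sum>k. \<mu> (E k)) = (\<Sum>k. \<integral>\<^sup>+i. chart_vol (C i) (E k \<inter> D i) \<partial>count_space UNIV)"
        by (simp add: \<mu>_def nn_integral_count_space_nat)
      also have "\<dots> = (\<integral>\<^sup>+i. (\<Sum>k. chart_vol (C i) (E k \<inter> D i)) \<partial>count_space UNIV)"
        by (rule nn_integral_suminf[symmetric]) simp
      also have "\<dots> = (\<integral>\<^sup>+i. chart_vol (C i) (\<Union>k. E k \<inter> D i) \<partial>count_space UNIV)"
      proof (rule nn_integral_cong, rule additive[OF CD(1)])
        show "E k \<inter> D i \<in> borel_sets" for i k using E CD(2)[of i] by auto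
        show "E k \<inter> D i \<subseteq> fst (C i)" for i k using CD(3)[of i] by auto
        show "disjoint_family (\<lambda>k. E k \<inter> D i)" for i using E(2) by (auto simp: disjoint_family_on_def)
      qed
      also have "\<dots> = \<mu> (\<Union>k. E k)" by (simp add: \<mu>_def nn_integral_count_space_nat)
      finally show "(\<Sum>k. \<mu> (E k)) = \<mu> (\<Union> (range E))" .
    qed
    show "E \<in> sets \<nu>" using that se by simp
  qed
  have "emeasure \<nu> E = chart_vol C' E" if C': "C' \<in> N" and E: "E \<in> borel_sets" "E \<subseteq> fst C'" for C' E
  proof -
    have "emeasure \<nu> E = (\<Sum>i. chart_vol C' (E \<inter> D i))"
      unfolding em[OF E(1)] \<mu>_def
      by (rule suminf_cong, rule chart_vol_change[OF CD(1) C']) (use E CD(2,3) in auto)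
    also have "\<dots> = chart_vol C' (\<Union>i. E \<inter> D i)"
    proof (rule additive[OF C'])
      show "disjoint_family (\<lambda>i. E \<inter> D i)"
        using CD(4) unfolding disjoint_family_on_def by blast
    qed (use E CD(2) in auto)
    also have "(\<Union>i. E \<inter> D i) = E" using CD(5) borel_sets_into[OF E(1)] by auto
    finally show ?thesis .
  qed
  then have "is_riemannian_measure N h \<nu>"
    unfolding is_riemannian_measure_def chart_vol_def using sp se by auto
  then show ?thesis ..
qed

lemma is_riemannian_measure: "is_riemannian_measure N h (riemannian_measure N h)"
proof -
  have "riemannian_measure N h = (THE \<nu>. is_riemannian_measure N h \<nu>)"
    unfolding riemannian_measure_def is_riemannian_measure_def volume_density_def ..
  then show ?thesis
    using riemannian_measure_exists riemannian_measure_unique theI[of "is_riemannian_measure N h"] by metis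
qed

abbreviation "\<nu> \<equiv> riemannian_measure N h"

lemma space_riemannian [simp]: "space \<nu> = points N"
  and sets_riemannian: "sets \<nu> = borel_sets"
  and emeasure_riemannian: "C \<in> N \<Longrightarrow> E \<in> borel_sets \<Longrightarrow> E \<subseteq> fst C \<Longrightarrow> emeasure \<nu> E = chart_vol C E"
  using is_riemannian_measure by (auto simp: is_riemannian_measure_def chart_vol_def)

text \<open>The density is bounded on a closed ball around each coordinate point, so every point has
  an open neighbourhood of finite measure; finitely many of these cover the space.\<close>

lemma finite_measure_riemannian: "finite_measure \<nu>"
proof
  have loc: "\<exists>W. openin (manifold_top N) W \<and> p \<in> W \<and> emeasure \<nu> W < \<infinity>" if "p \<in> points N" for p
  proof -
    define C where "C = chart_at N p"
    have C: "C \<in> N" "p \<in> fst C" using chart_at_mem[OF that] by (simp_all add: C_def)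
    obtain r where r: "r > 0" "cball (snd C p) r \<subseteq> snd C ` fst C"
      using open_contains_cball[of "snd C ` fst C"] open_chart_image[OF N C(1)] C(2) by auto
    have "compact (dens C ` cball (snd C p) r)"
      using dens_continuous[OF C(1)] r(2) by (intro compact_continuous_image) (auto intro: continuous_on_subset)
    then obtain K where K: "\<And>x. x \<in> cball (snd C p) r \<Longrightarrow> \<bar>dens C x\<bar> \<le> K"
      using compact_imp_bounded bounded_iff by (metis image_eqI real_norm_def)
    define W where "W = fst C \<inter> snd C -` ball (snd C p) r"
    have W: "openin (manifold_top N) W" unfolding W_def by (rule openin_chart_vimage[OF N C(1)]) simp
    then have "emeasure \<nu> W = chart_vol C W"
      using C by (intro emeasure_riemannian) (auto simp: W_def)
    also have "\<dots> \<le> (\<integral>\<^sup>+x\<in>cball (snd C p) r. ennreal K \<partial>lborel)"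
      unfolding chart_vol_def
      by (rule nn_integral_mono) (use K in \<open>auto simp: indicator_def W_def intro!: ennreal_leI dest: abs_le_D1\<close>)
    also have "\<dots> = ennreal K * emeasure lborel (cball (snd C p) r)" by (simp add: nn_integral_cmult_indicator)
    also have "\<dots> < \<infinity>" using emeasure_lborel_cball_finite[of "snd C p" r] by (simp add: ennreal_mult_less_top)
    finally show ?thesis using W C r(1) by (auto simp: W_def)
  qed
  then obtain W where W: "\<And>p. p \<in> points N \<Longrightarrow> openin (manifold_top N) (W p) \<and> p \<in> W p \<and> emeasure \<nu> (W p) < \<infinity>"
    by metis
  have "compactin (manifold_top N) (points N)" using compact by (simp add: compact_space_def topspace_manifold_top[OF N])
  then have "\<exists>\<F>. finite \<F> \<and> \<F> \<subseteq> W ` points N \<and> points N \<subseteq> \<Union>\<F>"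
    unfolding compactin_def using W by (elim conjE allE[of _ "W ` points N"]) auto
  then obtain F where F: "finite F" "F \<subseteq> points N" "points N \<subseteq> (\<Union>p\<in>F. W p)"
    by (metis finite_subset_image)
  have Wm: "W p \<in> sets \<nu>" if "p \<in> F" for p
    unfolding sets_riemannian using W F(2) that by (intro sigma_sets.Basic) auto
  have "emeasure \<nu> (space \<nu>) \<le> emeasure \<nu> (\<Union>p\<in>F. W p)"
    using F(1,3) Wm by (intro emeasure_mono sets.finite_UN) auto
  also have "\<dots> \<le> (\<Sum>p\<in>F. emeasure \<nu> (W p))"
    using F(1) Wm by (intro emeasure_subadditive_finite) auto
  also have "\<dots> < \<infinity>" using F W by auto
  finally show "emeasure \<nu> (space \<nu>) \<noteq> \<infinity>" by simp
qed

lemma continuous_map_measurable: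
  fixes f :: "'m \<Rightarrow> real"
  assumes "continuous_map (manifold_top N) euclidean f"
  shows "f \<in> borel_measurable \<nu>"
proof (rule borel_measurableI)
  fix U :: "real set" assume "open U"
  then have "openin (manifold_top N) {p \<in> points N. f p \<in> U}"
    using assms by (auto simp: continuous_map topspace_manifold_top[OF N])
  moreover have "f -` U \<inter> space \<nu> = {p \<in> points N. f p \<in> U}" by auto
  ultimately show "f -` U \<inter> space \<nu> \<in> sets \<nu>" by (auto simp: sets_riemannian)
qed

lemma nn_integral_chart:
  assumes C: "C \<in> N" and E: "E \<in> borel_sets" "E \<subseteq> fst C" and f: "f \<in> borel_measurable \<nu>"
  shows "(\<integral>\<^sup>+p\<in>E. f p \<partial>\<nu>) = (\<integral>\<^sup>+x\<in>snd C ` E. f (chart_inv C x) * ennreal (dens C x) \<partial>lborel)"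
proof (cases "E = {}")
  case False
  then obtain p0 where p0: "p0 \<in> E" by auto
  \<comment> \<open>The inverse chart is continued by the constant \<open>p0\<close> to a total
    measurable map, for which \<open>E\<close> must be nonempty. The restriction of \<nu> to
    \<open>E\<close> is then the image under \<open>k\<close> of a measure with density on the model
    space.\<close>
  define k where "k x = (if x \<in> snd C ` E then chart_inv C x else p0)" for x
  have invE: "chart_inv C (snd C p) = p" if "p \<in> E" for p using that E chart_inv_apply[OF N C] by auto
  have SE: "snd C ` E \<in> sets borel" by (rule chart_image_borel'[OF C E])
  have kE: "k x \<in> E" for x using p0 invE by (auto simp: k_def)
  have vim: "k -` B \<inter> snd C ` E = snd C ` (E \<inter> B)" for B using invE by (auto simp: k_def)
  have k [measurable]: "k \<in> measurable lborel \<nu>"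
  proof (rule measurableI)
    show "k x \<in> space \<nu>" for x using kE borel_sets_into[OF E(1)] by auto
    fix B assume "B \<in> sets \<nu>"
    then have "E \<inter> B \<in> borel_sets" using E(1) by (auto simp: sets_riemannian[symmetric])
    then have "snd C ` (E \<inter> B) \<in> sets borel" using E(2) by (intro chart_image_borel'[OF C]) auto
    moreover have "k -` B \<inter> space lborel = k -` B \<inter> snd C ` E \<union> (if p0 \<in> B then - (snd C ` E) else {})"
      by (auto simp: k_def split: if_splits)
    note this[unfolded vim]
    ultimately show "k -` B \<inter> space lborel \<in> sets lborel" using SE by auto
  qed
  have [measurable]: "rdens C \<in> borel_measurable borel" "E \<in> sets \<nu>" "snd C ` E \<in> sets borel"
    using rdens_measurable[OF C] E(1) SE by (simp_all add: sets_riemannian)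
  have meq: "density \<nu> (indicator E) = distr (density lborel (\<lambda>x. ennreal (rdens C x) * indicator (snd C ` E) x)) \<nu> k"
  proof (rule measure_eqI)
    fix B assume "B \<in> sets (density \<nu> (indicator E))"
    then have B [measurable]: "B \<in> sets \<nu>" by simp
    then have EB: "E \<inter> B \<in> borel_sets" using E(1) by (auto simp: sets_riemannian[symmetric])
    have "emeasure (density \<nu> (indicator E)) B = (\<integral>\<^sup>+p. indicator E p * indicator B p \<partial>\<nu>)"
      by (rule emeasure_density) simp_all
    also have "\<dots> = (\<integral>\<^sup>+p. indicator (E \<inter> B) p \<partial>\<nu>)" unfolding indicator_inter_arith ..
    also have "\<dots> = emeasure \<nu> (E \<inter> B)" using EB by (simp add: sets_riemannian)
    also have "\<dots> = (\<integral>\<^sup>+x\<in>snd C ` (E \<inter> B). ennreal (rdens C x) \<partial>lborel)"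
      using E(2) EB by (subst emeasure_riemannian[OF C]) (auto intro: chart_vol_rdens)
    also have "\<dots> = (\<integral>\<^sup>+x. (ennreal (rdens C x) * indicator (snd C ` E) x) * indicator (k -` B) x \<partial>lborel)"
      unfolding vim[symmetric] by (rule nn_integral_cong) (auto simp: indicator_def)
    also have "\<dots> = emeasure (density lborel (\<lambda>x. ennreal (rdens C x) * indicator (snd C ` E) x)) (k -` B \<inter> space lborel)"
      using measurable_sets[OF k B] by (subst emeasure_density) (auto simp: )
    also have "\<dots> = emeasure (distr (density lborel (\<lambda>x. ennreal (rdens C x) * indicator (snd C ` E) x)) \<nu> k) B"
      by (subst emeasure_distr) auto
    finally show "emeasure (density \<nu> (indicator E)) B =
        emeasure (distr (density lborel (\<lambda>x. ennreal (rdens C x) * indicator (snd C ` E) x)) \<nu> k) B" .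
  qed simp
  have "(\<integral>\<^sup>+p\<in>E. f p \<partial>\<nu>) = (\<integral>\<^sup>+p. f p \<partial>density \<nu> (indicator E))"
    using f by (subst nn_integral_density) (auto simp: mult.commute)
  also have "\<dots> = (\<integral>\<^sup>+x. f (k x) \<partial>density lborel (\<lambda>x. ennreal (rdens C x) * indicator (snd C ` E) x))"
    unfolding meq using f by (subst nn_integral_distr) auto
  also have "\<dots> = (\<integral>\<^sup>+x. (ennreal (rdens C x) * indicator (snd C ` E) x) * f (k x) \<partial>lborel)"
    using measurable_compose[OF k f] by (subst nn_integral_density) auto
  also have "\<dots> = (\<integral>\<^sup>+x\<in>snd C ` E. f (chart_inv C x) * ennreal (dens C x) \<partial>lborel)"
    using E(2) by (intro nn_integral_cong) (auto simp: k_def rdens_def indicator_def mult.commute)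
  finally show ?thesis .
qed simp

end

section \<open>The Levi-Civita connection\<close>

text \<open>In the basis \<open>e\<close> the form is diagonal with entries 1 and -1, so each
  coordinate of \<open>u\<close> can be read off from \<open>b u (e j)\<close> up to sign.\<close>

lemma lorentzian_nondegenerate:
  assumes "lorentzian_form b" "\<And>v. b u v = 0"
  shows "u = (0 :: 'e::euclidean_space)"
proof -
  obtain e :: "'e \<Rightarrow> 'e" and e0 where bil: "bilinear b" and sp: "span (e ` Basis) = UNIV"
    and e: "\<forall>i\<in>Basis. \<forall>j\<in>Basis. b (e i) (e j) = (if i \<noteq> j then 0 else if i = e0 then - 1 else 1)"
    using assms(1) unfolding lorentzian_form_def by metis
  define f where "f x = (\<Sum>i\<in>Basis. (x \<bullet> i) *\<^sub>R e i)" for x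
  have lin: "linear f"
    unfolding f_def by (intro linearI) (simp_all add: inner_add_left scaleR_add_left sum.distrib scaleR_sum_right)
  have "f i = e i" if "i \<in> Basis" for i
    using that by (simp add: f_def inner_Basis if_distrib[of "\<lambda>x. x *\<^sub>R _"] cong: if_cong)
  then have "e ` Basis \<subseteq> range f" by (metis image_subsetI rangeI)
  then have "range f = UNIV"
    using sp span_minimal[of "e ` Basis" "range f"] linear_subspace_image[OF lin subspace_UNIV] by auto
  then obtain x where x: "u = f x" by (metis UNIV_I imageE)
  have "x \<bullet> j = 0" if j: "j \<in> Basis" for j
  proof -
    have "b u (e j) = (\<Sum>i\<in>Basis. (x \<bullet> i) * b (e i) (e j))"
    proof -
      have "linear (\<lambda>u. b u (e j))" using bil by (simp add: bilinear_def)
      from linear_sum[OF this, of "\<lambda>i. (x \<bullet> i) *\<^sub>R e i" Basis] linear_scale[OF this]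
      show ?thesis by (simp add: x f_def)
    qed
    also have "\<dots> = (x \<bullet> j) * (if j = e0 then - 1 else 1)"
    proof -
      have "(\<Sum>i\<in>Basis. (x \<bullet> i) * b (e i) (e j)) =
          (\<Sum>i\<in>Basis. if i = j then (x \<bullet> j) * (if j = e0 then - 1 else 1) else 0)"
        by (rule sum.cong[OF refl]) (use e j in simp)
      then show ?thesis using j by simp
    qed
    finally have "(x \<bullet> j) * (if j = e0 then - 1 else 1) = 0" using assms(2)[of "e j"] by simp
    then show ?thesis by (simp split: if_splits)
  qed
  then have "x = 0" using euclidean_all_zero_iff by blast
  then show ?thesis by (simp add: x f_def)
qed

text \<open>The map \<open>f\<close> from \<open>z\<close> to the coefficients of \<open>b z\<close>
  is injective by nondegeneracy, hence surjective in finite dimension.\<close>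

lemma nondegenerate_represent:
  fixes b :: "'e::euclidean_space \<Rightarrow> 'e \<Rightarrow> real"
  assumes bil: "bilinear b" and nd: "\<And>u. (\<And>v. b u v = 0) \<Longrightarrow> u = 0" and l: "linear l"
  shows "\<exists>z. \<forall>w. b z w = l w"
proof -
  define f where "f z = (\<Sum>i\<in>Basis. b z i *\<^sub>R i)" for z
  have br: "linear (b z)" and bl: "linear (\<lambda>z. b z w)" for z w using bil by (auto simp: bilinear_def)
  have lin: "linear f"
    unfolding f_def by (intro linearI) (simp_all add: linear_add[OF bl] linear_scale[OF bl] scaleR_add_left sum.distrib scaleR_sum_right)
  have fi: "f z \<bullet> i = b z i" if "i \<in> Basis" for z i
    using that by (simp add: f_def inner_sum_left inner_Basis if_distrib[of "\<lambda>x. _ * x"] cong: if_cong)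
  have ext: "k w = k' w" if "linear k" "linear k'" "\<And>i. i \<in> Basis \<Longrightarrow> k i = k' i" for k k' :: "'e \<Rightarrow> real" and w
    using linear_eq_stdbasis[OF that(1,2)] that(3) by metis
  have "z = 0" if "f z = 0" for z
  proof (rule nd)
    fix v show "b z v = 0"
      using ext[OF br, of "\<lambda>_. 0" z v] fi[of _ z] that by (simp add: linear_zero)
  qed
  then have "inj f" using linear_injective_0[OF lin] by blast
  then have "surj f" using linear_injective_imp_surjective[OF lin] by blast
  then obtain z where z: "f z = (\<Sum>i\<in>Basis. l i *\<^sub>R i)" by (metis surjD)
  have "b z i = l i" if "i \<in> Basis" for i
    using fi[OF that, of z] that by (simp add: z inner_sum_left inner_Basis if_distrib[of "\<lambda>x. _ * x"] cong: if_cong)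
  then show ?thesis using ext[OF br l] by metis
qed

lemma eventually_nhds_continuous:
  assumes "continuous (at s) x" "open U" "x s \<in> U"
  shows "\<forall>\<^sub>F r in nhds s. x r \<in> U"
  using assms unfolding continuous_at_open eventually_nhds by blast

section \<open>Metric coefficients and Christoffel symbols in a chart\<close>

locale lorentz_manifold =
  fixes A :: "('m, 'e::euclidean_space) atlas" and g
  assumes SA: "smooth_atlas A" and LM: "lorentzian_metric A g"
begin

lemma diff_A: "diff_atlas A" by (rule smooth_atlas_imp_diff_atlas[OF SA])

abbreviation "G c \<equiv> metric_coord A g c"
abbreviation "DG c x w u v \<equiv> fderiv (\<lambda>y. metric_coord A g c y u v) x w"

lemma g_bilinear: "p \<in> points A \<Longrightarrow> bilinear (g p)"
  and g_sym: "p \<in> points A \<Longrightarrow> g p u v = g p v u"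
  and g_nondegenerate: "p \<in> points A \<Longrightarrow> (\<And>v. g p u v = 0) \<Longrightarrow> u = 0"
  using LM lorentzian_nondegenerate[of "g p" u] by (simp_all add: lorentzian_metric_def lorentzian_form_def)

context
  fixes c x assumes c: "c \<in> A" and x: "x \<in> snd c ` fst c"
begin

lemma chart_inv_points: "chart_inv c x \<in> points A" "chart_inv c x \<in> fst c"
  using chart_inv_mem[OF x] fst_subset_points[OF c] by auto

lemma linear_tan_vec: "linear (tan_vec A c (chart_inv c x))"
  unfolding tan_vec_def[abs_def]
  using linear_transition[OF diff_A c chart_at_mem(1)[OF chart_inv_points(1)] chart_inv_points(2) chart_at_mem(2)[OF chart_inv_points(1)]]
  by (simp add: chart_apply_inv[OF x])

lemma G_bilinear: "bilinear (G c x)"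
  using g_bilinear[OF chart_inv_points(1)] linear_compose[OF linear_tan_vec, of "g (chart_inv c x) _"]
    linear_compose[OF linear_tan_vec, of "\<lambda>u. g (chart_inv c x) u _"]
  by (auto simp: bilinear_def comp_def metric_coord_def)

lemma G_sym: "G c x u v = G c x v u"
  unfolding metric_coord_def by (rule g_sym[OF chart_inv_points(1)])

lemma G_nondegenerate:
  assumes "\<And>v. G c x u v = 0" shows "u = 0"
proof -
  have "g (chart_inv c x) (tan_vec A c (chart_inv c x) u) v = 0" for v
    using assms[of "tan_coord A c (chart_inv c x) v"]
    by (simp add: metric_coord_def tan_vec_coord[OF diff_A c chart_inv_points(2)])
  then have "tan_vec A c (chart_inv c x) u = 0" by (rule g_nondegenerate[OF chart_inv_points(1)])
  then have "tan_coord A c (chart_inv c x) 0 = u" using tan_coord_vec[OF diff_A c chart_inv_points(2)] by metis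
  then show ?thesis using linear_0[OF linear_tan_coord[OF diff_A c chart_inv_points(2)]] by simp
qed

end

lemma G_smooth: "c \<in> A \<Longrightarrow> smooth_on (snd c ` fst c) (\<lambda>x. G c x u v)"
  using LM by (auto simp: lorentzian_metric_def)

text \<open>Smoothness of the metric is given for constant arguments only; this expansion is what
  permits differentiation along moving vectors.\<close>

lemma G_expand:
  assumes "c \<in> A" "x \<in> snd c ` fst c"
  shows "G c x u v = (\<Sum>i\<in>Basis. \<Sum>j\<in>Basis. (u \<bullet> i) * (v \<bullet> j) * G c x i j)"
proof -
  have b: "linear (G c x w)" "linear (\<lambda>w. G c x w z)" for w z
    using G_bilinear[OF assms] by (auto simp: bilinear_def)
  show ?thesis
    by (subst linear_expand[OF b(2)], subst linear_expand[OF b(1)]) (simp add: sum_distrib_left mult.assoc)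
qed

context
  fixes c x assumes c: "c \<in> A" and x: "x \<in> snd c ` fst c"
begin

lemma DG_expand: "DG c x w u v = (\<Sum>i\<in>Basis. \<Sum>j\<in>Basis. (u \<bullet> i) * (v \<bullet> j) * DG c x w i j)"
proof -
  have "((\<lambda>y. \<Sum>i\<in>Basis. \<Sum>j\<in>Basis. (u \<bullet> i) * (v \<bullet> j) * G c y i j) has_derivative
      (\<lambda>w. \<Sum>i\<in>Basis. \<Sum>j\<in>Basis. (u \<bullet> i) * (v \<bullet> j) * DG c x w i j)) (at x)"
    by (intro has_derivative_sum has_derivative_mult_right smooth_on_has_derivative[OF G_smooth[OF c] x])
  then have "((\<lambda>y. G c y u v) has_derivative (\<lambda>w. \<Sum>i\<in>Basis. \<Sum>j\<in>Basis. (u \<bullet> i) * (v \<bullet> j) * DG c x w i j)) (at x)"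
    by (rule has_derivative_transform_within_open[OF _ open_chart_image[OF diff_A c] x]) (simp add: G_expand[OF c, of _ u v])
  from frechet_eq[OF this] show ?thesis by simp
qed

lemma DG_linear: "linear (\<lambda>w. DG c x w u v)"
  by (rule linear_frechet[OF smooth_on_differentiable[OF G_smooth[OF c] x]])

lemma DG_sym: "DG c x w u v = DG c x w v u"
proof -
  have "fderiv (\<lambda>y. G c y u v) x = fderiv (\<lambda>y. G c y v u) x"
    by (rule frechet_derivative_transform(1)[OF open_chart_image[OF diff_A c] x]) (rule G_sym[OF c])
  then show ?thesis by (rule fun_cong)
qed

lemma DG_bilinear: "bilinear (DG c x w)"
  unfolding bilinear_def
proof (intro conjI allI linearI)
  fix u v v' r
  show "DG c x w u (v + v') = DG c x w u v + DG c x w u v'"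
    by (subst (1 2 3) DG_expand) (simp add: inner_add_left algebra_simps sum.distrib)
  show "DG c x w u (r *\<^sub>R v) = r *\<^sub>R DG c x w u v"
    by (subst (1 2) DG_expand) (simp add: sum_distrib_left mult_ac)
  show "DG c x w (v + v') u = DG c x w v u + DG c x w v' u"
    by (subst (1 2 3) DG_expand) (simp add: inner_add_left algebra_simps sum.distrib)
  show "DG c x w (r *\<^sub>R v) u = r *\<^sub>R DG c x w v u"
    by (subst (1 2) DG_expand) (simp add: sum_distrib_left mult_ac)
qed

text \<open>Existence and uniqueness of the Levi-Civita connection at a point, so that the
  description \<open>christoffel\<close> satisfies its own specification.\<close>

lemma christoffel_spec:
  defines "\<Gamma> \<equiv> christoffel A g c x"
  shows "bilinear \<Gamma>" "\<Gamma> u v = \<Gamma> v u" "DG c x w u v = G c x (\<Gamma> w u) v + G c x u (\<Gamma> w v)"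
proof -
  let ?P = "\<lambda>\<Gamma>. bilinear \<Gamma> \<and> (\<forall>u v. \<Gamma> u v = \<Gamma> v u) \<and>
     (\<forall>u v w. DG c x w u v = G c x (\<Gamma> w u) v + G c x u (\<Gamma> w v))"
  \<comment> \<open>Koszul formula for coordinate fields, whose Lie brackets vanish:
    \<open>K u v w\<close> is the value that \<open>G c x (\<Gamma> u v) w\<close> must
    have.\<close>
  define K where "K u v w = (DG c x u v w + DG c x v u w - DG c x w u v) / 2" for u v w
  note dl = DG_linear and db = DG_bilinear[unfolded bilinear_def, rule_format]
  note gb = G_bilinear[OF c x] and gs = G_sym[OF c x] and gn = G_nondegenerate[OF c x]
  have dr: "linear (DG c x w u)" and dm: "linear (\<lambda>u. DG c x w u v)" for w u v
    using DG_bilinear[of w] by (auto simp: bilinear_def)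
  have gdiff: "G c x (z - z') w = G c x z w - G c x z' w" for z z' w by (rule bilinear_lsub[OF gb])
  have uniq: "z = z'" if "\<And>w. G c x z w = G c x z' w" for z z'
    using gn[of "z - z'"] that gdiff by simp
  have "\<exists>z. \<forall>w. G c x z w = K u v w" for u v
  proof (rule nondegenerate_represent[OF gb gn])
    show "linear (K u v)"
      by (intro linearI) (simp_all add: K_def linear_add[OF dr] linear_scale[OF dr] linear_add[OF dl] linear_scale[OF dl]
          field_simps)
  qed
  then obtain \<Gamma>' where \<Gamma>': "\<And>u v w. G c x (\<Gamma>' u v) w = K u v w" by metis
  have gadd: "G c x (z + z') w = G c x z w + G c x z' w" and gscale: "G c x (r *\<^sub>R z) w = r * G c x z w" for z z' w r
    by (simp_all add: bilinear_ladd[OF gb] bilinear_lmul[OF gb])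
  have "?P \<Gamma>'"
  proof (intro conjI allI)
    show "bilinear \<Gamma>'"
      unfolding bilinear_def
      by (intro conjI allI linearI; rule uniq; simp add: \<Gamma>' gadd gscale K_def linear_add[OF dr] linear_scale[OF dr]
          linear_add[OF dl] linear_scale[OF dl] linear_add[OF dm] linear_scale[OF dm] field_simps)
    show "\<Gamma>' u v = \<Gamma>' v u" for u v
      by (rule uniq) (simp add: \<Gamma>' K_def DG_sym[where u = u and v = v])
    show "DG c x w u v = G c x (\<Gamma>' w u) v + G c x u (\<Gamma>' w v)" for u v w
      unfolding gs[of u] \<Gamma>' K_def by (simp add: DG_sym[where u = v and v = w] DG_sym[where u = u and v = w] DG_sym[where u = v and v = u] field_simps)
  qed
  moreover have "\<Gamma>1 = \<Gamma>2" if 1: "?P \<Gamma>1" and 2: "?P \<Gamma>2" for \<Gamma>1 \<Gamma>2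
  proof (intro ext uniq)
    have "G c x (\<Gamma>0 u v) w = K u v w" if P: "?P \<Gamma>0" for \<Gamma>0 u v w
    proof -
      have s: "\<Gamma>0 a b = \<Gamma>0 b a" for a b using P by blast
      \<comment> \<open>In the signed sum of three instances of metric compatibility, symmetry of
        \<open>\<Gamma>0\<close> cancels all terms but two equal ones.\<close>
      have m: "DG c x w u v = G c x (\<Gamma>0 w u) v + G c x (\<Gamma>0 w v) u" for u v w
        using P gs by metis
      show ?thesis unfolding K_def m[of v w u] m[of u w v] m[of u v w] s[of v u] s[of w u] s[of w v] by simp
    qed
    then show "G c x (\<Gamma>1 u v) w = G c x (\<Gamma>2 u v) w" for u v w using 1 2 by metis
  qed
  ultimately have "?P \<Gamma>"
    unfolding \<Gamma>_def christoffel_def by (intro theI[where P = ?P]) auto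
  then show "bilinear \<Gamma>" "\<Gamma> u v = \<Gamma> v u" "DG c x w u v = G c x (\<Gamma> w u) v + G c x u (\<Gamma> w v)" by blast+
qed

end

text \<open>The derivative of the metric coefficients splits into the two Christoffel terms by
  metric compatibility. Here \<open>a\<close> and \<open>b\<close> are coordinates of vector fields
  along the curve \<open>x\<close>; both the geodesics and the leaf metrics are treated with this
  rule.\<close>

lemma metric_curve_derivative:
  assumes c: "c \<in> A" and x: "x s \<in> snd c ` fst c"
    and dx: "(x has_vector_derivative x') (at s)"
    and da: "(a has_vector_derivative a') (at s)" and db: "(b has_vector_derivative b') (at s)"
  defines "\<Gamma> \<equiv> christoffel A g c (x s)"
  shows "((\<lambda>r. G c (x r) (a r) (b r)) has_real_derivative
    G c (x s) (a' + \<Gamma> x' (a s)) (b s) + G c (x s) (a s) (b' + \<Gamma> x' (b s))) (at s)"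
proof -
  note dxd = dx[unfolded has_vector_derivative_def]
  have dG: "((\<lambda>r. G c (x r) i j) has_real_derivative DG c (x s) x' i j) (at s)" for i j
  proof -
    have "((\<lambda>r. G c (x r) i j) has_derivative (\<lambda>t. DG c (x s) (t *\<^sub>R x') i j)) (at s)"
      by (rule has_derivative_compose[of x "\<lambda>t. t *\<^sub>R x'" s UNIV, OF dx[unfolded has_vector_derivative_def]
            smooth_on_has_derivative[OF G_smooth[OF c] x]])
    then show ?thesis
      using linear_scale[OF DG_linear[OF c x]] by (simp add: has_field_derivative_def mult_commute_abs)
  qed
  have dinner: "((\<lambda>r. f r \<bullet> i) has_real_derivative f' \<bullet> i) (at s)" if "(f has_vector_derivative f') (at s)" for f :: "real \<Rightarrow> 'e" and f' i
    using bounded_linear.has_vector_derivative[OF bounded_linear_inner_left that]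
    by (simp add: has_real_derivative_iff_has_vector_derivative)
  have "((\<lambda>r. \<Sum>i\<in>Basis. \<Sum>j\<in>Basis. (a r \<bullet> i) * (b r \<bullet> j) * G c (x r) i j) has_real_derivative
      (\<Sum>i\<in>Basis. \<Sum>j\<in>Basis. ((a' \<bullet> i) * (b s \<bullet> j) + (b' \<bullet> j) * (a s \<bullet> i)) * G c (x s) i j +
        DG c (x s) x' i j * ((a s \<bullet> i) * (b s \<bullet> j)))) (at s)"
    by (intro DERIV_sum DERIV_mult dinner da db dG)
  also have "(\<Sum>i\<in>Basis. \<Sum>j\<in>Basis. ((a' \<bullet> i) * (b s \<bullet> j) + (b' \<bullet> j) * (a s \<bullet> i)) * G c (x s) i j +
        DG c (x s) x' i j * ((a s \<bullet> i) * (b s \<bullet> j))) =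
      G c (x s) a' (b s) + G c (x s) (a s) b' + DG c (x s) x' (a s) (b s)"
    unfolding G_expand[OF c x, of a' "b s"] G_expand[OF c x, of "a s" b'] DG_expand[OF c x, where w = x' and u = "a s" and v = "b s"]
      sum.distrib[symmetric] by (intro sum.cong refl) (simp add: algebra_simps)
  also have "\<dots> = G c (x s) (a' + \<Gamma> x' (a s)) (b s) + G c (x s) (a s) (b' + \<Gamma> x' (b s))"
    unfolding christoffel_spec(3)[OF c x] \<Gamma>_def
    by (simp add: bilinear_ladd[OF G_bilinear[OF c x]] bilinear_radd[OF G_bilinear[OF c x]])
  finally have D: "((\<lambda>r. \<Sum>i\<in>Basis. \<Sum>j\<in>Basis. (a r \<bullet> i) * (b r \<bullet> j) * G c (x r) i j) has_real_derivative
      G c (x s) (a' + \<Gamma> x' (a s)) (b s) + G c (x s) (a s) (b' + \<Gamma> x' (b s))) (at s)" .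
  have "continuous (at s) x" using dx by (rule has_vector_derivative_continuous)
  then have "\<forall>\<^sub>F r in nhds s. x r \<in> snd c ` fst c"
    by (rule eventually_nhds_continuous) (use open_chart_image[OF diff_A c] x in auto)
  then have "\<forall>\<^sub>F r in nhds s. G c (x r) (a r) (b r) = (\<Sum>i\<in>Basis. \<Sum>j\<in>Basis. (a r \<bullet> i) * (b r \<bullet> j) * G c (x r) i j)"
    by eventually_elim (rule G_expand[OF c])
  from DERIV_cong_ev[OF refl this refl] D show ?thesis by blast
qed

section \<open>Constant geodesics\<close>

lemma smooth_on_vector_derivative:
  assumes "smooth_on X (f :: real \<Rightarrow> 'b::real_normed_vector)" "r \<in> X"
  shows "(f has_vector_derivative fderiv f r 1) (at r)"
proof -
  note D = smooth_on_has_derivative[OF assms]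
  have "(\<lambda>t. t *\<^sub>R fderiv f r 1) = fderiv f r"
  proof (rule ext)
    fix t show "t *\<^sub>R fderiv f r 1 = fderiv f r t"
      using linear_scale[OF has_derivative_linear[OF D], of t 1] by (simp only: real_scaleR_def mult_1_right)
  qed
  with D show ?thesis unfolding has_vector_derivative_def by (simp only:)
qed

lemma mfderiv_euclid: "mfderiv euclid_atlas euclid_atlas f x v = fderiv f x v"
  by (simp add: mfderiv_def chart_at_euclid chart_inv_euclid' comp_def)

lemma tan_coord_mfderiv_param:
  assumes f: "smooth_param A W f" and "y \<in> W" "c \<in> A" "f y \<in> fst c"
  shows "tan_coord A c (f y) (mfderiv euclid_atlas A f y v) = fderiv (snd c \<circ> f) y v"
proof -
  have "f y \<in> points A" using f assms(2) by (auto simp: smooth_param_def)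
  note ca = chart_at_mem[OF this]
  show ?thesis
    unfolding mfderiv_param tan_coord_def
    using smooth_param_change_chart[OF diff_A f ca(1) assms(3) assms(2) ca(2) assms(4)] by simp
qed

lemma geodesic_equation:
  assumes geo: "geodesic A g I \<gamma>" and s: "s \<in> I"
  defines "c \<equiv> chart_at A (\<gamma> s)"
  defines "y \<equiv> snd c \<circ> \<gamma>"
  shows "fderiv (\<lambda>r. fderiv y r 1) s 1 +
    christoffel A g c (y s) (fderiv y s 1) (fderiv y s 1) = 0"
proof -
  have \<gamma>: "smooth_param A I \<gamma>" using geo by (simp add: geodesic_def smooth_map_on_euclid)
  have p: "\<gamma> s \<in> points A" using \<gamma> s by (auto simp: smooth_param_def)
  have c: "c \<in> A" "\<gamma> s \<in> fst c" using chart_at_mem[OF p] by (simp_all add: c_def)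
  have o: "open (I \<inter> \<gamma> -` fst c)" using \<gamma> c by (auto simp: smooth_param_def)
  have v: "velocity A \<gamma> r = mfderiv euclid_atlas A \<gamma> r 1" for r by (simp add: velocity_def)
  have "fderiv (\<lambda>q. tan_coord A c (\<gamma> q) (velocity A \<gamma> q)) s =
      fderiv (\<lambda>r. fderiv y r 1) s"
    by (rule frechet_derivative_transform(1)[OF o])
      (use s c in \<open>auto simp: v y_def intro: tan_coord_mfderiv_param[OF \<gamma>]\<close>)
  moreover have "velocity A \<gamma> s = fderiv y s 1"
    by (simp add: v mfderiv_param c_def[symmetric] y_def)
  moreover have "cov_along euclid_atlas A g \<gamma> (velocity A \<gamma>) s 1 = 0"
    using geo s by (simp add: geodesic_def)
  ultimately show ?thesis
    by (simp add: cov_along_def c_def[symmetric] mfderiv_euclid v[symmetric] y_def)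
qed

text \<open>The geodesic equation is only given in the preferred chart of each point of the curve; its
  Euler--Lagrange form holds in every chart.\<close>
lemma euler_lagrange:
  assumes geo: "geodesic A g I \<gamma>" and s: "s \<in> I" and d: "d \<in> A" "\<gamma> s \<in> fst d"
  defines "x \<equiv> snd d \<circ> \<gamma>"
  defines "v \<equiv> \<lambda>r. fderiv x r 1"
  shows "((\<lambda>r. G d (x r) (v r) e) has_real_derivative DG d (x s) e (v s) (v s) / 2) (at s)"
proof -
  define c where "c = chart_at A (\<gamma> s)"
  define y where "y = snd c \<circ> \<gamma>"
  define \<tau> where "\<tau> = snd c \<circ> chart_inv d"
  define X where "X = snd d ` (fst d \<inter> fst c)"
  define E where "E z w = fderiv \<tau> z w" for z w
  define y' where "y' r = fderiv y r 1" for r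
  have \<gamma>: "smooth_param A I \<gamma>" using geo by (simp add: geodesic_def smooth_map_on_euclid)
  have p: "\<gamma> s \<in> points A" using \<gamma> s by (auto simp: smooth_param_def)
  have c: "c \<in> A" "\<gamma> s \<in> fst c" using chart_at_mem[OF p] by (simp_all add: c_def)
  have X: "open X" "x s \<in> X" using open_overlap[OF diff_A d(1) c(1)] c d by (auto simp: X_def x_def)
  have \<tau>: "smooth_on X \<tau>" using SA c d by (auto simp: smooth_atlas_def X_def \<tau>_def)
  have smx: "smooth_on (I \<inter> \<gamma> -` fst d) x" and smy: "smooth_on (I \<inter> \<gamma> -` fst c) y"
    using \<gamma> c d by (auto simp: smooth_param_def x_def y_def)
  define J where "J = I \<inter> \<gamma> -` fst d \<inter> (I \<inter> \<gamma> -` fst c)"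
  have J: "open J" "s \<in> J" using \<gamma> c d s by (auto simp: J_def smooth_param_def)
  have \<tau>x: "\<tau> (x s) = y s" using d c by (simp add: \<tau>_def x_def y_def chart_inv_apply[OF diff_A])
  have ys: "y s \<in> snd c ` fst c" using c by (auto simp: y_def)
  let ?\<Gamma> = "christoffel A g c (y s)"
  have dx: "(x has_vector_derivative v s) (at s)" unfolding v_def
    by (rule smooth_on_vector_derivative[OF smx]) (use s d in auto)
  have dy: "(y has_vector_derivative y' s) (at s)" unfolding y'_def
    by (rule smooth_on_vector_derivative[OF smy]) (use s c in auto)
  have yv: "y' r = E (x r) (v r)" if "r \<in> J" for r
    unfolding y'_def y_def v_def x_def E_def \<tau>_def
    using smooth_param_change_chart[OF diff_A \<gamma> d(1) c(1), of r] that by (simp add: J_def)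
  \<comment> \<open>Second derivative of the transition map in the directions \<open>e\<close> and
    \<open>v s\<close>. Its symmetry makes the same vector appear in \<open>lhs\<close> and
    \<open>rhs\<close>.\<close>
  define E' where "E' = fderiv (\<lambda>z. E z e) (x s) (v s)"
  have E'_sym: "E' = fderiv (\<lambda>z. E z (v s)) (x s) e"
    unfolding E'_def E_def by (rule symmetric_second_derivative[OF X \<tau>])
  have dE: "((\<lambda>z. E z w) has_derivative fderiv (\<lambda>z. E z w) (x s)) (at (x s))" for w
    unfolding E_def by (rule smooth_on_has_derivative[OF smooth_on_frechet[OF \<tau>] X(2)])
  have vcomp: "((\<lambda>r. f (z r)) has_vector_derivative fderiv f (z s) z') (at s)"
    if "(z has_vector_derivative z') (at s)" "(f has_derivative fderiv f (z s)) (at (z s))"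
    for f :: "'e \<Rightarrow> 'e" and z :: "real \<Rightarrow> 'e" and z' s
  proof -
    have "((\<lambda>r. f (z r)) has_derivative (\<lambda>t. fderiv f (z s) (t *\<^sub>R z'))) (at s)"
      by (rule has_derivative_compose[of z "\<lambda>t. t *\<^sub>R z'" s UNIV, OF that(1)[unfolded has_vector_derivative_def] that(2)])
    then show ?thesis
      using linear_scale[OF has_derivative_linear[OF that(2)]] by (simp add: has_vector_derivative_def)
  qed
  have Gd: "G d z u w = G c (\<tau> z) (E z u) (E z w)" if "z \<in> X" for z u w
  proof -
    obtain q where q: "q \<in> fst d" "q \<in> fst c" "z = snd d q" using \<open>z \<in> X\<close> by (auto simp: X_def)
    show ?thesis
      using metric_coord_change[OF diff_A d(1) c(1) q(1,2), of g u w] q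
      by (simp add: \<tau>_def E_def chart_inv_apply[OF diff_A d(1)])
  qed
  \<comment> \<open>In the preferred chart the velocity is paired with the moving image
    \<open>E (x r) e\<close> of the constant vector \<open>e\<close>. The covariant derivative of
    the velocity vanishes at \<open>s\<close>, so only one term of the product rule
    survives.\<close>
  have lhs: "((\<lambda>r. G d (x r) (v r) e) has_real_derivative G c (y s) (y' s) (E' + ?\<Gamma> (y' s) (E (x s) e))) (at s)"
  proof -
    have d2: "(y' has_vector_derivative fderiv y' s 1) (at s)"
      unfolding y'_def by (rule smooth_on_vector_derivative[OF smooth_on_frechet[OF smy]]) (use s c in auto)
    have dEx: "((\<lambda>r. E (x r) e) has_vector_derivative E') (at s)"
      unfolding E'_def by (rule vcomp[OF dx dE])
    have "((\<lambda>r. G c (y r) (y' r) (E (x r) e)) has_real_derivative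
        G c (y s) (fderiv y' s 1 + ?\<Gamma> (y' s) (y' s)) (E (x s) e) +
        G c (y s) (y' s) (E' + ?\<Gamma> (y' s) (E (x s) e))) (at s)"
      by (rule metric_curve_derivative[OF c(1) ys dy d2 dEx])
    moreover have "fderiv y' s 1 + ?\<Gamma> (y' s) (y' s) = 0"
      using geodesic_equation[OF geo s] unfolding y'_def y_def c_def .
    ultimately have D: "((\<lambda>r. G c (y r) (y' r) (E (x r) e)) has_real_derivative
        G c (y s) (y' s) (E' + ?\<Gamma> (y' s) (E (x s) e))) (at s)"
      by (simp add: bilinear_lzero[OF G_bilinear[OF c(1) ys]])
    have eq: "G d (x r) (v r) e = G c (y r) (y' r) (E (x r) e)" if "r \<in> J" for r
    proof -
      have "x r \<in> X" "\<tau> (x r) = y r"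
        using that d by (auto simp: J_def x_def X_def \<tau>_def y_def chart_inv_apply[OF diff_A])
      then show ?thesis using Gd yv[OF that] by metis
    qed
    have "\<forall>\<^sub>F r in nhds s. G d (x r) (v r) e = G c (y r) (y' r) (E (x r) e)"
      using eventually_nhds_in_open[OF J] by eventually_elim (rule eq)
    from DERIV_cong_ev[OF refl this refl] D show ?thesis by blast
  qed
  \<comment> \<open>The same product rule along the straight line through \<open>x s\<close> in the
    direction \<open>e\<close>, with the velocity frozen at \<open>v s\<close>.\<close>
  have rhs: "DG d (x s) e (v s) (v s) = 2 * G c (y s) (y' s) (E' + ?\<Gamma> (y' s) (E (x s) e))"
  proof -
    define z where "z r = x s + r *\<^sub>R e" for r :: real
    have dz: "(z has_vector_derivative e) (at 0)" by (auto simp: z_def[abs_def] intro!: derivative_eq_intros)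
    have z0: "z 0 = x s" by (simp add: z_def)
    have d\<tau>: "((\<lambda>r. \<tau> (z r)) has_vector_derivative E (x s) e) (at 0)"
      using vcomp[OF dz, of \<tau>] smooth_on_has_derivative[OF \<tau> X(2)] by (simp add: z0 E_def)
    have dEz: "((\<lambda>r. E (z r) (v s)) has_vector_derivative E') (at 0)"
      unfolding E'_sym using vcomp[OF dz, of "\<lambda>z. E z (v s)"] dE by (simp add: z0)
    have "((\<lambda>r. G c (\<tau> (z r)) (E (z r) (v s)) (E (z r) (v s))) has_real_derivative
        G c (y s) (E' + ?\<Gamma> (E (x s) e) (y' s)) (y' s) + G c (y s) (y' s) (E' + ?\<Gamma> (E (x s) e) (y' s))) (at 0)"
      using metric_curve_derivative[OF c(1) _ d\<tau> dEz dEz] ys by (simp add: z0 \<tau>x yv[OF J(2)])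
    moreover have ev: "\<forall>\<^sub>F r in nhds 0. G d (z r) (v s) (v s) = G c (\<tau> (z r)) (E (z r) (v s)) (E (z r) (v s))"
    proof -
      have "continuous (at 0) z" using dz by (rule has_vector_derivative_continuous)
      then have "\<forall>\<^sub>F r in nhds 0. z r \<in> X"
        by (rule eventually_nhds_continuous) (use X z0 in auto)
      then show ?thesis by eventually_elim (rule Gd)
    qed
    ultimately have 1: "((\<lambda>r. G d (z r) (v s) (v s)) has_real_derivative
        G c (y s) (E' + ?\<Gamma> (E (x s) e) (y' s)) (y' s) + G c (y s) (y' s) (E' + ?\<Gamma> (E (x s) e) (y' s))) (at 0)"
      using DERIV_cong_ev[OF refl ev refl] by blast
    have xs: "x s \<in> snd d ` fst d" using d by (auto simp: x_def)
    have "((\<lambda>r. G d (z r) (v s) (v s)) has_derivative (\<lambda>t. DG d (x s) (t *\<^sub>R e) (v s) (v s))) (at 0)"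
      by (rule has_derivative_compose[of z "\<lambda>t. t *\<^sub>R e" 0 UNIV, OF dz[unfolded has_vector_derivative_def]])
        (simp add: z0 smooth_on_has_derivative[OF G_smooth[OF d(1)] xs])
    then have "((\<lambda>r. G d (z r) (v s) (v s)) has_real_derivative DG d (x s) e (v s) (v s)) (at 0)"
      using linear_scale[OF DG_linear[OF d(1) xs]] by (simp add: has_field_derivative_def mult_commute_abs)
    from DERIV_unique[OF this 1] show ?thesis
      using G_sym[OF c(1) ys] christoffel_spec(2)[OF c(1) ys] by simp
  qed
  show ?thesis using lhs by (simp add: rhs)
qed

end

text \<open>The squared norm of \<open>w\<close> times \<open>exp (- 2 * K * r)\<close> is
  nonincreasing to the right of \<open>s\<close>, and times \<open>exp (2 * K * r)\<close> it is
  nondecreasing to the left. As it vanishes at \<open>s\<close>, it cannot be positive on either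
  side.\<close>

lemma gronwall_zero:
  fixes w :: "real \<Rightarrow> 'b::real_inner"
  assumes der: "\<And>r. r \<in> ball s d \<Longrightarrow> (w has_vector_derivative w' r) (at r)"
    and bound: "\<And>r. r \<in> ball s d \<Longrightarrow> norm (w' r) \<le> K * norm (w r)" and "w s = 0" and r: "r \<in> ball s d"
  shows "w r = 0"
proof -
  have dw: "((\<lambda>r. (w r \<bullet> w r) * exp (k * r)) has_real_derivative
      (2 * (w r \<bullet> w' r) + k * (w r \<bullet> w r)) * exp (k * r)) (at r)" if "r \<in> ball s d" for r k
    using der[OF that] unfolding has_vector_derivative_def has_field_derivative_def
    by (auto intro!: derivative_eq_intros simp: fun_eq_iff algebra_simps inner_commute)
  have est: "\<bar>2 * (w r \<bullet> w' r)\<bar> \<le> 2 * K * (w r \<bullet> w r)" if "r \<in> ball s d" for r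
  proof -
    have "\<bar>w r \<bullet> w' r\<bar> \<le> norm (w r) * norm (w' r)" by (rule Cauchy_Schwarz_ineq2)
    also have "\<dots> \<le> norm (w r) * (K * norm (w r))" using bound[OF that] by (intro mult_left_mono) auto
    finally show ?thesis by (simp add: power2_norm_eq_inner[symmetric] power2_eq_square algebra_simps)
  qed
  have "(w r \<bullet> w r) * exp ((if s \<le> r then - 2 * K else 2 * K) * r) \<le> 0"
  proof (cases "s \<le> r")
    case True
    have "(w r \<bullet> w r) * exp (- 2 * K * r) \<le> (w s \<bullet> w s) * exp (- 2 * K * s)"
    proof (rule DERIV_nonpos_imp_nonincreasing[OF True, where f = "\<lambda>r. (w r \<bullet> w r) * exp (- 2 * K * r)"])
      fix q assume "s \<le> q" "q \<le> r"
      then have q: "q \<in> ball s d" using r by (auto simp: dist_real_def)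
      then show "\<exists>y. ((\<lambda>r. (w r \<bullet> w r) * exp (- 2 * K * r)) has_real_derivative y) (at q) \<and> y \<le> 0"
        using dw[OF q, of "- 2 * K"] est[OF q] by (auto intro!: exI mult_nonpos_nonneg)
    qed
    then show ?thesis using True \<open>w s = 0\<close> by simp
  next
    case False
    have "(w r \<bullet> w r) * exp (2 * K * r) \<le> (w s \<bullet> w s) * exp (2 * K * s)"
    proof (rule DERIV_nonneg_imp_nondecreasing[where f = "\<lambda>r. (w r \<bullet> w r) * exp (2 * K * r)"])
      fix q assume "r \<le> q" "q \<le> s"
      then have q: "q \<in> ball s d" using r by (auto simp: dist_real_def)
      then show "\<exists>y. ((\<lambda>r. (w r \<bullet> w r) * exp (2 * K * r)) has_real_derivative y) (at q) \<and> 0 \<le> y"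
        using dw[OF q, of "2 * K"] est[OF q] by (auto intro!: exI mult_nonneg_nonneg)
    qed (use False in simp)
    then show ?thesis using False \<open>w s = 0\<close> by simp
  qed
  then have "w r \<bullet> w r \<le> 0" by (simp add: mult_le_0_iff)
  then show ?thesis by (metis inner_gt_zero_iff not_le)
qed

text \<open>By homogeneity it is enough to look at unit vectors, and the product of \<open>B\<close>
  with the unit sphere is compact.\<close>

lemma homogeneous_bound:
  fixes f :: "'a::euclidean_space \<Rightarrow> 'b::euclidean_space \<Rightarrow> 'c::real_normed_vector"
  assumes "compact B" and cont: "continuous_on (B \<times> UNIV) (\<lambda>(z, u). f z u)"
    and hom: "\<And>z u t. z \<in> B \<Longrightarrow> f z (t *\<^sub>R u) = t ^ k *\<^sub>R f z u"
  shows "\<exists>K>0. \<forall>z\<in>B. \<forall>u. norm (f z u) \<le> K * norm u ^ k"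
    and "(\<And>z u. z \<in> B \<Longrightarrow> u \<noteq> 0 \<Longrightarrow> f z u \<noteq> 0) \<Longrightarrow> \<exists>m>0. \<forall>z\<in>B. \<forall>u. u \<noteq> 0 \<longrightarrow> m * norm u ^ k \<le> norm (f z u)"
proof -
  let ?S = "B \<times> (sphere 0 1 :: 'b set)"
  have S: "compact ?S" by (rule compact_Times[OF \<open>compact B\<close> compact_sphere])
  have cn: "continuous_on ?S (\<lambda>(z, u). norm (f z u))"
    using continuous_on_norm[OF continuous_on_subset[OF cont, of ?S]] by (simp add: case_prod_unfold Sigma_mono)
  have scale: "norm (f z u) = norm u ^ k * norm (f z (u /\<^sub>R norm u))" "u /\<^sub>R norm u \<in> sphere 0 1"
    if "z \<in> B" "u \<noteq> 0" for z u
    using hom[OF that(1), of "norm u" "u /\<^sub>R norm u"] that by simp_all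
  have "bounded ((\<lambda>(z, u). norm (f z u)) ` ?S)"
    by (rule compact_imp_bounded[OF compact_continuous_image[OF cn S]])
  then obtain K where K: "K > 0" "\<And>z u. z \<in> B \<Longrightarrow> u \<in> sphere 0 1 \<Longrightarrow> norm (f z u) \<le> K"
    unfolding bounded_pos by fastforce
  have "norm (f z u) \<le> K * norm u ^ k" if "z \<in> B" "u \<noteq> 0" for z u
    unfolding scale(1)[OF that] using mult_left_mono[OF K(2)[OF that(1) scale(2)[OF that]], of "norm u ^ k"]
    by (simp add: mult.commute)
  show "\<exists>m>0. \<forall>z\<in>B. \<forall>u. u \<noteq> 0 \<longrightarrow> m * norm u ^ k \<le> norm (f z u)"
    if ne: "\<And>z u. z \<in> B \<Longrightarrow> u \<noteq> 0 \<Longrightarrow> f z u \<noteq> 0"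
  proof (cases "?S = {}")
    case True
    then have "z \<in> B \<Longrightarrow> u = 0" for z :: 'a and u :: 'b using scale(2)[of z u] by auto
    then show ?thesis by (intro exI[of _ 1]) auto
  next
    case False
    from continuous_attains_inf[OF S this cn] obtain z0 u0 where
      m: "z0 \<in> B" "u0 \<in> sphere 0 1" "\<And>z u. z \<in> B \<Longrightarrow> u \<in> sphere 0 1 \<Longrightarrow> norm (f z0 u0) \<le> norm (f z u)"
      by fastforce
    have "u0 \<noteq> 0" using m(2) by auto
    then have "norm (f z0 u0) > 0" using ne[OF m(1)] by simp
    moreover have "norm (f z0 u0) * norm u ^ k \<le> norm (f z u)" if "z \<in> B" "u \<noteq> 0" for z u
      unfolding scale(1)[OF that] using mult_left_mono[OF m(3)[OF that(1) scale(2)[OF that]], of "norm u ^ k"]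
      by (simp add: mult.commute)
    ultimately show ?thesis by blast
  qed
  \<comment> \<open>At the zero vector homogeneity is used with factor 0. For \<open>k = 0\<close>
    this makes \<open>f z\<close> constant, because \<open>0 ^ 0 = 1\<close>, so that case falls
    back on a unit vector.\<close>
  have "norm (f z 0) \<le> K * norm (0 :: 'b) ^ k" if "z \<in> B" for z
  proof (cases "\<exists>u :: 'b. u \<in> sphere 0 1 \<and> k = 0")
    case True
    then obtain u :: 'b where "u \<in> sphere 0 1" "k = 0" by auto
    then show ?thesis using hom[OF that, of 0 u] K(2)[OF that, of u] by simp
  next
    case False
    have "k \<noteq> 0"
      using False nonempty_Basis by (metis dist_0_norm mem_sphere norm_Basis some_in_eq)
    then show ?thesis using hom[OF that, of 0 0] by (simp add: power_0_left)
  qed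
  then show "\<exists>K>0. \<forall>z\<in>B. \<forall>u. norm (f z u) \<le> K * norm u ^ k"
    using K(1) \<open>\<And>z u. z \<in> B \<Longrightarrow> u \<noteq> 0 \<Longrightarrow> norm (f z u) \<le> K * norm u ^ k\<close> by metis
qed

context lorentz_manifold
begin

text \<open>By \<open>euler_lagrange\<close> the momentum, the metric dual of the velocity, has a
  derivative that is quadratic in the velocity. Nondegeneracy bounds the velocity by the momentum,
  so the momentum satisfies a linear differential inequality and \<open>gronwall_zero\<close>
  applies; the equation is never solved for the acceleration.\<close>

lemma geodesic_locally_constant:
  assumes geo: "geodesic A g I \<gamma>" and s: "s \<in> I" and d: "d \<in> A" "\<gamma> s \<in> fst d"
    and v0: "fderiv (snd d \<circ> \<gamma>) s 1 = 0"
  obtains \<delta> where "\<delta> > 0" "ball s \<delta> \<subseteq> I"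
    "\<And>r. r \<in> ball s \<delta> \<Longrightarrow> \<gamma> r = \<gamma> s \<and> fderiv (snd d \<circ> \<gamma>) r 1 = 0"
proof -
  define x where "x = snd d \<circ> \<gamma>"
  define v where "v r = fderiv x r 1" for r
  define O' where "O' = I \<inter> \<gamma> -` fst d"
  have \<gamma>: "smooth_param A I \<gamma>" using geo by (simp add: geodesic_def smooth_map_on_euclid)
  have O': "open O'" "s \<in> O'" and smx: "smooth_on O' x"
    using \<gamma> d s by (auto simp: smooth_param_def O'_def x_def)
  have xs: "x s \<in> snd d ` fst d" using d by (auto simp: x_def)
  have smv: "smooth_on O' v" unfolding v_def by (rule smooth_on_frechet[OF smx])
  obtain \<rho> where \<rho>: "\<rho> > 0" "cball (x s) \<rho> \<subseteq> snd d ` fst d"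
    using open_contains_cball[of "snd d ` fst d"] open_chart_image[OF diff_A d(1)] xs by blast
  define B where "B = cball (x s) \<rho>"
  have Bimg: "z \<in> B \<Longrightarrow> z \<in> snd d ` fst d" for z using \<rho> by (auto simp: B_def)
  have B: "compact B" by (simp add: B_def)
  \<comment> \<open>\<open>P\<close> is the momentum and \<open>Q\<close> the force of the
    Euler--Lagrange equation, turned from covectors into vectors by the standard basis.\<close>
  define P where "P z u = (\<Sum>b\<in>Basis. G d z u b *\<^sub>R b)" for z u
  define Q where "Q z u = (\<Sum>b\<in>Basis. (DG d z b u u / 2) *\<^sub>R b)" for z u
  have contG: "continuous_on (B \<times> UNIV) (\<lambda>y. G d (fst y) i j)" for i j
  proof (rule continuous_on_compose2[OF smooth_on_continuous[OF G_smooth[OF d(1)]]])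
    show "fst ` (B \<times> UNIV) \<subseteq> snd d ` fst d" using Bimg by auto
  qed (auto intro!: continuous_intros)
  have contDG: "continuous_on (B \<times> UNIV) (\<lambda>y. DG d (fst y) w i j)" for w i j
  proof (rule continuous_on_compose2[OF smooth_on_continuous[OF smooth_on_frechet[OF G_smooth[OF d(1)]]]])
    show "fst ` (B \<times> UNIV) \<subseteq> snd d ` fst d" using Bimg by auto
  qed (auto intro!: continuous_intros)
  have contP: "continuous_on (B \<times> UNIV) (\<lambda>(z, u). P z u)"
  proof -
    have "continuous_on (B \<times> UNIV) (\<lambda>y. \<Sum>b\<in>Basis. (\<Sum>i\<in>Basis. \<Sum>j\<in>Basis. (snd y \<bullet> i) * (b \<bullet> j) * G d (fst y) i j) *\<^sub>R b)"
      by (intro continuous_intros contG)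
    then show ?thesis
      by (rule continuous_on_eq) (use Bimg in \<open>auto simp: P_def intro!: sum.cong arg_cong2[where f = scaleR] G_expand[OF d(1), symmetric]\<close>)
  qed
  have contQ: "continuous_on (B \<times> UNIV) (\<lambda>(z, u). Q z u)"
  proof -
    have "continuous_on (B \<times> UNIV) (\<lambda>y. \<Sum>b\<in>Basis. ((\<Sum>i\<in>Basis. \<Sum>j\<in>Basis. (snd y \<bullet> i) * (snd y \<bullet> j) * DG d (fst y) b i j) / 2) *\<^sub>R b)"
      by (intro continuous_intros contDG) auto
    then show ?thesis
      by (rule continuous_on_eq)
        (use Bimg in \<open>auto simp: Q_def intro!: sum.cong arg_cong2[where f = scaleR] arg_cong2[where f = "(/)"] DG_expand[OF d(1), symmetric]\<close>)
  qed
  have "\<exists>K>0. \<forall>z\<in>B. \<forall>u. norm (Q z u) \<le> K * norm u ^ 2"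
  proof (rule homogeneous_bound(1)[OF B contQ])
    fix z u and t :: real assume "z \<in> B"
    note b = DG_bilinear[OF d(1) Bimg[OF this]]
    show "Q z (t *\<^sub>R u) = t\<^sup>2 *\<^sub>R Q z u"
      by (simp add: Q_def bilinear_lmul[OF b] bilinear_rmul[OF b] scaleR_sum_right power2_eq_square mult.assoc)
  qed
  then obtain K where K: "K > 0" "\<And>z u. z \<in> B \<Longrightarrow> norm (Q z u) \<le> K * (norm u)\<^sup>2" by blast
  have "\<exists>m>0. \<forall>z\<in>B. \<forall>u. u \<noteq> 0 \<longrightarrow> m * norm u ^ 1 \<le> norm (P z u)"
  proof (rule homogeneous_bound(2)[OF B contP])
    fix z u and t :: real assume z: "z \<in> B"
    note b = G_bilinear[OF d(1) Bimg[OF z]]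
    show "P z (t *\<^sub>R u) = t ^ 1 *\<^sub>R P z u"
      by (simp add: P_def bilinear_lmul[OF b] scaleR_sum_right)
    show "P z u \<noteq> 0" if "u \<noteq> 0"
    proof
      assume "P z u = 0"
      then have "G d z u i = 0" if "i \<in> Basis" for i
        using that inner_sum_left_Basis[of i "G d z u"] by (simp add: P_def)
      then have "G d z u v = 0" for v
        using G_expand[OF d(1) Bimg[OF z], of u v] linear_expand[of "G d z u" v] b by (simp add: bilinear_def)
      then show False using G_nondegenerate[OF d(1) Bimg[OF z]] \<open>u \<noteq> 0\<close> by blast
    qed
  qed
  then obtain m where m: "m > 0" "\<And>z u. z \<in> B \<Longrightarrow> u \<noteq> 0 \<Longrightarrow> m * norm u \<le> norm (P z u)" by auto
  have "continuous (at s) x" "continuous (at s) v"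
    using smooth_on_continuous[OF smx] smooth_on_continuous[OF smv] O' by (auto simp: continuous_on_eq_continuous_at)
  then have "\<forall>\<^sub>F r in nhds s. x r \<in> ball (x s) \<rho>" "\<forall>\<^sub>F r in nhds s. v r \<in> ball 0 1"
  proof -
    have "v s = 0" using v0 by (simp add: v_def x_def)
    assume c: "continuous (at s) x" "continuous (at s) v"
    show "\<forall>\<^sub>F r in nhds s. x r \<in> ball (x s) \<rho>"
      by (rule eventually_nhds_continuous[OF c(1)]) (use \<rho>(1) in auto)
    show "\<forall>\<^sub>F r in nhds s. v r \<in> ball 0 1"
      by (rule eventually_nhds_continuous[OF c(2)]) (use \<open>v s = 0\<close> in auto)
  qed
  moreover have "\<forall>\<^sub>F r in nhds s. r \<in> O'" by (rule eventually_nhds_in_open[OF O'])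
  ultimately have "\<forall>\<^sub>F r in nhds s. x r \<in> ball (x s) \<rho> \<and> v r \<in> ball 0 1 \<and> r \<in> O'"
    by eventually_elim simp
  then obtain \<delta> where \<delta>: "\<delta> > 0" "\<And>r. r \<in> ball s \<delta> \<Longrightarrow> x r \<in> B \<and> norm (v r) \<le> 1 \<and> r \<in> O'"
    unfolding eventually_nhds_metric B_def by (force simp: dist_commute)
  define w where "w r = P (x r) (v r)" for r
  have v_zero: "v r = 0" if r: "r \<in> ball s \<delta>" for r
  proof -
    have "w r = 0"
    proof (rule gronwall_zero[of s \<delta> w "\<lambda>r. Q (x r) (v r)" "K / m", OF _ _ _ r])
      fix r assume r: "r \<in> ball s \<delta>"
      note \<delta>r = \<delta>(2)[OF r]
      have "((\<lambda>r. G d (x r) (v r) b) has_real_derivative DG d (x r) b (v r) (v r) / 2) (at r)" for b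
        unfolding x_def v_def by (rule euler_lagrange[OF geo]) (use \<delta>r d in \<open>auto simp: O'_def\<close>)
      then show "(w has_vector_derivative Q (x r) (v r)) (at r)"
        unfolding w_def P_def Q_def has_real_derivative_iff_has_vector_derivative
        by (intro has_vector_derivative_sum bounded_linear.has_vector_derivative[OF bounded_linear_scaleR_left])
      have "norm (Q (x r) (v r)) \<le> K * (norm (v r))\<^sup>2" using K(2) \<delta>r by blast
      \<comment> \<open>Close to \<open>s\<close> the velocity has norm at most 1, which turns the
        quadratic bound into a linear one.\<close>
      also have "\<dots> \<le> K * norm (v r)"
        using K(1) \<delta>r by (simp add: power2_eq_square mult_left_le)
      also have "\<dots> \<le> K / m * norm (w r)"
      proof (cases "v r = 0")
        case False
        then have "m * norm (v r) \<le> norm (w r)" using m(2) \<delta>r by (simp add: w_def)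
        then have "norm (v r) \<le> norm (w r) / m" using m(1) by (simp add: field_simps)
        then show ?thesis using mult_left_mono[of "norm (v r)" "norm (w r) / m" K] K(1) by simp
      qed (use K(1) m(1) in simp)
      finally show "norm (Q (x r) (v r)) \<le> K / m * norm (w r)" .
    next
      have "s \<in> ball s \<delta>" using \<delta>(1) by simp
      then have "x s \<in> B" using \<delta>(2) by blast
      then show "w s = 0" using v0
        by (simp add: w_def P_def v_def x_def[symmetric] bilinear_lzero[OF G_bilinear[OF d(1) Bimg]])
    qed
    then show "v r = 0" using m \<delta>(2)[OF r] unfolding w_def
      by (metis mult_pos_pos norm_zero not_le zero_less_norm_iff)
  qed
  have "x r = x s" if r: "r \<in> ball s \<delta>" for r
  proof (rule has_derivative_zero_unique[of "ball s \<delta>" x])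
    fix q assume "q \<in> ball s \<delta>"
    then have "(x has_vector_derivative 0) (at q)"
      using smooth_on_vector_derivative[OF smx, of q] \<delta>(2)[of q] v_zero[of q] by (simp add: v_def)
    then show "(x has_derivative (\<lambda>h. 0)) (at q within ball s \<delta>)"
      by (simp add: has_vector_derivative_def has_derivative_at_withinI)
  qed (use r \<delta> in auto)
  note xeq = this
  have eq: "\<gamma> r = \<gamma> s" if r: "r \<in> ball s \<delta>" for r
  proof (rule inj_onD[OF chart_inj[OF diff_A d(1)]])
    show "snd d (\<gamma> r) = snd d (\<gamma> s)" using xeq[OF r] by (simp add: x_def)
    show "\<gamma> r \<in> fst d" using \<delta>(2)[OF r] by (simp add: O'_def)
  qed (rule d(2))
  show ?thesis
  proof (rule that[OF \<delta>(1)])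
    show "ball s \<delta> \<subseteq> I" using \<delta>(2) by (auto simp: O'_def)
    fix r assume r: "r \<in> ball s \<delta>"
    show "\<gamma> r = \<gamma> s \<and> fderiv (snd d \<circ> \<gamma>) r 1 = 0"
      using eq[OF r] v_zero[OF r] by (simp add: v_def x_def)
  qed
qed

text \<open>The parameters at which the curve sits at \<open>p\<close> with zero velocity form an
  open subset of the unit interval by \<open>geodesic_locally_constant\<close>. It is also closed,
  as points of a Hausdorff space are closed and velocities are continuous; by connectedness it is
  everything.\<close>

lemma constant_geodesic:
  assumes H: "Hausdorff_space (manifold_top A)" and "exp_rel A g (p, 0) q"
  shows "q = p"
proof -
  obtain I \<gamma> where geo: "geodesic A g I \<gamma>" and I: "{0..1} \<subseteq> I" and \<gamma>0: "\<gamma> 0 = p" "velocity A \<gamma> 0 = 0" "\<gamma> 1 = q"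
    using assms(2) by (auto simp: exp_rel_def)
  have \<gamma>: "smooth_param A I \<gamma>" using geo by (simp add: geodesic_def smooth_map_on_euclid)
  have oI: "open I" using geo by (simp add: geodesic_def)
  have "p \<in> points A" using \<gamma> I \<gamma>0(1) by (force simp: smooth_param_def)
  define d where "d = chart_at A p"
  have d: "d \<in> A" "p \<in> fst d" using chart_at_mem[OF \<open>p \<in> points A\<close>] by (simp_all add: d_def)
  define v where "v r = fderiv (snd d \<circ> \<gamma>) r 1" for r
  \<comment> \<open>One chart \<open>d\<close> around \<open>p\<close> suffices: a parameter
    violates the condition either because the curve is off \<open>p\<close>, or because it lies in
    the domain of \<open>d\<close> with nonzero velocity there. Both are open conditions.\<close>
  define Z where "Z = {s \<in> {0..1}. \<gamma> s = p \<and> v s = 0}"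
  have "closedin (manifold_top A) {p}"
    using Hausdorff_imp_t1_space[OF H] \<open>p \<in> points A\<close>
    unfolding t1_space_closedin_singleton topspace_manifold_top[OF diff_A] by blast
  then have oc: "openin (manifold_top A) (points A - {p})"
    by (simp add: closedin_def topspace_manifold_top[OF diff_A])
  have oO: "open (I \<inter> \<gamma> -` fst d)" and smx: "smooth_on (I \<inter> \<gamma> -` fst d) (snd d \<circ> \<gamma>)"
    using \<gamma> d by (auto simp: smooth_param_def)
  have contv: "continuous_on (I \<inter> \<gamma> -` fst d) v"
    unfolding v_def by (rule smooth_on_continuous[OF smooth_on_frechet[OF smx]])
  have "0 \<in> Z" using \<gamma>0 by (simp add: Z_def v_def velocity_def mfderiv_param d_def)
  have "openin (top_of_set {0..1}) Z"
  proof (subst openin_subopen, rule ballI)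
    fix s assume s: "s \<in> Z"
    then have s': "s \<in> I" "\<gamma> s \<in> fst d" "fderiv (snd d \<circ> \<gamma>) s 1 = 0"
      using I d by (auto simp: Z_def v_def)
    obtain \<delta> where \<delta>: "\<delta> > 0" "\<And>r. r \<in> ball s \<delta> \<Longrightarrow> \<gamma> r = \<gamma> s \<and> v r = 0"
      unfolding v_def by (rule geodesic_locally_constant[OF geo s'(1) d(1) s'(2,3)]) blast
    show "\<exists>T. openin (top_of_set {0..1}) T \<and> s \<in> T \<and> T \<subseteq> Z"
    proof (intro exI[of _ "{0..1} \<inter> ball s \<delta>"] conjI)
      show "openin (top_of_set {0..1}) ({0..1} \<inter> ball s \<delta>)" by (rule openin_open_Int) simp
      show "s \<in> {0..1} \<inter> ball s \<delta>" using s \<delta>(1) by (simp add: Z_def)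
      show "{0..1} \<inter> ball s \<delta> \<subseteq> Z"
      proof
        fix r assume "r \<in> {0..1} \<inter> ball s \<delta>"
        then show "r \<in> Z" using \<delta>(2)[of r] s by (simp add: Z_def)
      qed
    qed
  qed
  moreover have "openin (top_of_set {0..1}) ({0..1} - Z)"
  proof -
    have o1: "open (I \<inter> \<gamma> -` (points A - {p}))" by (rule smooth_param_open_vimage[OF diff_A \<gamma> oc])
    have o2: "open ((I \<inter> \<gamma> -` fst d) \<inter> v -` (- {0}))"
      by (rule continuous_open_preimage[OF contv oO]) auto
    have "{0..1} - Z = {0..1} \<inter> ((I \<inter> \<gamma> -` (points A - {p})) \<union> ((I \<inter> \<gamma> -` fst d) \<inter> v -` (- {0})))"
      using I \<gamma> d by (auto simp: Z_def smooth_param_def image_subset_iff)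
    then show ?thesis using o1 o2 by (metis open_Un openin_open_Int)
  qed
  moreover have "Z \<subseteq> {0..1}" by (auto simp: Z_def)
  ultimately have "openin (top_of_set {0..1}) Z \<and> closedin (top_of_set {0..1}) Z"
    by (simp add: closedin_def)
  then have "Z = {} \<or> Z = {0..1}"
    using connected_clopen[of "{0..1 :: real}"] connected_Icc by blast
  then have "1 \<in> Z" using \<open>0 \<in> Z\<close> by auto
  then show ?thesis using \<gamma>0 by (simp add: Z_def)
qed

lemma geod_exp_zero:
  assumes "Hausdorff_space (manifold_top A)" and "(p, 0) \<in> exp_domain A g"
  shows "geod_exp A g (p, 0) = p"
proof -
  obtain q where q: "exp_rel A g (p, 0) q" using assms(2) by (auto simp: exp_domain_def)
  then have "exp_rel A g (p, 0) p" using constant_geodesic[OF assms(1) q] by simp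
  then show ?thesis unfolding geod_exp_def
    by (rule the_equality) (rule constant_geodesic[OF assms(1)])
qed

end

section \<open>The null hypersurface\<close>

lemma continuous_map_local:
  assumes "\<And>x. x \<in> topspace X \<Longrightarrow> \<exists>U. openin X U \<and> x \<in> U \<and> continuous_map (subtopology X U) Y f"
  shows "continuous_map X Y f"
  unfolding continuous_map
proof (intro conjI allI impI)
  have "f x \<in> topspace Y" if "x \<in> topspace X" for x
    using assms[OF that] that by (auto simp: continuous_map)
  then show "f ` topspace X \<subseteq> topspace Y" by blast
  fix O' assume O': "openin Y O'"
  have "\<exists>T. openin X T \<and> x \<in> T \<and> T \<subseteq> {x \<in> topspace X. f x \<in> O'}" if x: "x \<in> topspace X" "f x \<in> O'" for x
  proof -
    obtain U where U: "openin X U" "x \<in> U" "continuous_map (subtopology X U) Y f" using assms[OF x(1)] by blast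
    have "openin (subtopology X U) {x \<in> topspace (subtopology X U). f x \<in> O'}"
      using U(3) O' by (auto simp only: continuous_map)
    then have "openin X {x \<in> topspace (subtopology X U). f x \<in> O'}" using U(1) openin_trans_full by blast
    then show ?thesis using U x by (intro exI[of _ "{x \<in> topspace (subtopology X U). f x \<in> O'}"]) auto
  qed
  then show "openin X {x \<in> topspace X. f x \<in> O'}" by (subst openin_subopen) blast
qed

lemma continuous_map_base_point:
  assumes SA: "smooth_atlas A"
  shows "continuous_map (manifold_top (tangent_atlas A)) (manifold_top A) fst"
proof -
  note diff_A = smooth_atlas_imp_diff_atlas[OF SA]
  note diff_TA = smooth_atlas_imp_diff_atlas[OF smooth_atlas_tangent[OF SA]]
  show ?thesis
    unfolding continuous_map
  proof (intro conjI allI impI)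
    show "fst ` topspace (manifold_top (tangent_atlas A)) \<subseteq> topspace (manifold_top A)"
      by (auto simp: topspace_manifold_top[OF diff_A] topspace_manifold_top[OF diff_TA] points_tangent_atlas)
    fix U assume U: "openin (manifold_top A) U"
    have UA: "U \<subseteq> points A" using openin_subset[OF U] by (simp add: topspace_manifold_top[OF diff_A])
    have "{y \<in> topspace (manifold_top (tangent_atlas A)). fst y \<in> U} = U \<times> UNIV"
      using UA by (auto simp: topspace_manifold_top[OF diff_TA] points_tangent_atlas)
    also have "openin (manifold_top (tangent_atlas A)) (U \<times> UNIV)"
      unfolding openin_atlas[OF diff_TA]
    proof (intro conjI ballI)
      show "U \<times> UNIV \<subseteq> points (tangent_atlas A)" using UA by (auto simp: points_tangent_atlas)
      fix c' assume "c' \<in> tangent_atlas A"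
      then obtain c where c: "c \<in> A" "c' = tangent_chart A c" by (auto simp: tangent_atlas_eq)
      have "snd c' ` (fst c' \<inter> U \<times> UNIV) = snd c ` (fst c \<inter> U) \<times> UNIV"
      proof
        show "snd c ` (fst c \<inter> U) \<times> UNIV \<subseteq> snd c' ` (fst c' \<inter> U \<times> UNIV)"
        proof clarify
          fix p and u assume "p \<in> fst c" "p \<in> U"
          then show "(snd c p, u) \<in> snd c' ` (fst c' \<inter> U \<times> UNIV)"
            by (intro image_eqI[where x = "(p, tan_vec A c p u)"])
              (simp_all add: c(2) tangent_chart_def tan_coord_vec[OF diff_A c(1)])
        qed
      qed (auto simp: c(2) tangent_chart_def)
      then show "open (snd c' ` (fst c' \<inter> U \<times> UNIV))"
        using open_chart_openin[OF diff_A U c(1)] by (simp add: open_Times)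
    qed
    finally show "openin (manifold_top (tangent_atlas A)) {y \<in> topspace (manifold_top (tangent_atlas A)). fst y \<in> U}" .
  qed
qed

locale null_flow = lorentz_manifold A g
  for A :: "('m, 'e::euclidean_space) atlas" and g +
  fixes S :: "'m set" and AS :: "('m, real ^ 'n) atlas" and \<xi> :: "'m \<Rightarrow> 'e" and V :: "('m \<times> 'e) set"
  assumes Hausdorff: "Hausdorff_space (manifold_top A)"
    and embedded: "embedded_submanifold A S AS"
    and compact_S: "compactin (manifold_top A) S"
    and spacelike_S: "spacelike A g AS"
    and lightlike: "lightlike_normal_field A g AS \<xi>"
    and neighborhood: "normal_exp_neighborhood A g AS V"
begin

abbreviation "\<Phi> \<equiv> flow A g \<xi>"
abbreviation "\<O> \<equiv> flow_dom AS \<xi> V"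
abbreviation "\<Sigma> \<equiv> hypersurface A g AS \<xi> V"
abbreviation "NS \<equiv> hyper_atlas A g AS \<xi> V"
abbreviation "TA \<equiv> tangent_atlas A"
abbreviation "E \<equiv> geod_exp A g"

lemma AS_def: "AS = sub_atlas A S" and points_AS: "points AS = S" and S_subset: "S \<subseteq> points A"
  using embedded by (auto simp: embedded_submanifold_def)

lemma diff_AS: "diff_atlas AS" unfolding AS_def by (rule diff_atlas_sub_atlas[OF SA])

lemma top_AS: "manifold_top AS = subtopology (manifold_top A) S"
  unfolding AS_def by (rule manifold_top_sub_atlas[OF SA]) (use points_AS in \<open>simp add: AS_def\<close>)

lemma smooth_TA: "smooth_atlas TA" by (rule smooth_atlas_tangent[OF SA])
lemma diff_TA: "diff_atlas TA" by (rule smooth_atlas_imp_diff_atlas[OF smooth_TA])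

lemma \<xi>_smooth: "smooth_on_set A TA S (\<lambda>p. (p, \<xi> p))"
  and \<xi>_nonzero: "p \<in> S \<Longrightarrow> \<xi> p \<noteq> 0"
  and \<xi>_normal: "p \<in> S \<Longrightarrow> (p, \<xi> p) \<in> normal_bundle A g AS"
  using lightlike by (auto simp: lightlike_normal_field_def points_AS)

lemma scaled_normal: "p \<in> S \<Longrightarrow> (p, r *\<^sub>R \<xi> p) \<in> normal_bundle A g AS"
  using \<xi>_normal[of p] bilinear_lmul[OF g_bilinear[of p], of r "\<xi> p"] S_subset by (auto simp: normal_bundle_def)

section \<open>The flow in the coordinates of a chart of \<open>S\<close>\<close>

definition "coord_flow C = (\<lambda>(x, t). \<Phi> (chart_inv C x, t))"
definition "coord_dom C = {(x, t). x \<in> snd C ` fst C \<and> (chart_inv C x, t) \<in> \<O>}"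
text \<open>The normal vector to which \<open>E\<close> is applied. As \<open>E\<close> is a
  diffeomorphism on \<open>V\<close>, smoothness and the immersion property of the flow are obtained
  from this lift.\<close>

definition "coord_lift C = (\<lambda>(x, t :: real). (chart_inv C x, t *\<^sub>R \<xi> (chart_inv C x)))"

lemma coord_flow_lift: "coord_flow C y = E (coord_lift C y)"
  by (simp add: coord_flow_def coord_lift_def flow_def case_prod_unfold)

lemma flow_domI: "p \<in> S \<Longrightarrow> (p, t) \<in> \<O> \<longleftrightarrow> (p, t *\<^sub>R \<xi> p) \<in> V"
  by (simp add: flow_dom_def points_AS)

lemma flow_dom_S: "(p, t) \<in> \<O> \<Longrightarrow> p \<in> S"
  by (simp add: flow_dom_def points_AS)

context
  fixes C assumes C: "C \<in> AS"
begin

abbreviation "\<iota> \<equiv> chart_inv C"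
abbreviation "\<Omega> \<equiv> snd C ` fst C"

lemma AS_sub_atlas: "C \<in> sub_atlas A S" using C by (simp add: AS_def)

lemma \<Omega>_open: "open \<Omega>" by (rule open_chart_image[OF diff_AS C])

lemma \<Omega>U_open: "open (\<Omega> \<times> (UNIV :: real set))" using \<Omega>_open by (simp add: open_Times)

lemma \<iota>_fst: "x \<in> \<Omega> \<Longrightarrow> \<iota> x \<in> fst C"
  by (rule chart_inv_mem)

lemma \<iota>_S: "x \<in> \<Omega> \<Longrightarrow> \<iota> x \<in> S"
  by (rule subsetD[OF sub_chart_subset(1)[OF SA AS_sub_atlas] \<iota>_fst])

lemma \<iota>_smooth: "smooth_param A \<Omega> \<iota>" by (rule sub_chart_smooth[OF SA AS_sub_atlas])

lemma \<xi>_param: "smooth_param TA \<Omega> (\<lambda>x. (\<iota> x, \<xi> (\<iota> x)))"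
proof (rule smooth_param_local[OF \<Omega>_open])
  fix x assume x: "x \<in> \<Omega>"
  obtain W F where W: "\<iota> x \<in> W" "smooth_map_on A TA W F" "\<forall>q\<in>W \<inter> S. F q = (q, \<xi> q)"
    using \<xi>_smooth \<iota>_S[OF x] unfolding smooth_on_set_def by blast
  have "smooth_param TA (\<Omega> \<inter> \<iota> -` W) (F \<circ> \<iota>)" by (rule smooth_param_comp[OF diff_A diff_TA W(2) \<iota>_smooth])
  then have "smooth_param TA (\<Omega> \<inter> \<iota> -` W) (\<lambda>x. (\<iota> x, \<xi> (\<iota> x)))"
  proof (rule smooth_param_cong)
    fix z assume "z \<in> \<Omega> \<inter> \<iota> -` W"
    then have "\<iota> z \<in> W \<inter> S" using \<iota>_S by blast
    then show "(F \<circ> \<iota>) z = (\<iota> z, \<xi> (\<iota> z))" using W(3) by simp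
  qed
  then show "\<exists>U. x \<in> U \<and> smooth_param TA U (\<lambda>x. (\<iota> x, \<xi> (\<iota> x)))"
    using x W(1) by (intro exI[of _ "\<Omega> \<inter> \<iota> -` W"]) auto
qed

definition "\<xi>_coord d x = tan_coord A d (\<iota> x) (\<xi> (\<iota> x))"

lemma coord_lift_in_chart:
  assumes "d \<in> A" "x \<in> \<Omega>" "\<iota> x \<in> fst d"
  shows "snd (tangent_chart A d) (coord_lift C (x, t)) = (snd d (\<iota> x), t *\<^sub>R \<xi>_coord d x)"
  using linear_scale[OF linear_tan_coord[OF diff_A assms(1,3)]]
  by (simp add: tangent_chart_def coord_lift_def \<xi>_coord_def)

context
  fixes d assumes d: "d \<in> A"
begin

lemma smooth_\<xi>_coord: "smooth_on (\<Omega> \<inter> \<iota> -` fst d) (\<xi>_coord d)"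
proof -
  have o: "open (\<Omega> \<inter> \<iota> -` fst d)" using \<iota>_smooth d by (simp add: smooth_param_def)
  have "tangent_chart A d \<in> TA" using d by (simp add: tangent_atlas_eq)
  then have "smooth_on (\<Omega> \<inter> (\<lambda>x. (\<iota> x, \<xi> (\<iota> x))) -` fst (tangent_chart A d))
      (snd (tangent_chart A d) \<circ> (\<lambda>x. (\<iota> x, \<xi> (\<iota> x))))"
    using \<xi>_param by (auto simp: smooth_param_def)
  moreover have "\<Omega> \<inter> (\<lambda>x. (\<iota> x, \<xi> (\<iota> x))) -` fst (tangent_chart A d) = \<Omega> \<inter> \<iota> -` fst d"
    by (auto simp: tangent_chart_def)
  ultimately have "smooth_on (\<Omega> \<inter> \<iota> -` fst d) (snd (tangent_chart A d) \<circ> (\<lambda>x. (\<iota> x, \<xi> (\<iota> x))))"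
    by simp
  then have "smooth_on (\<Omega> \<inter> \<iota> -` fst d) (\<lambda>x. snd ((snd (tangent_chart A d) \<circ> (\<lambda>x. (\<iota> x, \<xi> (\<iota> x)))) x))"
    by (rule smooth_on_snd[OF o])
  then show ?thesis by (simp add: tangent_chart_def \<xi>_coord_def[abs_def])
qed

lemma smooth_coord_lift_in_chart:
  "smooth_on ((\<Omega> \<inter> \<iota> -` fst d) \<times> UNIV) (\<lambda>y. (snd d (\<iota> (fst y)), snd y *\<^sub>R \<xi>_coord d (fst y)))"
proof -
  have oU: "open (\<Omega> \<inter> \<iota> -` fst d)" and sU: "smooth_on (\<Omega> \<inter> \<iota> -` fst d) (snd d \<circ> \<iota>)"
    using \<iota>_smooth d by (auto simp: smooth_param_def)
  have o: "open ((\<Omega> \<inter> \<iota> -` fst d) \<times> (UNIV :: real set))" using oU by (simp add: open_Times)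
  note i = smooth_on_id[OF o]
  note f = smooth_on_fst[OF o i] and s = smooth_on_snd[OF o i]
  have "smooth_on ((\<Omega> \<inter> \<iota> -` fst d) \<times> (UNIV :: real set)) (\<lambda>y. (snd d \<circ> \<iota>) (fst y))"
    by (rule smooth_on_compose[OF o oU f sU]) auto
  moreover have "smooth_on ((\<Omega> \<inter> \<iota> -` fst d) \<times> UNIV) (\<lambda>y. snd y *\<^sub>R \<xi>_coord d (fst y))"
    by (rule smooth_on_scaleR[OF o s smooth_on_compose[OF o oU f smooth_\<xi>_coord]]) auto
  ultimately show ?thesis using smooth_on_Pair[OF o] by simp
qed

end

lemma smooth_coord_lift: "smooth_param TA (\<Omega> \<times> UNIV) (coord_lift C)"
proof (rule smooth_param_local[OF \<Omega>U_open])
  fix y assume y: "y \<in> \<Omega> \<times> (UNIV :: real set)"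
  define d where "d = chart_at A (\<iota> (fst y))"
  have d: "d \<in> A" "\<iota> (fst y) \<in> fst d"
    using chart_at_mem[of "\<iota> (fst y)" A] \<iota>_S[of "fst y"] y S_subset by (simp_all add: d_def mem_Times_iff subset_iff)
  define U where "U = (\<Omega> \<inter> \<iota> -` fst d) \<times> (UNIV :: real set)"
  have oU: "open U" using \<iota>_smooth d by (simp add: smooth_param_def U_def open_Times)
  have "smooth_param TA U (coord_lift C)"
  proof (rule smooth_param_in_chart[OF smooth_TA _ oU])
    show "tangent_chart A d \<in> TA" using d by (simp add: tangent_atlas_eq)
    show "coord_lift C ` U \<subseteq> fst (tangent_chart A d)" by (auto simp: U_def coord_lift_def tangent_chart_def)
    show "smooth_on U (snd (tangent_chart A d) \<circ> coord_lift C)"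
      by (rule smooth_on_cong[OF oU _ smooth_coord_lift_in_chart[OF d(1), folded U_def]])
        (use coord_lift_in_chart[OF d(1)] in \<open>auto simp: U_def\<close>)
  qed
  then show "\<exists>U. y \<in> U \<and> smooth_param TA U (coord_lift C)" using y d by (intro exI[of _ U]) (auto simp: U_def)
qed

lemma coord_dom_iff: "y \<in> coord_dom C \<longleftrightarrow> y \<in> \<Omega> \<times> UNIV \<and> coord_lift C y \<in> V"
proof (cases y)
  case (Pair x t)
  show ?thesis
  proof (cases "x \<in> \<Omega>")
    case True
    then show ?thesis using flow_domI[OF \<iota>_S[OF True]] by (simp add: Pair coord_dom_def coord_lift_def)
  qed (simp add: Pair coord_dom_def)
qed

text \<open>\<open>V\<close> is open only relative to the normal bundle. The lift of each
  \<open>(x, t)\<close> lies in that bundle, however, so membership in \<open>V\<close> reduces to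
  membership in the ambient open set \<open>O'\<close>.\<close>

lemma coord_dom_open: "open (coord_dom C)"
proof -
  obtain O' where O': "openin (manifold_top TA) O'" "V = O' \<inter> normal_bundle A g AS"
    using neighborhood by (auto simp: normal_exp_neighborhood_def openin_subtopology)
  have V_iff: "z \<in> V \<longleftrightarrow> z \<in> O' \<and> z \<in> normal_bundle A g AS" for z
    by (subst O'(2)) (rule Int_iff)
  have "coord_dom C = (\<Omega> \<times> UNIV) \<inter> coord_lift C -` O'"
  proof (intro set_eqI)
    fix y
    show "y \<in> coord_dom C \<longleftrightarrow> y \<in> (\<Omega> \<times> UNIV) \<inter> coord_lift C -` O'"
    proof (cases "y \<in> \<Omega> \<times> UNIV")
      case True
      then have "coord_lift C y \<in> normal_bundle A g AS"
        using \<iota>_S scaled_normal by (simp add: coord_lift_def case_prod_unfold mem_Times_iff)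
      with True show ?thesis unfolding coord_dom_iff V_iff by (simp only: Int_iff vimage_eq simp_thms)
    qed (simp add: coord_dom_iff)
  qed
  then show ?thesis using smooth_param_open_vimage[OF diff_TA smooth_coord_lift O'(1)] by simp
qed

text \<open>Smoothness of \<open>E\<close> on \<open>V\<close> means local extendability, so the
  flow is locally an extension \<open>F\<close> composed with the smooth lift.\<close>

lemma coord_flow_smooth: "smooth_param A (coord_dom C) (coord_flow C)"
proof (rule smooth_param_local[OF coord_dom_open])
  fix y assume y: "y \<in> coord_dom C"
  then have yV: "y \<in> \<Omega> \<times> UNIV" "coord_lift C y \<in> V" unfolding coord_dom_iff by auto
  have "smooth_on_set TA A V E"
    using neighborhood by (auto simp: normal_exp_neighborhood_def diffeo_def)
  then obtain W F where W: "coord_lift C y \<in> W" "smooth_map_on TA A W F" "\<forall>q\<in>W \<inter> V. F q = E q"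
    using yV unfolding smooth_on_set_def by blast
  have s: "smooth_param A ((\<Omega> \<times> UNIV) \<inter> coord_lift C -` W) (F \<circ> coord_lift C)"
    by (rule smooth_param_comp[OF diff_TA diff_A W(2) smooth_coord_lift])
  have "smooth_param A ((\<Omega> \<times> UNIV) \<inter> coord_lift C -` W \<inter> coord_dom C) (F \<circ> coord_lift C)"
    by (rule smooth_param_subset[OF s]) (use s coord_dom_open in \<open>auto simp: smooth_param_def\<close>)
  then have "smooth_param A ((\<Omega> \<times> UNIV) \<inter> coord_lift C -` W \<inter> coord_dom C) (coord_flow C)"
    by (rule smooth_param_cong) (use W(3) in \<open>simp add: coord_dom_iff coord_flow_lift\<close>)
  then show "\<exists>U. y \<in> U \<and> smooth_param A U (coord_flow C)"
    using y yV W by (intro exI[of _ "(\<Omega> \<times> UNIV) \<inter> coord_lift C -` W \<inter> coord_dom C"]) auto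
qed

end

lemma E_target:
  obtains W where "openin (manifold_top A) W" "bij_betw E V W" "smooth_on_set A TA W (inv_into V E)"
  using neighborhood by (auto simp: normal_exp_neighborhood_def diffeo_def)

lemma E_inj: "inj_on E V"
  using E_target by (metis bij_betw_def)

lemma flow_inj: "inj_on \<Phi> \<O>"
proof (rule inj_onI, clarify)
  fix p t p' t' assume *: "(p, t) \<in> \<O>" "(p', t') \<in> \<O>" "\<Phi> (p, t) = \<Phi> (p', t')"
  then have "(p, t *\<^sub>R \<xi> p) = (p', t' *\<^sub>R \<xi> p')"
    by (intro inj_onD[OF E_inj]) (auto simp: flow_def flow_dom_def)
  then show "p = p' \<and> t = t'" using \<xi>_nonzero[OF flow_dom_S[OF *(1)]] by auto
qed

abbreviation "\<pi> \<equiv> flow_inv A g AS \<xi> V"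

lemma flow_inv_flow: "y \<in> \<O> \<Longrightarrow> \<pi> (\<Phi> y) = y"
  unfolding flow_inv_def by (rule inv_into_f_f[OF flow_inj])

lemma flow_inv_dom: "q \<in> \<Sigma> \<Longrightarrow> \<pi> q \<in> \<O>" and flow_flow_inv: "q \<in> \<Sigma> \<Longrightarrow> \<Phi> (\<pi> q) = q"
  unfolding flow_inv_def hypersurface_def by (rule inv_into_into, simp) (rule f_inv_into_f, simp)

lemma inv_E: "q \<in> \<Sigma> \<Longrightarrow> inv_into V E q = (fst (\<pi> q), snd (\<pi> q) *\<^sub>R \<xi> (fst (\<pi> q)))"
  using flow_inv_dom[of q] flow_flow_inv[of q] E_inj
  by (intro inv_into_f_eq) (auto simp: flow_def flow_dom_def case_prod_unfold)

lemma \<Sigma>_subset: "bij_betw E V W \<Longrightarrow> \<Sigma> \<subseteq> W"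
  by (auto simp: hypersurface_def flow_def flow_dom_def bij_betw_def)

lemma \<Sigma>_points: "\<Sigma> \<subseteq> points A"
proof -
  obtain W where "openin (manifold_top A) W" "bij_betw E V W" using E_target by metis
  then show ?thesis using \<Sigma>_subset openin_subset topspace_manifold_top[OF diff_A] by blast
qed

lemma coord_flow_\<Sigma>: "y \<in> coord_dom C \<Longrightarrow> coord_flow C y \<in> \<Sigma>"
  by (auto simp: coord_flow_def coord_dom_def hypersurface_def)

lemma flow_inv_coord_flow: "y \<in> coord_dom C \<Longrightarrow> \<pi> (coord_flow C y) = (chart_inv C (fst y), snd y)"
  by (auto simp: coord_flow_def coord_dom_def flow_inv_flow)

text \<open>The inverse of \<open>E\<close>, extended locally to a smooth map \<open>F\<close>,
  takes the flow back to its lift. By the chain rule it remains to see that the lift has an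
  injective derivative.\<close>

lemma coord_flow_immersion:
  assumes C: "C \<in> AS" and y: "y \<in> coord_dom C" and c: "c \<in> A" "coord_flow C y \<in> fst c"
  shows "inj (fderiv (snd c \<circ> coord_flow C) y)"
proof -
  obtain x t where xt: "y = (x, t)" by (cases y)
  have yV: "x \<in> snd C ` fst C" "coord_lift C y \<in> V" using y coord_dom_iff[OF C] by (auto simp: xt)
  define q where "q = coord_flow C y"
  obtain W where W: "bij_betw E V W" "smooth_on_set A TA W (inv_into V E)" using E_target by metis
  have qW: "q \<in> W" using \<Sigma>_subset[OF W(1)] coord_flow_\<Sigma>[OF y] by (auto simp: q_def)
  then obtain G' F where F: "q \<in> G'" "smooth_map_on A TA G' F" "\<forall>q\<in>G' \<inter> W. F q = inv_into V E q"
    using W(2) unfolding smooth_on_set_def by blast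
  define p where "p = chart_inv C x"
  have p: "p \<in> S" using \<iota>_S[OF C yV(1)] by (simp add: p_def)
  define d where "d = chart_at A p"
  have d: "d \<in> A" "p \<in> fst d" using chart_at_mem[of p A] p S_subset by (auto simp: d_def)
  define D where "D = tangent_chart A d"
  have D: "D \<in> TA" using d by (simp add: D_def tangent_atlas_eq)
  have lift_eq: "F (coord_flow C z) = coord_lift C z" if "z \<in> coord_dom C" "coord_flow C z \<in> G'" for z
  proof -
    have "inv_into V E (coord_flow C z) = coord_lift C z"
      using that(1) unfolding coord_flow_lift coord_dom_iff[OF C] by (intro inv_into_f_f[OF E_inj]) auto
    moreover have "coord_flow C z \<in> W" using \<Sigma>_subset[OF W(1)] coord_flow_\<Sigma>[OF that(1)] by auto
    ultimately show ?thesis using F(3) that by auto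
  qed
  have Fq: "F q = coord_lift C y" using lift_eq[OF y] F(1) by (simp add: q_def)
  have qc: "snd c q \<in> snd c ` (fst c \<inter> G')" using c F(1) by (auto simp: q_def)
  have inv: "chart_inv c (snd c q) = q" using chart_inv_apply[OF diff_A c(1)] c(2) by (simp add: q_def)
  have FqD: "F q \<in> fst D" using d(2) by (simp add: Fq coord_lift_def xt p_def D_def tangent_chart_def)
  have dF: "(snd D \<circ> (F \<circ> chart_inv c)) differentiable (at (snd c q))"
    by (rule smooth_param_differentiable[OF smooth_map_on_imp_param[OF diff_A F(2) c(1)] D qc]) (simp add: inv FqD)
  have dc: "(snd c \<circ> coord_flow C) differentiable (at y)"
    by (rule smooth_param_differentiable[OF coord_flow_smooth[OF C] c(1) y c(2)])
  have G': "openin (manifold_top A) G'" using F(2) by (simp add: smooth_map_on_def)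
  have o: "open (coord_dom C \<inter> coord_flow C -` (fst c \<inter> G'))"
    by (rule smooth_param_open_vimage[OF diff_A coord_flow_smooth[OF C]]) (intro openin_Int openin_chart[OF diff_A c(1)] G')
  have "fderiv (snd D \<circ> coord_lift C) y =
      fderiv ((snd D \<circ> (F \<circ> chart_inv c)) \<circ> (snd c \<circ> coord_flow C)) y"
    by (rule frechet_derivative_transform(1)[OF o])
      (use y c F(1) lift_eq in \<open>auto simp: q_def chart_inv_apply[OF diff_A c(1)]\<close>)
  then have chain: "fderiv (snd D \<circ> coord_lift C) y v =
      fderiv (snd D \<circ> (F \<circ> chart_inv c)) (snd c q) (fderiv (snd c \<circ> coord_flow C) y v)" for v
    using frechet_derivative_comp[OF dc, of "snd D \<circ> (F \<circ> chart_inv c)" v] dF by (simp add: q_def)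
  define U where "U = snd C ` fst C \<inter> chart_inv C -` fst d"
  have U: "open U" "x \<in> U" using \<iota>_smooth[OF C] d yV(1) by (auto simp: smooth_param_def U_def p_def)
  have oU: "open (U \<times> (UNIV :: real set))" using U by (simp add: open_Times)
  define \<eta> where "\<eta> = \<xi>_coord C d"
  have d\<iota>: "((snd d \<circ> chart_inv C) has_derivative fderiv (snd d \<circ> chart_inv C) x) (at x)"
    by (rule has_frechet, rule smooth_param_differentiable[OF \<iota>_smooth[OF C] d(1) yV(1)]) (use d in \<open>simp add: p_def\<close>)
  have d\<eta>: "(\<eta> has_derivative fderiv \<eta> x) (at x)"
    unfolding \<eta>_def by (rule smooth_on_has_derivative[OF smooth_\<xi>_coord[OF C d(1)]]) (use U in \<open>auto simp: U_def\<close>)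
  have fd: "(fst has_derivative fst) (at y)" "(snd has_derivative snd) (at y)"
    by (auto intro!: derivative_eq_intros)
  \<comment> \<open>The first component is the derivative of the inverse chart, which is injective;
    the second is the product rule for \<open>t *\<^sub>R \<xi>\<close>. Once the first component
    kills \<open>fst w\<close>, only a multiple of the nonzero vector \<eta> is left.\<close>
  have "((\<lambda>z. ((snd d \<circ> chart_inv C) (fst z), snd z *\<^sub>R \<eta> (fst z))) has_derivative
      (\<lambda>w. (fderiv (snd d \<circ> chart_inv C) x (fst w),
        snd y *\<^sub>R fderiv \<eta> x (fst w) + snd w *\<^sub>R \<eta> (fst y)))) (at y)"
    using has_derivative_compose[OF fd(1), of "snd d \<circ> chart_inv C"] has_derivative_compose[OF fd(1), of \<eta>] d\<iota> d\<eta>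
    by (intro has_derivative_Pair has_derivative_scaleR fd) (auto simp: xt)
  then have "((snd D \<circ> coord_lift C) has_derivative
      (\<lambda>w. (fderiv (snd d \<circ> chart_inv C) x (fst w),
        snd y *\<^sub>R fderiv \<eta> x (fst w) + snd w *\<^sub>R \<eta> (fst y)))) (at y)"
  proof (rule has_derivative_transform_within_open[OF _ oU])
    fix z assume "z \<in> U \<times> (UNIV :: real set)"
    then show "((snd d \<circ> chart_inv C) (fst z), snd z *\<^sub>R \<eta> (fst z)) = (snd D \<circ> coord_lift C) z"
      using coord_lift_in_chart[OF C d(1), of "fst z" "snd z"] by (auto simp: U_def D_def \<eta>_def)
  qed (use U xt in auto)
  note DL = frechet_eq[OF this]
  have i\<iota>: "inj (fderiv (snd d \<circ> chart_inv C) x)"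
    by (rule sub_chart_immersion[OF SA AS_sub_atlas[OF C] yV(1) d(1)]) (use d in \<open>simp add: p_def\<close>)
  have \<eta>0: "\<eta> x \<noteq> 0"
  proof
    assume "\<eta> x = 0"
    then have "tan_coord A d p (\<xi> p) = 0" by (simp add: \<eta>_def \<xi>_coord_def[OF C] p_def)
    then have "\<xi> p = tan_vec A d p 0" using tan_vec_coord[OF diff_A d(1,2)] by metis
    moreover have "tan_vec A d p 0 = 0"
      using tan_vec_coord[OF diff_A d(1,2), of 0] linear_0[OF linear_tan_coord[OF diff_A d]] by simp
    ultimately show False using \<xi>_nonzero[OF p] by simp
  qed
  have lin: "linear (fderiv (snd c \<circ> coord_flow C) y)" by (rule linear_frechet[OF dc])
  have lin\<iota>: "linear (fderiv (snd d \<circ> chart_inv C) x)" by (rule has_derivative_linear[OF d\<iota>])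
  have "w = 0" if "fderiv (snd c \<circ> coord_flow C) y w = 0" for w
  proof -
    have "linear (fderiv (snd D \<circ> (F \<circ> chart_inv c)) (snd c q))" by (rule linear_frechet[OF dF])
    then have "fderiv (snd D \<circ> coord_lift C) y w = 0" unfolding chain that by (rule linear_0)
    then have 1: "fderiv (snd d \<circ> chart_inv C) x (fst w) = 0"
      and 2: "snd y *\<^sub>R fderiv \<eta> x (fst w) + snd w *\<^sub>R \<eta> (fst y) = 0"
      unfolding DL by (auto simp: zero_prod_def)
    have w1: "fst w = 0" using 1 i\<iota> lin\<iota> linear_injective_0 by blast
    then have "snd w *\<^sub>R \<eta> x = 0" using 2 linear_0[OF has_derivative_linear[OF d\<eta>]] by (simp add: xt)
    then show "w = 0" using w1 \<eta>0 by (simp add: prod_eq_iff)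
  qed
  then show ?thesis using linear_injective_0[OF lin] by blast
qed

end

lemma continuous_map_inner_euclidean:
  fixes f h :: "'a \<Rightarrow> 'b::euclidean_space"
  assumes "continuous_map X euclidean f" "continuous_map X euclidean h"
  shows "continuous_map X euclideanreal (\<lambda>x. f x \<bullet> h x)"
proof -
  have "continuous_map X (euclidean :: ('b \<times> 'b) topology) (\<lambda>x. (f x, h x))"
    using continuous_map_pairedI[OF assms] by (simp add: euclidean_product_topology)
  moreover have "continuous_map (euclidean :: ('b \<times> 'b) topology) euclideanreal (\<lambda>y. fst y \<bullet> snd y)"
    by (simp add: continuous_map_iff_continuous2 continuous_intros)
  ultimately show ?thesis using continuous_map_compose[of X euclidean _ euclideanreal] by (force simp: comp_def)
qed

context null_flow
begin

section \<open>Continuity of the inverse flow\<close>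

lemma topspace_sub: "Z \<subseteq> points A \<Longrightarrow> topspace (subtopology (manifold_top A) Z) = Z"
  by (simp add: topspace_manifold_top[OF diff_A] Int_absorb1)

lemma fst_\<pi>_S: "q \<in> \<Sigma> \<Longrightarrow> fst (\<pi> q) \<in> S"
  using flow_inv_dom[of q] flow_dom_S by (cases "\<pi> q") auto

lemma continuous_inv_E: "continuous_map (subtopology (manifold_top A) \<Sigma>) (manifold_top TA) (inv_into V E)"
proof -
  obtain W where W: "openin (manifold_top A) W" "bij_betw E V W" "smooth_on_set A TA W (inv_into V E)"
    using E_target by metis
  have "W \<subseteq> points A" using openin_subset[OF W(1)] by (simp add: topspace_manifold_top[OF diff_A])
  from continuous_map_smooth_on_set[OF diff_A diff_TA W(3) this] show ?thesis
    by (rule continuous_map_from_subtopology_mono) (rule \<Sigma>_subset[OF W(2)])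
qed

lemma continuous_fst_\<pi>:
  "continuous_map (subtopology (manifold_top A) \<Sigma>) (subtopology (manifold_top A) S) (\<lambda>q. fst (\<pi> q))"
proof -
  have "continuous_map (subtopology (manifold_top A) \<Sigma>) (manifold_top A) (fst \<circ> inv_into V E)"
    by (rule continuous_map_compose[OF continuous_inv_E continuous_map_base_point[OF SA]])
  then have "continuous_map (subtopology (manifold_top A) \<Sigma>) (manifold_top A) (\<lambda>q. fst (\<pi> q))"
    by (rule continuous_map_eq) (simp add: inv_E topspace_sub[OF \<Sigma>_points])
  then show ?thesis
    using fst_\<pi>_S by (auto simp: continuous_map_in_subtopology topspace_sub[OF \<Sigma>_points])
qed

text \<open>The fibre part of \<open>inv_into V E q\<close> is the time parameter times the fibre
  part of \<xi>. Locally the time is thus a quotient of two Euclidean inner products of continuous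
  functions.\<close>

lemma continuous_snd_\<pi>: "continuous_map (subtopology (manifold_top A) \<Sigma>) euclideanreal (\<lambda>q. snd (\<pi> q))"
proof (rule continuous_map_local)
  let ?X = "subtopology (manifold_top A) \<Sigma>"
  fix q0 assume "q0 \<in> topspace ?X"
  then have q0: "q0 \<in> \<Sigma>" by (simp add: topspace_sub[OF \<Sigma>_points])
  define d where "d = chart_at A (fst (\<pi> q0))"
  have d: "d \<in> A" "fst (\<pi> q0) \<in> fst d"
    using chart_at_mem[OF subsetD[OF S_subset fst_\<pi>_S[OF q0]]] by (simp_all add: d_def)
  define U where "U = {q \<in> \<Sigma>. fst (\<pi> q) \<in> fst d}"
  have cM: "continuous_map ?X (manifold_top A) (\<lambda>q. fst (\<pi> q))"
    using continuous_fst_\<pi> by (simp add: continuous_map_in_subtopology)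
  have "openin ?X {q \<in> topspace ?X. fst (\<pi> q) \<in> fst d}"
    by (rule openin_continuous_map_preimage[OF cM openin_chart[OF diff_A d(1)]])
  then have oU: "openin ?X U" by (simp only: U_def topspace_sub[OF \<Sigma>_points])
  define D where "D = tangent_chart A d"
  have D: "D \<in> TA" using d by (simp add: D_def tangent_atlas_eq)
  have "U \<subseteq> topspace ?X" unfolding topspace_sub[OF \<Sigma>_points] by (auto simp: U_def)
  then have UX: "topspace (subtopology ?X U) = U" by (rule topspace_subtopology_subset)
  have comp: "continuous_map (subtopology ?X U) euclidean (\<lambda>q. snd (snd D (k q)))"
    if "continuous_map (subtopology ?X U) (manifold_top TA) k" "\<And>q. q \<in> U \<Longrightarrow> k q \<in> fst D" for k
  proof -
    have "continuous_map (subtopology ?X U) (subtopology (manifold_top TA) (fst D)) k"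
      using that by (auto simp only: continuous_map_in_subtopology UX)
    from continuous_map_compose[OF this continuous_map_chart[OF diff_TA D]]
    have "continuous_map (subtopology ?X U) (euclidean :: ('e \<times> 'e) topology) (snd D \<circ> k)" .
    moreover have "continuous_map (euclidean :: ('e \<times> 'e) topology) euclidean snd"
      by (simp add: continuous_map_iff_continuous2 continuous_intros)
    ultimately have "continuous_map (subtopology ?X U) euclidean (snd \<circ> (snd D \<circ> k))"
      by (rule continuous_map_compose)
    then show ?thesis by (simp add: comp_def)
  qed
  define v where "v q = snd (snd D (inv_into V E q))" for q
  define w where "w q = snd (snd D (fst (\<pi> q), \<xi> (fst (\<pi> q))))" for q
  have v: "continuous_map (subtopology ?X U) euclidean v"
    unfolding v_def
  proof (rule comp)
    show "continuous_map (subtopology ?X U) (manifold_top TA) (inv_into V E)"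
      by (rule continuous_map_from_subtopology[OF continuous_inv_E])
    show "inv_into V E q \<in> fst D" if "q \<in> U" for q
      using that by (simp add: U_def inv_E D_def tangent_chart_def)
  qed
  have w: "continuous_map (subtopology ?X U) euclidean w"
    unfolding w_def
  proof (rule comp)
    have "continuous_map ?X (manifold_top TA) ((\<lambda>p. (p, \<xi> p)) \<circ> (\<lambda>q. fst (\<pi> q)))"
      by (rule continuous_map_compose[OF continuous_fst_\<pi> continuous_map_smooth_on_set[OF diff_A diff_TA \<xi>_smooth S_subset]])
    then show "continuous_map (subtopology ?X U) (manifold_top TA) (\<lambda>q. (fst (\<pi> q), \<xi> (fst (\<pi> q))))"
      by (simp add: comp_def continuous_map_from_subtopology)
    show "(fst (\<pi> q), \<xi> (fst (\<pi> q))) \<in> fst D" if "q \<in> U" for q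
      using that by (simp add: U_def D_def tangent_chart_def)
  qed
  have eq: "(v q \<bullet> w q) / (w q \<bullet> w q) = snd (\<pi> q)" and w0: "w q \<bullet> w q \<noteq> 0" if q: "q \<in> U" for q
  proof -
    let ?p = "fst (\<pi> q)"
    have p: "?p \<in> fst d" "?p \<in> S" "q \<in> \<Sigma>" using q fst_\<pi>_S by (auto simp: U_def)
    note lin = linear_tan_coord[OF diff_A d(1) p(1)]
    have wq: "w q = tan_coord A d ?p (\<xi> ?p)" by (simp add: w_def D_def tangent_chart_def)
    have vq: "v q = snd (\<pi> q) *\<^sub>R w q"
      using linear_scale[OF lin] p by (simp add: v_def wq inv_E D_def tangent_chart_def)
    have "w q \<noteq> 0"
    proof
      assume "w q = 0"
      then have "tan_coord A d ?p (\<xi> ?p) = tan_coord A d ?p 0" using linear_0[OF lin] wq by simp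
      then show False using tan_vec_coord[OF diff_A d(1) p(1)] \<xi>_nonzero[OF p(2)] by metis
    qed
    then show "w q \<bullet> w q \<noteq> 0" "(v q \<bullet> w q) / (w q \<bullet> w q) = snd (\<pi> q)" by (simp_all add: vq)
  qed
  have "continuous_map (subtopology ?X U) euclideanreal (\<lambda>q. (v q \<bullet> w q) / (w q \<bullet> w q))"
    by (intro continuous_map_real_divide continuous_map_inner_euclidean v w) (simp only: w0 UX not_False_eq_True)
  then have "continuous_map (subtopology ?X U) euclideanreal (\<lambda>q. snd (\<pi> q))"
    by (rule continuous_map_eq) (simp only: UX eq)
  then show "\<exists>U. openin ?X U \<and> q0 \<in> U \<and> continuous_map (subtopology ?X U) euclideanreal (\<lambda>q. snd (\<pi> q))"
    using oU q0 d by (intro exI[of _ U]) (auto simp: U_def)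
qed

section \<open>Explicit charts of the null hypersurface\<close>

lemma NS_def: "NS = sub_atlas A \<Sigma>" by (rule hyper_atlas_def)

text \<open>The flow parameters serve as coordinates on the hypersurface: a point goes to the
  coordinates of its starting point in \<open>S\<close> together with its affine parameter.\<close>

definition "hyper_chart C = (coord_flow C ` coord_dom C, inv_into (coord_dom C) (coord_flow C))"

context
  fixes C assumes C: "C \<in> AS"
begin

lemma snd_C_inv: "y \<in> coord_dom C \<Longrightarrow> snd C (chart_inv C (fst y)) = fst y"
  by (rule chart_apply_inv) (auto simp: coord_dom_def)

lemma coord_flow_inverse: "y \<in> coord_dom C \<Longrightarrow> (snd C (fst (\<pi> (coord_flow C y))), snd (\<pi> (coord_flow C y))) = y"
  by (simp add: flow_inv_coord_flow snd_C_inv)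

lemma coord_flow_inj: "inj_on (coord_flow C) (coord_dom C)"
  by (rule inj_on_inverseI[of _ "\<lambda>q. (snd C (fst (\<pi> q)), snd (\<pi> q))"]) (rule coord_flow_inverse)

lemma coord_flow_apply:
  assumes "(p, t) \<in> \<O>" "p \<in> fst C"
  shows "(snd C p, t) \<in> coord_dom C" "coord_flow C (snd C p, t) = \<Phi> (p, t)"
  using assms chart_inv_apply[OF diff_AS C] by (auto simp: coord_dom_def coord_flow_def)

lemma coord_flow_image: "coord_flow C ` coord_dom C = {q \<in> \<Sigma>. fst (\<pi> q) \<in> fst C}"
proof
  show "coord_flow C ` coord_dom C \<subseteq> {q \<in> \<Sigma>. fst (\<pi> q) \<in> fst C}"
  proof (rule image_subsetI)
    fix y assume y: "y \<in> coord_dom C"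
    then have "chart_inv C (fst y) \<in> fst C" by (intro chart_inv_mem) (auto simp: coord_dom_def)
    then show "coord_flow C y \<in> {q \<in> \<Sigma>. fst (\<pi> q) \<in> fst C}"
      using coord_flow_\<Sigma>[OF y] by (simp add: flow_inv_coord_flow[OF y])
  qed
  show "{q \<in> \<Sigma>. fst (\<pi> q) \<in> fst C} \<subseteq> coord_flow C ` coord_dom C"
  proof
    fix q assume q: "q \<in> {q \<in> \<Sigma>. fst (\<pi> q) \<in> fst C}"
    then have "(fst (\<pi> q), snd (\<pi> q)) \<in> \<O>" using flow_inv_dom by simp
    from coord_flow_apply[OF this] q have "(snd C (fst (\<pi> q)), snd (\<pi> q)) \<in> coord_dom C"
      "coord_flow C (snd C (fst (\<pi> q)), snd (\<pi> q)) = q" using flow_flow_inv by auto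
    then show "q \<in> coord_flow C ` coord_dom C" by (metis imageI)
  qed
qed

lemma continuous_chart_\<pi>:
  assumes "Z \<subseteq> \<Sigma>" "\<And>q. q \<in> Z \<Longrightarrow> fst (\<pi> q) \<in> fst C"
  shows "continuous_map (subtopology (manifold_top A) Z) euclidean (\<lambda>q. snd C (fst (\<pi> q)))"
proof -
  have ZA: "Z \<subseteq> points A" using assms(1) \<Sigma>_points by blast
  have "continuous_map (subtopology (manifold_top A) Z) (manifold_top A) (\<lambda>q. fst (\<pi> q))"
    using continuous_map_from_subtopology_mono[OF continuous_fst_\<pi> assms(1)] by (simp add: continuous_map_in_subtopology)
  then have "continuous_map (subtopology (manifold_top A) Z) (subtopology (manifold_top A) (fst C)) (\<lambda>q. fst (\<pi> q))"
    using assms(2) by (auto simp only: continuous_map_in_subtopology topspace_sub[OF ZA])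
  from continuous_map_compose[OF this continuous_map_sub_chart[OF SA AS_sub_atlas[OF C]]]
  show ?thesis by (simp add: comp_def)
qed

lemma openin_fst_\<pi>:
  assumes "Z \<subseteq> \<Sigma>"
  shows "openin (subtopology (manifold_top A) Z) {q \<in> Z. fst (\<pi> q) \<in> fst C}"
proof -
  have ZA: "Z \<subseteq> points A" using assms \<Sigma>_points by blast
  have "openin (subtopology (manifold_top A) S) (fst C)" by (rule sub_chart_openin[OF SA AS_sub_atlas[OF C]])
  from openin_continuous_map_preimage[OF continuous_map_from_subtopology_mono[OF continuous_fst_\<pi> assms] this]
  show ?thesis unfolding topspace_sub[OF ZA] .
qed

text \<open>The first component of \<pi> is continuous, which makes the image relatively open;
  continuity of both components gives the continuous inverse.\<close>

lemma hyper_chart: "hyper_chart C \<in> NS"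
  unfolding NS_def hyper_chart_def
proof (rule sub_atlasI[OF SA coord_flow_smooth[OF C] coord_flow_inj])
  let ?W = "coord_flow C ` coord_dom C"
  show "openin (subtopology (manifold_top A) \<Sigma>) ?W"
    unfolding coord_flow_image by (rule openin_fst_\<pi>) simp
  have W: "?W \<subseteq> \<Sigma>" "?W \<subseteq> points A" using coord_flow_\<Sigma> \<Sigma>_points by blast+
  have 1: "continuous_map (subtopology (manifold_top A) ?W) euclidean (\<lambda>q. snd C (fst (\<pi> q)))"
    by (rule continuous_chart_\<pi>[OF W(1)]) (simp add: coord_flow_image)
  have 2: "continuous_map (subtopology (manifold_top A) ?W) euclideanreal (\<lambda>q. snd (\<pi> q))"
    by (rule continuous_map_from_subtopology_mono[OF continuous_snd_\<pi> W(1)])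
  have "continuous_map (subtopology (manifold_top A) ?W) euclidean (\<lambda>q. (snd C (fst (\<pi> q)), snd (\<pi> q)))"
    using continuous_map_pairedI[OF 1 2] by (simp add: euclidean_product_topology)
  then show "continuous_map (subtopology (manifold_top A) ?W) euclidean (inv_into (coord_dom C) (coord_flow C))"
  proof (rule continuous_map_eq)
    fix q assume "q \<in> topspace (subtopology (manifold_top A) ?W)"
    then obtain y where y: "y \<in> coord_dom C" "q = coord_flow C y" by auto
    show "(snd C (fst (\<pi> q)), snd (\<pi> q)) = inv_into (coord_dom C) (coord_flow C) q"
      using coord_flow_inverse[OF y(1)] inv_into_f_f[OF coord_flow_inj y(1)] by (simp add: y(2))
  qed
  fix y assume y: "y \<in> coord_dom C"
  show "inj (fderiv (snd (chart_at A (coord_flow C y)) \<circ> coord_flow C) y)"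
    using chart_at_mem[OF subsetD[OF \<Sigma>_points coord_flow_\<Sigma>[OF y]]] by (intro coord_flow_immersion[OF C y]) auto
qed

lemma hyper_chart_inv: "y \<in> coord_dom C \<Longrightarrow> chart_inv (hyper_chart C) y = coord_flow C y"
  unfolding hyper_chart_def by (rule chart_inv_param[OF SA coord_flow_inj])

lemma hyper_chart_apply: "y \<in> coord_dom C \<Longrightarrow> snd (hyper_chart C) (coord_flow C y) = y"
  unfolding hyper_chart_def by (simp add: inv_into_f_f[OF coord_flow_inj])

lemma hyper_chart_mem: "y \<in> coord_dom C \<Longrightarrow> coord_flow C y \<in> fst (hyper_chart C)"
  by (simp add: hyper_chart_def)

end

lemma chart_AS_ex: "p \<in> S \<Longrightarrow> \<exists>C\<in>AS. p \<in> fst C"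
  using chart_at_mem[of p AS] points_AS by auto

text \<open>Joint continuity in point and time, for the compactness arguments on \<open>S\<close>
  times an interval. Locally on \<open>S\<close> it is the continuity of
  \<open>coord_flow C\<close>.\<close>

lemma continuous_flow:
  "continuous_map (subtopology (prod_topology (manifold_top A) euclideanreal) \<O>) (subtopology (manifold_top A) \<Sigma>) \<Phi>"
proof -
  let ?X = "subtopology (prod_topology (manifold_top A) euclideanreal) \<O>"
  have tX: "topspace ?X = \<O>"
    using flow_dom_S S_subset by (fastforce simp: topspace_manifold_top[OF diff_A])
  have "continuous_map ?X (manifold_top A) \<Phi>"
  proof (rule continuous_map_local)
    fix y assume "y \<in> topspace ?X"
    then have y: "y \<in> \<O>" by (simp only: tX)
    then have "fst y \<in> S" using flow_dom_S by (cases y) auto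
    then obtain C where C: "C \<in> AS" "fst y \<in> fst C" using chart_AS_ex by blast
    obtain O' where O': "openin (manifold_top A) O'" "fst C = O' \<inter> S"
      using sub_chart_openin[OF SA AS_sub_atlas[OF C(1)]] by (auto simp: openin_subtopology)
    define U where "U = (O' \<times> UNIV) \<inter> \<O>"
    have oU: "openin ?X U"
      unfolding U_def openin_subtopology
      by (intro exI[of _ "O' \<times> UNIV"] conjI openin_prod_Times_iff[THEN iffD2]) (use O'(1) in simp_all)
    have tU: "topspace (subtopology ?X U) = U" by (simp only: topspace_subtopology[of ?X] tX) (auto simp: U_def)
    have UC: "fst z \<in> fst C" if "z \<in> U" for z
      using that O'(2) flow_dom_S by (auto simp: U_def)
    have f: "continuous_map (subtopology ?X U) (manifold_top A) fst" "continuous_map (subtopology ?X U) euclideanreal snd"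
      using continuous_map_fst continuous_map_snd by (blast intro: continuous_map_from_subtopology)+
    then have "continuous_map (subtopology ?X U) (subtopology (manifold_top A) (fst C)) fst"
      using UC by (auto simp only: continuous_map_in_subtopology tU)
    from continuous_map_compose[OF this continuous_map_sub_chart[OF SA AS_sub_atlas[OF C(1)]]]
    have "continuous_map (subtopology ?X U) euclidean (\<lambda>z. snd C (fst z))" by (simp add: comp_def)
    from continuous_map_pairedI[OF this f(2)]
    have "continuous_map (subtopology ?X U) euclidean (\<lambda>z. (snd C (fst z), snd z))"
      by (simp add: euclidean_product_topology)
    moreover have dom: "(snd C (fst z), snd z) \<in> coord_dom C" "coord_flow C (snd C (fst z), snd z) = \<Phi> z" if "z \<in> U" for z
      using coord_flow_apply[OF C(1), of "fst z" "snd z"] UC[OF that] that by (simp_all add: U_def)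
    ultimately have "continuous_map (subtopology ?X U) (top_of_set (coord_dom C)) (\<lambda>z. (snd C (fst z), snd z))"
      by (auto simp only: continuous_map_in_subtopology tU)
    from continuous_map_compose[OF this continuous_map_smooth_param[OF diff_A coord_flow_smooth[OF C(1)]]]
    have "continuous_map (subtopology ?X U) (manifold_top A) (coord_flow C \<circ> (\<lambda>z. (snd C (fst z), snd z)))" .
    then have "continuous_map (subtopology ?X U) (manifold_top A) \<Phi>"
      by (rule continuous_map_eq) (simp only: tU dom comp_apply)
    moreover have "y \<in> U" using y C(2) O'(2) by (cases y) (auto simp: U_def)
    ultimately show "\<exists>U. openin ?X U \<and> y \<in> U \<and> continuous_map (subtopology ?X U) (manifold_top A) \<Phi>"
      using oU by blast
  qed
  then show ?thesis
    by (auto simp only: continuous_map_in_subtopology tX hypersurface_def)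
qed

text \<open>The fibres of \<open>V\<close> are star-shaped about 0. \<open>closed_segment\<close> is
  used because \<open>t\<close> may be negative.\<close>

lemma flow_dom_segment:
  assumes "(p, t) \<in> \<O>" "s \<in> closed_segment 0 t"
  shows "(p, s) \<in> \<O>"
proof -
  obtain r where r: "0 \<le> r" "r \<le> 1" "s = r * t" using assms(2) by (auto simp: closed_segment_def)
  have "(p, r *\<^sub>R (t *\<^sub>R \<xi> p)) \<in> V"
    using neighborhood assms(1) r unfolding normal_exp_neighborhood_def flow_dom_def by (metis (no_types, lifting) atLeastAtMost_iff case_prodD mem_Collect_eq)
  then show ?thesis using flow_dom_S[OF assms(1)] r by (simp add: flow_domI)
qed

lemma flow_dom_0: "p \<in> S \<Longrightarrow> (p, 0) \<in> \<O>"
  using neighborhood by (simp add: flow_domI normal_exp_neighborhood_def points_AS)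

lemma flow_0: "p \<in> S \<Longrightarrow> \<Phi> (p, 0) = p"
  using neighborhood geod_exp_zero[OF Hausdorff, of p]
  by (auto simp: flow_def normal_exp_neighborhood_def points_AS)

abbreviation "T \<equiv> common_domain AS \<xi> V"

lemma common_domain_iff: "t \<in> T \<longleftrightarrow> (\<forall>p\<in>S. (p, t) \<in> \<O>)"
  by (simp add: common_domain_def points_AS)

lemma common_domain_segment: "t \<in> T \<Longrightarrow> s \<in> closed_segment 0 t \<Longrightarrow> s \<in> T"
  using flow_dom_segment by (auto simp: common_domain_iff)

section \<open>A single leaf and its charts\<close>

context
  fixes t assumes t: "t \<in> T"
begin

abbreviation "L \<equiv> leaf A g AS \<xi> t"

lemma t_dom: "p \<in> S \<Longrightarrow> (p, t) \<in> \<O>"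
  using t by (simp add: common_domain_iff)

lemma leaf_eq: "L = (\<lambda>p. \<Phi> (p, t)) ` S"
  by (auto simp: leaf_def points_AS)

lemma leaf_\<Sigma>: "L \<subseteq> \<Sigma>"
  using t_dom by (auto simp: leaf_eq hypersurface_def)

lemma continuous_flow_t: "continuous_map (subtopology (manifold_top A) S) (subtopology (manifold_top A) L) (\<lambda>p. \<Phi> (p, t))"
proof -
  have "continuous_map (subtopology (manifold_top A) S) (prod_topology (manifold_top A) euclideanreal) (\<lambda>p. (p, t))"
    by (intro continuous_map_pairedI continuous_map_from_subtopology[OF continuous_map_id[unfolded id_def]]) simp
  then have "continuous_map (subtopology (manifold_top A) S)
      (subtopology (prod_topology (manifold_top A) euclideanreal) \<O>) (\<lambda>p. (p, t))"
    using t_dom by (auto simp only: continuous_map_in_subtopology topspace_sub[OF S_subset])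
  from continuous_map_compose[OF this continuous_flow]
  have "continuous_map (subtopology (manifold_top A) S) (manifold_top A) (\<lambda>p. \<Phi> (p, t))"
    by (simp add: comp_def continuous_map_in_subtopology)
  then show ?thesis by (auto simp only: continuous_map_in_subtopology topspace_sub[OF S_subset] leaf_eq)
qed

lemma compact_leaf: "compactin (manifold_top A) L"
proof -
  have "compactin (subtopology (manifold_top A) S) S" using compact_S by (simp add: compactin_subtopology)
  from image_compactin[OF this continuous_flow_t] show ?thesis by (simp add: compactin_subtopology leaf_eq)
qed

definition "leaf_param C x = coord_flow C (x, t)"
text \<open>The leaf inherits the coordinates of \<open>C\<close> along the flow, so corresponding
  points of \<open>S\<close> and of the leaf have equal coordinates and their volume densities can
  be compared directly.\<close>

definition "leaf_chart C = (leaf_param C ` (snd C ` fst C), inv_into (snd C ` fst C) (leaf_param C))"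

context
  fixes C assumes C: "C \<in> AS"
begin

lemma slice_dom: "x \<in> snd C ` fst C \<Longrightarrow> (x, t) \<in> coord_dom C"
  using \<iota>_S[OF C] t_dom by (auto simp: coord_dom_def)

lemma leaf_param_eq: "leaf_param C x = \<Phi> (chart_inv C x, t)"
  by (simp add: leaf_param_def coord_flow_def)

lemma leaf_param_inverse: "x \<in> snd C ` fst C \<Longrightarrow> snd C (fst (\<pi> (leaf_param C x))) = x"
  using coord_flow_inverse[OF C slice_dom] by (simp add: leaf_param_def)

lemma leaf_param_inj: "inj_on (leaf_param C) (snd C ` fst C)"
  by (rule inj_on_inverseI) (rule leaf_param_inverse)

lemma leaf_param_smooth: "smooth_param A (snd C ` fst C) (leaf_param C)"
proof -
  have "smooth_param A (snd C ` fst C) (coord_flow C \<circ> (\<lambda>x. (x, t)))"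
  proof (rule smooth_param_reparam[OF coord_flow_smooth[OF C] \<Omega>_open[OF C]])
    show "smooth_on (snd C ` fst C) (\<lambda>x. (x, t))"
      by (intro smooth_on_Pair smooth_on_id smooth_on_const \<Omega>_open[OF C])
    show "(\<lambda>x. (x, t)) ` snd C ` fst C \<subseteq> coord_dom C" using slice_dom by blast
  qed
  then show ?thesis by (simp add: comp_def leaf_param_def[abs_def])
qed

lemma frechet_leaf_param:
  assumes x: "x \<in> snd C ` fst C" and c: "c \<in> A" "leaf_param C x \<in> fst c"
  shows "fderiv (snd c \<circ> leaf_param C) x u = fderiv (snd c \<circ> coord_flow C) (x, t) (u, 0)"
proof -
  have "(snd c \<circ> coord_flow C) differentiable (at (x, t))"
    by (rule smooth_param_differentiable[OF coord_flow_smooth[OF C] c(1) slice_dom[OF x]]) (use c in \<open>simp add: leaf_param_def\<close>)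
  note D = has_frechet[OF this]
  have P: "((\<lambda>x. (x, t)) has_derivative (\<lambda>u. (u, 0))) (at x)"
    by (intro has_derivative_Pair has_derivative_ident has_derivative_const)
  have "((\<lambda>x. (snd c \<circ> coord_flow C) (x, t)) has_derivative
      (\<lambda>u. fderiv (snd c \<circ> coord_flow C) (x, t) (u, 0))) (at x)"
    by (rule has_derivative_compose[OF P D])
  from frechet_eq[OF this] show ?thesis by (simp add: comp_def leaf_param_def[abs_def])
qed

lemma leaf_param_image: "leaf_param C ` snd C ` fst C = {q \<in> L. fst (\<pi> q) \<in> fst C}"
proof
  show "leaf_param C ` snd C ` fst C \<subseteq> {q \<in> L. fst (\<pi> q) \<in> fst C}"
  proof (rule image_subsetI)
    fix x assume x: "x \<in> snd C ` fst C"
    have "chart_inv C x \<in> S" "chart_inv C x \<in> fst C" using \<iota>_S[OF C x] chart_inv_mem[OF x] by simp_all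
    then show "leaf_param C x \<in> {q \<in> L. fst (\<pi> q) \<in> fst C}"
      using t_dom by (simp add: leaf_param_eq leaf_eq flow_inv_flow)
  qed
  show "{q \<in> L. fst (\<pi> q) \<in> fst C} \<subseteq> leaf_param C ` snd C ` fst C"
  proof clarify
    fix q assume q: "q \<in> L" "fst (\<pi> q) \<in> fst C"
    then obtain p where p: "p \<in> S" "q = \<Phi> (p, t)" by (auto simp: leaf_eq)
    then have "p \<in> fst C" using q(2) t_dom by (simp add: flow_inv_flow)
    then show "q \<in> leaf_param C ` snd C ` fst C"
      using p(2) chart_inv_apply[OF diff_AS C] by (intro image_eqI[of _ _ "snd C p"]) (auto simp: leaf_param_eq)
  qed
qed

text \<open>The derivative is that of \<open>coord_flow C\<close> on vectors \<open>(u, 0)\<close>,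
  hence injective, and the inverse is the coordinate of the first component of \<pi>, hence
  continuous.\<close>

lemma leaf_chart: "leaf_chart C \<in> sub_atlas A L"
  unfolding leaf_chart_def
proof (rule sub_atlasI[OF SA leaf_param_smooth leaf_param_inj])
  let ?W = "leaf_param C ` snd C ` fst C"
  show "openin (subtopology (manifold_top A) L) ?W"
    unfolding leaf_param_image by (rule openin_fst_\<pi>[OF C leaf_\<Sigma>])
  have "?W \<subseteq> \<Sigma>" "\<And>q. q \<in> ?W \<Longrightarrow> fst (\<pi> q) \<in> fst C" unfolding leaf_param_image using leaf_\<Sigma> by auto
  from continuous_chart_\<pi>[OF C this]
  have "continuous_map (subtopology (manifold_top A) ?W) euclidean (\<lambda>q. snd C (fst (\<pi> q)))" by simp
  then show "continuous_map (subtopology (manifold_top A) ?W) euclidean (inv_into (snd C ` fst C) (leaf_param C))"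
  proof (rule continuous_map_eq)
    fix q assume "q \<in> topspace (subtopology (manifold_top A) ?W)"
    then obtain x where x: "x \<in> snd C ` fst C" "q = leaf_param C x" by auto
    show "snd C (fst (\<pi> q)) = inv_into (snd C ` fst C) (leaf_param C) q"
      unfolding x(2) leaf_param_inverse[OF x(1)] inv_into_f_f[OF leaf_param_inj x(1)] ..
  qed
  fix x assume x: "x \<in> snd C ` fst C"
  define c where "c = chart_at A (leaf_param C x)"
  have "leaf_param C x \<in> points A"
    using subsetD[OF \<Sigma>_points coord_flow_\<Sigma>[OF slice_dom[OF x]]] by (simp add: leaf_param_def)
  then have c: "c \<in> A" "leaf_param C x \<in> fst c" using chart_at_mem by (auto simp: c_def)
  have "inj (fderiv (snd c \<circ> coord_flow C) (x, t))"
    by (rule coord_flow_immersion[OF C slice_dom[OF x] c(1)]) (use c in \<open>simp add: leaf_param_def\<close>)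
  then show "inj (fderiv (snd (chart_at A (leaf_param C x)) \<circ> leaf_param C) x)"
    unfolding c_def[symmetric] by (auto simp: inj_def frechet_leaf_param[OF x c])
qed

lemma leaf_chart_inv: "x \<in> snd C ` fst C \<Longrightarrow> chart_inv (leaf_chart C) x = leaf_param C x"
  unfolding leaf_chart_def by (rule chart_inv_param[OF SA leaf_param_inj])

lemma leaf_chart_apply: "x \<in> snd C ` fst C \<Longrightarrow> snd (leaf_chart C) (leaf_param C x) = x"
  unfolding leaf_chart_def by (simp only: snd_conv inv_into_f_f[OF leaf_param_inj])

end

lemma points_leaf: "points (sub_atlas A L :: ('m, real ^ 'n) atlas) = L"
proof
  show "points (sub_atlas A L :: ('m, real ^ 'n) atlas) \<subseteq> L"
    unfolding points_def using sub_chart_subset(1)[OF SA] by blast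
  show "L \<subseteq> points (sub_atlas A L :: ('m, real ^ 'n) atlas)"
  proof
    fix q assume q: "q \<in> L"
    then obtain C where C: "C \<in> AS" "fst (\<pi> q) \<in> fst C"
      using chart_AS_ex fst_\<pi>_S leaf_\<Sigma> by blast
    then have "q \<in> fst (leaf_chart C)"
      unfolding leaf_chart_def fst_conv leaf_param_image[OF C(1)] using q by simp
    then show "q \<in> points (sub_atlas A L :: ('m, real ^ 'n) atlas)"
      using leaf_chart[OF C(1)] fst_subset_points by blast
  qed
qed

end

end

section \<open>Evolution of the induced metrics\<close>

context null_flow
begin

lemma coord_flow_points: "y \<in> coord_dom C \<Longrightarrow> coord_flow C y \<in> points A"
  using coord_flow_\<Sigma> \<Sigma>_points by blast

context
  fixes C y q c F
  assumes C: "C \<in> AS" and y: "y \<in> coord_dom C"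
  defines "q \<equiv> coord_flow C y"
  defines "c \<equiv> chart_at A q"
  defines "F \<equiv> snd c \<circ> coord_flow C"
begin

lemma pref_chart: "c \<in> A" "q \<in> fst c"
  using chart_at_mem[OF coord_flow_points[OF y]] by (simp_all add: c_def q_def)

lemma open_F_dom: "open (coord_dom C \<inter> coord_flow C -` fst c)"
  and smooth_F: "smooth_on (coord_dom C \<inter> coord_flow C -` fst c) F"
  and y_F_dom: "y \<in> coord_dom C \<inter> coord_flow C -` fst c"
  using coord_flow_smooth[OF C] pref_chart y by (auto simp: smooth_param_def F_def q_def)

lemma F_diff: "F differentiable (at y)"
  by (rule smooth_on_differentiable[OF smooth_F y_F_dom])

text \<open>\<open>dflow\<close> is taken in a preferred chart of the product atlas, whose factor
  \<open>C0\<close> on \<open>S\<close> may differ from \<open>C\<close>. The map \<open>L\<close>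
  is the derivative of the transition from \<open>C0\<close> to \<open>C\<close>; it leaves the time
  direction alone and is onto, so the null field and the screen do not depend on the choice.\<close>

lemma dflow_coord:
  obtains L where "linear L" "surj L" "\<And>u r. dflow A g AS \<xi> (\<pi> q) (u, r) = fderiv F y (L u, r)"
proof -
  define p where "p = chart_inv C (fst y)"
  define t where "t = snd y"
  have x: "fst y \<in> snd C ` fst C" using y by (auto simp: coord_dom_def)
  have pC: "p \<in> fst C" and yp: "y = (snd C p, t)"
    using chart_inv_mem[OF x] chart_apply_inv[OF x] by (simp_all add: p_def t_def)
  have \<pi>q: "\<pi> q = (p, t)" by (simp add: q_def flow_inv_coord_flow[OF y] p_def t_def)
  have \<Phi>q: "\<Phi> (p, t) = q" by (simp add: q_def coord_flow_def p_def t_def case_prod_unfold)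
  define E0 where "E0 = chart_at (prod_atlas AS (euclid_atlas :: (real, real) atlas)) (p, t)"
  have "(p, t) \<in> points (prod_atlas AS (euclid_atlas :: (real, real) atlas))"
  proof -
    have "(UNIV, \<lambda>x. x) \<in> (euclid_atlas :: (real, real) atlas)" by (simp add: euclid_atlas_def)
    then have "(fst C \<times> fst (UNIV, \<lambda>x. x), \<lambda>(p, q). (snd C p, snd (UNIV, \<lambda>x. x) q)) \<in>
        prod_atlas AS (euclid_atlas :: (real, real) atlas)"
      unfolding prod_atlas_def using C by (intro CollectI exI[of _ C] exI[of _ "(UNIV, \<lambda>x. x)"]) simp
    from fst_subset_points[OF this] pC show ?thesis by auto
  qed
  from chart_at_mem[OF this] obtain C0 where C0: "C0 \<in> AS" "p \<in> fst C0"
    and E0: "E0 = (fst C0 \<times> UNIV, \<lambda>(p, q). (snd C0 p, q))"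
    unfolding E0_def[symmetric] by (auto simp: prod_atlas_def euclid_atlas_def)
  have inv0: "chart_inv E0 (z, s) = (chart_inv C0 z, s)" if "z \<in> snd C0 ` fst C0" for z s
  proof -
    have "inj_on (snd E0) (fst E0)"
      using chart_inj[OF diff_AS C0(1)] by (auto simp: inj_on_def E0)
    moreover have "(chart_inv C0 z, s) \<in> fst E0" "snd E0 (chart_inv C0 z, s) = (z, s)"
      using chart_inv_mem[OF that] chart_apply_inv[OF that] by (simp_all add: E0)
    ultimately show ?thesis unfolding chart_inv_def[of E0] by (rule inv_into_f_eq)
  qed
  define \<tau> where "\<tau> = snd C \<circ> chart_inv C0"
  define L where "L = fderiv \<tau> (snd C0 p)"
  have \<tau>d: "\<tau> differentiable (at (snd C0 p))"
    unfolding \<tau>_def by (rule transition_differentiable[OF diff_AS C0(1) C C0(2) pC])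
  have \<tau>p: "\<tau> (snd C0 p) = snd C p" by (simp add: \<tau>_def chart_inv_apply[OF diff_AS C0])
  define O0 where "O0 = snd C0 ` (fst C0 \<inter> fst C) \<times> (UNIV :: real set)"
  have O0: "open O0" "(snd C0 p, t) \<in> O0"
    using open_overlap[OF diff_AS C0(1) C] C0(2) pC by (auto simp: O0_def open_Times)
  have eq: "(snd c \<circ> \<Phi> \<circ> chart_inv E0) z = (F \<circ> (\<lambda>z. (\<tau> (fst z), snd z))) z" if zO: "z \<in> O0" for z
  proof -
    obtain q' s where q': "z = (snd C0 q', s)" "q' \<in> fst C0" "q' \<in> fst C" using zO by (auto simp: O0_def)
    show ?thesis
      using inv0[of "snd C0 q'" s] q' chart_inv_apply[OF diff_AS C0(1) q'(2)] chart_inv_apply[OF diff_AS C q'(3)]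
      by (simp add: F_def coord_flow_def \<tau>_def)
  qed
  have dT: "((\<lambda>z. (\<tau> (fst z), snd z)) has_derivative (\<lambda>v. (L (fst v), snd v))) (at (snd C0 p, t))"
  proof (rule has_derivative_Pair)
    have "(fst has_derivative fst) (at (snd C0 p, t))" by (auto intro!: derivative_eq_intros)
    then show "((\<lambda>z. \<tau> (fst z)) has_derivative (\<lambda>v. L (fst v))) (at (snd C0 p, t))"
      unfolding L_def by (rule has_derivative_compose) (simp add: has_frechet[OF \<tau>d])
  qed (auto intro!: derivative_eq_intros)
  have "dflow A g AS \<xi> (\<pi> q) v = fderiv F y (L (fst v), snd v)" for v
  proof -
    have "dflow A g AS \<xi> (\<pi> q) v = fderiv (snd c \<circ> \<Phi> \<circ> chart_inv E0) (snd E0 (p, t)) v"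
      by (simp add: dflow_def mfderiv_def \<pi>q \<Phi>q E0_def[symmetric] c_def)
    also have "snd E0 (p, t) = (snd C0 p, t)" by (simp add: E0)
    also have "fderiv (snd c \<circ> \<Phi> \<circ> chart_inv E0) (snd C0 p, t) =
        fderiv (F \<circ> (\<lambda>z. (\<tau> (fst z), snd z))) (snd C0 p, t)"
      by (rule frechet_derivative_transform(1)[OF O0 eq])
    also have "\<dots> v = fderiv F y (L (fst v), snd v)"
      using frechet_derivative_comp[of "\<lambda>z. (\<tau> (fst z), snd z)" "(snd C0 p, t)" F v] F_diff dT
      by (simp add: \<tau>p yp[symmetric] frechet_eq[OF dT] differentiableI)
    finally show ?thesis .
  qed
  moreover have "linear L" unfolding L_def by (rule linear_frechet[OF \<tau>d])
  moreover have "surj L"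
  proof (rule surjI)
    fix u show "L (fderiv (snd C0 \<circ> chart_inv C) (snd C p) u) = u"
      unfolding L_def \<tau>_def
      by (simp add: frechet_transition_comp[OF diff_AS C C0(1) C pC C0(2) pC] frechet_transition_self[OF diff_AS C pC])
  qed
  ultimately show ?thesis using that by force
qed

lemma null_field_pref: "null_field A g AS \<xi> V q = fderiv F y (0, 1)"
proof -
  obtain L where L: "linear L" "\<And>u r. dflow A g AS \<xi> (\<pi> q) (u, r) = fderiv F y (L u, r)"
    using dflow_coord by metis
  then show ?thesis by (simp add: null_field_def linear_0)
qed

lemma screen_pref: "screen A g AS \<xi> V q = range (\<lambda>u. fderiv F y (u, 0))"
proof -
  obtain L where L: "surj L" "\<And>u r. dflow A g AS \<xi> (\<pi> q) (u, r) = fderiv F y (L u, r)"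
    using dflow_coord by metis
  have "range (\<lambda>u. fderiv F y (L u, 0)) = (\<lambda>u. fderiv F y (u, 0)) ` range L"
    by (simp add: image_image)
  then show ?thesis using L by (simp add: screen_def)
qed

end

section \<open>The null field and its covariant derivative in flow coordinates\<close>

lemma null_field_coord:
  assumes C: "C \<in> AS" and y: "y \<in> coord_dom C" and c: "c \<in> A" "coord_flow C y \<in> fst c"
  shows "tan_coord A c (coord_flow C y) (null_field A g AS \<xi> V (coord_flow C y)) =
    fderiv (snd c \<circ> coord_flow C) y (0, 1)"
  unfolding null_field_pref[OF C y] tan_coord_def
  using smooth_param_change_chart[OF diff_A coord_flow_smooth[OF C] pref_chart(1)[OF C y] c(1) y pref_chart(2)[OF C y] c(2)]
  by simp

lemma diff_NS: "diff_atlas NS"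
  unfolding NS_def by (rule diff_atlas_sub_atlas[OF SA])

context
  fixes C y q c F
  assumes C: "C \<in> AS" and y: "y \<in> coord_dom C"
  defines "q \<equiv> coord_flow C y"
  defines "c \<equiv> chart_at A q"
  defines "F \<equiv> snd c \<circ> coord_flow C"
begin

private lemma K: "hyper_chart C \<in> NS" "q \<in> fst (hyper_chart C)" "snd (hyper_chart C) q = y"
  using hyper_chart[OF C] hyper_chart_mem[OF C y] hyper_chart_apply[OF C y] by (simp_all add: q_def)

private lemma cq: "c \<in> A" "q \<in> fst c"
  using pref_chart[OF C y] by (simp_all add: c_def q_def)

private lemma frechet_hyper: "fderiv (h \<circ> chart_inv (hyper_chart C)) y = fderiv (h \<circ> coord_flow C) y"
  by (rule frechet_derivative_transform(1)[OF coord_dom_open[OF C] y]) (simp add: hyper_chart_inv[OF C])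

lemma mfderiv_hyper: "mfderiv NS A (\<lambda>q. q) q (tan_vec NS (hyper_chart C) q w) = fderiv F y w"
  using mfderiv_incl[OF SA NS_def K(1,2), of w] by (simp add: K(3) frechet_hyper c_def F_def)

lemma tangent_space_hyper: "tangent_space A NS q = range (fderiv F y)"
  using tangent_space_chart[OF SA NS_def K(1,2)] by (simp add: K(3) frechet_hyper c_def F_def)

text \<open>Injectivity of the inclusion differential lets the \<open>inv\<close> in
  \<open>nabla_null\<close> recover the coordinate vector \<open>w\<close>. In
  \<open>hyper_chart C\<close> the null field is the derivative of \<open>F\<close> in the last
  coordinate.\<close>

lemma nabla_null_coord:
  "nabla_null A g AS \<xi> V q (fderiv F y w) =
    fderiv (\<lambda>z. fderiv F z (0, 1)) y w +
    christoffel A g c (F y) (fderiv F y w) (fderiv F y (0, 1))"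
proof -
  define K where "K = hyper_chart C"
  define h where "h q' = tan_coord A c q' (null_field A g AS \<xi> V q')" for q'
  note sF = smooth_F[OF C y, folded q_def, folded c_def, folded F_def]
  note oF = open_F_dom[OF C y, folded q_def, folded c_def]
  note yF = y_F_dom[OF C y, folded q_def, folded c_def]
  have inv: "inv (mfderiv NS A (\<lambda>q. q) q) (fderiv F y w) = tan_vec NS K q w"
    unfolding mfderiv_hyper[symmetric] K_def by (rule inv_f_f[OF inj_mfderiv_incl[OF SA NS_def K(1,2)]])
  have hK: "(h \<circ> chart_inv K) z = fderiv F z (0, 1)" if "z \<in> coord_dom C \<inter> coord_flow C -` fst c" for z
    using that null_field_coord[OF C _ cq(1), of z] by (simp add: h_def K_def hyper_chart_inv[OF C] F_def)
  have hd: "(\<lambda>z. fderiv F z (0, 1)) differentiable (at y)"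
    by (rule smooth_on_differentiable[OF smooth_on_frechet[OF sF] yF])
  note tr = frechet_derivative_transform[OF oF yF, of "h \<circ> chart_inv K" "\<lambda>z. fderiv F z (0, 1)"]
  have "(h \<circ> chart_inv K) differentiable (at y)" using tr(2) hK hd by blast
  then have "mfderiv NS euclid_atlas h q (tan_vec NS K q w) = fderiv (h \<circ> chart_inv K) y w"
    using mfderiv_tan_vec[OF diff_NS K(1,2), of euclid_atlas h w]
    by (simp add: chart_at_euclid K(3) K_def comp_def)
  also have "fderiv (h \<circ> chart_inv K) y = fderiv (\<lambda>z. fderiv F z (0, 1)) y"
    using tr(1) hK by blast
  finally have 1: "mfderiv NS euclid_atlas h q (tan_vec NS K q w) =
      fderiv (\<lambda>z. fderiv F z (0, 1)) y w" .
  have 2: "mfderiv NS A (\<lambda>q. q) q (tan_vec NS K q w) = fderiv F y w"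
    unfolding K_def by (rule mfderiv_hyper)
  have 3: "null_field A g AS \<xi> V q = fderiv F y (0, 1)"
    using null_field_pref[OF C y] by (simp add: q_def c_def F_def)
  have "F y = snd c q" by (simp add: F_def q_def)
  then show ?thesis
    unfolding nabla_null_def cov_along_def inv c_def[symmetric] 2 3 1[unfolded h_def[abs_def]] by simp
qed

end

text \<open>The metric of the leaf at time \<open>s\<close> pulled back to \<open>S\<close>, in the
  coordinates of \<open>C\<close>. It is written with the preferred ambient chart of each point, so
  that it makes sense along the whole flow line.\<close>

definition "slice_metric C s x u v =
  g (coord_flow C (x, s))
    (fderiv (snd (chart_at A (coord_flow C (x, s))) \<circ> coord_flow C) (x, s) (u, 0))
    (fderiv (snd (chart_at A (coord_flow C (x, s))) \<circ> coord_flow C) (x, s) (v, 0))"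

lemma slice_metric_coord:
  assumes C: "C \<in> AS" and y: "(x, s) \<in> coord_dom C" and c: "c \<in> A" "coord_flow C (x, s) \<in> fst c"
  shows "slice_metric C s x u v = G c (snd c (coord_flow C (x, s)))
    (fderiv (snd c \<circ> coord_flow C) (x, s) (u, 0))
    (fderiv (snd c \<circ> coord_flow C) (x, s) (v, 0))"
proof -
  have "tan_coord A c (coord_flow C (x, s))
      (fderiv (snd (chart_at A (coord_flow C (x, s))) \<circ> coord_flow C) (x, s) w) =
      fderiv (snd c \<circ> coord_flow C) (x, s) w" for w
    unfolding tan_coord_def
    using smooth_param_change_chart[OF diff_A coord_flow_smooth[OF C] pref_chart(1)[OF C y] c(1) y pref_chart(2)[OF C y] c(2)]
    by simp
  then show ?thesis unfolding slice_metric_def by (subst metric_via_coord[OF diff_A c]) simp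
qed

end

locale umbilic_flow = null_flow A g S AS \<xi> V
  for A :: "('m, 'e::euclidean_space) atlas" and g S and AS :: "('m, real ^ 'n) atlas" and \<xi> V +
  fixes \<mu> :: "'m \<Rightarrow> real"
  assumes \<mu>_smooth: "smooth_on_set A euclid_atlas (hypersurface A g AS \<xi> V) \<mu>"
    and umbilic: "\<And>q X Y. q \<in> hypersurface A g AS \<xi> V \<Longrightarrow>
      X \<in> tangent_space A (hyper_atlas A g AS \<xi> V) q \<Longrightarrow> Y \<in> tangent_space A (hyper_atlas A g AS \<xi> V) q \<Longrightarrow>
      null_second_form A g AS \<xi> V q X Y = \<mu> q * g q X Y"
begin

lemma slice_metric_derivative:
  assumes C: "C \<in> AS" and y: "(x, s) \<in> coord_dom C"
  shows "((\<lambda>r. slice_metric C r x u v) has_real_derivative - 2 * \<mu> (coord_flow C (x, s)) * slice_metric C s x u v) (at s)"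
proof -
  define q where "q = coord_flow C (x, s)"
  define c where "c = chart_at A q"
  define F where "F = snd c \<circ> coord_flow C"
  define X where "X w = fderiv F (x, s) w" for w
  note sF = smooth_F[OF C y, folded q_def, folded c_def, folded F_def]
  note oF = open_F_dom[OF C y, folded q_def, folded c_def]
  note yF = y_F_dom[OF C y, folded q_def, folded c_def]
  note cq = pref_chart[OF C y, folded q_def, folded c_def]
  have q\<Sigma>: "q \<in> \<Sigma>" using coord_flow_\<Sigma>[OF y] by (simp add: q_def)
  have qA: "q \<in> points A" using q\<Sigma> \<Sigma>_points by blast
  have Fy: "F (x, s) = snd c q" by (simp add: F_def q_def)
  have img: "F (x, s) \<in> snd c ` fst c" using cq by (simp add: Fy)
  have line: "((\<lambda>r. (x, r)) has_derivative (\<lambda>r. (0, r))) (at s)"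
    by (intro has_derivative_Pair has_derivative_ident has_derivative_const)
  have along: "((\<lambda>r. f (x, r)) has_vector_derivative fderiv f (x, s) (0, 1)) (at s)"
    if "f differentiable (at (x, s))" for f :: "(real ^ 'n) \<times> real \<Rightarrow> 'e"
  proof -
    have "((\<lambda>r. f (x, r)) has_derivative (\<lambda>r. fderiv f (x, s) (0, r))) (at s)"
      by (rule has_derivative_compose[OF line has_frechet[OF that]])
    moreover have "(\<lambda>r. fderiv f (x, s) (0, r)) = (\<lambda>r. r *\<^sub>R fderiv f (x, s) (0, 1))"
    proof (rule ext)
      fix r :: real
      have "(0, r) = r *\<^sub>R ((0, 1) :: (real ^ 'n) \<times> real)" by simp
      then show "fderiv f (x, s) (0, r) = r *\<^sub>R fderiv f (x, s) (0, 1)"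
        by (simp only: linear_scale[OF linear_frechet[OF that]])
    qed
    ultimately show ?thesis by (simp only: has_vector_derivative_def)
  qed
  \<comment> \<open>The equality of mixed derivatives used here, with the symmetry of the
    Christoffel symbol used in \<open>nabla\<close>, is the coordinate form of torsion-freeness
    applied to the commuting fields of the flow coordinates.\<close>
  have da: "((\<lambda>r. fderiv F (x, r) (w, 0)) has_vector_derivative
      fderiv (\<lambda>z. fderiv F z (0, 1)) (x, s) (w, 0)) (at s)" for w
    using along[OF smooth_on_differentiable[OF smooth_on_frechet[OF sF] yF], of "(w, 0)"]
    unfolding symmetric_second_derivative[OF oF yF sF, of "(w, 0)" "(0, 1)"] .
  have dF: "((\<lambda>r. F (x, r)) has_vector_derivative X (0, 1)) (at s)"
    unfolding X_def by (rule along[OF smooth_on_differentiable[OF sF yF]])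
  have nabla: "nabla_null A g AS \<xi> V q (X (w, 0)) =
      fderiv (\<lambda>z. fderiv F z (0, 1)) (x, s) (w, 0) +
      christoffel A g c (F (x, s)) (X (0, 1)) (X (w, 0))" for w
    using nabla_null_coord[OF C y, folded q_def, folded c_def, folded F_def, of "(w, 0)"]
      christoffel_spec(2)[OF cq(1) img, of "X (w, 0)" "X (0, 1)"]
    by (simp add: X_def)
  have Gg: "G c (F (x, s)) a b = g q a b" for a b
    unfolding Fy by (simp add: metric_coord_at[OF diff_A cq]) (simp add: c_def tan_vec_chart_at[OF diff_A qA])
  have TX: "X w \<in> tangent_space A NS q" for w
    unfolding tangent_space_hyper[OF C y, folded q_def, folded c_def, folded F_def] X_def by simp
  have umb: "g q (nabla_null A g AS \<xi> V q (X w)) (X w') = - \<mu> q * g q (X w) (X w')" for w w'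
    using umbilic[OF q\<Sigma> TX TX, of w w'] by (simp add: null_second_form_def)
  have "((\<lambda>r. G c (F (x, r)) (fderiv F (x, r) (u, 0)) (fderiv F (x, r) (v, 0)))
      has_real_derivative g q (nabla_null A g AS \<xi> V q (X (u, 0))) (X (v, 0)) +
        g q (X (u, 0)) (nabla_null A g AS \<xi> V q (X (v, 0)))) (at s)"
    using metric_curve_derivative[OF cq(1) img dF da[of u] da[of v]]
    unfolding Gg[symmetric] nabla unfolding X_def .
  also have "g q (nabla_null A g AS \<xi> V q (X (u, 0))) (X (v, 0)) +
        g q (X (u, 0)) (nabla_null A g AS \<xi> V q (X (v, 0))) = - 2 * \<mu> q * slice_metric C s x u v"
  proof -
    have "slice_metric C s x u v = g q (X (u, 0)) (X (v, 0))"
      by (simp only: slice_metric_def q_def c_def F_def X_def)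
    then show ?thesis
      using umb[of "(u, 0)" "(v, 0)"] umb[of "(v, 0)" "(u, 0)"] g_sym[OF qA, of "X (u, 0)" "X (v, 0)"]
        g_sym[OF qA, of "X (u, 0)" "nabla_null A g AS \<xi> V q (X (v, 0))"] by simp
  qed
  finally have D: "((\<lambda>r. G c (F (x, r)) (fderiv F (x, r) (u, 0)) (fderiv F (x, r) (v, 0)))
      has_real_derivative - 2 * \<mu> q * slice_metric C s x u v) (at s)" .
  \<comment> \<open>The ambient chart inside \<open>slice_metric\<close> changes with
    \<open>r\<close>. For \<open>r\<close> near \<open>s\<close> the metric can be evaluated in the
    fixed chart \<open>c\<close>, in which the derivative was computed.\<close>
  have "continuous (at s) (\<lambda>r. (x, r))" using line by (rule has_derivative_continuous)
  then have "\<forall>\<^sub>F r in nhds s. (x, r) \<in> coord_dom C \<inter> coord_flow C -` fst c"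
    by (rule eventually_nhds_continuous) (rule oF, rule yF)
  then have "\<forall>\<^sub>F r in nhds s. slice_metric C r x u v =
      G c (F (x, r)) (fderiv F (x, r) (u, 0)) (fderiv F (x, r) (v, 0))"
    by eventually_elim (use slice_metric_coord[OF C _ cq(1)] in \<open>simp add: F_def\<close>)
  from DERIV_cong_ev[OF refl this refl] D show ?thesis by (simp add: q_def)
qed

section \<open>Integration of the evolution equation along flow lines\<close>

lemma continuous_\<mu>: "continuous_map (subtopology (manifold_top A) \<Sigma>) euclideanreal \<mu>"
  using continuous_map_smooth_on_set[OF diff_A smooth_atlas_imp_diff_atlas[OF smooth_atlas_euclid] \<mu>_smooth \<Sigma>_points]
  by (simp add: manifold_top_euclid)

lemma continuous_\<mu>_flow: "continuous_map (subtopology (prod_topology (manifold_top A) euclideanreal) \<O>) euclideanreal (\<lambda>z. \<mu> (\<Phi> z))"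
  using continuous_map_compose[OF continuous_flow continuous_\<mu>] by (simp add: comp_def)

lemma continuous_\<mu>_line:
  assumes "\<And>s. s \<in> J \<Longrightarrow> (p, s) \<in> \<O>"
  shows "continuous_on J (\<lambda>s. \<mu> (\<Phi> (p, s)))"
proof (cases "J = {}")
  case False
  then have p: "p \<in> points A" using assms flow_dom_S S_subset by blast
  have "continuous_map (top_of_set J) (prod_topology (manifold_top A) euclideanreal) (\<lambda>s. (p, s))"
    by (intro continuous_map_pairedI continuous_map_from_subtopology[OF continuous_map_id[unfolded id_def]])
      (simp add: p topspace_manifold_top[OF diff_A])
  then have "continuous_map (top_of_set J) (subtopology (prod_topology (manifold_top A) euclideanreal) \<O>) (\<lambda>s. (p, s))"
    using assms by (auto simp: continuous_map_in_subtopology)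
  from continuous_map_compose[OF this continuous_\<mu>_flow] show ?thesis by (simp add: comp_def)
qed simp

text \<open>\<open>t\<close> may have either sign; one-sided derivatives and integrals are therefore
  taken on this interval, which is the form expected by the fundamental theorem for
  \<open>LBINT\<close>.\<close>

lemma closed_segment_min_max: "closed_segment 0 t = {min 0 t..max 0 t}" for t :: real
  by (auto simp: closed_segment_eq_real_ivl)

lemma integral_line_derivative:
  assumes t: "(p, t) \<in> \<O>" and s: "s \<in> {min 0 t..max 0 t}"
  shows "((\<lambda>r. LBINT s=0..r. \<mu> (\<Phi> (p, s))) has_vector_derivative \<mu> (\<Phi> (p, s))) (at s within {min 0 t..max 0 t})"
proof (rule interval_integral_FTC2[of "min 0 t" 0 "max 0 t" "\<lambda>s. \<mu> (\<Phi> (p, s))" s, unfolded zero_ereal_def[symmetric]])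
  show "continuous_on {min 0 t..max 0 t} (\<lambda>s. \<mu> (\<Phi> (p, s)))"
    by (rule continuous_\<mu>_line) (use flow_dom_segment[OF t] in \<open>simp only: closed_segment_min_max\<close>)
qed (use s in auto)

lemma slice_metric_evolution:
  assumes C: "C \<in> AS" and y: "(x, t) \<in> coord_dom C"
  shows "slice_metric C t x u v = exp (- 2 * (LBINT s=0..t. \<mu> (coord_flow C (x, s)))) * slice_metric C 0 x u v"
proof -
  define p where "p = chart_inv C x"
  let ?I = "{min 0 t..max 0 t}"
  have pt: "(p, t) \<in> \<O>" using y by (simp add: coord_dom_def p_def)
  define M where "M r = (LBINT s=0..r. \<mu> (\<Phi> (p, s)))" for r :: real
  have cf: "coord_flow C (x, s) = \<Phi> (p, s)" for s by (simp add: coord_flow_def p_def)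
  have dom: "(x, s) \<in> coord_dom C" if "s \<in> ?I" for s
    using y flow_dom_segment[OF pt, unfolded closed_segment_min_max, OF that] by (simp add: coord_dom_def p_def)
  \<comment> \<open>Integrating factor: by \<open>slice_metric_derivative\<close> the function
    \<open>f\<close> has derivative zero.\<close>
  define f where "f r = slice_metric C r x u v * exp (2 * M r)" for r
  have "(f has_vector_derivative 0) (at s within ?I)" if s: "s \<in> ?I" for s
  proof -
    have 1: "((\<lambda>r. slice_metric C r x u v) has_real_derivative - 2 * \<mu> (\<Phi> (p, s)) * slice_metric C s x u v) (at s within ?I)"
      using slice_metric_derivative[OF C dom[OF s], of u v] unfolding cf by (rule DERIV_subset) simp
    have 2: "(M has_real_derivative \<mu> (\<Phi> (p, s))) (at s within ?I)"
      unfolding M_def has_real_derivative_iff_has_vector_derivative by (rule integral_line_derivative[OF pt s])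
    have "(f has_real_derivative 0) (at s within ?I)"
      unfolding f_def by (rule derivative_eq_intros 1 2 refl)+ (simp add: algebra_simps)
    then show ?thesis by (simp add: has_real_derivative_iff_has_vector_derivative)
  qed
  then have "f t = f 0"
    by (intro has_derivative_zero_unique[of ?I f]) (auto simp: has_vector_derivative_def)
  then have "slice_metric C t x u v * exp (2 * M t) = slice_metric C 0 x u v"
    by (simp add: f_def M_def zero_ereal_def[symmetric])
  then show ?thesis unfolding cf M_def[symmetric] by (simp add: exp_minus field_simps)
qed

lemma zero_T: "0 \<in> T" by (simp add: common_domain_iff flow_dom_0)

text \<open>The inverse of \<open>leaf_chart t C\<close> is the flow at time \<open>t\<close>, so
  its derivative is that of \<open>coord_flow C\<close> on vectors \<open>(u, 0)\<close>.\<close>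

lemma slice_metric_leaf:
  assumes t: "t \<in> T" and C: "C \<in> AS" and x: "x \<in> snd C ` fst C"
  shows "metric_coord (sub_atlas A (leaf A g AS \<xi> t) :: ('m, real ^ 'n) atlas)
    (induced_metric A g (sub_atlas A (leaf A g AS \<xi> t) :: ('m, real ^ 'n) atlas)) (leaf_chart t C) x u v = slice_metric C t x u v"
proof -
  let ?N = "sub_atlas A (leaf A g AS \<xi> t) :: ('m, real ^ 'n) atlas"
  define q where "q = leaf_param t C x"
  note dom = slice_dom[OF t C x]
  have qc: "q = coord_flow C (x, t)" by (simp add: q_def leaf_param_def[OF t])
  define c where "c = chart_at A q"
  note cq = pref_chart[OF C dom, folded qc, folded c_def]
  have qL: "q \<in> fst (leaf_chart t C)" using x by (simp add: leaf_chart_def[OF t] q_def)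
  have sq: "snd (leaf_chart t C) q = x" unfolding q_def by (rule leaf_chart_apply[OF t C x])
  have "fderiv (snd c \<circ> chart_inv (leaf_chart t C)) x w =
      fderiv (snd c \<circ> coord_flow C) (x, t) (w, 0)" for w
  proof -
    have "fderiv (snd c \<circ> chart_inv (leaf_chart t C)) x = fderiv (snd c \<circ> leaf_param t C) x"
      by (rule frechet_derivative_transform(1)[OF \<Omega>_open[OF C] x]) (simp add: leaf_chart_inv[OF t C])
    then show ?thesis using frechet_leaf_param[OF t C x cq(1)] cq(2) by (simp add: q_def)
  qed
  then show ?thesis
    using induced_metric_coord[OF SA refl leaf_chart[OF t C] qL cq, of g u v]
    by (simp add: sq slice_metric_coord[OF C dom cq(1)] cq qc[symmetric])
qed

text \<open>At time 0 the flow is the identity on \<open>S\<close> by \<open>flow_0\<close>, so it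
  has the same derivative along \<open>S\<close> as the inverse chart.\<close>

lemma slice_metric_0:
  assumes C: "C \<in> AS" and x: "x \<in> snd C ` fst C"
  shows "slice_metric C 0 x u v = metric_coord AS (induced_metric A g AS) C x u v"
proof -
  define p where "p = chart_inv C x"
  have pC: "p \<in> fst C" "snd C p = x" using chart_inv_mem[OF x] chart_apply_inv[OF x] by (simp_all add: p_def)
  note dom = slice_dom[OF zero_T C x]
  have p: "coord_flow C (x, 0) = p" using flow_0[OF \<iota>_S[OF C x]] by (simp add: coord_flow_def p_def)
  define c where "c = chart_at A p"
  note cq = pref_chart[OF C dom, unfolded p, folded c_def]
  have "fderiv (snd c \<circ> chart_inv C) x w =
      fderiv (snd c \<circ> coord_flow C) (x, 0) (w, 0)" for w
  proof -
    have "fderiv (snd c \<circ> chart_inv C) x = fderiv (snd c \<circ> leaf_param 0 C) x"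
      by (rule frechet_derivative_transform(1)[OF \<Omega>_open[OF C] x])
        (use flow_0[OF \<iota>_S[OF C]] in \<open>simp add: leaf_param_eq[OF zero_T C]\<close>)
    moreover have "leaf_param 0 C x \<in> fst c" using cq(2) p by (simp add: leaf_param_def[OF zero_T])
    ultimately show ?thesis using frechet_leaf_param[OF zero_T C x cq(1)] by simp
  qed
  then show ?thesis
    using induced_metric_coord[OF SA AS_def C pC(1) cq, of g u v]
    by (simp add: pC(2) slice_metric_coord[OF C dom cq(1)] cq p)
qed

text \<open>At time 0 this is the spacelike hypothesis, and \<open>slice_metric_evolution\<close>
  only multiplies by a positive exponential.\<close>

lemma slice_metric_pos:
  assumes C: "C \<in> AS" and y: "(x, t) \<in> coord_dom C" and u: "u \<noteq> 0"
  shows "slice_metric C t x u u > 0"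
proof -
  have x: "x \<in> snd C ` fst C" using y by (auto simp: coord_dom_def)
  define p where "p = chart_inv C x"
  have pC: "p \<in> fst C" "snd C p = x" using chart_inv_mem[OF x] chart_apply_inv[OF x] by (simp_all add: p_def)
  have p: "p \<in> S" "p \<in> points AS" "p \<in> points A" using \<iota>_S[OF C x] S_subset points_AS by (auto simp: p_def)
  define c where "c = chart_at A p"
  have c: "c \<in> A" "p \<in> fst c" using chart_at_mem[OF p(3)] by (simp_all add: c_def)
  let ?X = "fderiv (snd c \<circ> chart_inv C) x"
  have cd: "chart_inv C x \<in> fst c" using c by (simp add: p_def)
  have "?X u \<in> tangent_space A AS p"
    using tangent_space_chart[OF SA AS_def C pC(1)] by (simp add: pC(2) c_def)
  moreover have "?X u \<noteq> 0"
  proof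
    assume 0: "?X u = 0"
    have "linear ?X"
      by (rule linear_frechet, rule smooth_param_differentiable[OF \<iota>_smooth[OF C] c(1) x cd])
    then have "?X 0 = 0" by (rule linear_0)
    then show False using sub_chart_immersion[OF SA AS_sub_atlas[OF C] x c(1) cd] 0 u by (metis injD)
  qed
  ultimately have "g p (?X u) (?X u) > 0" using spacelike_S p(2) by (simp add: spacelike_def)
  moreover have "slice_metric C 0 x u u = g p (?X u) (?X u)"
    using slice_metric_0[OF C x, of u u] induced_metric_coord[OF SA AS_def C pC(1) c, of g u u]
    by (simp add: pC(2) metric_coord_at[OF diff_A c]) (simp add: c_def tan_vec_chart_at[OF diff_A p(3)])
  ultimately show ?thesis using slice_metric_evolution[OF C y, of u u] by simp
qed

lemma trace_on_scale:
  fixes W :: "'e set"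
  assumes "subspace W" "\<And>X. X \<in> W \<Longrightarrow> f X = k *\<^sub>R X"
  shows "trace_on W f = real (dim W) * k"
proof -
  define B where "B = (SOME B. independent B \<and> span B = W)"
  have "\<exists>B. independent B \<and> span B = W"
    using basis_exists[of W] assms(1) by (metis span_minimal subset_antisym)
  from someI_ex[OF this] have B: "independent B" "span B = W" by (simp_all add: B_def)
  have "trace_on W f = (\<Sum>b\<in>B. representation B (f b) b)" by (simp add: trace_on_def B_def[symmetric] Let_def)
  also have "\<dots> = (\<Sum>b\<in>B. k)"
  proof (rule sum.cong[OF refl])
    fix b assume b: "b \<in> B"
    then have bs: "b \<in> span B" by (rule span_base)
    have "f b = k *\<^sub>R b" by (rule assms(2)) (use bs B(2) in simp)
    then show "representation B (f b) b = k"
      by (simp add: representation_scale[OF B(1) bs] representation_basis[OF B(1) b])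
  qed
  also have "\<dots> = real (card B) * k" by simp
  also have "card B = dim W"
  proof -
    have "span B = span W" using span_span[of B] unfolding B(2) ..
    from dim_eq_card[OF this B(1)] show ?thesis ..
  qed
  finally show ?thesis .
qed

text \<open>By \<open>slice_metric_pos\<close> the metric is positive definite on the screen. Hence
  the description in \<open>screen_shape\<close> has a unique solution, multiplication by
  \<open>\<mu> q\<close>, whose trace is the dimension of the screen times
  \<open>\<mu> q\<close>.\<close>

lemma expansion_eq:
  assumes "q \<in> \<Sigma>"
  shows "expansion A g AS \<xi> V q = - real CARD('n) * \<mu> q"
proof -
  have "(fst (\<pi> q), snd (\<pi> q)) \<in> \<O>" using flow_inv_dom[OF assms] by simp
  moreover obtain C where C: "C \<in> AS" "fst (\<pi> q) \<in> fst C" using chart_AS_ex fst_\<pi>_S[OF assms] by blast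
  ultimately have "(snd C (fst (\<pi> q)), snd (\<pi> q)) \<in> coord_dom C \<and> coord_flow C (snd C (fst (\<pi> q)), snd (\<pi> q)) = q"
    using coord_flow_apply[OF C(1) _ C(2)] flow_flow_inv[OF assms] by simp
  then obtain x t where y: "(x, t) \<in> coord_dom C" and q: "q = coord_flow C (x, t)" by metis
  define c where "c = chart_at A q"
  define F where "F = snd c \<circ> coord_flow C"
  define X where "X u = fderiv F (x, t) (u, 0)" for u
  have qA: "q \<in> points A" using assms \<Sigma>_points by blast
  note cq = pref_chart[OF C(1) y, folded q, folded c_def]
  have dF: "F differentiable (at (x, t))" using F_diff[OF C(1) y] by (simp add: F_def c_def q)
  have lin: "linear X"
    unfolding X_def by (intro linearI)
      (simp_all add: linear_add[OF linear_frechet[OF dF], symmetric] linear_scale[OF linear_frechet[OF dF], symmetric])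
  have sl: "slice_metric C t x u v = g q (X u) (X v)" for u v
    by (simp add: slice_metric_def X_def F_def c_def q)
  have pos: "g q (X u) (X u) > 0" if "u \<noteq> 0" for u using slice_metric_pos[OF C(1) y that] by (simp add: sl)
  have inj: "inj X"
    unfolding linear_injective_0[OF lin]
    using pos bilinear_lzero[OF g_bilinear[OF qA]] by (metis less_irrefl)
  define W where "W = screen A g AS \<xi> V q"
  have W: "W = range X" using screen_pref[OF C(1) y] by (simp add: W_def X_def[abs_def] F_def c_def q)
  have T_hyper: "tangent_space A NS q = range (fderiv F (x, t))"
    using tangent_space_hyper[OF C(1) y] by (simp add: F_def c_def q)
  then have WT: "W \<subseteq> tangent_space A NS q" by (auto simp: W X_def)
  have sub: "subspace W" unfolding W by (rule linear_subspace_image[OF lin subspace_UNIV])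
  have "screen_shape A g AS \<xi> V q Y = \<mu> q *\<^sub>R Y" if Y: "Y \<in> W" for Y
    unfolding screen_shape_def
  proof (rule the_equality)
    show "\<mu> q *\<^sub>R Y \<in> screen A g AS \<xi> V q \<and>
        (\<forall>Y'\<in>tangent_space A NS q. null_second_form A g AS \<xi> V q Y Y' = g q (\<mu> q *\<^sub>R Y) Y')"
    proof (intro conjI ballI)
      show "\<mu> q *\<^sub>R Y \<in> screen A g AS \<xi> V q" using subspace_scale[OF sub Y] by (simp add: W_def)
      fix Y' assume "Y' \<in> tangent_space A NS q"
      from umbilic[OF assms subsetD[OF WT Y] this]
      show "null_second_form A g AS \<xi> V q Y Y' = g q (\<mu> q *\<^sub>R Y) Y'"
        by (simp add: bilinear_lmul[OF g_bilinear[OF qA]])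
    qed
  next
    fix Z assume Z: "Z \<in> screen A g AS \<xi> V q \<and>
        (\<forall>Y'\<in>tangent_space A NS q. null_second_form A g AS \<xi> V q Y Y' = g q Z Y')"
    \<comment> \<open>Uniqueness: the difference of two solutions is a screen vector orthogonal to
      itself.\<close>
    define D where "D = Z - \<mu> q *\<^sub>R Y"
    have "D \<in> W" using Z Y sub unfolding D_def W_def[symmetric] by (simp add: subspace_diff subspace_scale)
    then obtain u where u: "D = X u" by (auto simp: W)
    have DT: "D \<in> tangent_space A NS q" using \<open>D \<in> W\<close> WT by blast
    have "g q Z D = \<mu> q * g q Y D"
      using Z DT umbilic[OF assms subsetD[OF WT Y] DT] by simp
    then have "g q D D = 0"
      unfolding D_def by (simp add: bilinear_lsub[OF g_bilinear[OF qA]] bilinear_lmul[OF g_bilinear[OF qA]])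
    then have "u = 0" using pos[of u] u by auto
    then show "Z = \<mu> q *\<^sub>R Y" using u linear_0[OF lin] by (simp add: D_def)
  qed
  then have "trace_on W (screen_shape A g AS \<xi> V q) = real (dim W) * \<mu> q"
    by (rule trace_on_scale[OF sub])
  moreover have "dim W = CARD('n)"
    unfolding W using dim_image_eq[OF lin, of UNIV] inj by simp
  ultimately show ?thesis by (simp add: expansion_def W_def)
qed

end

section \<open>Volumes of the leaves\<close>

lemma det_scale_entries:
  fixes m :: "'n::finite \<Rightarrow> 'n \<Rightarrow> real"
  shows "det (\<chi> i j. k * m i j) = k ^ CARD('n) * det (\<chi> i j. m i j)"
  by (simp add: det_def prod.distrib sum_distrib_left mult_ac)

section \<open>Compact submanifolds with their induced metrics\<close>

context lorentz_manifold
begin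

lemma Ck_on_empty: "Ck_on k {} f"
  by (induction k arbitrary: f) auto

text \<open>The chart with empty domain belongs to every \<open>sub_atlas\<close>; in this way the
  empty set is covered as well.\<close>

lemma sub_atlas_nonempty: "sub_atlas A Z \<noteq> ({} :: ('m, 'd::euclidean_space) atlas)"
proof -
  define f :: "'d \<Rightarrow> 'm" where "f = (\<lambda>_. undefined)"
  have "(f ` {}, inv_into {} f) \<in> sub_atlas A Z"
    by (rule sub_atlasI[OF SA])
      (simp_all add: smooth_param_def smooth_on_def Ck_on_empty continuous_map_on_empty)
  then show ?thesis by blast
qed

text \<open>Applied to \<open>S\<close> and to every leaf. Continuity of the coefficients is checked
  near each point, where the induced metric is the pullback of \<open>G c\<close> for one fixed
  ambient chart \<open>c\<close>.\<close>

lemma compact_riemannian_sub_atlas: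
  fixes N :: "('m, real ^ 'n) atlas"
  assumes N_def: "N = sub_atlas A Z" and compact: "compactin (manifold_top A) Z" and pts: "points N = Z"
  shows "compact_riemannian N (induced_metric A g N)"
proof
  show dN: "diff_atlas N" unfolding N_def by (rule diff_atlas_sub_atlas[OF SA])
  show "N \<noteq> {}" unfolding N_def by (rule sub_atlas_nonempty)
  have "manifold_top N = subtopology (manifold_top A) Z"
    using pts unfolding N_def by (rule manifold_top_sub_atlas[OF SA])
  then show "compact_space (manifold_top N)" using compact by (simp add: compact_space_subtopology)
  have ZA: "Z \<subseteq> points A" using compactin_subset_topspace[OF compact] by (simp add: topspace_manifold_top[OF diff_A])
  fix p assume p: "p \<in> points N"
  define C where "C = chart_at N p"
  have C: "C \<in> N" "p \<in> fst C" using chart_at_mem[OF p] by (simp_all add: C_def)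
  have pA: "p \<in> points A" using p pts ZA by auto
  note ca = chart_at_mem[OF pA]
  have "mfderiv N A (\<lambda>q. q) p v =
      fderiv (snd (chart_at A p) \<circ> chart_inv C) (snd C p) (tan_coord N C p v)" for v
    using mfderiv_incl[OF SA N_def C, of "tan_coord N C p v"] by (simp add: tan_vec_coord[OF dN C])
  then have "mfderiv N A (\<lambda>q. q) p =
      (\<lambda>v. fderiv (snd (chart_at A p) \<circ> chart_inv C) (snd C p) (tan_coord N C p v))"
    by (rule ext)
  moreover have "linear (\<lambda>v. fderiv (snd (chart_at A p) \<circ> chart_inv C) (snd C p) (tan_coord N C p v))"
    by (rule linear_compose[unfolded o_def, OF linear_tan_coord[OF dN C] linear_frechet[OF sub_chart_differentiable[OF SA N_def C ca]]])
  ultimately have lin: "linear (mfderiv N A (\<lambda>q. q) p)" by (simp only:)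
  show "bilinear (induced_metric A g N p)"
    using g_bilinear[OF pA] linear_compose[OF lin, of "g p _"] linear_compose[OF lin, of "\<lambda>u. g p u _"]
    by (auto simp: bilinear_def comp_def induced_metric_def)
next
  fix C u v assume C: "C \<in> N"
  have dN: "diff_atlas N" unfolding N_def by (rule diff_atlas_sub_atlas[OF SA])
  have C': "C \<in> sub_atlas A Z" using C by (simp add: N_def)
  note sm = sub_chart_smooth[OF SA C']
  show "continuous_on (snd C ` fst C) (\<lambda>x. metric_coord N (induced_metric A g N) C x u v)"
  proof (rule continuous_at_imp_continuous_on, rule ballI)
    fix x assume x: "x \<in> snd C ` fst C"
    define c where "c = chart_at A (chart_inv C x)"
    have pA: "chart_inv C x \<in> points A" using sm x by (auto simp: smooth_param_def)
    have c: "c \<in> A" "chart_inv C x \<in> fst c" using chart_at_mem[OF pA] by (simp_all add: c_def)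
    define f where "f = snd c \<circ> chart_inv C"
    define U where "U = snd C ` fst C \<inter> chart_inv C -` fst c"
    have U: "open U" "x \<in> U" "smooth_on U f" using sm c x by (auto simp: smooth_param_def U_def f_def)
    have fU: "f ` U \<subseteq> snd c ` fst c" by (auto simp: f_def U_def)
    have eq: "(\<Sum>i\<in>Basis. \<Sum>j\<in>Basis. (fderiv f z u \<bullet> i) * (fderiv f z v \<bullet> j) * G c (f z) i j) =
        metric_coord N (induced_metric A g N) C z u v" if zU: "z \<in> U" for z
    proof -
      define p where "p = chart_inv C z"
      have z: "z \<in> snd C ` fst C" "p \<in> fst c" using zU by (auto simp: U_def p_def)
      have p: "p \<in> fst C" "snd C p = z" using chart_inv_mem[OF z(1)] chart_apply_inv[OF z(1)] by (simp_all add: p_def)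
      have fz: "f z = snd c p" by (simp add: f_def p_def)
      then have img: "f z \<in> snd c ` fst c" using z by simp
      show ?thesis
        using induced_metric_coord[OF SA N_def C p(1) c(1) z(2), of g u v]
        unfolding p(2) fz[symmetric] f_def[symmetric] G_expand[OF c(1) img, symmetric] by (rule sym)
    qed
    have cG: "continuous_on U (\<lambda>z. G c (f z) i j)" for i j
      by (rule continuous_on_compose2[OF smooth_on_continuous[OF G_smooth[OF c(1)]] smooth_on_continuous[OF U(3)] fU])
    have cf: "continuous_on U (\<lambda>z. fderiv f z w)" for w
      by (rule smooth_on_continuous[OF smooth_on_frechet[OF U(3)]])
    have "continuous_on U (\<lambda>z. \<Sum>i\<in>Basis. \<Sum>j\<in>Basis. (fderiv f z u \<bullet> i) * (fderiv f z v \<bullet> j) * G c (f z) i j)"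
      by (intro continuous_on_sum continuous_on_mult continuous_on_inner continuous_on_const cf cG)
    then have "continuous_on U (\<lambda>z. metric_coord N (induced_metric A g N) C z u v)"
      by (rule continuous_on_eq) (rule eq)
    then show "isCont (\<lambda>x. metric_coord N (induced_metric A g N) C x u v) x"
      using U(1,2) continuous_on_eq_continuous_at by blast
  qed
qed

end

context umbilic_flow
begin

abbreviation "h \<equiv> induced_metric A g AS"
abbreviation "\<nu> \<equiv> riemannian_measure AS h"
abbreviation "\<theta> p s \<equiv> expansion A g AS \<xi> V (\<Phi> (p, s))"
text \<open>The factor by which the flow changes the volume element at \<open>p\<close> up to time
  \<open>t\<close>; its integral over \<open>S\<close> turns out to be the volume of the
  leaf.\<close>

definition "growth p (t :: real) = exp (LBINT s=0..t. \<theta> p s)"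

lemma \<theta>_eq: "(p, s) \<in> \<O> \<Longrightarrow> \<theta> p s = - real CARD('n) * \<mu> (\<Phi> (p, s))"
  by (rule expansion_eq) (auto simp: hypersurface_def)

lemma growth_eq:
  assumes "(p, t) \<in> \<O>"
  shows "growth p t = exp (- real CARD('n) * (LBINT s=0..t. \<mu> (\<Phi> (p, s))))"
proof -
  have "(LBINT s=0..t. \<theta> p s) = (LBINT s=0..t. - real CARD('n) * \<mu> (\<Phi> (p, s)))"
  proof (rule interval_integral_cong)
    fix s assume "s \<in> einterval (min 0 (ereal t)) (max 0 (ereal t))"
    then have "s \<in> closed_segment 0 t"
      by (auto simp: closed_segment_min_max einterval_def min_def max_def zero_ereal_def split: if_splits)
    then show "\<theta> p s = - real CARD('n) * \<mu> (\<Phi> (p, s))" by (intro \<theta>_eq flow_dom_segment[OF assms])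
  qed
  then show ?thesis by (simp only: growth_def interval_lebesgue_integral_mult_right)
qed

sublocale AS: compact_riemannian AS h
  by (rule compact_riemannian_sub_atlas[OF AS_def compact_S points_AS])

text \<open>A single nonzero vector \<open>u\<close> is enough to read off the conformal factor from
  the two metrics.\<close>

lemma exp_integral_\<mu>:
  assumes C: "C \<in> AS" and y: "(x, t) \<in> coord_dom C" and u: "u \<noteq> 0"
  shows "exp (- 2 * (LBINT s=0..t. \<mu> (\<Phi> (chart_inv C x, s)))) = slice_metric C t x u u / slice_metric C 0 x u u"
proof -
  have "(x, 0) \<in> coord_dom C" using slice_dom[OF zero_T C] y by (auto simp: coord_dom_def)
  from slice_metric_pos[OF C this u] slice_metric_evolution[OF C y, of u u]
  show ?thesis by (simp add: coord_flow_def)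
qed

lemma growth_derivative:
  assumes pt: "(p, t) \<in> \<O>" and s: "s \<in> {min 0 t..max 0 t}"
  shows "(growth p has_real_derivative \<theta> p s * growth p s) (at s within {min 0 t..max 0 t})"
proof -
  let ?I = "{min 0 t..max 0 t}"
  have dom: "(p, r) \<in> \<O>" if "r \<in> ?I" for r
    using flow_dom_segment[OF pt] that by (simp only: closed_segment_min_max)
  have "((\<lambda>r. LBINT s=0..r. \<mu> (\<Phi> (p, s))) has_real_derivative \<mu> (\<Phi> (p, s))) (at s within ?I)"
    unfolding has_real_derivative_iff_has_vector_derivative by (rule integral_line_derivative[OF pt s])
  then have "((\<lambda>r. exp (- real CARD('n) * (LBINT s=0..r. \<mu> (\<Phi> (p, s))))) has_real_derivative \<theta> p s * growth p s) (at s within ?I)"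
    unfolding growth_eq[OF dom[OF s]] \<theta>_eq[OF dom[OF s]]
    by (auto intro!: derivative_eq_intros)
  then show ?thesis
    by (rule has_field_derivative_transform_within[OF _ zero_less_one s]) (simp add: growth_eq[OF dom])
qed

section \<open>Volume element and volume of one leaf\<close>

context
  fixes t assumes t: "t \<in> T"
begin

abbreviation "Nt \<equiv> sub_atlas A (leaf A g AS \<xi> t) :: ('m, real ^ 'n) atlas"
abbreviation "ht \<equiv> induced_metric A g Nt"

lemma leaf_riemannian: "compact_riemannian Nt ht"
  by (rule compact_riemannian_sub_atlas[OF refl compact_leaf[OF t] points_leaf[OF t]])

interpretation L: compact_riemannian Nt ht by (rule leaf_riemannian)

lemma density_leaf:
  assumes C: "C \<in> AS" and x: "x \<in> snd C ` fst C"
  shows "volume_density Nt ht (leaf_chart t C) x = growth (chart_inv C x) t * volume_density AS h C x"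
proof -
  let ?M = "LBINT s=0..t. \<mu> (\<Phi> (chart_inv C x, s))"
  have dom: "(chart_inv C x, t) \<in> \<O>" using slice_dom[OF t C x] by (simp add: coord_dom_def)
  have "metric_coord Nt ht (leaf_chart t C) x u v = exp (- 2 * ?M) * metric_coord AS h C x u v" for u v
    using slice_metric_evolution[OF C slice_dom[OF t C x], of u v]
    by (simp add: slice_metric_leaf[OF t C x] slice_metric_0[OF C x] coord_flow_def)
  then have "volume_density Nt ht (leaf_chart t C) x = sqrt (exp (- 2 * ?M) ^ CARD('n)) * volume_density AS h C x"
    by (simp add: volume_density_def det_scale_entries real_sqrt_mult)
  \<comment> \<open>The conformal factor enters the determinant with the power
    \<open>CARD('n)\<close>; it is written as a square so that the root cancels.\<close>
  also have "exp (- 2 * ?M) ^ CARD('n) = (exp (- real CARD('n) * ?M))\<^sup>2"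
    by (simp add: exp_of_nat_mult[symmetric] power2_eq_square exp_add[symmetric])
  finally show ?thesis by (simp add: growth_eq[OF dom])
qed

text \<open>By \<open>exp_integral_\<mu>\<close> this function is locally a quotient of metric coefficients, which avoids
  a discussion of integrals depending on a parameter in the topological space \<open>S\<close>.\<close>
lemma continuous_exp_\<mu>:
  "continuous_map (manifold_top AS) euclideanreal (\<lambda>p. exp (- 2 * (LBINT s=0..t. \<mu> (\<Phi> (p, s)))))"
  unfolding top_AS
proof (rule continuous_map_local)
  let ?X = "subtopology (manifold_top A) S"
  fix p assume "p \<in> topspace ?X"
  then have "p \<in> S" by (simp add: topspace_sub[OF S_subset])
  then obtain C where C: "C \<in> AS" "p \<in> fst C" using chart_AS_ex by blast
  define u :: "real ^ 'n" where "u = axis undefined 1"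
  have u: "u \<noteq> 0" by (simp add: u_def)
  have CS: "fst C \<subseteq> S" by (rule sub_chart_subset(1)[OF SA AS_sub_atlas[OF C(1)]])
  have oC: "openin ?X (fst C)" by (rule sub_chart_openin[OF SA AS_sub_atlas[OF C(1)]])
  have XC: "subtopology ?X (fst C) = subtopology (manifold_top A) (fst C)"
    using CS by (simp add: subtopology_subtopology Int_absorb1)
  have tC: "topspace (subtopology (manifold_top A) (fst C)) = fst C"
    using CS S_subset by (intro topspace_sub) blast
  define f where "f x = slice_metric C t x u u / slice_metric C 0 x u u" for x
  have "continuous_on (snd C ` fst C) (\<lambda>x. slice_metric C t x u u)"
  proof (rule continuous_on_eq)
    have "continuous_on (snd (leaf_chart t C) ` fst (leaf_chart t C)) (\<lambda>x. metric_coord Nt ht (leaf_chart t C) x u u)"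
      by (rule L.cont[OF leaf_chart[OF t C(1)]])
    moreover have "snd (leaf_chart t C) ` fst (leaf_chart t C) = snd C ` fst C"
      unfolding leaf_chart_def[OF t] fst_conv snd_conv by (rule inv_into_image_cancel[OF leaf_param_inj[OF t C(1)] subset_refl])
    ultimately show "continuous_on (snd C ` fst C) (\<lambda>x. metric_coord Nt ht (leaf_chart t C) x u u)" by simp
  qed (rule slice_metric_leaf[OF t C(1)])
  moreover have "continuous_on (snd C ` fst C) (\<lambda>x. slice_metric C 0 x u u)"
    by (rule continuous_on_eq[OF AS.cont[OF C(1)]]) (simp add: slice_metric_0[OF C(1)])
  ultimately have "continuous_on (snd C ` fst C) f"
    unfolding f_def
  proof (rule continuous_on_divide, intro ballI)
    fix x assume "x \<in> snd C ` fst C"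
    from slice_metric_pos[OF C(1) slice_dom[OF zero_T C(1) this] u] show "slice_metric C 0 x u u \<noteq> 0" by simp
  qed
  then have f: "continuous_map (top_of_set (snd C ` fst C)) euclideanreal f" by simp
  have "continuous_map (subtopology (manifold_top A) (fst C)) (top_of_set (snd C ` fst C)) (snd C)"
    using continuous_map_sub_chart[OF SA AS_sub_atlas[OF C(1)]] by (auto simp only: continuous_map_in_subtopology tC)
  from continuous_map_compose[OF this f]
  have "continuous_map (subtopology (manifold_top A) (fst C)) euclideanreal (f \<circ> snd C)" .
  then have "continuous_map (subtopology ?X (fst C)) euclideanreal (\<lambda>p. exp (- 2 * (LBINT s=0..t. \<mu> (\<Phi> (p, s)))))"
    unfolding XC
  proof (rule continuous_map_eq)
    fix p assume "p \<in> topspace (subtopology (manifold_top A) (fst C))"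
    then have p: "p \<in> fst C" by (simp only: tC)
    have "snd C p \<in> snd C ` fst C" using p by simp
    from exp_integral_\<mu>[OF C(1) slice_dom[OF t C(1) this] u]
    show "(f \<circ> snd C) p = exp (- 2 * (LBINT s=0..t. \<mu> (\<Phi> (p, s))))"
      by (simp add: f_def chart_inv_apply[OF diff_AS C(1) p])
  qed
  then show "\<exists>U. openin ?X U \<and> p \<in> U \<and> continuous_map (subtopology ?X U) euclideanreal (\<lambda>p. exp (- 2 * (LBINT s=0..t. \<mu> (\<Phi> (p, s)))))"
    using oC C(2) by blast
qed

lemma measurable_growth: "(\<lambda>p. growth p t) \<in> borel_measurable \<nu>"
proof -
  have [measurable]: "(\<lambda>p. exp (- 2 * (LBINT s=0..t. \<mu> (\<Phi> (p, s))))) \<in> borel_measurable \<nu>"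
    by (rule AS.continuous_map_measurable[OF continuous_exp_\<mu>])
  \<comment> \<open>\<open>growth\<close> is the conformal factor raised to the power
    \<open>CARD('n) / 2\<close>, so its measurability follows from that of the conformal
    factor.\<close>
  have "(\<lambda>p. exp (real CARD('n) / 2 * ln (exp (- 2 * (LBINT s=0..t. \<mu> (\<Phi> (p, s))))))) \<in> borel_measurable \<nu>"
    by measurable
  then show ?thesis
    by (rule measurable_cong[THEN iffD1, rotated]) (simp add: growth_eq t_dom[OF t] points_AS)
qed

lemma measurable_\<theta>: "(\<lambda>p. \<theta> p t) \<in> borel_measurable \<nu>"
proof -
  have "continuous_map (subtopology (manifold_top A) S) (subtopology (manifold_top A) \<Sigma>) (\<lambda>p. \<Phi> (p, t))"
    using continuous_flow_t[OF t] leaf_\<Sigma>[OF t] by (auto simp: continuous_map_in_subtopology)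
  from continuous_map_compose[OF this continuous_\<mu>]
  have "continuous_map (manifold_top AS) euclideanreal (\<lambda>p. \<mu> (\<Phi> (p, t)))" by (simp add: top_AS comp_def)
  from AS.continuous_map_measurable[OF this]
  have "(\<lambda>p. - real CARD('n) * \<mu> (\<Phi> (p, t))) \<in> borel_measurable \<nu>" by measurable
  then show ?thesis
    by (rule measurable_cong[THEN iffD1, rotated]) (simp add: \<theta>_eq t_dom[OF t] points_AS)
qed

text \<open>The projection of the leaf to \<open>S\<close> along the flow is continuous, and
  preimages under it respect complements and countable unions.\<close>

lemma leaf_borel: "B \<in> AS.borel_sets \<Longrightarrow> {q \<in> leaf A g AS \<xi> t. fst (\<pi> q) \<in> B} \<in> L.borel_sets"
proof (induction B rule: sigma_sets.induct)
  case (Basic B)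
  have tL: "manifold_top Nt = subtopology (manifold_top A) (leaf A g AS \<xi> t)"
    by (rule manifold_top_sub_atlas[OF SA points_leaf[OF t]])
  have "continuous_map (manifold_top Nt) (manifold_top AS) (\<lambda>q. fst (\<pi> q))"
    unfolding tL top_AS by (rule continuous_map_from_subtopology_mono[OF continuous_fst_\<pi> leaf_\<Sigma>[OF t]])
  from openin_continuous_map_preimage[OF this, of B] Basic show ?case
    by (auto simp: topspace_manifold_top[OF L.N] points_leaf[OF t] intro: sigma_sets.Basic)
next
  case (Compl B)
  have "{q \<in> leaf A g AS \<xi> t. fst (\<pi> q) \<in> points AS - B} = points Nt - {q \<in> leaf A g AS \<xi> t. fst (\<pi> q) \<in> B}"
    using fst_\<pi>_S leaf_\<Sigma>[OF t] by (auto simp: points_leaf[OF t] points_AS)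
  then show ?case using sigma_sets.Compl[OF Compl.IH] by simp
next
  case (Union B)
  have "{q \<in> leaf A g AS \<xi> t. fst (\<pi> q) \<in> (\<Union>i. B i)} = (\<Union>i. {q \<in> leaf A g AS \<xi> t. fst (\<pi> q) \<in> B i})" by auto
  then show ?case using sigma_sets.Union[OF Union.IH] by simp
qed (simp add: sigma_sets.Empty)

text \<open>A partition of \<open>S\<close> subordinate to charts is carried to the leaf by the
  flow. Corresponding pieces have the same image in the coordinates of \<open>C i\<close> and
  \<open>leaf_chart t (C i)\<close>, where \<open>density_leaf\<close> compares the
  integrands.\<close>

lemma emeasure_leaf: "emeasure (riemannian_measure Nt ht) (leaf A g AS \<xi> t) = (\<integral>\<^sup>+p. ennreal (growth p t) \<partial>\<nu>)"
proof -
  obtain C D where CD: "\<And>i. C i \<in> AS" "\<And>i. D i \<in> AS.borel_sets" "\<And>i::nat. D i \<subseteq> fst (C i)"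
    "disjoint_family D" "(\<Union>i. D i) = points AS"
    using AS.chart_partition by metis
  define B where "B i = {q \<in> leaf A g AS \<xi> t. fst (\<pi> q) \<in> D i}" for i
  have B: "B i \<in> L.borel_sets" for i unfolding B_def by (rule leaf_borel[OF CD(2)])
  have piece: "emeasure (riemannian_measure Nt ht) (B i) = (\<integral>\<^sup>+p\<in>D i. ennreal (growth p t) \<partial>\<nu>)" for i
  proof -
    have Bi: "B i = leaf_param t (C i) ` snd (C i) ` D i"
    proof
      show "leaf_param t (C i) ` snd (C i) ` D i \<subseteq> B i"
      proof (clarify)
        fix p assume p: "p \<in> D i"
        then have pS: "p \<in> S" "p \<in> fst (C i)" using CD(3,5) points_AS by blast+
        then show "leaf_param t (C i) (snd (C i) p) \<in> B i"
          using p t_dom[OF t] by (simp add: B_def leaf_param_eq[OF t CD(1)] chart_inv_apply[OF diff_AS CD(1)] leaf_eq[OF t] flow_inv_flow)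
      qed
      show "B i \<subseteq> leaf_param t (C i) ` snd (C i) ` D i"
      proof
        fix q assume "q \<in> B i"
        then have q: "q \<in> leaf A g AS \<xi> t" "fst (\<pi> q) \<in> D i" by (auto simp: B_def)
        then obtain p where p: "p \<in> S" "q = \<Phi> (p, t)" by (auto simp: leaf_eq[OF t])
        then have pD: "p \<in> D i" using q(2) t_dom[OF t p(1)] by (simp add: flow_inv_flow)
        then have "p \<in> fst (C i)" using CD(3) by blast
        then have "leaf_param t (C i) (snd (C i) p) = q"
          by (simp add: leaf_param_eq[OF t CD(1)] chart_inv_apply[OF diff_AS CD(1)] p(2))
        then show "q \<in> leaf_param t (C i) ` snd (C i) ` D i" using pD by blast
      qed
    qed
    have DC: "snd (C i) ` D i \<subseteq> snd (C i) ` fst (C i)" using CD(3) by blast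
    have fB: "B i \<subseteq> fst (leaf_chart t (C i))" unfolding Bi leaf_chart_def[OF t] fst_conv using DC by blast
    have img: "snd (leaf_chart t (C i)) ` B i = snd (C i) ` D i"
      unfolding Bi leaf_chart_def[OF t] snd_conv by (rule inv_into_image_cancel[OF leaf_param_inj[OF t CD(1)] DC])
    have "emeasure (riemannian_measure Nt ht) (B i) = (\<integral>\<^sup>+x\<in>snd (C i) ` D i. ennreal (volume_density Nt ht (leaf_chart t (C i)) x) \<partial>lborel)"
      using L.emeasure_riemannian[OF leaf_chart[OF t CD(1)] B fB] by (simp add: L.chart_vol_def img)
    also have "\<dots> = (\<integral>\<^sup>+x\<in>snd (C i) ` D i. ennreal (growth (chart_inv (C i) x) t) * ennreal (volume_density AS h (C i) x) \<partial>lborel)"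
    proof (rule nn_integral_cong)
      fix x
      show "ennreal (volume_density Nt ht (leaf_chart t (C i)) x) * indicator (snd (C i) ` D i) x =
          ennreal (growth (chart_inv (C i) x) t) * ennreal (volume_density AS h (C i) x) * indicator (snd (C i) ` D i) x"
      proof (cases "x \<in> snd (C i) ` D i")
        case True
        then have "x \<in> snd (C i) ` fst (C i)" using DC by blast
        from density_leaf[OF CD(1) this] show ?thesis by (simp add: ennreal_mult' growth_def)
      qed simp
    qed
    also have "\<dots> = (\<integral>\<^sup>+p\<in>D i. ennreal (growth p t) \<partial>\<nu>)"
      by (rule AS.nn_integral_chart[OF CD(1-3), symmetric]) (use measurable_growth in measurable)
    finally show ?thesis .
  qed
  have "leaf A g AS \<xi> t = (\<Union>i. B i)"
    using CD(5) fst_\<pi>_S leaf_\<Sigma>[OF t] points_AS by (auto simp: B_def)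
  then have "emeasure (riemannian_measure Nt ht) (leaf A g AS \<xi> t) = emeasure (riemannian_measure Nt ht) (\<Union>i. B i)"
    by (rule arg_cong)
  also have "\<dots> = (\<Sum>i. emeasure (riemannian_measure Nt ht) (B i))"
  proof (rule suminf_emeasure[symmetric])
    show "range B \<subseteq> sets (riemannian_measure Nt ht)" using B by (simp add: L.sets_riemannian image_subset_iff)
    show "disjoint_family B" using CD(4) unfolding disjoint_family_on_def B_def by blast
  qed
  also have "\<dots> = (\<Sum>i. \<integral>\<^sup>+p. ennreal (growth p t) * indicator (D i) p \<partial>\<nu>)" by (simp only: piece)
  also have "\<dots> = (\<integral>\<^sup>+p. (\<Sum>i. ennreal (growth p t) * indicator (D i) p) \<partial>\<nu>)"
    using CD(2) measurable_growth by (intro nn_integral_suminf[symmetric]) (auto simp: AS.sets_riemannian[symmetric])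
  also have "\<dots> = (\<integral>\<^sup>+p. ennreal (growth p t) \<partial>\<nu>)"
  proof (rule nn_integral_cong)
    fix p assume "p \<in> space \<nu>"
    then have p: "p \<in> (\<Union>i. D i)" using CD(5) by simp
    have "(\<Sum>i. ennreal (growth p t) * indicator (D i) p) = ennreal (growth p t) * (\<Sum>i. indicator (D i) p)"
      by (rule ennreal_suminf_cmult)
    also have "(\<Sum>i. indicator (D i) p :: ennreal) = indicator (\<Union>i. D i) p"
      by (rule suminf_indicator[OF CD(4)])
    finally show "(\<Sum>i. ennreal (growth p t) * indicator (D i) p) = ennreal (growth p t)" using p by simp
  qed
  finally show ?thesis .
qed

lemma vol_leaf: "vol A g Nt = (LINT p|\<nu>. growth p t)"
proof -
  have "vol A g Nt = enn2real (\<integral>\<^sup>+p. ennreal (growth p t) \<partial>\<nu>)"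
    unfolding vol_def points_leaf[OF t] measure_def emeasure_leaf ..
  also have "\<dots> = (LINT p|\<nu>. growth p t)"
    by (rule integral_eq_nn_integral[symmetric]) (use measurable_growth in \<open>auto simp: growth_def\<close>)
  finally show ?thesis .
qed

text \<open>\<open>S\<close> times the time interval is compact and \<mu> is continuous along the
  flow. The bound supplies the dominating constants for differentiation under the integral.\<close>

lemma bounded_\<theta>: "\<exists>K>0. \<forall>p\<in>S. \<forall>s\<in>{min 0 t..max 0 t}. \<bar>\<theta> p s\<bar> \<le> K"
proof -
  let ?I = "{min 0 t..max 0 t}"
  have dom: "S \<times> ?I \<subseteq> \<O>"
    using flow_dom_segment[OF t_dom[OF t]] unfolding closed_segment_min_max by blast
  have "compactin (prod_topology (manifold_top A) euclideanreal) (S \<times> ?I)"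
    using compact_S by (simp add: compactin_Times)
  then have "compactin (subtopology (prod_topology (manifold_top A) euclideanreal) \<O>) (S \<times> ?I)"
    using dom by (simp add: compactin_subtopology)
  from image_compactin[OF this continuous_\<mu>_flow] have "compact ((\<lambda>z. \<mu> (\<Phi> z)) ` (S \<times> ?I))" by simp
  from compact_imp_bounded[OF this] obtain B where
    B: "B > 0" "\<forall>y\<in>(\<lambda>z. \<mu> (\<Phi> z)) ` (S \<times> ?I). \<bar>y\<bar> \<le> B"
    unfolding bounded_pos real_norm_def by blast
  have "\<bar>\<theta> p s\<bar> \<le> real CARD('n) * B" if "p \<in> S" "s \<in> ?I" for p s
  proof -
    have "(p, s) \<in> \<O>" using that dom by blast
    moreover have "\<bar>\<mu> (\<Phi> (p, s))\<bar> \<le> B" using bspec[OF B(2) imageI[of "(p, s)"]] that by simp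
    ultimately show ?thesis using \<theta>_eq by (simp add: abs_mult)
  qed
  moreover have "real CARD('n) * B > 0" using B(1) by simp
  ultimately show ?thesis by blast
qed

end

section \<open>The total volume as a function of time\<close>

lemma growth_0: "growth p 0 = 1"
  by (simp add: growth_def zero_ereal_def)

lemma vol_S: "vol A g AS = (LINT p|\<nu>. growth p 0)"
  by (simp add: growth_0 vol_def)

lemma leaf_volume:
  assumes t: "t \<in> T"
  shows "vol A g (sub_atlas A (leaf A g AS \<xi> t) :: ('m, real ^ 'n) atlas) =
    vol A g AS * exp (LBINT s=0..t. average_expansion A g AS \<xi> V s)"
proof -
  let ?I = "{min 0 t..max 0 t}"
  define a where "a s = (LINT p|\<nu>. growth p s)" for s
  define a' where "a' s = (LINT p|\<nu>. \<theta> p s * growth p s)" for s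
  interpret finite_measure \<nu> by (rule AS.finite_measure_riemannian)
  have TI: "s \<in> T" if "s \<in> ?I" for s
    using common_domain_segment[OF t] that by (simp only: closed_segment_min_max)
  have sp: "space \<nu> = S" by (simp add: points_AS)
  obtain K where K: "K > 0" "\<And>p s. p \<in> S \<Longrightarrow> s \<in> ?I \<Longrightarrow> \<bar>\<theta> p s\<bar> \<le> K"
    using bounded_\<theta>[OF t] by blast
  have gpos: "growth p s > 0" for p s by (simp add: growth_def)
  have gder: "(growth p has_real_derivative \<theta> p s * growth p s) (at s within ?I)" if "p \<in> S" "s \<in> ?I" for p s
    by (rule growth_derivative[OF t_dom[OF t that(1)] that(2)])
  \<comment> \<open>The logarithm of \<open>growth\<close> has derivative \<theta>, bounded by
    \<open>K\<close>, so the mean value inequality bounds \<open>growth\<close> from both sides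
    without an estimate of the integral in its definition.\<close>
  have lnder: "((\<lambda>s. ln (growth p s)) has_real_derivative \<theta> p s) (at s within ?I)" if "p \<in> S" "s \<in> ?I" for p s
    using DERIV_chain'[OF gder[OF that] DERIV_ln[OF gpos]] gpos[of p s] by (simp add: field_simps)
  have lnbound: "\<bar>ln (growth p s)\<bar> \<le> K * \<bar>t\<bar>" if p: "p \<in> S" and s: "s \<in> ?I" for p s
  proof -
    have "norm (ln (growth p s) - ln (growth p 0)) \<le> K * norm (s - 0)"
      by (rule field_differentiable_bound[of ?I "\<lambda>s. ln (growth p s)" "\<theta> p"])
        (use lnder[OF p] K(2)[OF p] s in auto)
    also have "\<dots> \<le> K * \<bar>t\<bar>" using s K(1) by (auto intro!: mult_left_mono)
    finally show ?thesis by (simp add: growth_0)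
  qed
  \<comment> \<open>The bound \<open>growth p s \<le> Q\<close> feeds the dominating constant
    \<open>K * Q\<close>; the bound \<open>1 / Q \<le> growth p s\<close> later gives
    \<open>a s > 0\<close>, which makes the logarithm of \<open>a\<close> available.\<close>
  define Q where "Q = exp (K * \<bar>t\<bar>)"
  have Q: "Q > 0" "\<And>p s. p \<in> S \<Longrightarrow> s \<in> ?I \<Longrightarrow> growth p s \<le> Q" "\<And>p s. p \<in> S \<Longrightarrow> s \<in> ?I \<Longrightarrow> 1 / Q \<le> growth p s"
  proof -
    fix p s assume *: "p \<in> S" "s \<in> ?I"
    have "growth p s = exp (ln (growth p s))" using gpos by simp
    also have "\<dots> \<le> Q" using lnbound[OF *] unfolding Q_def by simp
    finally show "growth p s \<le> Q" .
    have "1 / Q = exp (- (K * \<bar>t\<bar>))" by (simp add: Q_def exp_minus field_simps)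
    also have "\<dots> \<le> exp (ln (growth p s))" using lnbound[OF *] by simp
    finally show "1 / Q \<le> growth p s" using gpos by simp
  qed (simp add: Q_def)
  have prod_bound: "\<bar>\<theta> p s * growth p s\<bar> \<le> K * Q" if "p \<in> S" "s \<in> ?I" for p s
    using K(1) K(2)[OF that] Q(2)[OF that] gpos[of p s] unfolding abs_mult by (intro mult_mono) auto
  have mg: "(\<lambda>p. growth p s) \<in> borel_measurable \<nu>" and mt: "(\<lambda>p. \<theta> p s) \<in> borel_measurable \<nu>" if "s \<in> ?I" for s
    using measurable_growth[OF TI[OF that]] measurable_\<theta>[OF TI[OF that]] by auto
  have ig: "integrable \<nu> (\<lambda>p. growth p s)" if s: "s \<in> ?I" for s
    by (rule integrable_const_bound[of _ Q]) (use Q(2)[OF _ s] gpos mg[OF s] in \<open>auto simp: points_AS abs_of_pos\<close>)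
  \<comment> \<open>Differentiation under the integral: the derivative is tested along sequences so
    that dominated convergence applies, and the mean value inequality bounds the difference
    quotients by \<open>K * Q\<close>.\<close>
  have der: "(a has_real_derivative a' s) (at s within ?I)" if s: "s \<in> ?I" for s
    unfolding has_field_derivative_iff tendsto_at_iff_sequentially
  proof (intro allI impI)
    fix X :: "nat \<Rightarrow> real" assume X: "\<forall>i. X i \<in> ?I - {s}" "X \<longlonglongrightarrow> s"
    have XI: "X i \<in> ?I" "X i \<noteq> s" for i using X(1) by auto
    have "(\<lambda>i. LINT p|\<nu>. (growth p (X i) - growth p s) / (X i - s)) \<longlonglongrightarrow> a' s"
      unfolding a'_def
    proof (rule integral_dominated_convergence[where w = "\<lambda>p. K * Q"])
      show "(\<lambda>p. \<theta> p s * growth p s) \<in> borel_measurable \<nu>" using mg[OF s] mt[OF s] by measurable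
      show "(\<lambda>p. (growth p (X i) - growth p s) / (X i - s)) \<in> borel_measurable \<nu>" for i
        using mg[OF s] mg[OF XI(1)[of i]] by measurable
      show "AE p in \<nu>. (\<lambda>i. (growth p (X i) - growth p s) / (X i - s)) \<longlonglongrightarrow> \<theta> p s * growth p s"
      proof (rule AE_I2)
        fix p assume "p \<in> space \<nu>"
        then have "p \<in> S" by (simp add: points_AS)
        from gder[OF this s] X show "(\<lambda>i. (growth p (X i) - growth p s) / (X i - s)) \<longlonglongrightarrow> \<theta> p s * growth p s"
          unfolding has_field_derivative_iff tendsto_at_iff_sequentially by (auto simp: comp_def)
      qed
      show "AE p in \<nu>. norm ((growth p (X i) - growth p s) / (X i - s)) \<le> K * Q" for i
      proof (rule AE_I2)
        fix p assume "p \<in> space \<nu>"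
        then have p: "p \<in> S" by (simp add: points_AS)
        have "norm (growth p (X i) - growth p s) \<le> (K * Q) * norm (X i - s)"
          by (rule field_differentiable_bound[of ?I "growth p" "\<lambda>s. \<theta> p s * growth p s"])
            (use gder[OF p] prod_bound[OF p] XI(1) s in auto)
        then show "norm ((growth p (X i) - growth p s) / (X i - s)) \<le> K * Q"
          using XI(2)[of i] by (simp add: field_simps)
      qed
    qed simp
    moreover have "(LINT p|\<nu>. (growth p (X i) - growth p s) / (X i - s)) = (a (X i) - a s) / (X i - s)" for i
      by (simp add: a_def ig[OF XI(1)] ig[OF s])
    ultimately show "((\<lambda>y. (a y - a s) / (y - s)) \<circ> X) \<longlonglongrightarrow> a' s" by (simp only: o_def)
  qed
  \<comment> \<open>The fundamental theorem below asks for a continuous integrand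
    \<open>a' / a\<close>; here dominated convergence is used once more, with the same
    constant.\<close>
  have cont': "continuous_on ?I a'"
    unfolding continuous_on_sequentially
  proof (intro allI ballI impI)
    fix X s assume s: "s \<in> ?I" and X: "(\<forall>i. X i \<in> ?I) \<and> X \<longlonglongrightarrow> s"
    then have XI: "X i \<in> ?I" for i by blast
    have "(\<lambda>i. LINT p|\<nu>. \<theta> p (X i) * growth p (X i)) \<longlonglongrightarrow> (LINT p|\<nu>. \<theta> p s * growth p s)"
    proof (rule integral_dominated_convergence[where w = "\<lambda>p. K * Q"])
      show "(\<lambda>p. \<theta> p s * growth p s) \<in> borel_measurable \<nu>" using mg[OF s] mt[OF s] by measurable
      show "(\<lambda>p. \<theta> p (X i) * growth p (X i)) \<in> borel_measurable \<nu>" for i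
        using mg[OF XI[of i]] mt[OF XI[of i]] by measurable
      show "AE p in \<nu>. norm (\<theta> p (X i) * growth p (X i)) \<le> K * Q" for i
        by (rule AE_I2) (use prod_bound[OF _ XI] in \<open>simp add: points_AS\<close>)
      show "AE p in \<nu>. (\<lambda>i. \<theta> p (X i) * growth p (X i)) \<longlonglongrightarrow> \<theta> p s * growth p s"
      proof (rule AE_I2)
        fix p assume "p \<in> space \<nu>"
        then have p: "p \<in> S" by (simp add: points_AS)
        have dom: "(p, r) \<in> \<O>" if "r \<in> ?I" for r using TI[OF that] p by (simp add: common_domain_iff)
        have "continuous_on ?I (\<lambda>r. - real CARD('n) * \<mu> (\<Phi> (p, r)))"
          by (intro continuous_intros continuous_\<mu>_line dom)
        then have "continuous_on ?I (\<theta> p)" by (rule continuous_on_eq) (simp add: \<theta>_eq[OF dom])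
        moreover have "continuous_on ?I (growth p)"
          using gder[OF p] by (intro DERIV_continuous_on) 
        ultimately have "continuous_on ?I (\<lambda>r. \<theta> p r * growth p r)" by (intro continuous_intros)
        then show "(\<lambda>i. \<theta> p (X i) * growth p (X i)) \<longlonglongrightarrow> \<theta> p s * growth p s"
          using X s unfolding continuous_on_sequentially by (auto simp: comp_def)
      qed
    qed simp
    then show "(a' \<circ> X) \<longlonglongrightarrow> a' s" by (simp add: a'_def comp_def)
  qed
  have avg: "average_expansion A g AS \<xi> V s = a' s / a s" for s
    by (simp add: average_expansion_def a_def a'_def growth_def Let_def)
  have va: "vol A g (sub_atlas A (leaf A g AS \<xi> t) :: ('m, real ^ 'n) atlas) = a t" "vol A g AS = a 0"
    by (simp_all add: a_def vol_leaf[OF t] vol_S)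
  have t_I: "t \<in> ?I" "0 \<in> ?I" by auto
  show ?thesis
  proof (cases "measure \<nu> (space \<nu>) = 0")
    \<comment> \<open>includes \<open>S = {}\<close>, where the average expansion is the junk value \<open>0 / 0 = 0\<close>\<close>
    case True
    then have "emeasure \<nu> (space \<nu>) = 0" by (simp add: emeasure_eq_measure)
    then have "AE p in \<nu>. growth p s = 0" for s by (intro AE_I[of _ _ "space \<nu>"] sets.top) auto
    then have "a s = 0" if "s \<in> ?I" for s
      using integral_cong_AE[OF mg[OF that], of "\<lambda>_. 0"] by (simp add: a_def)
    then show ?thesis using t_I unfolding va by simp
  next
    case False
    then have pos: "measure \<nu> (space \<nu>) > 0" using measure_nonneg[of \<nu> "space \<nu>"] by linarith
    have apos: "a s > 0" if s: "s \<in> ?I" for s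
    proof -
      have "0 < 1 / Q * measure \<nu> (space \<nu>)" using Q(1) pos by simp
      also have "\<dots> = (LINT p|\<nu>. 1 / Q)" by simp
      also have "\<dots> \<le> a s" unfolding a_def
        by (rule integral_mono) (use ig[OF s] Q(3)[OF _ s] in \<open>auto simp: points_AS\<close>)
      finally show ?thesis .
    qed
    have cont_a: "continuous_on ?I a" using der by (rule DERIV_continuous_on)
    have "(LBINT s=0..t. a' s / a s) = ln (a t) - ln (a 0)"
      unfolding zero_ereal_def
    proof (rule interval_integral_FTC_finite)
      show "continuous_on ?I (\<lambda>s. a' s / a s)"
        using apos by (intro continuous_on_divide cont' cont_a) fastforce
      fix s assume "min 0 t \<le> s" "s \<le> max 0 t"
      then have s: "s \<in> ?I" by simp
      have "((\<lambda>s. ln (a s)) has_real_derivative 1 / a s * a' s) (at s within ?I)"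
        using DERIV_chain'[OF der[OF s] DERIV_ln_divide[OF apos[OF s]]] .
      then show "((\<lambda>s. ln (a s)) has_vector_derivative a' s / a s) (at s within ?I)"
        by (simp add: has_real_derivative_iff_has_vector_derivative)
    qed
    then show ?thesis
      unfolding va avg using apos[OF t_I(1)] apos[OF t_I(2)] by (simp add: exp_diff)
  qed
qed

end

theorem theorem7p14:
  fixes A :: "('m, real ^ 'k) atlas"
    and g :: "'m \<Rightarrow> real ^ 'k \<Rightarrow> real ^ 'k \<Rightarrow> real"
    and T \<xi> :: "'m \<Rightarrow> real ^ 'k"
    and S :: "'m set"
    and AS :: "('m, real ^ 'n) atlas"
    and V :: "('m \<times> (real ^ 'k)) set"
    and t :: real
  assumes "CARD('k) = CARD('n) + 2" and "CARD('n) + 2 \<ge> 4"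
    and "spacetime A g T" and "orientable A"
    and "embedded_submanifold A S AS"
    and "compactin (manifold_top A) S" and "connectedin (manifold_top A) S"
    and "spacelike A g AS"
    and "lightlike_normal_field A g AS \<xi>"
    and "normal_exp_neighborhood A g AS V"
    and "totally_umbilical A g AS \<xi> V"
    and "t \<in> common_domain AS \<xi> V"
  shows "vol A g (sub_atlas A (leaf A g AS \<xi> t) :: ('m, real ^ 'n) atlas) =
    vol A g AS * exp (LBINT s=0..t. average_expansion A g AS \<xi> V s)"
proof -
  obtain \<mu> where \<mu>: "smooth_on_set A euclid_atlas (hypersurface A g AS \<xi> V) \<mu>"
    "\<forall>q\<in>hypersurface A g AS \<xi> V. \<forall>X\<in>tangent_space A (hyper_atlas A g AS \<xi> V) q.
      \<forall>Y\<in>tangent_space A (hyper_atlas A g AS \<xi> V) q. null_second_form A g AS \<xi> V q X Y = \<mu> q * g q X Y"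
    using \<open>totally_umbilical A g AS \<xi> V\<close> unfolding totally_umbilical_def by blast
  interpret umbilic_flow A g S AS \<xi> V \<mu>
    using assms \<mu> by unfold_locales (auto simp: spacetime_def smooth_manifold_def)
  show ?thesis by (rule leaf_volume) fact
qed

end
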